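(* Let $\Omega\subset\mathbb{R}$ be an open interval, let $0<\sigma<1$ and let $\varphi\in H^1_0(\Omega)$. Then there exists a solution $u\in C_w(\mathbb{R};H^1_0(\Omega))\cap L^\infty(\mathbb{R};H^1_0(\Omega))$ of the Cauchy problem $$i\partial_t u+\partial_x^2u+i|u|^{2\sigma}\partial_xu=0,\qquad u|_{\partial\Omega}=0,\qquad u(0)=\varphi .$$ In addition, $$M(u(t))=M(\varphi)\quad\text{and}\quad E(u(t))\le E(\varphi)$$ for all $t\in\mathbb{R}$.
   Context: $\Omega$ may be bounded or unbounded; functions are complex-valued. The Dirichlet boundary condition is encoded by $u(t)\in H^1_0(\Omega)$, the closure of $C_c^\infty(\Omega)$ in $H^1(\Omega)$; the equation is understood in the sense of distributions on $\mathbb{R}\times\Omega$. $C_w(\mathbb{R};X)$ is the space of weakly continuous functions from $\mathbb{R}$ to the Banach space $X$. The charge and energy are $$M(u)=\int_\Omega|u|^2\,dx,\qquad E(u)=\int_\Omega\Bigl(|\partial_xu|^2+\frac{1}{\sigma+1}\mathrm{Im}\bigl(|u|^{2\sigma}\overline{u}\,\partial_xu\bigr)\Bigr)dx .$$ *)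

theory Defs
  imports "HOL-Analysis.Analysis"
begin

section \<open>Test functions and distributions\<close>

definition dir_deriv :: "'a::real_normed_vector \<Rightarrow> ('a \<Rightarrow> 'b::real_normed_vector) \<Rightarrow> 'a \<Rightarrow> 'b" where
  "dir_deriv e f = (\<lambda>p. frechet_derivative f (at p) e)"

primrec Ck :: "nat \<Rightarrow> ('a::real_normed_vector \<Rightarrow> 'b::real_normed_vector) \<Rightarrow> bool" where
  "Ck 0 f \<longleftrightarrow> continuous_on UNIV f"
| "Ck (Suc n) f \<longleftrightarrow> (\<forall>p. f differentiable (at p)) \<and> (\<forall>e. Ck n (dir_deriv e f))"

text \<open>\<open>C_c\<^sup>\<infinity>(U)\<close>, its elements being extended by zero to the whole space.\<close>

definition test_functions :: "'a::euclidean_space set \<Rightarrow> ('a \<Rightarrow> complex) set" where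
  "test_functions U = {\<psi>. (\<forall>n. Ck n \<psi>) \<and>
     compact (closure {p. \<psi> p \<noteq> 0}) \<and> closure {p. \<psi> p \<noteq> 0} \<subseteq> U}"

definition locally_integrable :: "'a::euclidean_space set \<Rightarrow> ('a \<Rightarrow> complex) \<Rightarrow> bool" where
  "locally_integrable U f \<longleftrightarrow> (\<forall>K. compact K \<and> K \<subseteq> U \<longrightarrow> set_integrable lebesgue K f)"

text \<open>Distributions are represented as functionals, only their values on
  \<^term>\<open>test_functions U\<close> being relevant.\<close>

definition dist_of :: "'a::euclidean_space set \<Rightarrow> ('a \<Rightarrow> complex) \<Rightarrow> ('a \<Rightarrow> complex) \<Rightarrow> complex" where
  "dist_of U f = (\<lambda>\<psi>. set_lebesgue_integral lebesgue U (\<lambda>p. f p * \<psi> p))"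

definition dist_deriv ::
  "'a::euclidean_space \<Rightarrow> (('a \<Rightarrow> complex) \<Rightarrow> complex) \<Rightarrow> ('a \<Rightarrow> complex) \<Rightarrow> complex" where
  "dist_deriv e T = (\<lambda>\<psi>. - T (dir_deriv e \<psi>))"

definition has_weak_deriv ::
  "'a::euclidean_space set \<Rightarrow> 'a \<Rightarrow> ('a \<Rightarrow> complex) \<Rightarrow> ('a \<Rightarrow> complex) \<Rightarrow> bool" where
  "has_weak_deriv U e f g \<longleftrightarrow> locally_integrable U f \<and> locally_integrable U g \<and>
     (\<forall>\<psi>\<in>test_functions U. dist_deriv e (dist_of U f) \<psi> = dist_of U g \<psi>)"

section \<open>Sobolev spaces on an open set of the line\<close>

text \<open>Elements of the function spaces are represented by functions on the line, of which only
  the a.e. class on \<open>\<Omega>\<close> matters. In particular the choice in \<open>weak_deriv\<close> is immaterial, weak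
  derivatives being unique a.e. on \<open>\<Omega>\<close>.\<close>

definition weak_deriv :: "real set \<Rightarrow> (real \<Rightarrow> complex) \<Rightarrow> real \<Rightarrow> complex" where
  "weak_deriv \<Omega> f = (SOME g. has_weak_deriv \<Omega> 1 f g)"

definition L2 :: "real set \<Rightarrow> (real \<Rightarrow> complex) set" where
  "L2 \<Omega> = {f. set_borel_measurable lebesgue \<Omega> f \<and>
     set_integrable lebesgue \<Omega> (\<lambda>x. (cmod (f x))\<^sup>2)}"

definition H1 :: "real set \<Rightarrow> (real \<Rightarrow> complex) set" where
  "H1 \<Omega> = {f \<in> L2 \<Omega>. \<exists>g\<in>L2 \<Omega>. has_weak_deriv \<Omega> 1 f g}"

definition H1_norm :: "real set \<Rightarrow> (real \<Rightarrow> complex) \<Rightarrow> real" where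
  "H1_norm \<Omega> f = sqrt ((LINT x:\<Omega>|lebesgue. (cmod (f x))\<^sup>2) +
     (LINT x:\<Omega>|lebesgue. (cmod (weak_deriv \<Omega> f x))\<^sup>2))"

definition H10 :: "real set \<Rightarrow> (real \<Rightarrow> complex) set" where
  "H10 \<Omega> = {f \<in> H1 \<Omega>. \<forall>\<epsilon>>0. \<exists>\<psi>\<in>test_functions \<Omega>. H1_norm \<Omega> (\<lambda>x. f x - \<psi> x) < \<epsilon>}"

text \<open>Boundedness forces the functionals below to take equal values on functions of \<open>H10 \<Omega>\<close>
  that agree a.e. on \<open>\<Omega>\<close>.\<close>

definition H10_dual :: "real set \<Rightarrow> ((real \<Rightarrow> complex) \<Rightarrow> complex) set" where
  "H10_dual \<Omega> = {l.
     (\<forall>f\<in>H10 \<Omega>. \<forall>g\<in>H10 \<Omega>. l (\<lambda>x. f x + g x) = l f + l g) \<and>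
     (\<forall>c. \<forall>f\<in>H10 \<Omega>. l (\<lambda>x. c * f x) = c * l f) \<and>
     (\<exists>C. \<forall>f\<in>H10 \<Omega>. cmod (l f) \<le> C * H1_norm \<Omega> f)}"

section \<open>Spaces of functions of time with values in \<open>H10 \<Omega>\<close>\<close>

definition Cw_H10 :: "real set \<Rightarrow> (real \<Rightarrow> real \<Rightarrow> complex) set" where
  "Cw_H10 \<Omega> = {u. (\<forall>t. u t \<in> H10 \<Omega>) \<and>
     (\<forall>l\<in>H10_dual \<Omega>. continuous_on UNIV (\<lambda>t. l (u t)))}"

definition simple_H10 :: "real set \<Rightarrow> (real \<Rightarrow> real \<Rightarrow> complex) \<Rightarrow> bool" where
  "simple_H10 \<Omega> s \<longleftrightarrow> finite (range s) \<and> range s \<subseteq> H10 \<Omega> \<and> (\<forall>y. s -` {y} \<in> sets lebesgue)"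

text \<open>The first condition is strong (Bochner) measurability.\<close>

definition Linf_H10 :: "real set \<Rightarrow> (real \<Rightarrow> real \<Rightarrow> complex) set" where
  "Linf_H10 \<Omega> = {u.
     (\<exists>s. (\<forall>n::nat. simple_H10 \<Omega> (s n)) \<and>
        (AE t in lebesgue. (\<lambda>n. H1_norm \<Omega> (\<lambda>x. s n t x - u t x)) \<longlonglongrightarrow> 0)) \<and>
     (\<exists>C. AE t in lebesgue. u t \<in> H10 \<Omega> \<and> H1_norm \<Omega> (u t) \<le> C)}"

section \<open>The equation, the charge and the energy\<close>

text \<open>Points of \<open>\<real> \<times> \<Omega>\<close> are pairs \<open>(t, x)\<close>, so \<open>(1, 0)\<close> and \<open>(0, 1)\<close> are the time and space
  directions. The function \<open>v\<close> is \<open>\<partial>\<^sub>x u\<close>, unique a.e. Local integrability of \<open>u\<close> (part of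
  \<open>has_weak_deriv\<close>) and of the nonlinearity makes them distributions on \<open>\<real> \<times> \<Omega>\<close>; for \<open>u\<close> this
  includes joint measurability, which is a condition on the choice of the representatives \<open>u t\<close>.\<close>

definition dnls_solution :: "real set \<Rightarrow> real \<Rightarrow> (real \<Rightarrow> real \<Rightarrow> complex) \<Rightarrow> bool" where
  "dnls_solution \<Omega> \<sigma> u \<longleftrightarrow>
    (let U = (UNIV :: real set) \<times> \<Omega>; w = (\<lambda>(t, x). u t x) in
     \<exists>v. has_weak_deriv U (0, 1) w v \<and>
       locally_integrable U (\<lambda>p. of_real (cmod (w p) powr (2 * \<sigma>)) * v p) \<and>
       (\<forall>\<psi>\<in>test_functions U.
          \<i> * dist_deriv (1, 0) (dist_of U w) \<psi>
          + dist_deriv (0, 1) (dist_deriv (0, 1) (dist_of U w)) \<psi>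
          + \<i> * dist_of U (\<lambda>p. of_real (cmod (w p) powr (2 * \<sigma>)) * v p) \<psi> = 0))"

definition charge :: "real set \<Rightarrow> (real \<Rightarrow> complex) \<Rightarrow> real" where
  "charge \<Omega> f = (LINT x:\<Omega>|lebesgue. (cmod (f x))\<^sup>2)"

definition energy :: "real set \<Rightarrow> real \<Rightarrow> (real \<Rightarrow> complex) \<Rightarrow> real" where
  "energy \<Omega> \<sigma> f = (LINT x:\<Omega>|lebesgue. (cmod (weak_deriv \<Omega> f x))\<^sup>2 +
     1 / (\<sigma> + 1) * Im (of_real (cmod (f x) powr (2 * \<sigma>)) * cnj (f x) * weak_deriv \<Omega> f x))"

end

(* Galerkin approximations in the span of finitely many test functions conserve charge and energy;
   as \<sigma> < 1, the energy bounds them in H1, uniformly in time. Along a subsequence they converge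
   weakly for every t to a weakly continuous H1-valued function u that solves the equation; weak
   convergence is convergence of the coefficients in an orthonormal basis of test functions.

   The charge of u is conserved by an elementary substitute for the product rule in the duality of
   H1_0 and H^-1: with f(s,t) = Re <u(s), u(t)>, the terms of d/ds f(s,t) + d/dt f(s,t) that contain
   two derivatives cancel, and the remaining ones are O(|s - t|^(1/2)). Shifting the integration
   variable in the integral of f(t+h,t) and letting h tend to 0 gives conservation. Equality of the
   charges turns weak into strong L2 convergence, so the nonlinear part of the energy converges, and
   the energy inequality follows from weak lower semicontinuity of the norm of the derivative. *)
theory Submission
  imports Defs "HOL-Complex_Analysis.Great_Picard" "HOL-Computational_Algebra.Polynomial"
begin

section \<open>Square integrable functions\<close>

text \<open>The domain may be unbounded, so there is no compact embedding, and the nonlinearity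
  contains u_x, which converges only weakly. Two one-dimensional facts help. Point evaluation is
  bounded on H1_0, so weak convergence is pointwise with a uniform bound; the factor |u|^(2
  \<sigma>) is moved onto the test function, where dominated convergence makes it strong. And |f|^2
  <= 2 ||f|| ||f_x|| bounds the nonlinear energy by a multiple of ||f_x||^(1 + \<sigma>).

  The energy survives projection because its derivative at u in direction w is 2 Re (i
  \<open>Phi\<close> (u, w)), \<open>Phi\<close> being the weak form of u_t: for w = u_t in the
  Galerkin space, \<open>Phi\<close> (u, w) = ||u_t||^2 is real. Charge survives because Re
  \<open>Phi\<close> (u, u) = 0.

  One sequence of test functions is orthogonalized twice: the L2 basis \<open>b\<close> carries the
  differential equation, the H1 basis \<open>e\<close> the weak limits, and their partial spans
  agree. Weak limits only give ||u(t)|| <= ||u(0)||, so conservation of charge has to be proved from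
  the limit equation, tested with u at another time.\<close>

definition sq :: "'a measure \<Rightarrow> ('a \<Rightarrow> complex) \<Rightarrow> bool" where
  "sq M f \<longleftrightarrow> f \<in> borel_measurable M \<and> integrable M (\<lambda>x. (cmod (f x))\<^sup>2)"

definition nr :: "'a measure \<Rightarrow> ('a \<Rightarrow> complex) \<Rightarrow> real" where
  "nr M f = sqrt (\<integral>x. (cmod (f x))\<^sup>2 \<partial>M)"

definition ip :: "'a measure \<Rightarrow> ('a \<Rightarrow> complex) \<Rightarrow> ('a \<Rightarrow> complex) \<Rightarrow> complex" where
  "ip M f g = (\<integral>x. f x * cnj (g x) \<partial>M)"

lemma sq_measurable: "sq M f \<Longrightarrow> f \<in> borel_measurable M"
  by (simp add: sq_def)

lemma sq_integrable: "sq M f \<Longrightarrow> integrable M (\<lambda>x. (cmod (f x))\<^sup>2)"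
  by (simp add: sq_def)

lemma nr_nonneg [simp]: "0 \<le> nr M f"
  by (simp add: nr_def)

lemma nr_power2: "(nr M f)\<^sup>2 = (\<integral>x. (cmod (f x))\<^sup>2 \<partial>M)"
  by (simp add: nr_def)

lemma sq_bound:
  assumes "sq M f" "g \<in> borel_measurable M" "AE x in M. cmod (g x) \<le> C * cmod (f x)"
  shows "sq M g"
  unfolding sq_def
proof
  show "integrable M (\<lambda>x. (cmod (g x))\<^sup>2)"
  proof (rule Bochner_Integration.integrable_bound[where f="\<lambda>x. C\<^sup>2 * (cmod (f x))\<^sup>2"])
    show "integrable M (\<lambda>x. C\<^sup>2 * (cmod (f x))\<^sup>2)"
      using assms(1) by (simp add: sq_def)
    show "(\<lambda>x. (cmod (g x))\<^sup>2) \<in> borel_measurable M"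
      using assms(2) by measurable
    show "AE x in M. norm ((cmod (g x))\<^sup>2) \<le> norm (C\<^sup>2 * (cmod (f x))\<^sup>2)"
      using assms(3)
    proof eventually_elim
      case (elim x)
      then have "(cmod (g x))\<^sup>2 \<le> (C * cmod (f x))\<^sup>2" by (intro power_mono) auto
      then show ?case by (simp add: power_mult_distrib)
    qed
  qed
qed fact

lemma sq_zero [simp]: "sq M (\<lambda>x. 0)"
  by (simp add: sq_def)

lemma sq_cmult [intro]: "sq M f \<Longrightarrow> sq M (\<lambda>x. c * f x)"
  by (rule sq_bound[of M f _ "cmod c"]) (auto simp: norm_mult sq_def)

lemma borel_measurable_cnj [measurable (raw)]:
  "f \<in> borel_measurable M \<Longrightarrow> (\<lambda>x. cnj (f x)) \<in> borel_measurable M"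
  by (rule borel_measurable_continuous_on[OF linear_continuous_on[OF bounded_linear_cnj]])

lemma sq_cnj [intro]: "sq M f \<Longrightarrow> sq M (\<lambda>x. cnj (f x))"
  by (rule sq_bound[of M f _ 1]) (auto simp: sq_def)

lemma sq_uminus [intro]: "sq M f \<Longrightarrow> sq M (\<lambda>x. - f x)"
  by (rule sq_bound[of M f _ 1]) (auto simp: sq_def)

lemma power2_norm_add_le: "(cmod (a + b))\<^sup>2 \<le> 2 * (cmod a)\<^sup>2 + 2 * (cmod b)\<^sup>2"
proof -
  have "(cmod (a + b))\<^sup>2 \<le> (cmod a + cmod b)\<^sup>2"
    by (intro power_mono norm_triangle_ineq) auto
  also have "\<dots> \<le> 2 * (cmod a)\<^sup>2 + 2 * (cmod b)\<^sup>2"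
    using zero_le_power2[of "cmod a - cmod b"] by (simp add: power2_eq_square algebra_simps)
  finally show ?thesis .
qed

lemma sq_add [intro]:
  assumes "sq M f" "sq M g"
  shows "sq M (\<lambda>x. f x + g x)"
  unfolding sq_def
proof
  show m: "(\<lambda>x. f x + g x) \<in> borel_measurable M" using assms by (auto simp: sq_def)
  show "integrable M (\<lambda>x. (cmod (f x + g x))\<^sup>2)"
  proof (rule Bochner_Integration.integrable_bound[where f="\<lambda>x. 2 * (cmod (f x))\<^sup>2 + 2 * (cmod (g x))\<^sup>2"])
    show "integrable M (\<lambda>x. 2 * (cmod (f x))\<^sup>2 + 2 * (cmod (g x))\<^sup>2)"
      using assms by (simp add: sq_def)
    show "(\<lambda>x. (cmod (f x + g x))\<^sup>2) \<in> borel_measurable M" using m by measurable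
  qed (use power2_norm_add_le in \<open>auto\<close>)
qed

lemma sq_diff [intro]: "sq M f \<Longrightarrow> sq M g \<Longrightarrow> sq M (\<lambda>x. f x - g x)"
  using sq_add[of M f "\<lambda>x. - g x"] by auto

lemma sq_sum [intro]: "(\<And>i. i \<in> I \<Longrightarrow> sq M (f i)) \<Longrightarrow> sq M (\<lambda>x. \<Sum>i\<in>I. f i x)"
  by (induction I rule: infinite_finite_induct) auto

lemma sq_mult_integrable:
  assumes "sq M f" "sq M g"
  shows "integrable M (\<lambda>x. f x * g x)"
proof (rule Bochner_Integration.integrable_bound[where f="\<lambda>x. (cmod (f x))\<^sup>2 + (cmod (g x))\<^sup>2"])
  show "AE x in M. norm (f x * g x) \<le> norm ((cmod (f x))\<^sup>2 + (cmod (g x))\<^sup>2)"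
  proof (rule AE_I2)
    fix x
    have "2 * (cmod (f x) * cmod (g x)) \<le> (cmod (f x))\<^sup>2 + (cmod (g x))\<^sup>2"
      using zero_le_power2[of "cmod (f x) - cmod (g x)"] by (simp add: power2_eq_square algebra_simps)
    moreover have "0 \<le> cmod (f x) * cmod (g x)" by simp
    ultimately have "cmod (f x) * cmod (g x) \<le> (cmod (f x))\<^sup>2 + (cmod (g x))\<^sup>2" by linarith
    then show "norm (f x * g x) \<le> norm ((cmod (f x))\<^sup>2 + (cmod (g x))\<^sup>2)"
      by (simp add: norm_mult)
  qed
qed (use assms in \<open>auto simp: sq_def\<close>)

lemma sq_ip_integrable: "sq M f \<Longrightarrow> sq M g \<Longrightarrow> integrable M (\<lambda>x. f x * cnj (g x))"
  by (intro sq_mult_integrable sq_cnj)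

lemma sq_norm_mult_integrable: "sq M f \<Longrightarrow> sq M g \<Longrightarrow> integrable M (\<lambda>x. cmod (f x) * cmod (g x))"
  using integrable_norm[OF sq_mult_integrable[of M f g]] by (simp add: norm_mult)

lemma nr_Cauchy_Schwarz:
  assumes f: "sq M f" and g: "sq M g"
  shows "(\<integral>x. cmod (f x) * cmod (g x) \<partial>M) \<le> nr M f * nr M g"
proof -
  define A where "A = (\<integral>x. (cmod (f x))\<^sup>2 \<partial>M)"
  define B where "B = (\<integral>x. (cmod (g x))\<^sup>2 \<partial>M)"
  define J where "J = (\<integral>x. cmod (f x) * cmod (g x) \<partial>M)"
  have A0: "0 \<le> A" and B0: "0 \<le> B" and J0: "0 \<le> J"
    unfolding A_def B_def J_def by (auto intro: integral_nonneg_AE)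
  have [simp]: "integrable M (\<lambda>x. cmod (f x) * cmod (g x))"
    by (rule sq_norm_mult_integrable) fact+
  \<comment> \<open>Discriminant method: the integral of (s |f| - |g|)^2 is nonnegative for every
    real s, and a suitable s is inserted below.\<close>
  have quad: "2 * s * J \<le> s\<^sup>2 * A + B" for s
  proof -
    have "0 \<le> (\<integral>x. (s * cmod (f x) - cmod (g x))\<^sup>2 \<partial>M)" by (rule integral_nonneg_AE) auto
    also have "\<dots> = (\<integral>x. s\<^sup>2 * (cmod (f x))\<^sup>2 - 2 * s * (cmod (f x) * cmod (g x)) + (cmod (g x))\<^sup>2 \<partial>M)"
      by (intro Bochner_Integration.integral_cong) (auto simp: power2_eq_square algebra_simps)
    also have "\<dots> = s\<^sup>2 * A - 2 * s * J + B"
      unfolding A_def B_def J_def using f g by (simp add: sq_def)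
    finally show ?thesis by simp
  qed
  have "J\<^sup>2 \<le> A * B"
  proof (cases "A = 0")
    case True
    have "J = 0"
    proof (rule ccontr)
      assume "J \<noteq> 0"
      with J0 have "J > 0" by simp
      \<comment> \<open>With A = 0 the left side of \<open>quad\<close> is unbounded in s; this s
        makes it exceed B.\<close>
      have "2 * ((B + 1) / J) * J \<le> B" using quad[of "(B + 1) / J"] True by simp
      with \<open>J > 0\<close> B0 show False by simp
    qed
    then show ?thesis using True by simp
  next
    case False
    then have "A > 0" using A0 by simp
    have "2 * (J / A) * J \<le> (J / A)\<^sup>2 * A + B" by (rule quad)
    with \<open>A > 0\<close> have "J\<^sup>2 / A \<le> B" by (simp add: power2_eq_square field_simps)
    with \<open>A > 0\<close> show ?thesis by (simp add: field_simps)
  qed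
  then have "J \<le> sqrt (A * B)" by (simp add: real_le_rsqrt)
  then show ?thesis unfolding nr_def J_def A_def B_def by (simp add: real_sqrt_mult)
qed

lemma ip_Cauchy_Schwarz:
  assumes "sq M f" "sq M g"
  shows "cmod (ip M f g) \<le> nr M f * nr M g"
proof -
  have "cmod (ip M f g) \<le> (\<integral>x. cmod (f x) * cmod (g x) \<partial>M)"
    unfolding ip_def using integral_norm_bound[of M "\<lambda>x. f x * cnj (g x)"] by (simp add: norm_mult)
  also have "\<dots> \<le> nr M f * nr M g" by (rule nr_Cauchy_Schwarz) fact+
  finally show ?thesis .
qed

lemma ip_add_left: "sq M f \<Longrightarrow> sq M g \<Longrightarrow> sq M h \<Longrightarrow> ip M (\<lambda>x. f x + g x) h = ip M f h + ip M g h"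
  unfolding ip_def by (simp add: distrib_right sq_ip_integrable)

lemma ip_diff_left: "sq M f \<Longrightarrow> sq M g \<Longrightarrow> sq M h \<Longrightarrow> ip M (\<lambda>x. f x - g x) h = ip M f h - ip M g h"
  unfolding ip_def by (simp add: left_diff_distrib sq_ip_integrable)

lemma ip_cmult_left: "ip M (\<lambda>x. c * f x) h = c * ip M f h"
  unfolding ip_def by (simp add: mult.assoc)

lemma ip_commute: "ip M g f = cnj (ip M f g)"
  unfolding ip_def by (subst Bochner_Integration.integral_cnj[symmetric]) (simp add: mult.commute)

lemma ip_add_right: "sq M f \<Longrightarrow> sq M g \<Longrightarrow> sq M h \<Longrightarrow> ip M h (\<lambda>x. f x + g x) = ip M h f + ip M h g"
  unfolding ip_def by (simp add: distrib_left sq_ip_integrable)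

lemma ip_diff_right: "sq M f \<Longrightarrow> sq M g \<Longrightarrow> sq M h \<Longrightarrow> ip M h (\<lambda>x. f x - g x) = ip M h f - ip M h g"
  unfolding ip_def by (simp add: right_diff_distrib sq_ip_integrable)

lemma ip_cmult_right: "ip M h (\<lambda>x. c * f x) = cnj c * ip M h f"
  using ip_commute[of M h "\<lambda>x. c * f x"] ip_commute[of M h f] by (simp add: ip_cmult_left)

lemma ip_zero_left [simp]: "ip M (\<lambda>x. 0) h = 0"
  by (simp add: ip_def)

lemma ip_zero_right [simp]: "ip M h (\<lambda>x. 0) = 0"
  by (simp add: ip_def)

lemma ip_sum_left:
  "(\<And>i. i \<in> I \<Longrightarrow> sq M (f i)) \<Longrightarrow> sq M h \<Longrightarrow> ip M (\<lambda>x. \<Sum>i\<in>I. f i x) h = (\<Sum>i\<in>I. ip M (f i) h)"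
  by (induction I rule: infinite_finite_induct) (auto simp: ip_add_left sq_sum)

lemma ip_self: "ip M f f = of_real ((nr M f)\<^sup>2)"
proof -
  have "f x * cnj (f x) = complex_of_real ((cmod (f x))\<^sup>2)" for x
    by (simp only: complex_norm_square)
  then show ?thesis
    unfolding ip_def nr_power2 by (simp only: integral_complex_of_real)
qed

lemma nr_add_power2:
  assumes "sq M f" "sq M g"
  shows "(nr M (\<lambda>x. f x + g x))\<^sup>2 = (nr M f)\<^sup>2 + 2 * Re (ip M f g) + (nr M g)\<^sup>2"
proof -
  have "complex_of_real ((nr M (\<lambda>x. f x + g x))\<^sup>2) = ip M (\<lambda>x. f x + g x) (\<lambda>x. f x + g x)"
    by (simp add: ip_self)
  also have "\<dots> = ip M f f + ip M f g + cnj (ip M f g) + ip M g g"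
    using assms by (simp add: ip_add_left ip_add_right sq_add ip_commute[of M g f])
  also have "Re \<dots> = (nr M f)\<^sup>2 + 2 * Re (ip M f g) + (nr M g)\<^sup>2" by (simp add: ip_self del: of_real_power)
  finally show ?thesis by (metis Re_complex_of_real)
qed

lemma nr_cmult: "nr M (\<lambda>x. c * f x) = cmod c * nr M f"
  unfolding nr_def by (simp add: norm_mult power_mult_distrib real_sqrt_mult)

lemma nr_zero [simp]: "nr M (\<lambda>x. 0) = 0"
  by (simp add: nr_def)

lemma nr_cnj [simp]: "nr M (\<lambda>x. cnj (f x)) = nr M f"
  by (simp add: nr_def)

lemma nr_diff_commute: "nr M (\<lambda>x. f x - g x) = nr M (\<lambda>x. g x - f x)"
  by (simp add: nr_def norm_minus_commute)

lemma nr_triangle: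
  assumes "sq M f" "sq M g"
  shows "nr M (\<lambda>x. f x + g x) \<le> nr M f + nr M g"
proof (rule power2_le_imp_le)
  have "Re (ip M f g) \<le> nr M f * nr M g"
    using ip_Cauchy_Schwarz[OF assms] complex_Re_le_cmod order_trans by blast
  then show "(nr M (\<lambda>x. f x + g x))\<^sup>2 \<le> (nr M f + nr M g)\<^sup>2"
    unfolding nr_add_power2[OF assms] by (simp add: power2_eq_square algebra_simps)
qed simp

lemma nr_diff_power2:
  assumes "sq M f" "sq M g"
  shows "(nr M (\<lambda>x. f x - g x))\<^sup>2 = (nr M f)\<^sup>2 - 2 * Re (ip M f g) + (nr M g)\<^sup>2"
  using nr_add_power2[of M f "\<lambda>x. (-1) * g x"] assms ip_cmult_right[of M f "-1" g] nr_cmult[of M "-1" g]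
  by (auto simp: sq_uminus)

lemma nr_triangle_diff:
  assumes "sq M f" "sq M g" "sq M h"
  shows "nr M (\<lambda>x. f x - h x) \<le> nr M (\<lambda>x. f x - g x) + nr M (\<lambda>x. g x - h x)"
  using nr_triangle[OF sq_diff[OF assms(1,2)] sq_diff[OF assms(2,3)]] by simp

lemma nr_diff_le:
  assumes "sq M f" "sq M g"
  shows "nr M (\<lambda>x. f x - g x) \<le> nr M f + nr M g"
  using nr_triangle_diff[OF assms(1) sq_zero assms(2)] by (simp add: nr_def)

lemma nr_mono:
  assumes "sq M f" "g \<in> borel_measurable M" "AE x in M. cmod (g x) \<le> C * cmod (f x)" "0 \<le> C"
  shows "nr M g \<le> C * nr M f"
proof -
  have "(\<integral>x. (cmod (g x))\<^sup>2 \<partial>M) \<le> (\<integral>x. C\<^sup>2 * (cmod (f x))\<^sup>2 \<partial>M)"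
  proof (rule integral_mono_AE)
    show "integrable M (\<lambda>x. (cmod (g x))\<^sup>2)" using sq_bound[OF assms(1-3)] by (rule sq_integrable)
    show "integrable M (\<lambda>x. C\<^sup>2 * (cmod (f x))\<^sup>2)" using sq_integrable[OF assms(1)] by simp
    show "AE x in M. (cmod (g x))\<^sup>2 \<le> C\<^sup>2 * (cmod (f x))\<^sup>2" using assms(3)
      by eventually_elim (metis norm_ge_zero power_mono power_mult_distrib)
  qed
  then have "sqrt (\<integral>x. (cmod (g x))\<^sup>2 \<partial>M) \<le> sqrt (C\<^sup>2 * (\<integral>x. (cmod (f x))\<^sup>2 \<partial>M))"
    by simp
  then show ?thesis using assms(4) by (simp add: nr_def real_sqrt_mult)
qed

lemma nr_cong_AE:
  assumes "sq M f" "g \<in> borel_measurable M" "AE x in M. f x = g x"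
  shows "nr M f = nr M g"
  unfolding nr_def using assms by (intro arg_cong[of _ _ sqrt] integral_cong_AE) (auto simp: sq_def)

lemma nr_zero_imp_AE:
  assumes "sq M f" "nr M f = 0"
  shows "AE x in M. f x = 0"
  using integral_nonneg_eq_0_iff_AE[OF sq_integrable[OF assms(1)]] assms(2) by (simp add: nr_def)

lemma tendsto_nr:
  assumes "\<And>n. sq M (s n)" "sq M f" "(\<lambda>n. nr M (\<lambda>x. s n x - f x)) \<longlonglongrightarrow> 0"
  shows "(\<lambda>n. nr M (s n)) \<longlonglongrightarrow> nr M f"
proof (rule LIM_zero_cancel, rule tendsto_rabs_zero_cancel, rule real_tendsto_sandwich[OF _ _ tendsto_const assms(3)])
  have "\<bar>nr M (s n) - nr M f\<bar> \<le> nr M (\<lambda>x. s n x - f x)" for n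
    using nr_triangle[OF sq_diff[OF assms(1)[of n] assms(2)] assms(2)]
      nr_triangle[OF sq_diff[OF assms(2) assms(1)[of n]] assms(1)[of n]] nr_diff_commute[of M "s n" f]
    by simp
  then show "\<forall>\<^sub>F n in sequentially. \<bar>nr M (s n) - nr M f\<bar> \<le> nr M (\<lambda>x. s n x - f x)" by simp
qed simp

lemma tendsto_ip_left:
  assumes "\<And>n. sq M (s n)" "sq M f" "sq M h" "(\<lambda>n. nr M (\<lambda>x. s n x - f x)) \<longlonglongrightarrow> 0"
  shows "(\<lambda>n. ip M (s n) h) \<longlonglongrightarrow> ip M f h"
proof (rule LIM_zero_cancel, rule tendsto_norm_zero_cancel, rule real_tendsto_sandwich[OF _ _ tendsto_const])
  have "cmod (ip M (s n) h - ip M f h) \<le> nr M (\<lambda>x. s n x - f x) * nr M h" for n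
    using ip_Cauchy_Schwarz[OF sq_diff[OF assms(1)[of n] assms(2)] assms(3)] assms
    by (simp add: ip_diff_left)
  then show "\<forall>\<^sub>F n in sequentially. cmod (ip M (s n) h - ip M f h) \<le> nr M (\<lambda>x. s n x - f x) * nr M h" by simp
  show "(\<lambda>n. nr M (\<lambda>x. s n x - f x) * nr M h) \<longlonglongrightarrow> 0"
    using tendsto_mult_left_zero[OF assms(4)] .
qed simp

text \<open>If \<open>\<parallel>d\<^sub>k\<parallel> \<le> 2\<^sup>-\<^sup>k\<close> then \<open>\<Sum> 2\<^sup>k |d\<^sub>k|\<^sup>2\<close> is integrable, so that \<open>|d\<^sub>k| \<le> C 2\<^sup>-\<^sup>k\<^sup>/\<^sup>2\<close> almost everywhere.\<close>

lemma fast_Cauchy_AE: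
  assumes s: "\<And>k. sq M (s k)" and fast: "\<And>k. nr M (\<lambda>x. s (Suc k) x - s k x) \<le> (1/2)^k"
  shows "AE x in M. convergent (\<lambda>k. s k x)"
proof -
  define d where "d k x = s (Suc k) x - s k x" for k x
  have d: "sq M (d k)" for k unfolding d_def[abs_def] by (intro sq_diff s)
  have int: "integrable M (\<lambda>x. 2^k * (cmod (d k x))\<^sup>2)" for k
    using sq_integrable[OF d[of k]] by simp
  have [measurable]: "d k \<in> borel_measurable M" for k using d by (rule sq_measurable)
  have "(\<integral>\<^sup>+x. (\<Sum>k. ennreal (2^k * (cmod (d k x))\<^sup>2)) \<partial>M) = (\<Sum>k. \<integral>\<^sup>+x. ennreal (2^k * (cmod (d k x))\<^sup>2) \<partial>M)"
    by (rule nn_integral_suminf) measurable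
  also have "\<dots> = (\<Sum>k. ennreal (2^k * (nr M (d k))\<^sup>2))"
    using int by (subst nn_integral_eq_integral) (auto simp: nr_power2)
  also have "\<dots> \<le> (\<Sum>k. ennreal ((1/2)^k))"
  proof (intro suminf_le ennreal_leI)
    fix k
    have "(nr M (d k))\<^sup>2 \<le> ((1/2)^k)\<^sup>2" unfolding d_def[abs_def] by (intro power_mono fast) simp
    then have "2^k * (nr M (d k))\<^sup>2 \<le> 2^k * ((1/2)^k)\<^sup>2" by simp
    also have "\<dots> = (2^k * (1/2)^k) * (1/2)^k" by (simp only: power2_eq_square mult.assoc)
    also have "(2::real)^k * (1/2)^k = 1" by (simp add: power_divide)
    also have "1 * (1/2::real)^k = (1/2)^k" by simp
    finally show "2^k * (nr M (d k))\<^sup>2 \<le> (1/2)^k" .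
  qed auto
  also have "\<dots> = ennreal (\<Sum>k. (1/2)^k)"
    by (rule suminf_ennreal2) (auto intro: summable_geometric)
  also have "\<dots> < \<infinity>" by simp
  finally have "AE x in M. (\<Sum>k. ennreal (2^k * (cmod (d k x))\<^sup>2)) \<noteq> \<infinity>"
    by (intro nn_integral_PInf_AE) auto
  then show ?thesis
  proof eventually_elim
    case (elim x)
    then have "summable (\<lambda>k. 2^k * (cmod (d k x))\<^sup>2)"
      by (intro summable_suminf_not_top) auto
    then have "(\<lambda>k. 2^k * (cmod (d k x))\<^sup>2) \<longlonglongrightarrow> 0" by (rule summable_LIMSEQ_zero)
    then have "Bseq (\<lambda>k. 2^k * (cmod (d k x))\<^sup>2)" by (intro convergent_imp_Bseq) (auto simp: convergent_def)
    then obtain K where K: "K > 0" "\<And>k. 2^k * (cmod (d k x))\<^sup>2 \<le> K"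
      by (auto simp: Bseq_def)
    have bd: "cmod (d k x) \<le> sqrt K * (1 / sqrt 2)^k" for k
    proof -
      have "(cmod (d k x))\<^sup>2 \<le> K / 2^k" using K(2)[of k] by (simp add: field_simps)
      then have "cmod (d k x) \<le> sqrt (K / 2^k)" by (simp add: real_le_rsqrt)
      also have "\<dots> = sqrt K * (1 / sqrt 2)^k" by (simp add: real_sqrt_divide real_sqrt_power power_divide)
      finally show ?thesis .
    qed
    have "summable (\<lambda>k. d k x)"
      by (rule summable_comparison_test'[of "\<lambda>k. sqrt K * (1 / sqrt 2)^k" 0])
         (auto intro!: summable_mult summable_geometric bd)
    then have "summable (\<lambda>k. s (Suc k) x - s k x)" by (simp add: d_def)
    then have "convergent (\<lambda>n. s 0 x + (\<Sum>k<n. s (Suc k) x - s k x))"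
      by (intro convergent_add convergent_const) (simp add: summable_iff_convergent)
    moreover have "s 0 x + (\<Sum>k<n. s (Suc k) x - s k x) = s n x" for n
      by (simp add: sum_lessThan_telescope[of "\<lambda>k. s k x"])
    ultimately show ?case by simp
  qed
qed

text \<open>Fatou's lemma for |s k|^2: norm balls are closed under almost everywhere convergence.
  Square integrability of the limit comes out of the same estimate as the bound.\<close>

lemma Fatou_nr:
  assumes s: "\<And>k. sq M (s k)" and [measurable]: "f \<in> borel_measurable M"
    and lim: "AE x in M. (\<lambda>k. s k x) \<longlonglongrightarrow> f x"
    and bd: "\<And>k. nr M (s k) \<le> C"
  shows "sq M f" "nr M f \<le> C"
proof -
  have C0: "0 \<le> C" using bd[of 0] nr_nonneg[of M "s 0"] by linarith
  have [measurable]: "s k \<in> borel_measurable M" for k using s by (rule sq_measurable)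
  have "(\<integral>\<^sup>+x. ennreal ((cmod (f x))\<^sup>2) \<partial>M) = (\<integral>\<^sup>+x. liminf (\<lambda>k. ennreal ((cmod (s k x))\<^sup>2)) \<partial>M)"
  proof (rule nn_integral_cong_AE)
    show "AE x in M. ennreal ((cmod (f x))\<^sup>2) = liminf (\<lambda>k. ennreal ((cmod (s k x))\<^sup>2))"
      using lim
    proof eventually_elim
      case (elim x)
      then have "(\<lambda>k. ennreal ((cmod (s k x))\<^sup>2)) \<longlonglongrightarrow> ennreal ((cmod (f x))\<^sup>2)"
        by (intro tendsto_intros)
      then show ?case by (intro lim_imp_Liminf[symmetric]) auto
    qed
  qed
  also have "\<dots> \<le> liminf (\<lambda>k. \<integral>\<^sup>+x. ennreal ((cmod (s k x))\<^sup>2) \<partial>M)"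
    by (rule nn_integral_liminf) measurable
  also have "\<dots> = liminf (\<lambda>k. ennreal ((nr M (s k))\<^sup>2))"
    using sq_integrable[OF s] by (subst nn_integral_eq_integral) (auto simp: nr_power2)
  also have "\<dots> \<le> ennreal (C\<^sup>2)"
  proof -
    have "liminf (\<lambda>k. ennreal ((nr M (s k))\<^sup>2)) \<le> liminf (\<lambda>k::nat. ennreal (C\<^sup>2))"
      using bd by (intro Liminf_mono always_eventually allI ennreal_leI power_mono) auto
    then show ?thesis by (simp add: Liminf_const)
  qed
  finally have *: "(\<integral>\<^sup>+x. ennreal ((cmod (f x))\<^sup>2) \<partial>M) \<le> ennreal (C\<^sup>2)" .
  then have "integrable M (\<lambda>x. (cmod (f x))\<^sup>2)"
    by (intro integrableI_nonneg) (auto simp: le_less_trans)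
  then show "sq M f" by (simp add: sq_def)
  then have "(nr M f)\<^sup>2 \<le> C\<^sup>2"
    using * C0 by (simp add: nr_power2 nn_integral_eq_integral sq_integrable)
  then show "nr M f \<le> C" using C0 by (rule power2_le_imp_le)
qed

text \<open>The factor \<open>1 - (1/2)^j\<close> is that of a partial sum of the geometric series;
  keeping it exact lets the induction close.\<close>

lemma fast_Cauchy_tail:
  assumes s: "\<And>k. sq M (s k)" and fast: "\<And>k. nr M (\<lambda>x. s (Suc k) x - s k x) \<le> (1/2)^k"
  shows "nr M (\<lambda>x. s (k + j) x - s k x) \<le> 2 * (1/2)^k * (1 - (1/2)^j)"
proof (induction j)
  case (Suc j)
  have "nr M (\<lambda>x. s (k + Suc j) x - s k x)
      \<le> nr M (\<lambda>x. s (Suc (k + j)) x - s (k + j) x) + nr M (\<lambda>x. s (k + j) x - s k x)"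
    using nr_triangle_diff[OF s s s] by simp
  also have "\<dots> \<le> (1/2)^(k + j) + 2 * (1/2)^k * (1 - (1/2)^j)"
    using Suc fast[of "k + j"] by simp
  also have "\<dots> = 2 * (1/2)^k * (1 - (1/2)^(Suc j))" by (simp add: power_add algebra_simps)
  finally show ?case .
qed simp

text \<open>A quantitative Riesz-Fischer theorem. The limit is given by the total operator
  \<open>lim\<close>, hence is measurable and the same explicit formula wherever the lemma is used;
  the rate comes from \<open>Fatou_nr\<close> applied to the differences of \<open>s k\<close> and
  \<open>s (k + j)\<close> as j grows.\<close>

lemma fast_Cauchy_lim:
  assumes s: "\<And>k. sq M (s k)" and fast: "\<And>k. nr M (\<lambda>x. s (Suc k) x - s k x) \<le> (1/2)^k"
  defines "f \<equiv> \<lambda>x. lim (\<lambda>k. s k x)"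
  shows "AE x in M. (\<lambda>k. s k x) \<longlonglongrightarrow> f x" "sq M f"
    "nr M (\<lambda>x. s k x - f x) \<le> 2 * (1/2)^k"
proof -
  have [measurable]: "s k \<in> borel_measurable M" for k using s by (rule sq_measurable)
  have fm[measurable]: "f \<in> borel_measurable M" unfolding f_def by measurable
  show lim: "AE x in M. (\<lambda>k. s k x) \<longlonglongrightarrow> f x"
    using fast_Cauchy_AE[OF s fast] unfolding f_def by eventually_elim (simp add: convergent_LIMSEQ_iff)
  have tail: "nr M (\<lambda>x. s k x - s (k + j) x) \<le> 2 * (1/2)^k" for k j
  proof -
    have "(1 - (1/2)^j) \<le> (1::real)" by simp
    then have "2 * (1/2)^k * (1 - (1/2)^j) \<le> 2 * (1/2)^k * (1::real)" by (intro mult_left_mono) auto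
    then show ?thesis
      using fast_Cauchy_tail[OF s fast, of k j] unfolding nr_diff_commute[of M "s k"] by linarith
  qed
  have L: "sq M (\<lambda>x. s k x - f x) \<and> nr M (\<lambda>x. s k x - f x) \<le> 2 * (1/2)^k" for k
  proof -
    have lim_k: "AE x in M. (\<lambda>j. s k x - s (k + j) x) \<longlonglongrightarrow> s k x - f x"
      using lim
    proof eventually_elim
      case (elim x)
      show ?case
        using LIMSEQ_ignore_initial_segment[OF elim, of k] by (intro tendsto_intros) (simp add: add.commute)
    qed
    have m: "(\<lambda>x. s k x - f x) \<in> borel_measurable M" by measurable
    show ?thesis
      using Fatou_nr[OF sq_diff[OF s s] m lim_k tail] by blast
  qed
  show "nr M (\<lambda>x. s k x - f x) \<le> 2 * (1/2)^k" using L by blast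
  have "sq M (\<lambda>x. s 0 x - (s 0 x - f x))" by (rule sq_diff[OF s]) (use L in blast)
  then show "sq M f" by simp
qed

section \<open>Test functions\<close>

lemma dir_deriv_eq: "(f has_derivative f') (at p) \<Longrightarrow> dir_deriv e f p = f' e"
  unfolding dir_deriv_def by (metis frechet_derivative_at)

lemma Ck_continuous: "Ck n f \<Longrightarrow> continuous_on UNIV f"
  by (cases n) (auto intro: differentiable_imp_continuous_on simp: differentiable_on_def differentiable_at_withinI)

lemma Ck_has_derivative: "Ck (Suc n) f \<Longrightarrow> (f has_derivative frechet_derivative f (at p)) (at p)"
  by (simp add: frechet_derivative_works[symmetric])

lemma Ck_const: "Ck n (\<lambda>p. c)"
proof (induction n arbitrary: c)
  case (Suc n)
  have "dir_deriv e (\<lambda>p. c) = (\<lambda>p. 0)" for e :: 'a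
    by (auto simp: fun_eq_iff dir_deriv_def)
  then show ?case using Suc by simp
qed simp

lemma Ck_add: "Ck n f \<Longrightarrow> Ck n g \<Longrightarrow> Ck n (\<lambda>p. f p + g p)"
proof (induction n arbitrary: f g)
  case (Suc n)
  have d: "((\<lambda>p. f p + g p) has_derivative
      (\<lambda>h. frechet_derivative f (at p) h + frechet_derivative g (at p) h)) (at p)" for p
    by (rule has_derivative_add[OF Ck_has_derivative[OF Suc.prems(1)] Ck_has_derivative[OF Suc.prems(2)]])
  then have "dir_deriv e (\<lambda>p. f p + g p) = (\<lambda>p. dir_deriv e f p + dir_deriv e g p)" for e
    by (intro ext) (simp only: dir_deriv_eq[OF d], simp only: dir_deriv_def)
  then show ?case using Suc differentiableI[OF d] by auto
qed (auto intro: continuous_intros)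

lemma Ck_linear: "bounded_linear L \<Longrightarrow> Ck n f \<Longrightarrow> Ck n (\<lambda>p. L (f p))"
proof (induction n arbitrary: f)
  case (Suc n)
  have d: "((\<lambda>p. L (f p)) has_derivative (\<lambda>h. L (frechet_derivative f (at p) h))) (at p)" for p
    by (rule bounded_linear.has_derivative[OF Suc.prems(1) Ck_has_derivative[OF Suc.prems(2)]])
  then have "dir_deriv e (\<lambda>p. L (f p)) = (\<lambda>p. L (dir_deriv e f p))" for e
    by (intro ext) (simp only: dir_deriv_eq[OF d], simp only: dir_deriv_def)
  moreover have "Ck n (\<lambda>p. L (dir_deriv e f p))" for e using Suc by simp
  ultimately show ?case using d by (auto simp: differentiable_def)
next
  case 0
  then show ?case
    using continuous_on_compose2[OF linear_continuous_on[OF 0(1), of UNIV], of UNIV f] by simp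
qed

text \<open>The chain rule turns the direction \<open>e\<close> into \<open>A e\<close>, which the
  quantifier over all directions in \<open>Ck\<close> absorbs. Used for scaled bumps and for time
  slices of test functions.\<close>

lemma Ck_affine: "bounded_linear A \<Longrightarrow> Ck n f \<Longrightarrow> Ck n (\<lambda>p. f (A p + b))"
proof (induction n arbitrary: f)
  case 0
  have "continuous_on UNIV (\<lambda>p. A p + b)"
    by (intro continuous_intros linear_continuous_on 0)
  then show ?case using 0 continuous_on_compose2[of UNIV f UNIV "\<lambda>p. A p + b"] by simp
next
  case (Suc n)
  have A: "((\<lambda>p. A p + b) has_derivative A) (at p)" for p
    using bounded_linear.has_derivative[OF Suc.prems(1) has_derivative_ident]
    by (auto intro!: derivative_eq_intros)
  have d: "((\<lambda>p. f (A p + b)) has_derivative (\<lambda>h. frechet_derivative f (at (A p + b)) (A h))) (at p)" for p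
    by (rule has_derivative_compose[OF A Ck_has_derivative[OF Suc.prems(2)]])
  then have "dir_deriv e (\<lambda>p. f (A p + b)) = (\<lambda>p. dir_deriv (A e) f (A p + b))" for e
    by (intro ext) (simp only: dir_deriv_eq[OF d], simp only: dir_deriv_def)
  then show ?case using Suc d by (auto simp: differentiable_def)
qed

lemma Ck_Suc_imp: "Ck (Suc n) f \<Longrightarrow> Ck n f"
proof (induction n arbitrary: f)
  case 0
  then show ?case using Ck_continuous[of "Suc 0" f] by simp
next
  case (Suc n)
  show ?case
    unfolding Ck.simps(2)[of n] using Suc.prems Suc.IH unfolding Ck.simps(2)[of "Suc n"] by blast
qed

lemma Ck_mult:
  fixes f g :: "'a::real_normed_vector \<Rightarrow> complex"
  shows "Ck n f \<Longrightarrow> Ck n g \<Longrightarrow> Ck n (\<lambda>p. f p * g p)"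
proof (induction n arbitrary: f g)
  case (Suc n)
  have d: "((\<lambda>p. f p * g p) has_derivative
      (\<lambda>h. f p * frechet_derivative g (at p) h + frechet_derivative f (at p) h * g p)) (at p)" for p
    by (rule has_derivative_mult[OF Ck_has_derivative[OF Suc.prems(1)] Ck_has_derivative[OF Suc.prems(2)]])
  then have "dir_deriv e (\<lambda>p. f p * g p) = (\<lambda>p. f p * dir_deriv e g p + dir_deriv e f p * g p)" for e
    by (intro ext) (simp only: dir_deriv_eq[OF d], simp only: dir_deriv_def)
  moreover have "Ck n f" "Ck n g" using Suc.prems by (simp_all only: Ck_Suc_imp)
  ultimately show ?case using Suc differentiableI[OF d] by (auto intro!: Ck_add)
qed (auto intro: continuous_intros)

lemma tfI:
  assumes "\<And>n. Ck n \<psi>" "compact K" "K \<subseteq> U" "\<And>p. p \<notin> K \<Longrightarrow> \<psi> p = 0"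
  shows "\<psi> \<in> test_functions U"
proof -
  have K: "closure {p. \<psi> p \<noteq> 0} \<subseteq> K"
    using assms by (intro closure_minimal compact_imp_closed) auto
  then have "compact (K \<inter> closure {p. \<psi> p \<noteq> 0})"
    by (intro compact_Int_closed assms closed_closure)
  then show ?thesis
    unfolding test_functions_def using assms K by (auto simp: Int_absorb1)
qed

lemma tf_Ck: "\<psi> \<in> test_functions U \<Longrightarrow> Ck n \<psi>"
  by (simp add: test_functions_def)

lemma tf_continuous: "\<psi> \<in> test_functions U \<Longrightarrow> continuous_on S \<psi>"
  using Ck_continuous[OF tf_Ck] continuous_on_subset by blast

lemma tf_measurable [measurable_dest]: "\<psi> \<in> test_functions U \<Longrightarrow> \<psi> \<in> borel_measurable borel"
  by (intro borel_measurable_continuous_onI tf_continuous)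

lemma tf_has_derivative: "\<psi> \<in> test_functions U \<Longrightarrow> (\<psi> has_derivative frechet_derivative \<psi> (at p)) (at p)"
  using tf_Ck[of \<psi> U 1] by (simp flip: frechet_derivative_works)

lemma tf_support:
  assumes "\<psi> \<in> test_functions U"
  obtains K where "compact K" "K \<subseteq> U" "\<And>p. p \<notin> K \<Longrightarrow> \<psi> p = 0"
proof
  show "compact (closure {p. \<psi> p \<noteq> 0})" "closure {p. \<psi> p \<noteq> 0} \<subseteq> U"
    using assms by (simp_all add: test_functions_def)
  show "\<psi> p = 0" if "p \<notin> closure {p. \<psi> p \<noteq> 0}" for p
    using that closure_subset[of "{p. \<psi> p \<noteq> 0}"] by blast
qed

lemma tf_outside: "\<psi> \<in> test_functions U \<Longrightarrow> p \<notin> U \<Longrightarrow> \<psi> p = 0"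
  by (metis tf_support subsetD)

lemma tf_zero [simp]: "(\<lambda>p. 0) \<in> test_functions U"
  by (rule tfI[of _ "{}"]) (auto intro: Ck_const)

lemma tf_add:
  assumes "\<psi> \<in> test_functions U" "\<eta> \<in> test_functions U"
  shows "(\<lambda>p. \<psi> p + \<eta> p) \<in> test_functions U"
proof -
  obtain K where K: "compact K" "K \<subseteq> U" "\<And>p. p \<notin> K \<Longrightarrow> \<psi> p = 0" using assms(1) by (metis tf_support)
  obtain K' where K': "compact K'" "K' \<subseteq> U" "\<And>p. p \<notin> K' \<Longrightarrow> \<eta> p = 0" using assms(2) by (metis tf_support)
  show ?thesis
    by (rule tfI[of _ "K \<union> K'"]) (use K K' tf_Ck[OF assms(1)] tf_Ck[OF assms(2)] in \<open>auto intro!: Ck_add\<close>)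
qed

lemma tf_linear:
  assumes "\<psi> \<in> test_functions U" "bounded_linear L"
  shows "(\<lambda>p. L (\<psi> p)) \<in> test_functions U"
proof -
  obtain K where K: "compact K" "K \<subseteq> U" "\<And>p. p \<notin> K \<Longrightarrow> \<psi> p = 0" using assms(1) by (metis tf_support)
  have "L 0 = 0" using assms(2) by (simp add: linear_0 bounded_linear.linear)
  then show ?thesis
    using K Ck_linear[OF assms(2) tf_Ck[OF assms(1)]] by (intro tfI[of _ K]) auto
qed

lemma tf_cmult: "\<psi> \<in> test_functions U \<Longrightarrow> (\<lambda>p. c * \<psi> p) \<in> test_functions U"
  by (rule tf_linear) (auto intro: bounded_linear_mult_right)

lemma tf_cnj: "\<psi> \<in> test_functions U \<Longrightarrow> (\<lambda>p. cnj (\<psi> p)) \<in> test_functions U"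
  by (rule tf_linear) (auto intro: bounded_linear_cnj)

lemma tf_uminus: "\<psi> \<in> test_functions U \<Longrightarrow> (\<lambda>p. - \<psi> p) \<in> test_functions U"
  using tf_cmult[of \<psi> U "-1"] by simp

lemma tf_diff: "\<psi> \<in> test_functions U \<Longrightarrow> \<eta> \<in> test_functions U \<Longrightarrow> (\<lambda>p. \<psi> p - \<eta> p) \<in> test_functions U"
  using tf_add[of \<psi> U "\<lambda>p. - \<eta> p"] by (simp add: tf_uminus)

lemma tf_sum: "(\<And>i. i \<in> I \<Longrightarrow> \<psi> i \<in> test_functions U) \<Longrightarrow> (\<lambda>p. \<Sum>i\<in>I. \<psi> i p) \<in> test_functions U"
  by (induction I rule: infinite_finite_induct) (auto intro: tf_add)

lemma tf_dir_deriv: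
  assumes "\<psi> \<in> test_functions U"
  shows "dir_deriv e \<psi> \<in> test_functions U"
proof -
  obtain K where K: "compact K" "K \<subseteq> U" "\<And>p. p \<notin> K \<Longrightarrow> \<psi> p = 0" using assms by (metis tf_support)
  show ?thesis
  proof (rule tfI[OF _ K(1,2)])
    show "Ck n (dir_deriv e \<psi>)" for n
      using tf_Ck[OF assms, of "Suc n"] by simp
    fix p assume p: "p \<notin> K"
    have "(\<psi> has_derivative (\<lambda>h. 0)) (at p)"
    proof (rule has_derivative_transform_within_open[OF has_derivative_const])
      show "open (- K)" using K(1) by (simp add: compact_imp_closed open_Compl)
    qed (use p K(3) in auto)
    then show "dir_deriv e \<psi> p = 0" by (simp add: dir_deriv_eq)
  qed
qed

section \<open>Test functions of one variable: integration by parts and the sup bound\<close>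

abbreviation D :: "(real \<Rightarrow> complex) \<Rightarrow> real \<Rightarrow> complex" where
  "D \<equiv> dir_deriv 1"

lemma tf_vector_derivative:
  fixes \<psi> :: "real \<Rightarrow> complex"
  assumes "\<psi> \<in> test_functions U"
  shows "(\<psi> has_vector_derivative D \<psi> x) (at x within S)"
proof -
  have d: "(\<psi> has_derivative frechet_derivative \<psi> (at x)) (at x)"
    using assms by (rule tf_has_derivative)
  interpret bounded_linear "frechet_derivative \<psi> (at x)" using d by (rule has_derivative_bounded_linear)
  have "frechet_derivative \<psi> (at x) = (\<lambda>h. h *\<^sub>R D \<psi> x)"
    unfolding dir_deriv_def by (metis mult.right_neutral real_scaleR_def scaleR)
  then show ?thesis using d by (auto simp: has_vector_derivative_def intro: has_derivative_at_withinI)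
qed

lemma D_eq: "(\<psi> has_vector_derivative d) (at x) \<Longrightarrow> D \<psi> x = d"
  unfolding has_vector_derivative_def by (drule dir_deriv_eq[where e=1]) simp

lemma D_add: "\<psi> \<in> test_functions U \<Longrightarrow> \<eta> \<in> test_functions V \<Longrightarrow> D (\<lambda>x. \<psi> x + \<eta> x) x = D \<psi> x + D \<eta> x"
  by (intro D_eq has_vector_derivative_add tf_vector_derivative)

lemma D_diff: "\<psi> \<in> test_functions U \<Longrightarrow> \<eta> \<in> test_functions V \<Longrightarrow> D (\<lambda>x. \<psi> x - \<eta> x) x = D \<psi> x - D \<eta> x"
  by (intro D_eq has_vector_derivative_diff tf_vector_derivative)

lemma D_cmult: "\<psi> \<in> test_functions U \<Longrightarrow> D (\<lambda>x. c * \<psi> x) x = c * D \<psi> x"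
  by (intro D_eq has_vector_derivative_mult_right tf_vector_derivative)

lemma D_cnj: "\<psi> \<in> test_functions U \<Longrightarrow> D (\<lambda>x. cnj (\<psi> x)) x = cnj (D \<psi> x)"
  by (intro D_eq has_vector_derivative_cnj tf_vector_derivative)

lemma D_zero: "D (\<lambda>x. 0) x = 0"
  by (rule D_eq) simp

lemma D_sum: "(\<And>i. i \<in> I \<Longrightarrow> \<psi> i \<in> test_functions U) \<Longrightarrow> D (\<lambda>x. \<Sum>i\<in>I. \<psi> i x) x = (\<Sum>i\<in>I. D (\<psi> i) x)"
  by (intro D_eq has_vector_derivative_sum tf_vector_derivative)

lemma tf_bound:
  fixes \<psi> :: "'a::euclidean_space \<Rightarrow> complex"
  assumes "\<psi> \<in> test_functions U"
  obtains R C where "0 < R" "0 < C" "\<And>x. cmod (\<psi> x) \<le> C" "\<And>x. R < norm x \<Longrightarrow> \<psi> x = 0"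
proof -
  obtain K where K: "compact K" "K \<subseteq> U" "\<And>p. p \<notin> K \<Longrightarrow> \<psi> p = 0" using assms by (metis tf_support)
  from K(1) obtain R where R: "R > 0" "\<And>x. x \<in> K \<Longrightarrow> norm x \<le> R"
    by (meson bounded_pos compact_imp_bounded)
  have "bounded (\<psi> ` K)"
    by (intro compact_imp_bounded compact_continuous_image K tf_continuous[OF assms])
  then obtain C where C: "C > 0" "\<And>x. x \<in> K \<Longrightarrow> cmod (\<psi> x) \<le> C"
    by (auto simp: bounded_pos)
  show ?thesis
  proof (rule that[OF R(1) C(1)])
    show "cmod (\<psi> x) \<le> C" for x using C K(3)[of x] by (cases "x \<in> K") auto
    show "\<psi> x = 0" if "R < norm x" for x using R(2)[of x] K(3)[of x] that by fastforce
  qed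
qed

lemma tf_radius:
  fixes \<psi> :: "'a::euclidean_space \<Rightarrow> complex"
  assumes "\<psi> \<in> test_functions U"
  shows "\<exists>R>0. \<forall>x. R < norm x \<longrightarrow> \<psi> x = 0"
  by (rule tf_bound[OF assms]) blast

lemma continuous_compact_support_integrable:
  fixes f :: "real \<Rightarrow> 'b::euclidean_space"
  assumes "continuous_on UNIV f" "\<And>x. R < \<bar>x\<bar> \<Longrightarrow> f x = 0"
  shows "integrable lborel f"
proof -
  have "integrable lborel (\<lambda>x. indicator {-R..R} x *\<^sub>R f x)"
    by (rule borel_integrable_compact) (auto intro: continuous_on_subset assms)
  moreover have "(\<lambda>x. indicator {-R..R} x *\<^sub>R f x) = f"
    using assms(2) by (fastforce simp: indicator_def)
  ultimately show ?thesis by simp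
qed

lemma tf_sq:
  fixes \<psi> :: "real \<Rightarrow> complex"
  assumes "\<psi> \<in> test_functions U"
  shows "sq lborel \<psi>"
proof -
  obtain R where R: "0 < R" "\<forall>x. R < norm x \<longrightarrow> \<psi> x = 0" using tf_radius[OF assms] by blast
  then have "integrable lborel (\<lambda>x. (cmod (\<psi> x))\<^sup>2)"
    using R by (intro continuous_compact_support_integrable[of _ R]) (auto intro!: continuous_intros tf_continuous[OF assms])
  then show ?thesis using assms by (auto simp: sq_def tf_measurable)
qed

lemma integral_derivative_zero:
  fixes f :: "real \<Rightarrow> 'b::euclidean_space"
  assumes f: "\<And>x. (f has_vector_derivative f' x) (at x)" and "continuous_on UNIV f'"
    and supp: "\<And>x. R < \<bar>x\<bar> \<Longrightarrow> f x = 0" "\<And>x. R < \<bar>x\<bar> \<Longrightarrow> f' x = 0"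
  shows "(\<integral>x. f' x \<partial>lborel) = 0"
proof -
  \<comment> \<open>\<open>R\<close> may be negative; the enlarged interval is nondegenerate and f
    vanishes at both of its end points.\<close>
  define S where "S = max R 0 + 1"
  have "(\<integral>x. indicator {-S..S} x *\<^sub>R f' x \<partial>lborel) = f S - f (-S)"
    using assms by (intro integral_FTC_Icc) (auto simp: S_def intro: has_vector_derivative_at_within continuous_on_subset)
  moreover have "(\<lambda>x. indicator {-S..S} x *\<^sub>R f' x) = f'"
    using supp(2) by (fastforce simp: indicator_def S_def)
  moreover have "f S = 0" "f (-S) = 0" by (auto intro!: supp(1) simp: S_def)
  ultimately show ?thesis by simp
qed

lemma tf_by_parts:
  fixes \<psi> \<eta> :: "real \<Rightarrow> complex"
  assumes "\<psi> \<in> test_functions U" "\<eta> \<in> test_functions V"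
  shows "(\<integral>x. D \<psi> x * \<eta> x \<partial>lborel) = - (\<integral>x. \<psi> x * D \<eta> x \<partial>lborel)"
proof -
  obtain R where R: "0 < R" "\<forall>x. R < norm x \<longrightarrow> \<psi> x = 0" using tf_radius[OF assms(1)] by blast
  obtain S where S: "0 < S" "\<forall>x. S < norm x \<longrightarrow> D \<psi> x = 0" using tf_radius[OF tf_dir_deriv[OF assms(1)]] by blast
  have "(\<integral>x. \<psi> x * D \<eta> x + D \<psi> x * \<eta> x \<partial>lborel) = 0"
    using assms R S
    by (intro integral_derivative_zero[of "\<lambda>x. \<psi> x * \<eta> x" _ "max R S"])
       (auto intro!: has_vector_derivative_mult tf_vector_derivative continuous_intros
         tf_continuous[OF assms(1)] tf_continuous[OF assms(2)] tf_continuous[OF tf_dir_deriv[OF assms(1)]]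
         tf_continuous[OF tf_dir_deriv[OF assms(2)]])
  moreover have "integrable lborel (\<lambda>x. \<psi> x * D \<eta> x)" "integrable lborel (\<lambda>x. D \<psi> x * \<eta> x)"
    using assms by (auto intro!: sq_mult_integrable tf_sq tf_dir_deriv)
  ultimately show ?thesis by (simp add: add_eq_0_iff)
qed

text \<open>Integrate the derivative of |\<psi>|^2, which is at most 2 |\<psi>| |D \<psi>|, from a
  point outside the support up to x, and apply Cauchy-Schwarz. This is the one-dimensional Sobolev
  embedding on which pointwise convergence and the a priori bound rest.\<close>

lemma tf_sup_bound:
  fixes \<psi> :: "real \<Rightarrow> complex"
  assumes "\<psi> \<in> test_functions U"
  shows "(cmod (\<psi> x))\<^sup>2 \<le> 2 * nr lborel \<psi> * nr lborel (D \<psi>)"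
proof -
  obtain R where R: "0 < R" "\<forall>x. R < norm x \<longrightarrow> \<psi> x = 0" using tf_radius[OF assms] by blast
  define S where "S = max R \<bar>x\<bar> + 1"
  define f' where "f' y = \<psi> y * cnj (D \<psi> y) + D \<psi> y * cnj (\<psi> y)" for y
  have le: "-S \<le> x" and "\<psi> (-S) = 0"
    using R(2) by (auto simp: S_def)
  have sq1: "sq lborel \<psi>" "sq lborel (D \<psi>)" using assms by (auto intro!: tf_sq tf_dir_deriv)
  have int: "integrable lborel (\<lambda>y. cmod (\<psi> y) * cmod (D \<psi> y))"
    by (rule sq_norm_mult_integrable) fact+
  have intf: "integrable lborel f'"
    unfolding f'_def[abs_def] using sq1 by (auto intro!: Bochner_Integration.integrable_add sq_ip_integrable)
  have "(\<integral>y. indicator {-S..x} y *\<^sub>R f' y \<partial>lborel) = \<psi> x * cnj (\<psi> x) - \<psi> (-S) * cnj (\<psi> (-S))"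
    using assms unfolding f'_def
    by (intro integral_FTC_Icc le has_vector_derivative_mult has_vector_derivative_cnj tf_vector_derivative
        continuous_intros tf_continuous tf_dir_deriv)
  then have "complex_of_real ((cmod (\<psi> x))\<^sup>2) = (\<integral>y. indicator {-S..x} y *\<^sub>R f' y \<partial>lborel)"
    using \<open>\<psi> (-S) = 0\<close> by (simp only: complex_norm_square mult_zero_left diff_zero)
  then have "(cmod (\<psi> x))\<^sup>2 = cmod (\<integral>y. indicator {-S..x} y *\<^sub>R f' y \<partial>lborel)"
    by (metis norm_of_real abs_of_nonneg zero_le_power2)
  also have "\<dots> \<le> (\<integral>y. cmod (indicator {-S..x} y *\<^sub>R f' y) \<partial>lborel)"
    by (rule integral_norm_bound)
  also have "\<dots> \<le> (\<integral>y. 2 * (cmod (\<psi> y) * cmod (D \<psi> y)) \<partial>lborel)"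
  proof (rule Bochner_Integration.integral_mono)
    show "integrable lborel (\<lambda>y. cmod (indicator {-S..x} y *\<^sub>R f' y))"
      by (intro integrable_norm integrable_mult_indicator intf) auto
    fix y
    have "cmod (f' y) \<le> cmod (\<psi> y * cnj (D \<psi> y)) + cmod (D \<psi> y * cnj (\<psi> y))"
      unfolding f'_def by (rule norm_triangle_ineq)
    then show "cmod (indicator {-S..x} y *\<^sub>R f' y) \<le> 2 * (cmod (\<psi> y) * cmod (D \<psi> y))"
      by (auto simp: indicator_def norm_mult)
  qed (use int in simp)
  also have "\<dots> \<le> 2 * (nr lborel \<psi> * nr lborel (D \<psi>))"
    using nr_Cauchy_Schwarz[OF sq1] by simp
  finally show ?thesis by simp
qed

section \<open>Bump functions and the fundamental lemma of the calculus of variations\<close>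

text \<open>Carrying the polynomial p as a parameter makes the class of functions p(1/x) exp(-1/x),
  extended by zero, closed under differentiation: p becomes X^2 (p - p'). Smoothness then follows by
  induction.\<close>

definition flat :: "real poly \<Rightarrow> real \<Rightarrow> real" where
  "flat p x = (if 0 < x then poly p (1/x) * exp (- (1/x)) else 0)"

lemma tendsto_poly_exp: "((\<lambda>y::real. poly p y * exp (- y)) \<longlongrightarrow> 0) at_top"
proof -
  have "((\<lambda>y. \<Sum>i\<le>degree p. coeff p i * (y ^ i / exp y)) \<longlongrightarrow> (\<Sum>i\<le>degree p. coeff p i * 0)) at_top"
    by (intro tendsto_intros tendsto_power_div_exp_0)
  moreover have "(\<lambda>y. \<Sum>i\<le>degree p. coeff p i * (y ^ i / exp y)) = (\<lambda>y::real. poly p y * exp (- y))"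
    by (simp add: poly_altdef sum_distrib_right exp_minus divide_inverse mult.assoc fun_eq_iff)
  ultimately show ?thesis by simp
qed

lemma flat_has_derivative:
  "(flat p has_real_derivative flat ([:0, 0, 1:] * (p - pderiv p)) x) (at x)"
proof -
  consider "x < 0" | "x > 0" | "x = 0" by linarith
  then show ?thesis
  proof cases
    case 1
    have "(flat p has_real_derivative 0) (at x)"
      by (rule has_field_derivative_transform_within_open[of "\<lambda>_. 0" _ _ "{..<0}"])
         (use 1 in \<open>auto simp: flat_def\<close>)
    then show ?thesis using 1 by (simp add: flat_def)
  next
    case 2
    have "((\<lambda>x. poly p (1/x) * exp (- (1/x))) has_real_derivative
        flat ([:0, 0, 1:] * (p - pderiv p)) x) (at x)"
      using 2 by (auto intro!: derivative_eq_intros poly_DERIV[THEN DERIV_chain2] simp: flat_def field_simps power2_eq_square)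
    then show ?thesis
      by (rule has_field_derivative_transform_within_open[of _ _ _ "{0<..}"])
         (use 2 in \<open>auto simp: flat_def\<close>)
  next
    case 3
    have r: "((\<lambda>h. flat p h / h) \<longlongrightarrow> 0) (at_right 0)"
    proof -
      \<comment> \<open>Substituting y = 1/h turns the difference quotient at 0 into y p(y) exp(-y),
        which tends to 0.\<close>
      have "((\<lambda>y. poly ([:0, 1:] * p) y * exp (- y)) \<longlongrightarrow> 0) at_top" by (rule tendsto_poly_exp)
      then have "((\<lambda>h. poly ([:0, 1:] * p) (inverse h) * exp (- inverse h)) \<longlongrightarrow> 0) (at_right 0)"
        by (rule filterlim_compose[OF _ filterlim_inverse_at_top_right])
      then show ?thesis
        by (rule Lim_transform_eventually)
           (auto simp: eventually_at_right_field flat_def field_simps intro!: exI[of _ 1])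
    qed
    have l: "((\<lambda>h. flat p h / h) \<longlongrightarrow> 0) (at_left 0)"
      by (rule Lim_transform_eventually[OF tendsto_const])
         (auto simp: eventually_at_left_field flat_def intro!: exI[of _ "-1"])
    have "((\<lambda>h. flat p h / h) \<longlongrightarrow> 0) (at 0)"
      using r l by (simp add: filterlim_split_at)
    then have "(flat p has_real_derivative 0) (at 0)"
      by (simp add: DERIV_def flat_def)
    then show ?thesis using 3 by (simp add: flat_def)
  qed
qed

lemma Ck_flat: "Ck n (\<lambda>x. complex_of_real (flat p x))"
proof (induction n arbitrary: p)
  case 0
  have "isCont (flat p) x" for x using flat_has_derivative DERIV_isCont by blast
  then have "continuous_on UNIV (flat p)" by (simp add: continuous_at_imp_continuous_on)
  then show ?case by (auto intro: continuous_intros)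
next
  case (Suc n)
  define q where "q = [:0, 0, 1:] * (p - pderiv p)"
  have d: "((\<lambda>x. complex_of_real (flat p x)) has_derivative (\<lambda>h. of_real (h * flat q x))) (at x)" for x
    using flat_has_derivative[of p x] unfolding q_def[symmetric]
    by (intro has_derivative_of_real) (simp add: has_field_derivative_def mult_commute_abs)
  have "dir_deriv e (\<lambda>x. complex_of_real (flat p x)) = (\<lambda>x. of_real e * of_real (flat q x))" for e
    using dir_deriv_eq[OF d] by auto
  moreover have "Ck n (\<lambda>x. complex_of_real e * of_real (flat q x))" for e
    by (intro Ck_linear[OF bounded_linear_mult_right] Suc)
  ultimately show ?case using differentiableI[OF d] by simp
qed

text \<open>The scale n sharpens the profile: exp(-1/(n y)) tends to 1 for y > 0. With values
  bounded by 1 and support in the closed interval, these functions converge boundedly to the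
  indicator of the open interval.\<close>

definition bump :: "nat \<Rightarrow> real \<Rightarrow> real \<Rightarrow> real \<Rightarrow> complex" where
  "bump n a b x = of_real (flat 1 (real n * (x - a)) * flat 1 (real n * (b - x)))"

lemma bump_test:
  assumes "{a..b} \<subseteq> U"
  shows "bump n a b \<in> test_functions U"
proof (rule tfI[of _ "{a..b}"])
  show "Ck k (bump n a b)" for k
  proof -
    have "Ck k (\<lambda>x. complex_of_real (flat 1 (real n * x + (- real n * a)))
        * complex_of_real (flat 1 (- real n * x + (real n * b))))"
      by (intro Ck_mult Ck_affine[OF bounded_linear_mult_right] Ck_flat)
    then show ?thesis by (simp add: bump_def[abs_def] algebra_simps)
  qed
  show "bump n a b x = 0" if "x \<notin> {a..b}" for x
    using that by (auto simp: bump_def flat_def zero_less_mult_iff)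
qed (use assms in auto)

lemma bump_bound: "cmod (bump n a b x) \<le> indicator {a..b} x"
proof (cases "x \<in> {a..b}")
  case True
  have "\<bar>flat 1 y\<bar> \<le> 1" for y by (simp add: flat_def)
  then have "\<bar>flat 1 (real n * (x - a))\<bar> * \<bar>flat 1 (real n * (b - x))\<bar> \<le> 1 * 1"
    by (intro mult_mono) auto
  then show ?thesis using True by (simp add: bump_def norm_mult)
next
  case False
  then show ?thesis by (auto simp: bump_def flat_def zero_less_mult_iff)
qed

lemma bump_tendsto: "(\<lambda>n. bump n a b x) \<longlonglongrightarrow> indicator {a<..<b} x"
proof (cases "x \<in> {a<..<b}")
  case True
  have 1: "(\<lambda>n. flat 1 (real n * y)) \<longlonglongrightarrow> 1" if "y > 0" for y
  proof -
    have "(\<lambda>n. exp (- (1 / y * inverse (real n)))) \<longlonglongrightarrow> exp (- (1 / y * 0))"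
      by (intro tendsto_intros lim_inverse_n)
    then have "(\<lambda>n. exp (- (1 / y * inverse (real n)))) \<longlonglongrightarrow> 1" by simp
    then show ?thesis
      by (rule Lim_transform_eventually)
         (use that in \<open>auto intro!: eventually_sequentiallyI[of 1] simp: flat_def field_simps\<close>)
  qed
  have "(\<lambda>n. bump n a b x) \<longlonglongrightarrow> of_real (1 * 1)"
    unfolding bump_def using True by (intro tendsto_of_real tendsto_mult 1) auto
  then show ?thesis using True by simp
next
  case False
  then have "bump n a b x = 0" for n
    by (cases "n = 0") (auto simp: bump_def flat_def zero_less_mult_iff)
  then show ?thesis using False by simp
qed

text \<open>Open intervals form an intersection-stable generator, so the vanishing spreads to Borel
  sets by the pi-lambda theorem, and to Lebesgue sets by passing to Borel supersets that differ by a
  null set. Uniqueness of densities is then applied to real and imaginary part.\<close>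

lemma set_integral_zero_imp_AE:
  fixes h :: "real \<Rightarrow> complex"
  assumes h: "integrable lebesgue h"
    and zero: "\<And>a b. (LINT x:{a<..<b}|lebesgue. h x) = 0"
  shows "AE x in lebesgue. h x = 0"
proof -
  let ?G = "range (\<lambda>(a, b). box a b :: real set)"
  have seth: "set_integrable lebesgue A h" if "A \<in> sets lebesgue" for A
    using h that unfolding set_integrable_def by (rule integrable_mult_indicator[rotated])
  \<comment> \<open>The complement step of the pi-lambda argument needs the integral over the whole
    line, obtained from growing intervals.\<close>
  have all: "(LINT x:UNIV|lebesgue. h x) = 0"
  proof -
    have "(\<lambda>n. LINT x:{- real n<..<real n}|lebesgue. h x) \<longlonglongrightarrow> (LINT x:UNIV|lebesgue. h x)"
      unfolding set_lebesgue_integral_def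
    proof (rule integral_dominated_convergence[where w="\<lambda>x. cmod (h x)"])
      show "AE x in lebesgue. (\<lambda>n. indicat_real {- real n<..<real n} x *\<^sub>R h x) \<longlonglongrightarrow> indicat_real UNIV x *\<^sub>R h x"
      proof (rule AE_I2, rule tendsto_eventually)
        fix x :: real
        obtain N :: nat where "\<bar>x\<bar> < real N" using reals_Archimedean2 by blast
        then show "\<forall>\<^sub>F n in sequentially. indicat_real {- real n<..<real n} x *\<^sub>R h x = indicat_real UNIV x *\<^sub>R h x"
          unfolding eventually_sequentially by (intro exI[of _ N]) (auto simp: indicator_def)
      qed
      show "(\<lambda>x. indicat_real {- real n<..<real n} x *\<^sub>R h x) \<in> borel_measurable lebesgue" for n
        using h by (intro borel_measurable_scaleR borel_measurable_indicator) auto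
    qed (use h in \<open>auto simp: indicator_def\<close>)
    then show ?thesis using zero by (simp add: LIMSEQ_const_iff)
  qed
  have borel: "(LINT x:A|lebesgue. h x) = 0" if "A \<in> sets borel" for A
  proof -
    have "A \<in> sigma_sets UNIV ?G" using that by (simp add: borel_eq_box)
    have "Int_stable ?G" by (auto simp: Int_stable_def Int_interval image_iff box_Int_box)
    moreover have "?G \<subseteq> Pow UNIV" by simp
    moreover note \<open>A \<in> sigma_sets UNIV ?G\<close>
    ultimately show ?thesis
    proof (induction rule: sigma_sets_induct_disjoint)
      case (union A)
      have [measurable]: "A i \<in> sets lebesgue" for i
      proof -
        have "A i \<in> sets borel" using union(2) by (auto simp: borel_eq_box)
        then show ?thesis by simp
      qed
      have "(LINT x:(\<Union>i. A i)|lebesgue. h x) = (\<Sum>i. (LINT x:(A i)|lebesgue. h x))"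
        by (rule lebesgue_integral_countable_add) (use union(1) in \<open>auto simp: disjoint_family_on_def intro!: seth\<close>)
      then show ?case using union by simp
    next
      case (compl A)
      then have "A \<in> sets borel" by (auto simp: borel_eq_box)
      then have [measurable]: "A \<in> sets lebesgue" by simp
      have "(LINT x:A \<union> (UNIV - A)|lebesgue. h x) = (LINT x:A|lebesgue. h x) + (LINT x:UNIV - A|lebesgue. h x)"
        by (rule set_integral_Un) (auto intro!: seth)
      then show ?case using compl all by simp
    next
      case empty
      then show ?case by (simp add: set_lebesgue_integral_def)
    next
      case (basic A)
      then show ?case using zero by (auto simp: box_real)
    qed
  qed
  have leb: "(LINT x:A|lebesgue. h x) = 0" if "A \<in> sets lebesgue" for A
  proof -
    have Al: "A \<in> sets lebesgue" using that .
    obtain A' where A': "A \<subseteq> A'" "A' \<in> sets lborel" "A' - A \<in> null_sets lebesgue" "emeasure lebesgue A = emeasure lborel A'"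
      using Al by (rule Lebesgue_Measure.completion_upper)
    have "(LINT x:A|lebesgue. h x) = (LINT x:A'|lebesgue. h x)"
      unfolding set_lebesgue_integral_def
    proof (rule integral_cong_AE)
      show "AE x in lebesgue. indicat_real A x *\<^sub>R h x = indicat_real A' x *\<^sub>R h x"
        using AE_not_in[OF A'(3)] by eventually_elim (use A'(1) in \<open>auto simp: indicator_def\<close>)
    qed (use h A' \<open>A \<in> sets lebesgue\<close> in \<open>auto intro!: borel_measurable_scaleR borel_measurable_indicator\<close>)
    also have "\<dots> = 0" using borel A'(2) by simp
    finally show ?thesis .
  qed
  have Re: "(LINT x:A|lebesgue. Re (h x)) = 0" and Im: "(LINT x:A|lebesgue. Im (h x)) = 0"
    if "A \<in> sets lebesgue" for A
  proof -
    have "integrable lebesgue (\<lambda>x. indicat_real A x *\<^sub>R h x)" using seth[OF that] by (simp add: set_integrable_def)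
    from integral_Re[OF this] integral_Im[OF this] leb[OF that]
    show "(LINT x:A|lebesgue. Re (h x)) = 0" "(LINT x:A|lebesgue. Im (h x)) = 0"
      by (simp_all add: set_lebesgue_integral_def)
  qed
  have "AE x in lebesgue. Re (h x) = 0"
    by (rule density_unique_real) (use h Re in \<open>auto simp: set_lebesgue_integral_def\<close>)
  moreover have "AE x in lebesgue. Im (h x) = 0"
    by (rule density_unique_real) (use h Im in \<open>auto simp: set_lebesgue_integral_def\<close>)
  ultimately show ?thesis by eventually_elim (simp add: complex_eq_iff)
qed

text \<open>On a compact subinterval of \<Omega> the bumps converge boundedly to the indicator of
  its interior, which makes the integral of h over that interior vanish. Integrability of h is only
  local, so \<open>set_integral_zero_imp_AE\<close> is applied to h cut off to such intervals and
  the results are patched.\<close>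

lemma fundamental_lemma:
  fixes h :: "real \<Rightarrow> complex"
  assumes "open \<Omega>" and h: "locally_integrable \<Omega> h"
    and zero: "\<And>\<psi>. \<psi> \<in> test_functions \<Omega> \<Longrightarrow> (LINT x:\<Omega>|lebesgue. h x * \<psi> x) = 0"
  shows "AE x in lebesgue. x \<in> \<Omega> \<longrightarrow> h x = 0"
proof -
  have hint: "integrable lebesgue (\<lambda>x. indicat_real {a..b} x *\<^sub>R h x)" if "{a..b} \<subseteq> \<Omega>" for a b
    using h that by (auto simp: locally_integrable_def set_integrable_def)
  have ioo: "(LINT x:{a<..<b}|lebesgue. h x) = 0" if ab: "{a..b} \<subseteq> \<Omega>" for a b
  proof -
    have eq: "(LINT x:\<Omega>|lebesgue. h x * bump n a b x) = (\<integral>x. (indicat_real {a..b} x *\<^sub>R h x) * bump n a b x \<partial>lebesgue)" for n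
      unfolding set_lebesgue_integral_def
      using ab tf_outside[OF bump_test[of a b "{a..b}"]]
      by (intro Bochner_Integration.integral_cong) (auto simp: indicator_def)
    have "(\<lambda>n. \<integral>x. (indicat_real {a..b} x *\<^sub>R h x) * bump n a b x \<partial>lebesgue)
        \<longlonglongrightarrow> (\<integral>x. (indicat_real {a..b} x *\<^sub>R h x) * indicator {a<..<b} x \<partial>lebesgue)"
    proof (rule integral_dominated_convergence[where w="\<lambda>x. cmod (indicat_real {a..b} x *\<^sub>R h x)"])
      show "AE x in lebesgue. (\<lambda>n. (indicat_real {a..b} x *\<^sub>R h x) * bump n a b x)
          \<longlonglongrightarrow> (indicat_real {a..b} x *\<^sub>R h x) * indicator {a<..<b} x"
        by (intro AE_I2 tendsto_intros bump_tendsto)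
      show "AE x in lebesgue. norm ((indicat_real {a..b} x *\<^sub>R h x) * bump n a b x) \<le> cmod (indicat_real {a..b} x *\<^sub>R h x)" for n
      proof (rule AE_I2)
        fix x
        have "cmod (bump n a b x) \<le> 1"
          using bump_bound[of n a b x] by (rule order_trans) (simp add: indicator_def)
        then show "norm ((indicat_real {a..b} x *\<^sub>R h x) * bump n a b x) \<le> cmod (indicat_real {a..b} x *\<^sub>R h x)"
          unfolding norm_mult by (intro mult_left_le) auto
      qed
      have bm: "bump n a b \<in> borel_measurable lebesgue" for n
        using tf_measurable[OF bump_test[OF ab]] by (simp add: measurable_completion)
      show "(\<lambda>x. (indicat_real {a..b} x *\<^sub>R h x) * bump n a b x) \<in> borel_measurable lebesgue" for n
        using hint[OF ab] bm by (intro borel_measurable_times) auto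
      show "(\<lambda>x. (indicat_real {a..b} x *\<^sub>R h x) * indicator {a<..<b} x) \<in> borel_measurable lebesgue"
        using hint[OF ab] by (intro borel_measurable_times borel_measurable_indicator) auto
      show "integrable lebesgue (\<lambda>x. cmod (indicat_real {a..b} x *\<^sub>R h x))"
        using hint[OF ab] by (rule integrable_norm)
    qed
    moreover have "(\<integral>x. (indicat_real {a..b} x *\<^sub>R h x) * indicator {a<..<b} x \<partial>lebesgue) = (LINT x:{a<..<b}|lebesgue. h x)"
      unfolding set_lebesgue_integral_def
      by (intro Bochner_Integration.integral_cong) (auto simp: indicator_def)
    ultimately show ?thesis
      using zero[OF bump_test[OF ab]] unfolding eq[symmetric] by (simp add: LIMSEQ_const_iff)
  qed
  have loc: "AE x in lebesgue. x \<in> {a<..<b} \<longrightarrow> h x = 0" if ab: "{a..b} \<subseteq> \<Omega>" for a b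
  proof -
    have "AE x in lebesgue. indicat_real {a<..<b} x *\<^sub>R h x = 0"
    proof (rule set_integral_zero_imp_AE)
      have "integrable lebesgue (\<lambda>x. indicat_real {a<..<b} x *\<^sub>R (indicat_real {a..b} x *\<^sub>R h x))"
        by (intro integrable_mult_indicator hint ab) auto
      also have "(\<lambda>x. indicat_real {a<..<b} x *\<^sub>R (indicat_real {a..b} x *\<^sub>R h x)) = (\<lambda>x. indicat_real {a<..<b} x *\<^sub>R h x)"
        by (auto simp: indicator_def)
      finally show "integrable lebesgue (\<lambda>x. indicat_real {a<..<b} x *\<^sub>R h x)" .
      fix c d :: real
      have "(LINT x:{c<..<d}|lebesgue. indicat_real {a<..<b} x *\<^sub>R h x) = (LINT x:{max a c<..<min b d}|lebesgue. h x)"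
        unfolding set_lebesgue_integral_def
        by (intro Bochner_Integration.integral_cong) (auto simp: indicator_def)
      also have "\<dots> = 0"
        using ab by (intro ioo) auto
      finally show "(LINT x:{c<..<d}|lebesgue. indicat_real {a<..<b} x *\<^sub>R h x) = 0" .
    qed
    then show ?thesis by eventually_elim (auto simp: indicator_def split: if_splits)
  qed
  \<comment> \<open>Countably many intervals with rational end points cover \<Omega>, so the
    exceptional null sets can be united.\<close>
  define Q where "Q = {(a, b). a \<in> \<rat> \<and> b \<in> \<rat> \<and> {a..b} \<subseteq> \<Omega>}"
  have "countable Q"
    by (rule countable_subset[of _ "\<rat> \<times> \<rat>"]) (auto simp: Q_def countable_rat)
  then have "AE x in lebesgue. \<forall>(a, b)\<in>Q. x \<in> {a<..<b} \<longrightarrow> h x = 0"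
    by (subst AE_ball_countable) (use loc in \<open>auto simp: Q_def\<close>)
  then show ?thesis
  proof eventually_elim
    case (elim x)
    show ?case
    proof
      assume "x \<in> \<Omega>"
      with \<open>open \<Omega>\<close> obtain e where e: "e > 0" "ball x e \<subseteq> \<Omega>" by (meson openE)
      obtain a where a: "a \<in> \<rat>" "x - e < a" "a < x" using Rats_dense_in_real[of "x - e" x] e by auto
      obtain b where b: "b \<in> \<rat>" "x < b" "b < x + e" using Rats_dense_in_real[of x "x + e"] e by auto
      have "{a..b} \<subseteq> ball x e" using a b by (auto simp: dist_real_def)
      then have "(a, b) \<in> Q" using a b e by (auto simp: Q_def)
      then show "h x = 0" using elim a b by auto
    qed
  qed
qed

section \<open>Separability\<close>

text \<open>A test function is described up to a small error in \<open>C\<^sup>1\<close> by finitely many integers: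
  the radius of its support, a mesh size, and the rounded values of its derivative on the mesh.\<close>

definition encodes :: "nat \<Rightarrow> nat \<times> nat \<times> (int \<Rightarrow> int) \<Rightarrow> (real \<Rightarrow> complex) \<Rightarrow> bool" where
  "encodes N = (\<lambda>(m, n, z) \<psi>. (\<forall>x. real m < \<bar>x\<bar> \<longrightarrow> \<psi> x = 0) \<and> n > 0 \<and>
     (\<forall>x y. \<bar>x - y\<bar> \<le> 1 / n \<longrightarrow> cmod (D \<psi> x - D \<psi> y) \<le> 1 / (real N * (real m + 1)^2)) \<and>
     (\<forall>j. z (2 * j) = \<lfloor>real N * (real m + 1)^2 * Re (D \<psi> (j / n))\<rfloor>) \<and>
     (\<forall>j. z (2 * j + 1) = \<lfloor>real N * (real m + 1)^2 * Im (D \<psi> (j / n))\<rfloor>))"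

lemma floor_eq_imp_diff: "\<lfloor>a\<rfloor> = \<lfloor>b :: real\<rfloor> \<Longrightarrow> \<bar>a - b\<bar> \<le> 1"
  by linarith

lemma compact_support_uniform:
  assumes "\<psi> \<in> test_functions (\<Omega> :: real set)" "0 < e"
  shows "\<exists>d>0. \<forall>x y. \<bar>x - y\<bar> < d \<longrightarrow> cmod (\<psi> x - \<psi> y) < e"
proof -
  obtain R where R: "0 < R" "\<forall>x. R < norm x \<longrightarrow> \<psi> x = 0" using tf_radius[OF assms(1)] by blast
  have "uniformly_continuous_on {-R-1..R+1} \<psi>"
    by (intro compact_uniformly_continuous tf_continuous[OF assms(1)]) auto
  then obtain d where d: "d > 0" "\<forall>x\<in>{-R-1..R+1}. \<forall>y\<in>{-R-1..R+1}. dist y x < d \<longrightarrow> dist (\<psi> y) (\<psi> x) < e"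
    using assms(2) by (metis uniformly_continuous_on_def)
  show ?thesis
  proof (intro exI[of _ "min d 1"] conjI allI impI)
    fix x y :: real assume xy: "\<bar>x - y\<bar> < min d 1"
    show "cmod (\<psi> x - \<psi> y) < e"
    proof (cases "x \<in> {-R-1..R+1} \<and> y \<in> {-R-1..R+1}")
      case True
      then show ?thesis using d(2) xy by (auto simp: dist_norm abs_minus_commute norm_minus_commute)
    next
      case False
      then have "R < \<bar>x\<bar>" "R < \<bar>y\<bar>" using xy by auto
      then show ?thesis using R(2) assms(2) by simp
    qed
  qed (use d in auto)
qed

lemma encodes_exists:
  assumes "\<psi> \<in> test_functions (\<Omega> :: real set)" "N > 0"
  shows "\<exists>m n z. encodes N (m, n, z) \<psi> \<and> finite {j. z j \<noteq> 0}"
proof -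
  obtain R where R: "0 < R" "\<forall>x. R < norm x \<longrightarrow> \<psi> x = 0" using tf_radius[OF assms(1)] by blast
  obtain R' where R': "0 < R'" "\<forall>x. R' < norm x \<longrightarrow> D \<psi> x = 0"
    using tf_radius[OF tf_dir_deriv[OF assms(1)]] by blast
  define m where "m = nat \<lceil>R\<rceil>"
  have m: "R \<le> real m" using R(1) unfolding m_def by linarith
  define C where "C = real N * (real m + 1)^2"
  have C: "C > 0" using assms(2) by (simp add: C_def)
  obtain d where d: "d > 0" "\<forall>x y. \<bar>x - y\<bar> < d \<longrightarrow> cmod (D \<psi> x - D \<psi> y) < 1 / C"
    using compact_support_uniform[OF tf_dir_deriv[OF assms(1), of 1], of "1 / C"] C by auto
  obtain n where n: "n > 0" "1 / real n < d"
    using d(1) by (metis nat_approx_posE zero_less_Suc)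
  define z :: "int \<Rightarrow> int" where "z j = (if even j then \<lfloor>C * Re (D \<psi> (of_int (j div 2) / n))\<rfloor>
      else \<lfloor>C * Im (D \<psi> (of_int (j div 2) / n))\<rfloor>)" for j
  have "encodes N (m, n, z) \<psi>"
    unfolding encodes_def using R(2) m n d(2) by (auto simp: z_def C_def intro: less_imp_le)
  moreover have "finite {j. z j \<noteq> 0}"
  proof (rule finite_subset)
    show "{j. z j \<noteq> 0} \<subseteq> {- 2 * \<lceil>R' * n\<rceil> - 2 .. 2 * \<lceil>R' * n\<rceil> + 2}"
    proof (intro subsetI, rule ccontr)
      fix j assume "j \<in> {j. z j \<noteq> 0}" "j \<notin> {- 2 * \<lceil>R' * n\<rceil> - 2 .. 2 * \<lceil>R' * n\<rceil> + 2}"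
      then have j: "z j \<noteq> 0" "j \<notin> {- 2 * \<lceil>R' * n\<rceil> - 2 .. 2 * \<lceil>R' * n\<rceil> + 2}" by auto
      then have "\<bar>j div 2\<bar> > \<lceil>R' * n\<rceil>" by auto
      then have "R' * n < \<bar>of_int (j div 2)\<bar>" by linarith
      then have "R' < \<bar>of_int (j div 2) / n\<bar>" using n by (simp add: field_simps)
      then have "D \<psi> (of_int (j div 2) / n) = 0" using R'(2) by auto
      then show False using j(1) by (simp add: z_def split: if_splits)
    qed
  qed simp
  ultimately show ?thesis by blast
qed

text \<open>Equal codes give |D \<psi> - D \<eta>| <= 4/C with C = N (m+1)^2: 1/C twice for moving
  to the mesh point, 2/C for the two rounded components. Integrating over a length of at most 2
  (m+1) gives 8 (m+1)/C for the functions themselves, and the square (m+1)^2 in the tolerance leaves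
  room for the length of the support in the L2 norm.\<close>

lemma encodes_close:
  assumes tf: "\<psi> \<in> test_functions (\<Omega> :: real set)" "\<eta> \<in> test_functions \<Omega>" and "N > 0"
    and enc: "encodes N (m, n, z) \<psi>" "encodes N (m, n, z) \<eta>"
  shows "nr lborel (\<lambda>x. \<psi> x - \<eta> x) \<le> 16 / N" "nr lborel (\<lambda>x. D \<psi> x - D \<eta> x) \<le> 16 / N"
proof -
  define C where "C = real N * (real m + 1)^2"
  have C: "C > 0" using assms(3) by (simp add: C_def)
  define \<theta> where "\<theta> x = \<psi> x - \<eta> x" for x
  have \<theta>: "\<theta> \<in> test_functions \<Omega>" unfolding \<theta>_def by (rule tf_diff[OF tf])
  have D\<theta>: "D \<theta> x = D \<psi> x - D \<eta> x" for x unfolding \<theta>_def by (rule D_diff[OF tf])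
  have n: "n > 0" using enc(1) by (simp add: encodes_def)
  have Dbd: "cmod (D \<theta> x) \<le> 4 / C" for x
  proof -
    define j where "j = \<lfloor>x * n\<rfloor>"
    have "\<bar>x * n - of_int j\<bar> \<le> 1" unfolding j_def by linarith
    moreover have "x - of_int j / n = (x * n - of_int j) / n" using n by (simp add: field_simps)
    ultimately have "\<bar>x - of_int j / n\<bar> \<le> 1 / n" using n by (simp add: abs_divide divide_right_mono)
    then have 1: "cmod (D \<psi> x - D \<psi> (of_int j / n)) \<le> 1 / C" "cmod (D \<eta> x - D \<eta> (of_int j / n)) \<le> 1 / C"
      using enc unfolding encodes_def C_def by auto
    have "\<bar>C * Re (D \<psi> (of_int j / n)) - C * Re (D \<eta> (of_int j / n))\<bar> \<le> 1"
      "\<bar>C * Im (D \<psi> (of_int j / n)) - C * Im (D \<eta> (of_int j / n))\<bar> \<le> 1"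
      using enc unfolding encodes_def C_def by (auto intro!: floor_eq_imp_diff)
    then have "C * \<bar>Re (D \<psi> (of_int j / n) - D \<eta> (of_int j / n))\<bar> \<le> 1" "C * \<bar>Im (D \<psi> (of_int j / n) - D \<eta> (of_int j / n))\<bar> \<le> 1"
      using C by (auto simp: abs_mult right_diff_distrib[symmetric])
    then have "\<bar>Re (D \<psi> (of_int j / n) - D \<eta> (of_int j / n))\<bar> \<le> 1 / C" "\<bar>Im (D \<psi> (of_int j / n) - D \<eta> (of_int j / n))\<bar> \<le> 1 / C"
      using C by (auto simp: field_simps)
    then have 2: "cmod (D \<psi> (of_int j / n) - D \<eta> (of_int j / n)) \<le> 2 / C"
      using cmod_le[of "D \<psi> (of_int j / n) - D \<eta> (of_int j / n)"] by simp
    have "D \<theta> x = (D \<psi> x - D \<psi> (of_int j / n)) + (D \<psi> (of_int j / n) - D \<eta> (of_int j / n)) - (D \<eta> x - D \<eta> (of_int j / n))"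
      by (simp add: D\<theta>)
    then have "cmod (D \<theta> x) \<le> cmod (D \<psi> x - D \<psi> (of_int j / n)) + cmod (D \<psi> (of_int j / n) - D \<eta> (of_int j / n)) + cmod (D \<eta> x - D \<eta> (of_int j / n))"
      by (simp only:) (rule order_trans[OF norm_triangle_ineq4 add_right_mono[OF norm_triangle_ineq]])
    then show ?thesis using 1 2 by simp
  qed
  have zero: "\<theta> x = 0" if "real m < \<bar>x\<bar>" for x
    using that enc by (auto simp: encodes_def \<theta>_def)
  have Dzero: "D \<theta> x = 0" if "real m < \<bar>x\<bar>" for x
  proof (rule D_eq)
    have "open {x::real. real m < \<bar>x\<bar>}" by (intro open_Collect_less continuous_intros)
    then show "(\<theta> has_vector_derivative 0) (at x)"
      using that zero by (intro has_vector_derivative_transform_within_open[OF has_vector_derivative_const, of "{x. real m < \<bar>x\<bar>}"]) auto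
  qed
  have bd: "cmod (\<theta> x) \<le> 8 * (real m + 1) / C" for x
  proof (cases "real m < \<bar>x\<bar>")
    case False
    have "norm (\<theta> x - \<theta> (- real m - 1)) \<le> 4 / C * norm (x - (- real m - 1))"
    proof (rule differentiable_bound[of UNIV \<theta> "\<lambda>x h. h *\<^sub>R D \<theta> x"])
      show "(\<theta> has_derivative (\<lambda>h. h *\<^sub>R D \<theta> x)) (at x within UNIV)" for x
        using tf_vector_derivative[OF \<theta>] by (simp add: has_vector_derivative_def)
      show "onorm (\<lambda>h. h *\<^sub>R D \<theta> x) \<le> 4 / C" for x
      proof (rule onorm_le)
        show "norm (h *\<^sub>R D \<theta> x) \<le> 4 / C * norm h" for h
          using mult_right_mono[OF Dbd[of x] norm_ge_zero[of h]] by (simp add: mult.commute)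
      qed
    qed auto
    also have "\<dots> \<le> 4 / C * (2 * (real m + 1))"
      using False C by (intro mult_left_mono) auto
    finally show ?thesis using zero[of "- real m - 1"] by (simp add: field_simps)
  qed (use zero C in simp)
  have L2: "nr lborel f \<le> 16 / N"
    if f: "continuous_on UNIV f" and f0: "\<And>x. real m < \<bar>x\<bar> \<Longrightarrow> f x = 0"
      and fb: "\<And>x. cmod (f x) \<le> 8 * (real m + 1) / C" for f :: "real \<Rightarrow> complex"
  proof -
    define B where "B = (8 * (real m + 1) / C)\<^sup>2"
    have "(\<integral>x. (cmod (f x))\<^sup>2 \<partial>lborel) \<le> (\<integral>x. B * indicator {- real m..real m} x \<partial>lborel)"
    proof (rule Bochner_Integration.integral_mono)
      show "integrable lborel (\<lambda>x. (cmod (f x))\<^sup>2)"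
        by (rule continuous_compact_support_integrable[of _ "real m"]) (use f f0 in \<open>auto intro!: continuous_intros\<close>)
      show "(cmod (f x))\<^sup>2 \<le> B * indicator {- real m..real m} x" for x
        using f0[of x] fb[of x] unfolding B_def by (auto simp: indicator_def intro!: power_mono)
    qed auto
    also have "\<dots> = B * (2 * real m)" by simp
    also have "\<dots> \<le> B * (2 * (real m + 1))" by (intro mult_left_mono) (auto simp: B_def)
    also have "\<dots> = 128 / (real N)\<^sup>2 * (1 / (real m + 1))"
      using assms(3) by (simp add: B_def C_def power2_eq_square divide_simps) (simp add: algebra_simps)
    also have "\<dots> \<le> 128 / (real N)\<^sup>2 * 1" by (intro mult_left_mono) auto
    also have "\<dots> \<le> (16 / N)\<^sup>2" by (simp add: power_divide divide_right_mono)
    finally show ?thesis unfolding nr_def by (intro real_le_lsqrt) auto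
  qed
  show "nr lborel (\<lambda>x. \<psi> x - \<eta> x) \<le> 16 / N"
    using L2[of \<theta>] zero bd tf_continuous[OF \<theta>] by (simp add: \<theta>_def[abs_def])
  have "4 / C \<le> 8 * (real m + 1) / C" using C by (intro divide_right_mono) auto
  then have "cmod (D \<theta> x) \<le> 8 * (real m + 1) / C" for x using Dbd[of x] by linarith
  then have "nr lborel (D \<theta>) \<le> 16 / N"
    using L2[of "D \<theta>"] Dzero tf_continuous[OF tf_dir_deriv[OF \<theta>]] by simp
  then show "nr lborel (\<lambda>x. D \<psi> x - D \<eta> x) \<le> 16 / N" by (simp add: D\<theta>[abs_def])
qed

text \<open>A finitely supported function is decoded from a finite list of pairs, with default value
  0.\<close>

lemma countable_finite_support: "countable {z :: int \<Rightarrow> int. finite {j. z j \<noteq> 0}}"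
proof (rule countable_subset)
  define F :: "(int \<times> int) list \<Rightarrow> int \<Rightarrow> int" where
    "F xs j = (case map_of xs j of None \<Rightarrow> 0 | Some v \<Rightarrow> v)" for xs j
  show "countable (range F)" by simp
  show "{z. finite {j. z j \<noteq> 0}} \<subseteq> range F"
  proof
    fix z :: "int \<Rightarrow> int" assume "z \<in> {z. finite {j. z j \<noteq> 0}}"
    then obtain js where js: "set js = {j. z j \<noteq> 0}" using finite_list by auto
    have "z = F (map (\<lambda>j. (j, z j)) js)"
      using js by (auto simp: F_def map_of_map_restrict restrict_map_def)
    then show "z \<in> range F" by blast
  qed
qed

text \<open>For each of the countably many codes one test function with that code is chosen, if
  there is any; it is close to every other test function with the same code. The accuracy N is part
  of the code.\<close>

theorem test_functions_separable:
  fixes \<Omega> :: "real set"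
  shows "\<exists>d :: nat \<Rightarrow> real \<Rightarrow> complex. (\<forall>k. d k \<in> test_functions \<Omega>) \<and>
    (\<forall>\<psi>\<in>test_functions \<Omega>. \<forall>\<epsilon>>0. \<exists>k. nr lborel (\<lambda>x. \<psi> x - d k x) < \<epsilon> \<and> nr lborel (\<lambda>x. D \<psi> x - D (d k) x) < \<epsilon>)"
proof -
  define K :: "(nat \<times> nat \<times> nat \<times> (int \<Rightarrow> int)) set" where
    "K = UNIV \<times> UNIV \<times> UNIV \<times> {z. finite {j. z j \<noteq> 0}}"
  have K: "countable K" unfolding K_def by (intro countable_SIGMA countable_finite_support) auto
  define P where "P = (\<lambda>(N, c) \<psi>. \<psi> \<in> test_functions \<Omega> \<and> encodes N c \<psi>)"
  define r where "r \<kappa> = (if \<exists>\<psi>. P \<kappa> \<psi> then SOME \<psi>. P \<kappa> \<psi> else (\<lambda>x. 0))" for \<kappa>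
  have r_test: "r \<kappa> \<in> test_functions \<Omega>" for \<kappa>
    unfolding r_def using someI_ex[of "P \<kappa>"] by (cases \<kappa>) (auto simp: P_def)
  have Kne: "K \<noteq> {}" by (auto simp: K_def intro!: exI[of _ "\<lambda>_. 0"])
  define d where "d k = r (from_nat_into K k)" for k
  show ?thesis
  proof (intro exI[of _ d] conjI ballI allI impI)
    show "d k \<in> test_functions \<Omega>" for k by (simp add: d_def r_test)
    fix \<psi> and \<epsilon> :: real assume \<psi>: "\<psi> \<in> test_functions \<Omega>" and "\<epsilon> > 0"
    obtain N :: nat where N: "N > 0" "16 / N < \<epsilon>"
    proof -
      obtain N :: nat where "16 / \<epsilon> < N" using reals_Archimedean2 by blast
      with \<open>\<epsilon> > 0\<close> show ?thesis
        using \<open>16 / \<epsilon> < N\<close> that[of N] by (cases "N = 0") (auto simp: field_simps)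
    qed
    obtain m n z where e: "encodes N (m, n, z) \<psi>" "finite {j. z j \<noteq> 0}"
      using encodes_exists[OF \<psi> N(1)] by blast
    let ?\<kappa> = "(N, m, n, z)"
    have "?\<kappa> \<in> K" using e by (simp add: K_def)
    then obtain k where k: "from_nat_into K k = ?\<kappa>" using K by (metis from_nat_into_surj)
    have "P ?\<kappa> \<psi>" using \<psi> e by (simp add: P_def)
    then have "P ?\<kappa> (r ?\<kappa>)" unfolding r_def using someI[of "P ?\<kappa>" \<psi>] by auto
    then have "d k \<in> test_functions \<Omega>" "encodes N (m, n, z) (d k)" by (auto simp: P_def d_def k)
    from encodes_close[OF \<psi> this(1) N(1) e(1) this(2)] N(2)
    show "\<exists>k. nr lborel (\<lambda>x. \<psi> x - d k x) < \<epsilon> \<and> nr lborel (\<lambda>x. D \<psi> x - D (d k) x) < \<epsilon>"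
      by (intro exI[of _ k]) linarith
  qed
qed

section \<open>The space \<open>H10\<close>\<close>

text \<open>\<open>HH \<Omega> f g\<close>: the pair \<open>(f, g)\<close> is a limit of pairs \<open>(\<psi>, \<psi>')\<close> in \<open>L\<^sup>2 \<times> L\<^sup>2\<close>, and \<open>f\<close> is the
  continuous representative, extended by zero to the line.\<close>

definition HH :: "real set \<Rightarrow> (real \<Rightarrow> complex) \<Rightarrow> (real \<Rightarrow> complex) \<Rightarrow> bool" where
  "HH \<Omega> f g \<longleftrightarrow> sq lborel f \<and> sq lborel g \<and>
    (\<exists>\<psi>. (\<forall>n. \<psi> n \<in> test_functions \<Omega>) \<and> (\<lambda>n. nr lborel (\<lambda>x. \<psi> n x - f x)) \<longlonglongrightarrow> 0 \<and>
      (\<lambda>n. nr lborel (\<lambda>x. D (\<psi> n) x - g x)) \<longlonglongrightarrow> 0 \<and> (\<forall>x. (\<lambda>n. \<psi> n x) \<longlonglongrightarrow> f x))"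

lemma HH_sq: "HH \<Omega> f g \<Longrightarrow> sq lborel f" "HH \<Omega> f g \<Longrightarrow> sq lborel g"
  by (auto simp: HH_def)

lemma HH_measurable: "HH \<Omega> f g \<Longrightarrow> f \<in> borel_measurable borel" "HH \<Omega> f g \<Longrightarrow> g \<in> borel_measurable borel"
  using sq_measurable[OF HH_sq(1)] sq_measurable[OF HH_sq(2)] by auto

lemma HH_seq:
  assumes "HH \<Omega> f g"
  obtains \<psi> where "\<And>n. \<psi> n \<in> test_functions \<Omega>" "(\<lambda>n. nr lborel (\<lambda>x. \<psi> n x - f x)) \<longlonglongrightarrow> 0"
    "(\<lambda>n. nr lborel (\<lambda>x. D (\<psi> n) x - g x)) \<longlonglongrightarrow> 0" "\<And>x. (\<lambda>n. \<psi> n x) \<longlonglongrightarrow> f x"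
  using assms unfolding HH_def by blast

lemma tf_D_sq: "\<psi> \<in> test_functions U \<Longrightarrow> sq lborel (D \<psi>)"
  by (intro tf_sq tf_dir_deriv)

lemma HH_tf: "\<psi> \<in> test_functions \<Omega> \<Longrightarrow> HH \<Omega> \<psi> (D \<psi>)"
  unfolding HH_def by (intro conjI tf_sq tf_D_sq exI[of _ "\<lambda>_. \<psi>"]) auto

lemma nr_tendsto_add:
  assumes "\<And>n. sq M (s n)" "\<And>n. sq M (t n)" "sq M f" "sq M g"
    "(\<lambda>n. nr M (\<lambda>x. s n x - f x)) \<longlonglongrightarrow> 0" "(\<lambda>n. nr M (\<lambda>x. t n x - g x)) \<longlonglongrightarrow> 0"
  shows "(\<lambda>n. nr M (\<lambda>x. (s n x + t n x) - (f x + g x))) \<longlonglongrightarrow> 0"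
proof (rule real_tendsto_sandwich[OF _ _ tendsto_const tendsto_add_zero[OF assms(5,6)]])
  have "nr M (\<lambda>x. (s n x + t n x) - (f x + g x)) \<le> nr M (\<lambda>x. s n x - f x) + nr M (\<lambda>x. t n x - g x)" for n
    using nr_triangle[OF sq_diff[OF assms(1)[of n] assms(3)] sq_diff[OF assms(2)[of n] assms(4)]]
    by (simp add: add_diff_add)
  then show "\<forall>\<^sub>F n in sequentially. nr M (\<lambda>x. (s n x + t n x) - (f x + g x))
    \<le> nr M (\<lambda>x. s n x - f x) + nr M (\<lambda>x. t n x - g x)" by simp
qed simp

lemma HH_add:
  assumes "HH \<Omega> f g" "HH \<Omega> f' g'"
  shows "HH \<Omega> (\<lambda>x. f x + f' x) (\<lambda>x. g x + g' x)"
proof -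
  obtain \<psi> where p: "\<And>n. \<psi> n \<in> test_functions \<Omega>" "(\<lambda>n. nr lborel (\<lambda>x. \<psi> n x - f x)) \<longlonglongrightarrow> 0"
    "(\<lambda>n. nr lborel (\<lambda>x. D (\<psi> n) x - g x)) \<longlonglongrightarrow> 0" "\<And>x. (\<lambda>n. \<psi> n x) \<longlonglongrightarrow> f x"
    using assms(1) by (rule HH_seq) blast
  obtain \<eta> where e: "\<And>n. \<eta> n \<in> test_functions \<Omega>" "(\<lambda>n. nr lborel (\<lambda>x. \<eta> n x - f' x)) \<longlonglongrightarrow> 0"
    "(\<lambda>n. nr lborel (\<lambda>x. D (\<eta> n) x - g' x)) \<longlonglongrightarrow> 0" "\<And>x. (\<lambda>n. \<eta> n x) \<longlonglongrightarrow> f' x"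
    using assms(2) by (rule HH_seq) blast
  note s = HH_sq[OF assms(1)] HH_sq[OF assms(2)]
  show ?thesis
    unfolding HH_def
  proof (intro conjI exI[of _ "\<lambda>n x. \<psi> n x + \<eta> n x"] allI)
    show "(\<lambda>n. nr lborel (\<lambda>x. \<psi> n x + \<eta> n x - (f x + f' x))) \<longlonglongrightarrow> 0"
      by (intro nr_tendsto_add tf_sq[OF p(1)] tf_sq[OF e(1)] s p e)
    have "(\<lambda>n. nr lborel (\<lambda>x. (D (\<psi> n) x + D (\<eta> n) x) - (g x + g' x))) \<longlonglongrightarrow> 0"
      by (intro nr_tendsto_add tf_D_sq[OF p(1)] tf_D_sq[OF e(1)] s p e)
    then show "(\<lambda>n. nr lborel (\<lambda>x. D (\<lambda>x. \<psi> n x + \<eta> n x) x - (g x + g' x))) \<longlonglongrightarrow> 0"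
      by (simp add: D_add[OF p(1) e(1)])
  qed (use s in \<open>auto intro!: p e tf_add tendsto_add\<close>)
qed

lemma HH_cmult:
  assumes "HH \<Omega> f g"
  shows "HH \<Omega> (\<lambda>x. c * f x) (\<lambda>x. c * g x)"
proof -
  obtain \<psi> where p: "\<And>n. \<psi> n \<in> test_functions \<Omega>" "(\<lambda>n. nr lborel (\<lambda>x. \<psi> n x - f x)) \<longlonglongrightarrow> 0"
    "(\<lambda>n. nr lborel (\<lambda>x. D (\<psi> n) x - g x)) \<longlonglongrightarrow> 0" "\<And>x. (\<lambda>n. \<psi> n x) \<longlonglongrightarrow> f x"
    using assms(1) by (rule HH_seq) blast
  show ?thesis
    unfolding HH_def
  proof (intro conjI exI[of _ "\<lambda>n x. c * \<psi> n x"] allI)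
    have *: "nr M (\<lambda>x. c * a x - c * b x) = cmod c * nr M (\<lambda>x. a x - b x)" for M and a b :: "real \<Rightarrow> complex"
      using nr_cmult[of M c "\<lambda>x. a x - b x"] by (simp add: right_diff_distrib)
    show "(\<lambda>n. nr lborel (\<lambda>x. c * \<psi> n x - c * f x)) \<longlonglongrightarrow> 0"
      unfolding * by (intro tendsto_mult_right_zero p)
    show "(\<lambda>n. nr lborel (\<lambda>x. D (\<lambda>x. c * \<psi> n x) x - c * g x)) \<longlonglongrightarrow> 0"
      unfolding D_cmult[OF p(1)] * by (intro tendsto_mult_right_zero p)
  qed (use HH_sq[OF assms] in \<open>auto intro!: p tf_cmult tendsto_mult\<close>)
qed

lemma HH_diff:
  assumes "HH \<Omega> f g" "HH \<Omega> f' g'"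
  shows "HH \<Omega> (\<lambda>x. f x - f' x) (\<lambda>x. g x - g' x)"
  using HH_add[OF assms(1) HH_cmult[OF assms(2), of "-1"]] by simp

lemma HH_zero: "HH \<Omega> (\<lambda>x. 0) (\<lambda>x. 0)"
  using HH_tf[OF tf_zero, of \<Omega>] by (simp add: D_zero[abs_def])

lemma HH_sup_bound:
  assumes "HH \<Omega> f g"
  shows "(cmod (f x))\<^sup>2 \<le> 2 * nr lborel f * nr lborel g"
proof -
  obtain \<psi> where p: "\<And>n. \<psi> n \<in> test_functions \<Omega>" "(\<lambda>n. nr lborel (\<lambda>x. \<psi> n x - f x)) \<longlonglongrightarrow> 0"
    "(\<lambda>n. nr lborel (\<lambda>x. D (\<psi> n) x - g x)) \<longlonglongrightarrow> 0" "\<And>x. (\<lambda>n. \<psi> n x) \<longlonglongrightarrow> f x"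
    using assms(1) by (rule HH_seq) blast
  show ?thesis
  proof (rule LIMSEQ_le)
    show "(\<lambda>n. (cmod (\<psi> n x))\<^sup>2) \<longlonglongrightarrow> (cmod (f x))\<^sup>2" by (intro tendsto_intros p)
    show "(\<lambda>n. 2 * nr lborel (\<psi> n) * nr lborel (D (\<psi> n))) \<longlonglongrightarrow> 2 * nr lborel f * nr lborel g"
      by (intro tendsto_intros tendsto_nr HH_sq[OF assms] p tf_sq[OF p(1)] tf_D_sq[OF p(1)])
  qed (use tf_sup_bound[OF p(1)] in blast)
qed

text \<open>The form used most: one common bound for both norms, with the factor sqrt 2 rounded up
  to 2.\<close>

lemma HH_sup_bound':
  assumes "HH \<Omega> f g" "nr lborel f \<le> a" "nr lborel g \<le> a"
  shows "cmod (f x) \<le> 2 * a"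
proof (rule power2_le_imp_le)
  have a: "0 \<le> a" using assms(2) nr_nonneg[of lborel f] by linarith
  have "(cmod (f x))\<^sup>2 \<le> 2 * (nr lborel f * nr lborel g)"
    using HH_sup_bound[OF assms(1)] by (simp add: mult.assoc)
  also have "\<dots> \<le> 2 * (a * a)" using assms a by (intro mult_left_mono mult_mono) auto
  also have "\<dots> \<le> (2 * a)\<^sup>2" by (simp add: power2_eq_square)
  finally show "(cmod (f x))\<^sup>2 \<le> (2 * a)\<^sup>2" .
  show "0 \<le> 2 * a" using a by simp
qed

lemma HH_outside: "HH \<Omega> f g \<Longrightarrow> x \<notin> \<Omega> \<Longrightarrow> f x = 0"
proof -
  assume "HH \<Omega> f g" "x \<notin> \<Omega>"
  then obtain \<psi> where p: "\<And>n. \<psi> n \<in> test_functions \<Omega>" "(\<lambda>n. \<psi> n x) \<longlonglongrightarrow> f x"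
    by (auto simp: HH_def)
  have "\<psi> n x = 0" for n using tf_outside[OF p(1) \<open>x \<notin> \<Omega>\<close>] .
  then show "f x = 0" using p(2) by (simp add: LIMSEQ_const_iff)
qed

text \<open>The derivatives of the approximating test functions vanish outside \<Omega>, hence so
  does their L2 limit. Together with \<open>HH_outside\<close> this identifies integrals over
  \<Omega> with integrals over the line.\<close>

lemma HH_deriv_outside:
  assumes "open \<Omega>" "HH \<Omega> f g"
  shows "AE x in lborel. x \<notin> \<Omega> \<longrightarrow> g x = 0"
proof -
  obtain \<psi> where p: "\<And>n. \<psi> n \<in> test_functions \<Omega>" "(\<lambda>n. nr lborel (\<lambda>x. \<psi> n x - f x)) \<longlonglongrightarrow> 0"
    "(\<lambda>n. nr lborel (\<lambda>x. D (\<psi> n) x - g x)) \<longlonglongrightarrow> 0" "\<And>x. (\<lambda>n. \<psi> n x) \<longlonglongrightarrow> f x"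
    using assms(2) by (rule HH_seq) blast
  define h where "h x = indicator (- \<Omega>) x * g x" for x
  have [measurable]: "g \<in> borel_measurable borel" "\<Omega> \<in> sets borel"
    using HH_measurable[OF assms(2)] assms(1) by auto
  have hm: "h \<in> borel_measurable lborel" unfolding h_def by measurable
  have hs: "sq lborel h"
    by (rule sq_bound[OF HH_sq(2)[OF assms(2)] hm, of 1]) (auto simp: h_def indicator_def)
  have "nr lborel h \<le> 1 * nr lborel (\<lambda>x. D (\<psi> n) x - g x)" for n
  proof (rule nr_mono[OF _ hm])
    show "AE x in lborel. cmod (h x) \<le> 1 * cmod (D (\<psi> n) x - g x)"
      using tf_outside[OF tf_dir_deriv[OF p(1)]] by (auto simp: h_def indicator_def)
  qed (use HH_sq(2)[OF assms(2)] tf_D_sq[OF p(1)] in auto)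
  then have "nr lborel h \<le> 0"
    using LIMSEQ_le_const[OF p(3), of "nr lborel h"] by auto
  then have "AE x in lborel. h x = 0"
    using nr_zero_imp_AE[OF hs] nr_nonneg[of lborel h] by linarith
  then show ?thesis by eventually_elim (auto simp: h_def)
qed

lemma HH_by_parts:
  assumes "HH \<Omega> f g" "\<eta> \<in> test_functions V"
  shows "(\<integral>x. f x * D \<eta> x \<partial>lborel) = - (\<integral>x. g x * \<eta> x \<partial>lborel)"
proof -
  obtain \<psi> where p: "\<And>n. \<psi> n \<in> test_functions \<Omega>" "(\<lambda>n. nr lborel (\<lambda>x. \<psi> n x - f x)) \<longlonglongrightarrow> 0"
    "(\<lambda>n. nr lborel (\<lambda>x. D (\<psi> n) x - g x)) \<longlonglongrightarrow> 0" "\<And>x. (\<lambda>n. \<psi> n x) \<longlonglongrightarrow> f x"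
    using assms(1) by (rule HH_seq) blast
  have 1: "(\<lambda>n. ip lborel (\<psi> n) (\<lambda>x. cnj (D \<eta> x))) \<longlonglongrightarrow> ip lborel f (\<lambda>x. cnj (D \<eta> x))"
    by (intro tendsto_ip_left tf_sq[OF p(1)] HH_sq[OF assms(1)] p sq_cnj tf_D_sq[OF assms(2)])
  have 2: "(\<lambda>n. - ip lborel (D (\<psi> n)) (\<lambda>x. cnj (\<eta> x))) \<longlonglongrightarrow> - ip lborel g (\<lambda>x. cnj (\<eta> x))"
    by (intro tendsto_minus tendsto_ip_left tf_D_sq[OF p(1)] HH_sq[OF assms(1)] p sq_cnj tf_sq[OF assms(2)])
  have "ip lborel (\<psi> n) (\<lambda>x. cnj (D \<eta> x)) = - ip lborel (D (\<psi> n)) (\<lambda>x. cnj (\<eta> x))" for n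
    using tf_by_parts[OF p(1) assms(2)] by (simp add: ip_def)
  then have "ip lborel f (\<lambda>x. cnj (D \<eta> x)) = - ip lborel g (\<lambda>x. cnj (\<eta> x))"
    using LIMSEQ_unique[OF 1] 2 by simp
  then show ?thesis by (simp add: ip_def)
qed

lemma HH_approx:
  assumes "HH \<Omega> f g" "0 < e"
  shows "\<exists>\<psi>\<in>test_functions \<Omega>. nr lborel (\<lambda>x. \<psi> x - f x) < e \<and> nr lborel (\<lambda>x. D \<psi> x - g x) < e"
proof -
  obtain \<psi> where p: "\<And>n. \<psi> n \<in> test_functions \<Omega>" "(\<lambda>n. nr lborel (\<lambda>x. \<psi> n x - f x)) \<longlonglongrightarrow> 0"
    "(\<lambda>n. nr lborel (\<lambda>x. D (\<psi> n) x - g x)) \<longlonglongrightarrow> 0" "\<And>x. (\<lambda>n. \<psi> n x) \<longlonglongrightarrow> f x"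
    using assms(1) by (rule HH_seq) blast
  have "\<forall>\<^sub>F n in sequentially. nr lborel (\<lambda>x. \<psi> n x - f x) < e \<and> nr lborel (\<lambda>x. D (\<psi> n) x - g x) < e"
    using order_tendstoD(2)[OF p(2) assms(2)] order_tendstoD(2)[OF p(3) assms(2)] by (rule eventually_conj)
  then obtain n where "nr lborel (\<lambda>x. \<psi> n x - f x) < e \<and> nr lborel (\<lambda>x. D (\<psi> n) x - g x) < e"
    by (auto simp: eventually_sequentially)
  then show ?thesis using p(1) by blast
qed

text \<open>Fatou, applied to the differences of f and \<open>s n\<close> beyond a large index,
  bounds the norm of f - h by every positive number.\<close>

lemma nr_limit_unique:
  assumes "\<And>n. sq M (s n)" "sq M f" "(\<lambda>n. nr M (\<lambda>x. s n x - f x)) \<longlonglongrightarrow> 0"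
    and "h \<in> borel_measurable M" "AE x in M. (\<lambda>n. s n x) \<longlonglongrightarrow> h x"
  shows "AE x in M. f x = h x"
proof -
  have fm: "f \<in> borel_measurable M" using assms(2) by (rule sq_measurable)
  have *: "sq M (\<lambda>x. f x - h x) \<and> nr M (\<lambda>x. f x - h x) \<le> e" if e: "e > 0" for e
  proof -
    obtain N where N: "\<And>n. n \<ge> N \<Longrightarrow> nr M (\<lambda>x. s n x - f x) < e"
      using order_tendstoD(2)[OF assms(3) e] by (auto simp: eventually_sequentially)
    have lim: "AE x in M. (\<lambda>n. f x - s (n + N) x) \<longlonglongrightarrow> f x - h x"
      using assms(5) by eventually_elim (intro tendsto_intros LIMSEQ_ignore_initial_segment)
    have "sq M (\<lambda>x. f x - s (n + N) x)" "nr M (\<lambda>x. f x - s (n + N) x) \<le> e" for n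
      using N[of "n + N"] assms(1,2) by (auto simp: nr_diff_commute[of M f])
    from Fatou_nr[OF this(1) borel_measurable_diff[OF fm assms(4)] lim this(2)] show ?thesis by blast
  qed
  have "nr M (\<lambda>x. f x - h x) \<le> 0" by (rule field_le_epsilon) (use * in auto)
  then have "nr M (\<lambda>x. f x - h x) = 0" using nr_nonneg[of M "\<lambda>x. f x - h x"] by linarith
  then have "AE x in M. f x - h x = 0" using nr_zero_imp_AE[OF conjunct1[OF *[OF zero_less_one]]] by blast
  then show ?thesis by eventually_elim simp
qed

text \<open>By the sup bound, L2 convergence of the functions and of their derivatives makes the
  test functions uniformly Cauchy, so they converge at every point; that limit is the
  representative.\<close>

lemma HH_representative:
  assumes p: "\<And>n. \<psi> n \<in> test_functions \<Omega>" and "sq lborel f" "sq lborel g"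
    and c: "(\<lambda>n. nr lborel (\<lambda>x. \<psi> n x - f x)) \<longlonglongrightarrow> 0" "(\<lambda>n. nr lborel (\<lambda>x. D (\<psi> n) x - g x)) \<longlonglongrightarrow> 0"
  shows "\<exists>f'. HH \<Omega> f' g \<and> (AE x in lborel. f x = f' x)"
proof -
  have conv: "convergent (\<lambda>n. \<psi> n x)" for x
  proof (rule Cauchy_convergent, rule CauchyI)
    fix e :: real assume "e > 0"
    \<comment> \<open>Two errors of e/8 give e/4 for a difference, and the sup bound doubles this to
      e/2.\<close>
    then have e4: "e / 8 > 0" by simp
    have "\<forall>\<^sub>F n in sequentially. nr lborel (\<lambda>x. \<psi> n x - f x) < e/8 \<and> nr lborel (\<lambda>x. D (\<psi> n) x - g x) < e/8"
      using order_tendstoD(2)[OF c(1) e4] order_tendstoD(2)[OF c(2) e4] by (rule eventually_conj)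
    then obtain N where N: "\<And>n. n \<ge> N \<Longrightarrow> nr lborel (\<lambda>x. \<psi> n x - f x) < e/8"
      "\<And>n. n \<ge> N \<Longrightarrow> nr lborel (\<lambda>x. D (\<psi> n) x - g x) < e/8"
      by (auto simp: eventually_sequentially)
    show "\<exists>M. \<forall>m\<ge>M. \<forall>n\<ge>M. norm (\<psi> m x - \<psi> n x) < e"
    proof (intro exI[of _ N] allI impI)
      fix m n assume mn: "m \<ge> N" "n \<ge> N"
      have "nr lborel (\<lambda>x. \<psi> m x - \<psi> n x) \<le> e/4"
        using nr_triangle_diff[OF tf_sq[OF p] assms(2) tf_sq[OF p], of m n] N(1)[OF mn(1)] N(1)[OF mn(2)]
        unfolding nr_diff_commute[of lborel f] by linarith
      moreover have "nr lborel (\<lambda>x. D (\<psi> m) x - D (\<psi> n) x) \<le> e/4"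
        using nr_triangle_diff[OF tf_D_sq[OF p] assms(3) tf_D_sq[OF p], of m n] N(2)[OF mn(1)] N(2)[OF mn(2)]
        unfolding nr_diff_commute[of lborel g] by linarith
      ultimately have "cmod (\<psi> m x - \<psi> n x) \<le> 2 * (e/4)"
        by (rule HH_sup_bound'[OF HH_diff[OF HH_tf[OF p] HH_tf[OF p]]])
      then show "norm (\<psi> m x - \<psi> n x) < e" using \<open>e > 0\<close> by simp
    qed
  qed
  define f' where "f' x = lim (\<lambda>n. \<psi> n x)" for x
  have lim: "(\<lambda>n. \<psi> n x) \<longlonglongrightarrow> f' x" for x
    using conv[of x] unfolding f'_def by (simp add: convergent_LIMSEQ_iff)
  have [measurable]: "\<psi> n \<in> borel_measurable borel" for n using tf_measurable[OF p] .
  have f'm: "f' \<in> borel_measurable lborel"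
    using borel_measurable_LIMSEQ_metric[of \<psi> lborel f'] lim by simp
  have eq: "AE x in lborel. f x = f' x"
    by (rule nr_limit_unique[OF tf_sq[OF p] assms(2) c(1) f'm]) (simp add: lim)
  have f's: "sq lborel f'"
    by (rule sq_bound[OF assms(2) f'm, of 1]) (use eq in auto)
  have "nr lborel (\<lambda>x. \<psi> n x - f x) = nr lborel (\<lambda>x. \<psi> n x - f' x)" for n
    by (rule nr_cong_AE) (use f'm eq tf_sq[OF p] assms(2) in auto)
  then have "HH \<Omega> f' g"
    unfolding HH_def using f's assms(3) p c lim by auto
  then show ?thesis using eq by blast
qed

subsection \<open>Weak derivatives\<close>

lemma sq_lebesgue: "sq lborel f \<Longrightarrow> sq lebesgue f"
  unfolding sq_def by (auto simp: measurable_completion intro: integrable_completion[THEN iffD2])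

lemma nr_lebesgue: "f \<in> borel_measurable borel \<Longrightarrow> nr lebesgue f = nr lborel f"
  by (simp add: nr_def integral_completion)

text \<open>The bridge from the official definitions, which integrate over \<Omega> with respect to
  \<open>lebesgue\<close>, to Borel functions on the whole line, where all estimates take
  place.\<close>

lemma set_lebesgue_integral_support:
  fixes h :: "'a::euclidean_space \<Rightarrow> 'b::{banach, second_countable_topology}"
  assumes "open U" "h \<in> borel_measurable borel" "AE p in lborel. p \<notin> U \<longrightarrow> h p = 0"
  shows "(LINT p:U|lebesgue. h p) = (\<integral>p. h p \<partial>lborel)"
proof -
  have [measurable]: "h \<in> borel_measurable borel" "U \<in> sets borel" using assms by auto
  have "(LINT p:U|lebesgue. h p) = (\<integral>p. indicat_real U p *\<^sub>R h p \<partial>lborel)"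
    unfolding set_lebesgue_integral_def by (rule integral_completion) measurable
  also have "\<dots> = (\<integral>p. h p \<partial>lborel)"
    by (rule integral_cong_AE) (use assms(3) in \<open>auto simp: indicator_def\<close>)
  finally show ?thesis .
qed

lemma locally_integrable_sq:
  fixes \<Omega> :: "real set"
  assumes "sq lborel f"
  shows "locally_integrable \<Omega> f"
  unfolding locally_integrable_def set_integrable_def
proof (intro allI impI)
  fix K :: "real set" assume K: "compact K \<and> K \<subseteq> \<Omega>"
  have [measurable]: "f \<in> borel_measurable borel" "K \<in> sets borel"
    using sq_measurable[OF assms] K by (auto intro!: borel_closed compact_imp_closed)
  have "sq lborel (indicator K :: real \<Rightarrow> complex)"
  proof -
    have "integrable lborel (indicat_real K)"
      using K by (intro integrable_real_indicator emeasure_compact_finite) auto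
    moreover have "(\<lambda>x. (cmod (indicator K x))\<^sup>2) = indicat_real K" by (auto simp: indicator_def)
    ultimately show ?thesis by (simp add: sq_def)
  qed
  from sq_mult_integrable[OF this assms]
  have "integrable lborel (\<lambda>x. indicat_real K x *\<^sub>R f x)"
    by (rule back_subst[of "integrable lborel"]) (auto simp: indicator_def)
  then show "integrable lebesgue (\<lambda>x. indicat_real K x *\<^sub>R f x)"
    by (subst integrable_completion) auto
qed

lemma locally_integrable_mult_test:
  assumes g: "locally_integrable U g" and \<psi>: "\<psi> \<in> test_functions U"
  shows "set_integrable lebesgue U (\<lambda>p. g p * \<psi> p)"
proof -
  obtain K where K: "compact K" "K \<subseteq> U" "\<And>p. p \<notin> K \<Longrightarrow> \<psi> p = 0" using \<psi> by (metis tf_support)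
  obtain R C where C: "0 < R" "0 < C" "\<And>x. cmod (\<psi> x) \<le> C" "\<And>x. R < norm x \<Longrightarrow> \<psi> x = 0"
    using \<psi> by (rule tf_bound) blast
  have int: "integrable lebesgue (\<lambda>p. indicat_real K p *\<^sub>R g p)"
    using g K by (auto simp: locally_integrable_def set_integrable_def)
  have \<psi>m: "\<psi> \<in> borel_measurable lebesgue"
    using tf_measurable[OF \<psi>] by (simp add: measurable_completion)
  have "integrable lebesgue (\<lambda>p. (indicat_real K p *\<^sub>R g p) * \<psi> p)"
  proof (rule Bochner_Integration.integrable_bound[where f="\<lambda>p. C * cmod (indicat_real K p *\<^sub>R g p)"])
    show "integrable lebesgue (\<lambda>p. C * cmod (indicat_real K p *\<^sub>R g p))"
      using integrable_norm[OF int] by simp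
    show "(\<lambda>p. (indicat_real K p *\<^sub>R g p) * \<psi> p) \<in> borel_measurable lebesgue"
      using int \<psi>m by (intro borel_measurable_times) auto
    show "AE p in lebesgue. norm ((indicat_real K p *\<^sub>R g p) * \<psi> p) \<le> norm (C * cmod (indicat_real K p *\<^sub>R g p))"
    proof (rule AE_I2)
      fix p
      have "cmod (indicat_real K p *\<^sub>R g p) * cmod (\<psi> p) \<le> cmod (indicat_real K p *\<^sub>R g p) * C"
        by (intro mult_left_mono C) auto
      then show "norm ((indicat_real K p *\<^sub>R g p) * \<psi> p) \<le> norm (C * cmod (indicat_real K p *\<^sub>R g p))"
        using C(2) by (simp only: norm_mult) (simp add: mult.commute)
    qed
  qed
  moreover have "(\<lambda>p. (indicat_real K p *\<^sub>R g p) * \<psi> p) = (\<lambda>p. indicat_real U p *\<^sub>R (g p * \<psi> p))"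
    using K by (fastforce simp: indicator_def)
  ultimately show ?thesis by (simp add: set_integrable_def)
qed

lemma locally_integrable_diff:
  "locally_integrable U f \<Longrightarrow> locally_integrable U g \<Longrightarrow> locally_integrable U (\<lambda>p. f p - g p)"
  by (auto simp: locally_integrable_def)

lemma has_weak_deriv_unique:
  fixes \<Omega> :: "real set"
  assumes "open \<Omega>" "has_weak_deriv \<Omega> 1 f g" "has_weak_deriv \<Omega> 1 f h"
  shows "AE x in lebesgue. x \<in> \<Omega> \<longrightarrow> g x = h x"
proof -
  have "AE x in lebesgue. x \<in> \<Omega> \<longrightarrow> g x - h x = 0"
  proof (rule fundamental_lemma[OF assms(1)])
    show "locally_integrable \<Omega> (\<lambda>x. g x - h x)"
      using assms by (auto simp: has_weak_deriv_def intro: locally_integrable_diff)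
    fix \<psi> assume \<psi>: "\<psi> \<in> test_functions \<Omega>"
    have "(LINT x:\<Omega>|lebesgue. g x * \<psi> x) = (LINT x:\<Omega>|lebesgue. h x * \<psi> x)"
      using assms(2,3) \<psi> by (simp add: has_weak_deriv_def dist_of_def)
    moreover have "set_integrable lebesgue \<Omega> (\<lambda>x. g x * \<psi> x)" "set_integrable lebesgue \<Omega> (\<lambda>x. h x * \<psi> x)"
      using assms \<psi> by (auto simp: has_weak_deriv_def intro!: locally_integrable_mult_test)
    ultimately show "(LINT x:\<Omega>|lebesgue. (g x - h x) * \<psi> x) = 0"
      by (simp add: left_diff_distrib set_integral_diff)
  qed
  then show ?thesis by eventually_elim auto
qed

lemma weak_deriv_AE:
  fixes \<Omega> :: "real set"
  assumes "open \<Omega>" "has_weak_deriv \<Omega> 1 f g"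
  shows "AE x in lebesgue. x \<in> \<Omega> \<longrightarrow> weak_deriv \<Omega> f x = g x"
proof (rule has_weak_deriv_unique[OF assms(1) _ assms(2)])
  show "has_weak_deriv \<Omega> 1 f (weak_deriv \<Omega> f)"
    unfolding weak_deriv_def using someI[where P="has_weak_deriv \<Omega> 1 f", OF assms(2)] by simp
qed

lemma has_weak_deriv_diff:
  assumes "has_weak_deriv U e f g" "has_weak_deriv U e f' g'"
  shows "has_weak_deriv U e (\<lambda>p. f p - f' p) (\<lambda>p. g p - g' p)"
  unfolding has_weak_deriv_def
proof (intro conjI ballI)
  fix \<psi> assume \<psi>: "\<psi> \<in> test_functions U"
  have l: "locally_integrable U f" "locally_integrable U g" "locally_integrable U f'" "locally_integrable U g'"
    and e: "- (LINT p:U|lebesgue. f p * dir_deriv e \<psi> p) = (LINT p:U|lebesgue. g p * \<psi> p)"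
      "- (LINT p:U|lebesgue. f' p * dir_deriv e \<psi> p) = (LINT p:U|lebesgue. g' p * \<psi> p)"
    using assms \<psi> by (auto simp: has_weak_deriv_def dist_deriv_def dist_of_def)
  have "(LINT p:U|lebesgue. (f p - f' p) * dir_deriv e \<psi> p)
      = (LINT p:U|lebesgue. f p * dir_deriv e \<psi> p) - (LINT p:U|lebesgue. f' p * dir_deriv e \<psi> p)"
    unfolding left_diff_distrib
    by (intro set_integral_diff locally_integrable_mult_test l tf_dir_deriv \<psi>)
  moreover have "(LINT p:U|lebesgue. (g p - g' p) * \<psi> p)
      = (LINT p:U|lebesgue. g p * \<psi> p) - (LINT p:U|lebesgue. g' p * \<psi> p)"
    unfolding left_diff_distrib
    by (intro set_integral_diff locally_integrable_mult_test l \<psi>)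
  ultimately show "dist_deriv e (dist_of U (\<lambda>p. f p - f' p)) \<psi> = dist_of U (\<lambda>p. g p - g' p) \<psi>"
    unfolding dist_deriv_def dist_of_def e[symmetric] by simp
qed (use assms in \<open>auto simp: has_weak_deriv_def intro!: locally_integrable_diff\<close>)

lemma HH_weak_deriv:
  assumes "open \<Omega>" "HH \<Omega> f g"
  shows "has_weak_deriv \<Omega> 1 f g"
  unfolding has_weak_deriv_def
proof (intro conjI ballI)
  show "locally_integrable \<Omega> f" "locally_integrable \<Omega> g"
    using HH_sq[OF assms(2)] by (auto intro: locally_integrable_sq)
  fix \<psi> assume \<psi>: "\<psi> \<in> test_functions \<Omega>"
  note [measurable] = HH_measurable[OF assms(2)] tf_measurable[OF \<psi>] tf_measurable[OF tf_dir_deriv[OF \<psi>]]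
  have "(LINT x:\<Omega>|lebesgue. f x * D \<psi> x) = (\<integral>x. f x * D \<psi> x \<partial>lborel)"
    by (rule set_lebesgue_integral_support[OF assms(1)]) (auto simp: tf_outside[OF tf_dir_deriv[OF \<psi>]])
  moreover have "(LINT x:\<Omega>|lebesgue. g x * \<psi> x) = (\<integral>x. g x * \<psi> x \<partial>lborel)"
    by (rule set_lebesgue_integral_support[OF assms(1)]) (auto simp: tf_outside[OF \<psi>])
  ultimately show "dist_deriv 1 (dist_of \<Omega> f) \<psi> = dist_of \<Omega> g \<psi>"
    using HH_by_parts[OF assms(2) \<psi>] by (simp add: dist_deriv_def dist_of_def)
qed

text \<open>Lebesgue measure is complete, so f inherits measurability from g. This matters for
  \<open>weak_deriv\<close>, an arbitrary choice known only up to null sets.\<close>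

lemma set_integral_cong_AE':
  fixes f g :: "'a::euclidean_space \<Rightarrow> 'b::euclidean_space"
  assumes "open U" "AE x in lebesgue. x \<in> U \<longrightarrow> f x = g x"
    and "set_borel_measurable lebesgue U g"
  shows "(LINT x:U|lebesgue. f x) = (LINT x:U|lebesgue. g x)"
proof -
  have AE: "AE x in lebesgue. indicat_real U x *\<^sub>R f x = indicat_real U x *\<^sub>R g x"
    using assms(2) by eventually_elim (auto simp: indicator_def)
  have gm: "(\<lambda>x. indicat_real U x *\<^sub>R g x) \<in> borel_measurable lebesgue"
    using assms(3) by (simp add: set_borel_measurable_def)
  moreover have "(\<lambda>x. indicat_real U x *\<^sub>R f x) \<in> borel_measurable lebesgue"
    by (rule borel_measurable_AE[OF gm]) (use AE in auto)
  ultimately show ?thesis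
    unfolding set_lebesgue_integral_def using AE by (intro integral_cong_AE)
qed

lemma HH_set_integral:
  assumes "open \<Omega>" "HH \<Omega> f g"
  shows "(LINT x:\<Omega>|lebesgue. (cmod (f x))\<^sup>2) = (nr lborel f)\<^sup>2"
    "(LINT x:\<Omega>|lebesgue. (cmod (g x))\<^sup>2) = (nr lborel g)\<^sup>2"
proof -
  note [measurable] = HH_measurable[OF assms(2)]
  show "(LINT x:\<Omega>|lebesgue. (cmod (f x))\<^sup>2) = (nr lborel f)\<^sup>2"
    unfolding nr_power2 by (rule set_lebesgue_integral_support[OF assms(1)]) (auto simp: HH_outside[OF assms(2)])
  show "(LINT x:\<Omega>|lebesgue. (cmod (g x))\<^sup>2) = (nr lborel g)\<^sup>2"
    unfolding nr_power2
    by (rule set_lebesgue_integral_support[OF assms(1)]) (use HH_deriv_outside[OF assms] in \<open>auto elim!: eventually_mono\<close>)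
qed

lemma set_borel_measurable_lebesgue:
  fixes h :: "'a::euclidean_space \<Rightarrow> 'b::euclidean_space"
  assumes "open U" "h \<in> borel_measurable borel"
  shows "set_borel_measurable lebesgue U h"
proof -
  have [measurable]: "h \<in> borel_measurable borel" "U \<in> sets borel" using assms by auto
  have "(\<lambda>x. indicat_real U x *\<^sub>R h x) \<in> borel_measurable lborel" by measurable
  then show ?thesis unfolding set_borel_measurable_def by (rule measurable_completion)
qed

section \<open>Comparison of \<open>H10\<close> with \<open>HH\<close>\<close>

lemma H1_norm_HH:
  assumes "open \<Omega>" "HH \<Omega> f g"
  shows "H1_norm \<Omega> f = sqrt ((nr lborel f)\<^sup>2 + (nr lborel g)\<^sup>2)"
proof -
  note [measurable] = HH_measurable[OF assms(2)]
  have "AE x in lebesgue. x \<in> \<Omega> \<longrightarrow> (cmod (weak_deriv \<Omega> f x))\<^sup>2 = (cmod (g x))\<^sup>2"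
    using weak_deriv_AE[OF assms(1) HH_weak_deriv[OF assms]] by eventually_elim simp
  then have "(LINT x:\<Omega>|lebesgue. (cmod (weak_deriv \<Omega> f x))\<^sup>2) = (LINT x:\<Omega>|lebesgue. (cmod (g x))\<^sup>2)"
    by (rule set_integral_cong_AE'[OF assms(1)]) (auto intro!: set_borel_measurable_lebesgue assms)
  then show ?thesis unfolding H1_norm_def HH_set_integral[OF assms] by simp
qed

lemma sq_imp_L2:
  assumes "open \<Omega>" "sq lborel f"
  shows "f \<in> L2 \<Omega>"
proof -
  note [measurable] = sq_measurable[OF assms(2)]
  have "set_integrable lebesgue \<Omega> (\<lambda>x. (cmod (f x))\<^sup>2)"
    unfolding set_integrable_def
    using sq_integrable[OF sq_lebesgue[OF assms(2)]] assms(1) by (intro integrable_mult_indicator) auto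
  then show ?thesis
    using assms by (auto simp: L2_def intro!: set_borel_measurable_lebesgue)
qed

lemma HH_imp_H10:
  assumes "open \<Omega>" "HH \<Omega> f g"
  shows "f \<in> H10 \<Omega>"
  unfolding H10_def
proof (intro CollectI conjI allI impI)
  show "f \<in> H1 \<Omega>"
    using sq_imp_L2[OF assms(1)] HH_sq[OF assms(2)] HH_weak_deriv[OF assms] by (auto simp: H1_def)
  fix e :: real assume "e > 0"
  then have "e / 2 > 0" by simp
  from HH_approx[OF assms(2) this] obtain \<psi> where p: "\<psi> \<in> test_functions \<Omega>"
    "nr lborel (\<lambda>x. \<psi> x - f x) < e / 2" "nr lborel (\<lambda>x. D \<psi> x - g x) < e / 2" by blast
  have "H1_norm \<Omega> (\<lambda>x. f x - \<psi> x)
      = sqrt ((nr lborel (\<lambda>x. \<psi> x - f x))\<^sup>2 + (nr lborel (\<lambda>x. D \<psi> x - g x))\<^sup>2)"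
    using H1_norm_HH[OF assms(1) HH_diff[OF assms(2) HH_tf[OF p(1)]]]
    by (simp add: nr_diff_commute[of lborel f] nr_diff_commute[of lborel g])
  also have "\<dots> \<le> nr lborel (\<lambda>x. \<psi> x - f x) + nr lborel (\<lambda>x. D \<psi> x - g x)"
    by (rule sqrt_sum_squares_le_sum) auto
  also have "\<dots> < e" using p by simp
  finally show "\<exists>\<psi>\<in>test_functions \<Omega>. H1_norm \<Omega> (\<lambda>x. f x - \<psi> x) < e" using p(1) by blast
qed

lemma L2_imp_sq:
  assumes "f \<in> L2 \<Omega>"
  shows "sq lebesgue (\<lambda>x. indicat_real \<Omega> x *\<^sub>R f x)"
proof -
  have "(\<lambda>x. (cmod (indicat_real \<Omega> x *\<^sub>R f x))\<^sup>2) = (\<lambda>x. indicat_real \<Omega> x *\<^sub>R (cmod (f x))\<^sup>2)"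
    by (auto simp: indicator_def)
  then show ?thesis
    using assms unfolding L2_def sq_def set_borel_measurable_def set_integrable_def by simp
qed

lemma nr_indicator:
  "nr lebesgue (\<lambda>x. indicat_real \<Omega> x *\<^sub>R f x) = sqrt (LINT x:\<Omega>|lebesgue. (cmod (f x))\<^sup>2)"
  unfolding nr_def set_lebesgue_integral_def
  by (intro arg_cong[of _ _ sqrt] Bochner_Integration.integral_cong) (auto simp: indicator_def)

text \<open>Only the values of f on \<Omega> matter, and f is merely Lebesgue measurable, so it is
  cut off by the indicator. Test functions approaching it at a geometric rate in H1 are fast Cauchy
  in L2 together with their derivatives. Their Borel measurable limits agree almost everywhere on
  \<Omega> with f and its weak derivative, and \<open>HH_representative\<close> supplies the
  continuous version.\<close>

lemma H10_imp_HH: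
  assumes "open \<Omega>" "f \<in> H10 \<Omega>"
  shows "\<exists>F G. HH \<Omega> F G \<and> (AE x in lebesgue. x \<in> \<Omega> \<longrightarrow> f x = F x) \<and>
    (AE x in lebesgue. x \<in> \<Omega> \<longrightarrow> weak_deriv \<Omega> f x = G x)"
proof -
  obtain g where f: "f \<in> L2 \<Omega>" and g: "g \<in> L2 \<Omega>" and fg: "has_weak_deriv \<Omega> 1 f g"
    using assms(2) by (auto simp: H10_def H1_def)
  define f1 where "f1 x = indicat_real \<Omega> x *\<^sub>R f x" for x
  define g1 where "g1 x = indicat_real \<Omega> x *\<^sub>R g x" for x
  have s1: "sq lebesgue f1" "sq lebesgue g1"
    unfolding f1_def g1_def by (intro L2_imp_sq f g)+
  have bnd: "nr lebesgue (\<lambda>x. f1 x - \<psi> x) \<le> H1_norm \<Omega> (\<lambda>x. f x - \<psi> x)"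
    "nr lebesgue (\<lambda>x. g1 x - D \<psi> x) \<le> H1_norm \<Omega> (\<lambda>x. f x - \<psi> x)" if p: "\<psi> \<in> test_functions \<Omega>" for \<psi>
  proof -
    have wd: "has_weak_deriv \<Omega> 1 (\<lambda>x. f x - \<psi> x) (\<lambda>x. g x - D \<psi> x)"
      by (rule has_weak_deriv_diff[OF fg HH_weak_deriv[OF assms(1) HH_tf]]) (rule p)
    have eq1: "(\<lambda>x. f1 x - \<psi> x) = (\<lambda>x. indicat_real \<Omega> x *\<^sub>R (f x - \<psi> x))"
      using tf_outside[OF p] by (auto simp: f1_def indicator_def)
    have eq2: "(\<lambda>x. g1 x - D \<psi> x) = (\<lambda>x. indicat_real \<Omega> x *\<^sub>R (g x - D \<psi> x))"
      using tf_outside[OF tf_dir_deriv[OF p]] by (auto simp: g1_def indicator_def)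
    have "sq lebesgue (\<lambda>x. g1 x - D \<psi> x)" by (intro sq_diff s1 sq_lebesgue tf_D_sq[OF p])
    then have m: "set_borel_measurable lebesgue \<Omega> (\<lambda>x. g x - D \<psi> x)"
      unfolding eq2 set_borel_measurable_def by (rule sq_measurable)
    have m2: "set_borel_measurable lebesgue \<Omega> (\<lambda>x. (cmod (g x - D \<psi> x))\<^sup>2)"
    proof -
      have "(\<lambda>x. (cmod (indicat_real \<Omega> x *\<^sub>R (g x - D \<psi> x)))\<^sup>2) \<in> borel_measurable lebesgue"
        using m unfolding set_borel_measurable_def by measurable
      moreover have "(\<lambda>x. (cmod (indicat_real \<Omega> x *\<^sub>R (g x - D \<psi> x)))\<^sup>2) = (\<lambda>x. indicat_real \<Omega> x *\<^sub>R (cmod (g x - D \<psi> x))\<^sup>2)"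
        by (auto simp: indicator_def)
      ultimately show ?thesis by (simp add: set_borel_measurable_def)
    qed
    have "AE x in lebesgue. x \<in> \<Omega> \<longrightarrow> (cmod (weak_deriv \<Omega> (\<lambda>x. f x - \<psi> x) x))\<^sup>2 = (cmod (g x - D \<psi> x))\<^sup>2"
      using weak_deriv_AE[OF assms(1) wd] by eventually_elim simp
    from set_integral_cong_AE'[OF assms(1) this m2]
    have "H1_norm \<Omega> (\<lambda>x. f x - \<psi> x) = sqrt ((nr lebesgue (\<lambda>x. f1 x - \<psi> x))\<^sup>2 + (nr lebesgue (\<lambda>x. g1 x - D \<psi> x))\<^sup>2)"
      unfolding H1_norm_def eq1 eq2 nr_indicator
      by (simp add: set_lebesgue_integral_def integral_nonneg_AE)
    then show "nr lebesgue (\<lambda>x. f1 x - \<psi> x) \<le> H1_norm \<Omega> (\<lambda>x. f x - \<psi> x)"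
      "nr lebesgue (\<lambda>x. g1 x - D \<psi> x) \<le> H1_norm \<Omega> (\<lambda>x. f x - \<psi> x)"
      by (auto intro: real_le_rsqrt)
  qed
  \<comment> \<open>The extra factor 1/2 makes consecutive approximants differ by at most (3/4)
    (1/2)^k, within the rate that \<open>fast_Cauchy_lim\<close> demands.\<close>
  have "\<forall>k::nat. \<exists>\<psi>. \<psi> \<in> test_functions \<Omega> \<and> H1_norm \<Omega> (\<lambda>x. f x - \<psi> x) < (1/2)^k / 2"
  proof
    fix k :: nat
    have "(1/2 :: real)^k / 2 > 0" by simp
    then show "\<exists>\<psi>. \<psi> \<in> test_functions \<Omega> \<and> H1_norm \<Omega> (\<lambda>x. f x - \<psi> x) < (1/2)^k / 2"
      using assms(2) unfolding H10_def by blast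
  qed
  from choice[OF this] obtain \<psi> where "\<forall>k::nat. \<psi> k \<in> test_functions \<Omega> \<and> H1_norm \<Omega> (\<lambda>x. f x - \<psi> k x) < (1/2)^k / 2"
    by blast
  then have p: "\<And>k. \<psi> k \<in> test_functions \<Omega>" and pn: "\<And>k. H1_norm \<Omega> (\<lambda>x. f x - \<psi> k x) < (1/2)^k / 2"
    by auto
  have b1: "nr lebesgue (\<lambda>x. \<psi> k x - f1 x) \<le> (1/2)^k / 2" and b2: "nr lebesgue (\<lambda>x. D (\<psi> k) x - g1 x) \<le> (1/2)^k / 2" for k
    using bnd[OF p, of k] pn[of k]
    unfolding nr_diff_commute[of lebesgue f1] nr_diff_commute[of lebesgue g1] by linarith+
  have half: "(1/2)^(Suc k) / 2 + (1/2)^k / 2 \<le> (1/2 :: real)^k" for k by simp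
  have c1: "nr lborel (\<lambda>x. \<psi> (Suc k) x - \<psi> k x) \<le> (1/2)^k" for k
  proof -
    have "nr lebesgue (\<lambda>x. \<psi> (Suc k) x - \<psi> k x) \<le> (1/2)^k"
      using nr_triangle_diff[OF sq_lebesgue[OF tf_sq[OF p]] s1(1) sq_lebesgue[OF tf_sq[OF p]], of "Suc k" k]
        b1[of "Suc k"] b1[of k] half[of k] unfolding nr_diff_commute[of lebesgue f1] by linarith
    then show ?thesis using tf_measurable[OF p] by (simp add: nr_lebesgue)
  qed
  have c2: "nr lborel (\<lambda>x. D (\<psi> (Suc k)) x - D (\<psi> k) x) \<le> (1/2)^k" for k
  proof -
    have "nr lebesgue (\<lambda>x. D (\<psi> (Suc k)) x - D (\<psi> k) x) \<le> (1/2)^k"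
      using nr_triangle_diff[OF sq_lebesgue[OF tf_D_sq[OF p]] s1(2) sq_lebesgue[OF tf_D_sq[OF p]], of "Suc k" k]
        b2[of "Suc k"] b2[of k] half[of k] unfolding nr_diff_commute[of lebesgue g1] by linarith
    then show ?thesis using tf_measurable[OF tf_dir_deriv[OF p]] by (simp add: nr_lebesgue)
  qed
  define F0 where "F0 x = lim (\<lambda>k. \<psi> k x)" for x
  define G where "G x = lim (\<lambda>k. D (\<psi> k) x)" for x
  have F0: "AE x in lborel. (\<lambda>k. \<psi> k x) \<longlonglongrightarrow> F0 x" "sq lborel F0" "\<And>k. nr lborel (\<lambda>x. \<psi> k x - F0 x) \<le> 2 * (1/2)^k"
    unfolding F0_def[abs_def] by (rule fast_Cauchy_lim[where s=\<psi>, OF tf_sq[OF p] c1])+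
  have G: "AE x in lborel. (\<lambda>k. D (\<psi> k) x) \<longlonglongrightarrow> G x" "sq lborel G" "\<And>k. nr lborel (\<lambda>x. D (\<psi> k) x - G x) \<le> 2 * (1/2)^k"
    unfolding G_def[abs_def] by (rule fast_Cauchy_lim[where s="\<lambda>k. D (\<psi> k)", OF tf_D_sq[OF p] c2])+
  have pw: "(\<lambda>k. 2 * (1/2 :: real)^k) \<longlonglongrightarrow> 0" "(\<lambda>k. (1/2 :: real)^k / 2) \<longlonglongrightarrow> 0"
    by (auto intro!: tendsto_mult_right_zero tendsto_divide_zero LIMSEQ_realpow_zero)
  have squeeze: "(\<lambda>k. nr M (\<lambda>x. s k x - h x)) \<longlonglongrightarrow> 0" if "\<And>k. nr M (\<lambda>x. s k x - h x) \<le> b k" "b \<longlonglongrightarrow> 0"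
    for M :: "real measure" and s h and b :: "nat \<Rightarrow> real"
    by (rule real_tendsto_sandwich[OF _ _ tendsto_const that(2)]) (use that(1) in auto)
  obtain F where F: "HH \<Omega> F G" "AE x in lborel. F0 x = F x"
    using HH_representative[OF p F0(2) G(2) squeeze[OF F0(3) pw(1)] squeeze[OF G(3) pw(1)]] by blast
  have "AE x in lebesgue. f1 x = F0 x"
    using AE_completion[OF F0(1)] sq_measurable[OF sq_lebesgue[OF F0(2)]]
    by (intro nr_limit_unique[OF sq_lebesgue[OF tf_sq[OF p]] s1(1) squeeze[OF b1 pw(2)]])
  then have f: "AE x in lebesgue. x \<in> \<Omega> \<longrightarrow> f x = F x"
    using AE_completion[OF F(2)] by eventually_elim (auto simp: f1_def)
  have "AE x in lebesgue. g1 x = G x"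
    using AE_completion[OF G(1)] sq_measurable[OF sq_lebesgue[OF G(2)]]
    by (intro nr_limit_unique[OF sq_lebesgue[OF tf_D_sq[OF p]] s1(2) squeeze[OF b2 pw(2)]])
  then have "AE x in lebesgue. x \<in> \<Omega> \<longrightarrow> weak_deriv \<Omega> f x = G x"
    using weak_deriv_AE[OF assms(1) fg] by eventually_elim (auto simp: g1_def)
  with F(1) f show ?thesis by blast
qed

section \<open>Gram-Schmidt orthogonalization\<close>

definition lin :: "(nat \<Rightarrow> 'a \<Rightarrow> complex) \<Rightarrow> nat \<Rightarrow> ('a \<Rightarrow> complex) set" where
  "lin e n = {f. \<exists>a. f = (\<lambda>x. \<Sum>k<n. a k * e k x)}"

lemma linI: "(\<lambda>x. \<Sum>k<n. a k * e k x) \<in> lin e n"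
  by (auto simp: lin_def)

lemma lin_add: "f \<in> lin e n \<Longrightarrow> g \<in> lin e n \<Longrightarrow> (\<lambda>x. f x + g x) \<in> lin e n"
proof -
  assume "f \<in> lin e n" "g \<in> lin e n"
  then obtain a b where "f = (\<lambda>x. \<Sum>k<n. a k * e k x)" "g = (\<lambda>x. \<Sum>k<n. b k * e k x)"
    by (auto simp: lin_def)
  then have "(\<lambda>x. f x + g x) = (\<lambda>x. \<Sum>k<n. (a k + b k) * e k x)"
    by (simp add: distrib_right sum.distrib)
  then show ?thesis by (auto simp: lin_def)
qed

lemma lin_cmult: "f \<in> lin e n \<Longrightarrow> (\<lambda>x. c * f x) \<in> lin e n"
proof -
  assume "f \<in> lin e n"
  then obtain a where "f = (\<lambda>x. \<Sum>k<n. a k * e k x)" by (auto simp: lin_def)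
  then have "(\<lambda>x. c * f x) = (\<lambda>x. \<Sum>k<n. (c * a k) * e k x)"
    by (simp add: sum_distrib_left mult.assoc)
  then show ?thesis by (auto simp: lin_def)
qed

lemma lin_zero: "(\<lambda>x. 0) \<in> lin e n"
  unfolding lin_def by (intro CollectI exI[of _ "\<lambda>_. 0"]) simp

lemma lin_diff: "f \<in> lin e n \<Longrightarrow> g \<in> lin e n \<Longrightarrow> (\<lambda>x. f x - g x) \<in> lin e n"
proof -
  assume "f \<in> lin e n" "g \<in> lin e n"
  from lin_add[OF this(1) lin_cmult[OF this(2), of "-1"]] show ?thesis by simp
qed

lemma lin_sum: "(\<And>i. i \<in> I \<Longrightarrow> f i \<in> lin e n) \<Longrightarrow> (\<lambda>x. \<Sum>i\<in>I. f i x) \<in> lin e n"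
  by (induction I rule: infinite_finite_induct) (auto intro: lin_add lin_zero)

lemma lin_mono: "n \<le> m \<Longrightarrow> lin e n \<subseteq> lin e m"
proof
  fix f assume nm: "n \<le> m" and "f \<in> lin e n"
  then obtain a where f: "f = (\<lambda>x. \<Sum>k<n. a k * e k x)" by (auto simp: lin_def)
  have "(\<Sum>k<n. a k * e k x) = (\<Sum>k<m. (if k < n then a k else 0) * e k x)" for x
    using nm by (intro sum.mono_neutral_cong_left) auto
  then show "f \<in> lin e m" unfolding f lin_def by auto
qed

lemma lin_basis: "k < n \<Longrightarrow> e k \<in> lin e n"
proof -
  assume "k < n"
  then have "(\<Sum>j<n. (if j = k then 1 else 0) * e j x) = e k x" for x
    by (simp add: if_distrib[of "\<lambda>c. c * _"] sum.delta cong: if_cong)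
  then show ?thesis unfolding lin_def by (intro CollectI exI[of _ "\<lambda>j. if j = k then 1 else 0"]) auto
qed

lemma lin_subset: "(\<And>k. k < n \<Longrightarrow> e k \<in> lin d m) \<Longrightarrow> lin e n \<subseteq> lin d m"
proof
  fix f assume *: "\<And>k. k < n \<Longrightarrow> e k \<in> lin d m" and "f \<in> lin e n"
  then obtain a where "f = (\<lambda>x. \<Sum>k<n. a k * e k x)" by (auto simp: lin_def)
  then show "f \<in> lin d m" using * by (auto intro!: lin_sum lin_cmult)
qed

text \<open>An abstract scalar product, because Gram-Schmidt is carried out twice on the test
  functions, for L2 and for H1. Definiteness can be an equality of functions there, since test
  functions are continuous.\<close>

locale inner =
  fixes T :: "('a \<Rightarrow> complex) set" and Q :: "('a \<Rightarrow> complex) \<Rightarrow> ('a \<Rightarrow> complex) \<Rightarrow> complex"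
  assumes T_zero: "(\<lambda>x. 0) \<in> T"
    and T_add: "f \<in> T \<Longrightarrow> g \<in> T \<Longrightarrow> (\<lambda>x. f x + g x) \<in> T"
    and T_cmult: "f \<in> T \<Longrightarrow> (\<lambda>x. c * f x) \<in> T"
    and Q_add: "f \<in> T \<Longrightarrow> g \<in> T \<Longrightarrow> h \<in> T \<Longrightarrow> Q (\<lambda>x. f x + g x) h = Q f h + Q g h"
    and Q_cmult: "f \<in> T \<Longrightarrow> h \<in> T \<Longrightarrow> Q (\<lambda>x. c * f x) h = c * Q f h"
    and Q_commute: "f \<in> T \<Longrightarrow> h \<in> T \<Longrightarrow> Q h f = cnj (Q f h)"
    and Q_nonneg: "f \<in> T \<Longrightarrow> 0 \<le> Re (Q f f)"
    and Q_definite: "f \<in> T \<Longrightarrow> Q f f = 0 \<Longrightarrow> f = (\<lambda>x. 0)"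
begin

lemma T_sum: "(\<And>i. i \<in> I \<Longrightarrow> f i \<in> T) \<Longrightarrow> (\<lambda>x. \<Sum>i\<in>I. f i x) \<in> T"
  by (induction I rule: infinite_finite_induct) (auto intro: T_add T_zero)

lemma T_diff: "f \<in> T \<Longrightarrow> g \<in> T \<Longrightarrow> (\<lambda>x. f x - g x) \<in> T"
  using T_add[of f "\<lambda>x. (-1) * g x"] T_cmult[of g "-1"] by simp

lemma T_lin: "(\<And>k. e k \<in> T) \<Longrightarrow> f \<in> lin e n \<Longrightarrow> f \<in> T"
  by (auto simp: lin_def intro!: T_sum T_cmult)

lemma Q_zero_left: "h \<in> T \<Longrightarrow> Q (\<lambda>x. 0) h = 0"
  using Q_cmult[OF T_zero, of h 0] by simp

lemma Q_zero_right: "h \<in> T \<Longrightarrow> Q h (\<lambda>x. 0) = 0"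
  using Q_commute[OF T_zero, of h] Q_zero_left[of h] by simp

lemma Q_sum: "(\<And>i. i \<in> I \<Longrightarrow> f i \<in> T) \<Longrightarrow> h \<in> T \<Longrightarrow> Q (\<lambda>x. \<Sum>i\<in>I. f i x) h = (\<Sum>i\<in>I. Q (f i) h)"
  by (induction I rule: infinite_finite_induct) (auto simp: Q_add T_sum Q_zero_left)

lemma Q_diff: "f \<in> T \<Longrightarrow> g \<in> T \<Longrightarrow> h \<in> T \<Longrightarrow> Q (\<lambda>x. f x - g x) h = Q f h - Q g h"
  using Q_add[of f "\<lambda>x. (-1) * g x" h] Q_cmult[of g h "-1"] T_cmult[of g "-1"] by simp

lemma Q_cmult_right: "f \<in> T \<Longrightarrow> h \<in> T \<Longrightarrow> Q h (\<lambda>x. c * f x) = cnj c * Q h f"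
  using Q_commute[OF T_cmult, of f h c] Q_commute[of f h] by (simp add: Q_cmult)

lemma Q_sum_right: "(\<And>i. i \<in> I \<Longrightarrow> f i \<in> T) \<Longrightarrow> h \<in> T \<Longrightarrow> Q h (\<lambda>x. \<Sum>i\<in>I. f i x) = (\<Sum>i\<in>I. Q h (f i))"
  using Q_commute[OF T_sum, of I f h] by (simp add: Q_sum Q_commute[symmetric])

lemma Q_self: "f \<in> T \<Longrightarrow> Q f f = of_real (Re (Q f f))"
  using Q_commute[of f f] by (metis complex_cnj_cancel_iff Reals_cnj_iff of_real_Re)

text \<open>For a zero residual the factor is 1 / sqrt 0 = 0, so the result is 0. Linearly dependent
  input thus yields zero vectors instead of being excluded, and the squared norm of a vector of
  \<open>gs\<close> is 1 or 0.\<close>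

definition normed :: "('a \<Rightarrow> complex) \<Rightarrow> 'a \<Rightarrow> complex" where
  "normed r = (\<lambda>x. of_real (1 / sqrt (Re (Q r r))) * r x)"

fun gs :: "(nat \<Rightarrow> 'a \<Rightarrow> complex) \<Rightarrow> nat \<Rightarrow> 'a \<Rightarrow> complex" where
  "gs d n = normed (\<lambda>x. d n x - (\<Sum>k\<in>{..<n}. Q (d n) (gs d k) * gs d k x))"

declare gs.simps [simp del]

definition resid :: "(nat \<Rightarrow> 'a \<Rightarrow> complex) \<Rightarrow> nat \<Rightarrow> 'a \<Rightarrow> complex" where
  "resid d n = (\<lambda>x. d n x - (\<Sum>k<n. Q (d n) (gs d k) * gs d k x))"

lemma gs_eq: "gs d n = normed (resid d n)"
  unfolding resid_def by (rule gs.simps)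

lemma normed_T: "r \<in> T \<Longrightarrow> normed r \<in> T"
  unfolding normed_def by (rule T_cmult)

context
  fixes d :: "nat \<Rightarrow> 'a \<Rightarrow> complex"
  assumes d: "\<And>k. d k \<in> T"
begin

lemma gs_T: "gs d n \<in> T"
proof (induction n rule: less_induct)
  case (less n)
  then show ?case unfolding gs_eq[of d n] resid_def by (auto intro!: normed_T T_diff T_sum T_cmult d)
qed

lemma resid_T: "resid d n \<in> T"
  unfolding resid_def by (auto intro!: T_diff T_sum T_cmult d gs_T)

lemma gs_norm: "Q (gs d n) (gs d n) = (if resid d n = (\<lambda>x. 0) then 0 else 1)"
proof (cases "Re (Q (resid d n) (resid d n)) = 0")
  case True
  then have "Q (resid d n) (resid d n) = 0" using Q_self[OF resid_T, of n] by (simp only: of_real_0)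
  then have "resid d n = (\<lambda>x. 0)" using Q_definite[OF resid_T] by simp
  then show ?thesis by (simp add: gs_eq normed_def Q_zero_left T_zero)
next
  case False
  define q where "q = Re (Q (resid d n) (resid d n))"
  have q: "q > 0" using False Q_nonneg[OF resid_T, of n] by (simp add: q_def)
  have "Q (gs d n) (gs d n) = of_real (1 / sqrt q) * (cnj (of_real (1 / sqrt q)) * Q (resid d n) (resid d n))"
    unfolding gs_eq normed_def q_def[symmetric]
    by (simp only: Q_cmult[OF resid_T T_cmult[OF resid_T]] Q_cmult_right[OF resid_T resid_T])
  also have "\<dots> = of_real (1 / sqrt q * (1 / sqrt q) * q)"
    by (subst Q_self[OF resid_T]) (simp only: q_def[symmetric] complex_cnj_complex_of_real of_real_mult mult.assoc)
  also have "\<dots> = 1" using q by (simp add: field_simps)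
  finally show ?thesis using False Q_zero_left[OF T_zero] by auto
qed

lemma gs_zero: "Q (gs d n) (gs d n) = 0 \<Longrightarrow> gs d n = (\<lambda>x. 0)"
  using Q_definite[OF gs_T] .

lemma gs_norm_cases: "Q (gs d n) (gs d n) = 1 \<or> gs d n = (\<lambda>x. 0) \<and> Q (gs d n) (gs d n) = 0"
  using gs_norm[of n] gs_zero[of n] by (auto split: if_splits)

lemma gs_orthogonal_less: "k < n \<Longrightarrow> Q (gs d n) (gs d k) = 0"
proof (induction n arbitrary: k rule: less_induct)
  case (less n)
  have "Q (resid d n) (gs d k) = Q (d n) (gs d k) - (\<Sum>j<n. Q (d n) (gs d j) * Q (gs d j) (gs d k))"
    unfolding resid_def by (simp add: Q_diff Q_sum Q_cmult d gs_T T_sum T_cmult)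
  also have "(\<Sum>j<n. Q (d n) (gs d j) * Q (gs d j) (gs d k)) = (\<Sum>j<n. if j = k then Q (d n) (gs d k) * Q (gs d k) (gs d k) else 0)"
  proof (intro sum.cong refl)
    fix j assume "j \<in> {..<n}"
    then have j: "j < n" by simp
    have "Q (gs d j) (gs d k) = 0" if "j \<noteq> k"
    proof (cases "k < j")
      case True then show ?thesis using less.IH[OF j] by blast
    next
      case False
      then have "Q (gs d k) (gs d j) = 0" using that less.IH[OF less.prems, of j] by auto
      then show ?thesis using Q_commute[OF gs_T gs_T, of k j] by simp
    qed
    then show "Q (d n) (gs d j) * Q (gs d j) (gs d k) = (if j = k then Q (d n) (gs d k) * Q (gs d k) (gs d k) else 0)"
      by auto
  qed
  also have "\<dots> = Q (d n) (gs d k) * Q (gs d k) (gs d k)" using less.prems by simp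
  \<comment> \<open>Either \<open>gs d k\<close> has norm 1, or it is zero and both terms
    vanish.\<close>
  also have "Q (d n) (gs d k) - \<dots> = 0"
    using gs_norm_cases[of k] by (auto simp: Q_zero_right d)
  finally show ?case
    unfolding gs_eq[of d n] normed_def by (subst Q_cmult) (simp_all add: resid_T gs_T)
qed

lemma gs_orthogonal: "j \<noteq> k \<Longrightarrow> Q (gs d j) (gs d k) = 0"
  using gs_orthogonal_less[of k j] gs_orthogonal_less[of j k] Q_commute[OF gs_T gs_T, of k j]
  by (cases j k rule: linorder_cases) auto

lemma resid_gs: "resid d n = (\<lambda>x. of_real (sqrt (Re (Q (resid d n) (resid d n)))) * gs d n x)"
proof (cases "Re (Q (resid d n) (resid d n)) = 0")
  case True
  then have "Q (resid d n) (resid d n) = 0" using Q_self[OF resid_T, of n] by (simp only: of_real_0)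
  then have "resid d n = (\<lambda>x. 0)" using Q_definite[OF resid_T] by simp
  then show ?thesis using True by auto
next
  case False
  then show ?thesis by (simp add: gs_eq normed_def fun_eq_iff)
qed

text \<open>The right side does not involve the scalar product, so two orthogonalizations of one
  sequence have the same partial spans; an element of a Galerkin space therefore has a finite
  expansion in both bases.\<close>

lemma lin_gs: "lin (gs d) n = lin d n"
proof (induction n)
  case 0
  show ?case by (simp add: lin_def)
next
  case (Suc n)
  have s: "(\<lambda>x. \<Sum>k<n. Q (d n) (gs d k) * gs d k x) \<in> lin (gs d) n" by (rule linI)
  show ?case
  proof (rule subset_antisym)
    have "resid d n \<in> lin d (Suc n)"
      unfolding resid_def using s Suc lin_mono[of n "Suc n" d] lin_basis[of n "Suc n" d] by (intro lin_diff) auto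
    then have "gs d n \<in> lin d (Suc n)" unfolding gs_eq normed_def by (rule lin_cmult)
    moreover have "gs d k \<in> lin d (Suc n)" if "k < n" for k
      using lin_basis[of k n "gs d"] that Suc lin_mono[of n "Suc n" d] by auto
    ultimately show "lin (gs d) (Suc n) \<subseteq> lin d (Suc n)" by (intro lin_subset) (auto simp: less_Suc_eq)
    have "(\<lambda>x. resid d n x + (\<Sum>k<n. Q (d n) (gs d k) * gs d k x)) \<in> lin (gs d) (Suc n)"
    proof (rule lin_add)
      show "resid d n \<in> lin (gs d) (Suc n)" by (subst resid_gs) (intro lin_cmult lin_basis, simp)
    qed (use s lin_mono[of n "Suc n" "gs d"] in auto)
    then have "d n \<in> lin (gs d) (Suc n)" by (simp add: resid_def)
    moreover have "d k \<in> lin (gs d) (Suc n)" if "k < n" for k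
      using lin_basis[of k n d] that Suc lin_mono[of n "Suc n" "gs d"] by auto
    ultimately show "lin d (Suc n) \<subseteq> lin (gs d) (Suc n)" by (intro lin_subset) (auto simp: less_Suc_eq)
  qed
qed

lemma Q_gs_sum:
  assumes "k < n"
  shows "Q (\<lambda>x. \<Sum>j<n. a j * gs d j x) (gs d k) = a k * Q (gs d k) (gs d k)"
proof -
  have "Q (\<lambda>x. \<Sum>j<n. a j * gs d j x) (gs d k) = (\<Sum>j<n. a j * Q (gs d j) (gs d k))"
    by (simp add: Q_sum Q_cmult T_cmult gs_T)
  also have "\<dots> = (\<Sum>j<n. if j = k then a k * Q (gs d k) (gs d k) else 0)"
    by (intro sum.cong) (auto simp: gs_orthogonal)
  finally show ?thesis using assms by simp
qed

lemma gs_expansion: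
  assumes "f \<in> lin d n"
  shows "f = (\<lambda>x. \<Sum>k<n. Q f (gs d k) * gs d k x)"
proof -
  from assms obtain a where f: "f = (\<lambda>x. \<Sum>k<n. a k * gs d k x)"
    unfolding lin_gs[symmetric] by (auto simp: lin_def)
  have "Q f (gs d k) * gs d k x = a k * gs d k x" if "k < n" for k x
    unfolding f Q_gs_sum[OF that] using gs_norm_cases[of k] by auto
  then have "(\<lambda>x. \<Sum>k<n. Q f (gs d k) * gs d k x) = (\<lambda>x. \<Sum>k<n. a k * gs d k x)"
    by (intro ext sum.cong) auto
  then show ?thesis using f by simp
qed

lemma gs_Parseval:
  "Re (Q (\<lambda>x. \<Sum>k<n. a k * gs d k x) (\<lambda>x. \<Sum>k<n. a k * gs d k x)) = (\<Sum>k<n. (cmod (a k))\<^sup>2 * Re (Q (gs d k) (gs d k)))"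
proof -
  have "Q (\<lambda>x. \<Sum>k<n. a k * gs d k x) (\<lambda>x. \<Sum>k<n. a k * gs d k x)
      = (\<Sum>k<n. cnj (a k) * Q (\<lambda>x. \<Sum>j<n. a j * gs d j x) (gs d k))"
    by (simp add: Q_sum_right Q_cmult_right T_sum T_cmult gs_T)
  also have "\<dots> = (\<Sum>k<n. of_real ((cmod (a k))\<^sup>2) * Q (gs d k) (gs d k))"
    by (intro sum.cong) (auto simp: Q_gs_sum complex_norm_square mult_ac simp del: of_real_power)
  finally show ?thesis by (simp del: of_real_power)
qed

lemma gs_Parseval_le:
  "Re (Q (\<lambda>x. \<Sum>k<n. a k * gs d k x) (\<lambda>x. \<Sum>k<n. a k * gs d k x)) \<le> (\<Sum>k<n. (cmod (a k))\<^sup>2)"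
  unfolding gs_Parseval
proof (intro sum_mono)
  show "(cmod (a k))\<^sup>2 * Re (Q (gs d k) (gs d k)) \<le> (cmod (a k))\<^sup>2" for k
    using gs_norm_cases[of k] by auto
qed

text \<open>Bessel's inequality for a bounded linear functional l instead of a vector: test l with
  the combination whose coefficients are the conjugates of \<open>l (gs d k)\<close>. It covers L2
  pairings, point evaluation and arbitrary elements of the dual without a representing
  vector.\<close>

lemma gs_Bessel:
  assumes add: "\<And>f g. f \<in> T \<Longrightarrow> g \<in> T \<Longrightarrow> l (\<lambda>x. f x + g x) = l f + l g"
    and cmult: "\<And>c f. f \<in> T \<Longrightarrow> l (\<lambda>x. c * f x) = c * l f"
    and bd: "\<And>f. f \<in> T \<Longrightarrow> cmod (l f) \<le> L * sqrt (Re (Q f f))" and "0 \<le> L"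
  shows "(\<Sum>k<n. (cmod (l (gs d k)))\<^sup>2) \<le> L\<^sup>2"
proof -
  define S where "S = (\<Sum>k<n. (cmod (l (gs d k)))\<^sup>2)"
  define f where "f = (\<lambda>x. \<Sum>k<n. cnj (l (gs d k)) * gs d k x)"
  have sum: "l (\<lambda>x. \<Sum>i\<in>I. h i x) = (\<Sum>i\<in>I. l (h i))" if "\<And>i. i \<in> I \<Longrightarrow> h i \<in> T" for I and h :: "nat \<Rightarrow> 'a \<Rightarrow> complex"
    using that
    by (induction I rule: infinite_finite_induct) (use cmult[OF T_zero, of 0] in \<open>auto simp: add T_sum\<close>)
  have fT: "f \<in> T" unfolding f_def by (intro T_sum T_cmult gs_T)
  have "l f = (\<Sum>k<n. cnj (l (gs d k)) * l (gs d k))"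
    unfolding f_def by (simp add: sum cmult T_cmult gs_T)
  also have "\<dots> = of_real S"
    unfolding S_def of_real_sum by (intro sum.cong) (simp_all add: complex_norm_square mult.commute del: of_real_power)
  finally have "l f = of_real S" .
  then have "cmod (l f) = S" by (simp only: norm_of_real) (simp add: S_def sum_nonneg)
  moreover have "Re (Q f f) \<le> S" unfolding f_def S_def using gs_Parseval_le[of "\<lambda>k. cnj (l (gs d k))" n] by simp
  ultimately have "S \<le> L * sqrt S"
    using bd[OF fT] mult_left_mono[of "sqrt (Re (Q f f))" "sqrt S" L] \<open>0 \<le> L\<close> by simp
  moreover have S0: "0 \<le> S" unfolding S_def by (intro sum_nonneg) auto
  ultimately have "sqrt S * sqrt S \<le> L * sqrt S" by simp
  then have "sqrt S \<le> L" using \<open>0 \<le> L\<close> S0 by (cases "S = 0") (auto dest!: mult_right_le_imp_le simp del: real_sqrt_mult_self)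
  then have "(sqrt S)\<^sup>2 \<le> L\<^sup>2" using S0 by (intro power_mono) auto
  then show ?thesis using S0 by (simp add: S_def)
qed

end

end

section \<open>Weak convergence of square summable sequences\<close>

lemma Cauchy_Schwarz_sum:
  fixes a b :: "nat \<Rightarrow> complex"
  assumes "finite I"
  shows "(\<Sum>k\<in>I. cmod (a k * b k)) \<le> sqrt (\<Sum>k\<in>I. (cmod (a k))\<^sup>2) * sqrt (\<Sum>k\<in>I. (cmod (b k))\<^sup>2)"
proof -
  have "(\<Sum>k\<in>I. cmod (a k) * cmod (b k))\<^sup>2 \<le> (\<Sum>k\<in>I. (cmod (a k))\<^sup>2) * (\<Sum>k\<in>I. (cmod (b k))\<^sup>2)"
    by (rule Cauchy_Schwarz_ineq_sum)
  then have "(\<Sum>k\<in>I. cmod (a k) * cmod (b k)) \<le> sqrt ((\<Sum>k\<in>I. (cmod (a k))\<^sup>2) * (\<Sum>k\<in>I. (cmod (b k))\<^sup>2))"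
    by (rule real_le_rsqrt)
  then show ?thesis by (simp add: norm_mult real_sqrt_mult)
qed

lemma summable_square_bound:
  fixes a :: "nat \<Rightarrow> complex"
  assumes "\<And>N. (\<Sum>k<N. (cmod (a k))\<^sup>2) \<le> C"
  shows "summable (\<lambda>k. (cmod (a k))\<^sup>2)"
  by (rule summableI_nonneg_bounded[of _ C]) (use assms in auto)

lemma summable_product:
  fixes a b :: "nat \<Rightarrow> complex"
  assumes a: "\<And>N. (\<Sum>k<N. (cmod (a k))\<^sup>2) \<le> C\<^sup>2" and b: "\<And>N. (\<Sum>k<N. (cmod (b k))\<^sup>2) \<le> L\<^sup>2"
  shows "summable (\<lambda>k. cmod (a k * b k))"
proof (rule summableI_nonneg_bounded)
  fix N
  have "(\<Sum>k<N. cmod (a k * b k)) \<le> sqrt (\<Sum>k<N. (cmod (a k))\<^sup>2) * sqrt (\<Sum>k<N. (cmod (b k))\<^sup>2)"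
    by (rule Cauchy_Schwarz_sum) simp
  also have "\<dots> \<le> sqrt (C\<^sup>2) * sqrt (L\<^sup>2)"
    by (intro mult_mono real_sqrt_le_mono a b) (auto intro: sum_nonneg)
  finally show "(\<Sum>k<N. cmod (a k * b k)) \<le> sqrt (C\<^sup>2) * sqrt (L\<^sup>2)" .
qed simp

lemma weak_limit_square_bound:
  fixes a :: "nat \<Rightarrow> nat \<Rightarrow> complex"
  assumes a: "\<And>n N. (\<Sum>k<N. (cmod (a n k))\<^sup>2) \<le> C" and lim: "\<And>k. (\<lambda>n. a n k) \<longlonglongrightarrow> a' k"
  shows "(\<Sum>k<N. (cmod (a' k))\<^sup>2) \<le> C"
proof (rule LIMSEQ_le_const2)
  show "(\<lambda>n. \<Sum>k<N. (cmod (a n k))\<^sup>2) \<longlonglongrightarrow> (\<Sum>k<N. (cmod (a' k))\<^sup>2)"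
    by (intro tendsto_intros lim)
qed (use a in auto)

text \<open>Cauchy-Schwarz makes the tails small uniformly in n, because the square sums of
  \<open>a n\<close> are bounded and those of b converge; a finite sum remains, where coordinatewise
  convergence suffices.\<close>

lemma weak_convergence:
  fixes a :: "nat \<Rightarrow> nat \<Rightarrow> complex"
  assumes a: "\<And>n N. (\<Sum>k<N. (cmod (a n k))\<^sup>2) \<le> C\<^sup>2" and b: "\<And>N. (\<Sum>k<N. (cmod (b k))\<^sup>2) \<le> L\<^sup>2"
    and lim: "\<And>k. (\<lambda>n. a n k) \<longlonglongrightarrow> a' k" and C: "0 \<le> C"
  shows "(\<lambda>n. \<Sum>k. a n k * b k) \<longlonglongrightarrow> (\<Sum>k. a' k * b k)"
proof (rule LIMSEQ_I)
  fix e :: real assume e: "e > 0"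
  note a' = weak_limit_square_bound[OF a lim]
  \<comment> \<open>Each of the two tails then costs at most C \<delta> <= e/4; the summand 1 covers
    C = 0.\<close>
  define \<delta> where "\<delta> = e / (4 * (C + 1))"
  have \<delta>: "\<delta> > 0" using e C by (simp add: \<delta>_def)
  have sb: "summable (\<lambda>k. (cmod (b k))\<^sup>2)" by (rule summable_square_bound[OF b])
  obtain N where N: "\<And>M. M \<ge> N \<Longrightarrow> (\<Sum>k\<in>{N..<M}. (cmod (b k))\<^sup>2) < \<delta>\<^sup>2"
  proof -
    obtain N where "\<forall>m\<ge>N. \<forall>n. norm (\<Sum>k\<in>{m..<n}. (cmod (b k))\<^sup>2) < \<delta>\<^sup>2"
      using sb[unfolded summable_Cauchy] \<delta> by (meson zero_less_power)
    then show ?thesis by (intro that[of N]) (auto simp: sum_nonneg)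
  qed
  have tail: "cmod ((\<Sum>k. c k * b k) - (\<Sum>k<N. c k * b k)) \<le> C * \<delta>"
    if c: "\<And>M. (\<Sum>k<M. (cmod (c k))\<^sup>2) \<le> C\<^sup>2" for c
  proof (rule LIMSEQ_le_const2)
    have "summable (\<lambda>k. c k * b k)" by (rule summable_norm_cancel) (rule summable_product[OF c b])
    then have "(\<lambda>M. \<Sum>k<M. c k * b k) \<longlonglongrightarrow> (\<Sum>k. c k * b k)" by (rule summable_LIMSEQ)
    then show "(\<lambda>M. cmod ((\<Sum>k<M. c k * b k) - (\<Sum>k<N. c k * b k))) \<longlonglongrightarrow> cmod ((\<Sum>k. c k * b k) - (\<Sum>k<N. c k * b k))"
      by (intro tendsto_intros)
    show "\<exists>N'. \<forall>M\<ge>N'. cmod ((\<Sum>k<M. c k * b k) - (\<Sum>k<N. c k * b k)) \<le> C * \<delta>"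
    proof (intro exI[of _ N] allI impI)
      fix M assume M: "M \<ge> N"
      have "(\<Sum>k<M. c k * b k) - (\<Sum>k<N. c k * b k) = (\<Sum>k\<in>{N..<M}. c k * b k)"
        using M by (simp add: lessThan_atLeast0 sum_diff_nat_ivl)
      then have "cmod ((\<Sum>k<M. c k * b k) - (\<Sum>k<N. c k * b k)) \<le> (\<Sum>k\<in>{N..<M}. cmod (c k * b k))"
        by (simp only: norm_sum)
      also have "\<dots> \<le> sqrt (\<Sum>k\<in>{N..<M}. (cmod (c k))\<^sup>2) * sqrt (\<Sum>k\<in>{N..<M}. (cmod (b k))\<^sup>2)"
        by (rule Cauchy_Schwarz_sum) simp
      also have "\<dots> \<le> sqrt (C\<^sup>2) * sqrt (\<delta>\<^sup>2)"
      proof (intro mult_mono real_sqrt_le_mono)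
        have "(\<Sum>k\<in>{N..<M}. (cmod (c k))\<^sup>2) \<le> (\<Sum>k<M. (cmod (c k))\<^sup>2)" by (intro sum_mono2) auto
        then show "(\<Sum>k\<in>{N..<M}. (cmod (c k))\<^sup>2) \<le> C\<^sup>2" using c[of M] by linarith
      qed (use N[OF M] in \<open>auto intro!: sum_nonneg\<close>)
      finally show "cmod ((\<Sum>k<M. c k * b k) - (\<Sum>k<N. c k * b k)) \<le> C * \<delta>" using C \<delta> by simp
    qed
  qed
  have "C * \<delta> \<le> e / 4" using e C by (simp add: \<delta>_def field_simps)
  have "(\<lambda>n. \<Sum>k<N. a n k * b k) \<longlonglongrightarrow> (\<Sum>k<N. a' k * b k)" by (intro tendsto_intros lim)
  then obtain n0 where n0: "\<And>n. n \<ge> n0 \<Longrightarrow> cmod ((\<Sum>k<N. a n k * b k) - (\<Sum>k<N. a' k * b k)) < e / 4"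
    using LIMSEQ_D[OF _ divide_pos_pos[OF e zero_less_numeral[of "num.Bit0 (num.Bit0 num.One)"]]] by fastforce
  show "\<exists>no. \<forall>n\<ge>no. norm ((\<Sum>k. a n k * b k) - (\<Sum>k. a' k * b k)) < e"
  proof (intro exI[of _ n0] allI impI)
    fix n assume n: "n \<ge> n0"
    have "(\<Sum>k. a n k * b k) - (\<Sum>k. a' k * b k) = ((\<Sum>k. a n k * b k) - (\<Sum>k<N. a n k * b k))
      + ((\<Sum>k<N. a n k * b k) - (\<Sum>k<N. a' k * b k)) - ((\<Sum>k. a' k * b k) - (\<Sum>k<N. a' k * b k))" by simp
    then have "norm ((\<Sum>k. a n k * b k) - (\<Sum>k. a' k * b k)) \<le> cmod ((\<Sum>k. a n k * b k) - (\<Sum>k<N. a n k * b k))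
      + cmod ((\<Sum>k<N. a n k * b k) - (\<Sum>k<N. a' k * b k)) + cmod ((\<Sum>k. a' k * b k) - (\<Sum>k<N. a' k * b k))"
      by (simp only:) (rule order_trans[OF norm_triangle_ineq4 add_right_mono[OF norm_triangle_ineq]])
    also have "\<dots> < e"
      using tail[OF a, of n] tail[OF a'] n0[OF n] \<open>C * \<delta> \<le> e / 4\<close> e by linarith
    finally show "norm ((\<Sum>k. a n k * b k) - (\<Sum>k. a' k * b k)) < e" .
  qed
qed

section \<open>Expansions in an orthonormal basis of \<open>H10\<close>\<close>

definition hip :: "(real \<Rightarrow> complex) \<Rightarrow> (real \<Rightarrow> complex) \<Rightarrow> complex" where
  "hip f g = ip lborel f g + ip lborel (D f) (D g)"

definition pw :: "real \<Rightarrow> complex \<Rightarrow> complex" where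
  "pw \<sigma> z = of_real (cmod z powr (2 * \<sigma>))"

lemma cnj_pw [simp]: "cnj (pw \<sigma> z) = pw \<sigma> z"
  by (simp add: pw_def)

lemma norm_pw: "cmod (pw \<sigma> z) = cmod z powr (2 * \<sigma>)"
  by (simp add: pw_def)

lemma norm_pw_le: "0 < \<sigma> \<Longrightarrow> cmod z \<le> B \<Longrightarrow> cmod (pw \<sigma> z) \<le> B powr (2 * \<sigma>)"
  by (simp add: norm_pw powr_mono2)

lemma tendsto_pw:
  assumes "0 < \<sigma>" "(f \<longlongrightarrow> z) F"
  shows "((\<lambda>x. pw \<sigma> (f x)) \<longlongrightarrow> pw \<sigma> z) F"
  unfolding pw_def using assms
  by (intro tendsto_of_real tendsto_powr' tendsto_norm tendsto_const) auto

lemma continuous_on_pw: "0 < \<sigma> \<Longrightarrow> continuous_on UNIV (pw \<sigma>)"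
  unfolding continuous_on_def by (auto intro: tendsto_pw tendsto_ident_at)

lemma borel_measurable_pw [measurable (raw)]:
  assumes "f \<in> borel_measurable M"
  shows "(\<lambda>x. pw \<sigma> (f x)) \<in> borel_measurable M"
  using assms unfolding pw_def by measurable

lemma D_add_fun: "\<psi> \<in> test_functions U \<Longrightarrow> \<eta> \<in> test_functions V \<Longrightarrow> D (\<lambda>x. \<psi> x + \<eta> x) = (\<lambda>x. D \<psi> x + D \<eta> x)"
  by (intro ext D_add)

lemma D_cmult_fun: "\<psi> \<in> test_functions U \<Longrightarrow> D (\<lambda>x. c * \<psi> x) = (\<lambda>x. c * D \<psi> x)"
  by (intro ext D_cmult)

lemma real_tendsto_0I: "(\<And>n. 0 \<le> f n) \<Longrightarrow> (\<And>n. f n \<le> b n) \<Longrightarrow> b \<longlonglongrightarrow> 0 \<Longrightarrow> f \<longlonglongrightarrow> (0::real)"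
  by (rule real_tendsto_sandwich[OF _ _ tendsto_const]) auto

locale basis =
  fixes \<Omega> :: "real set" and d :: "nat \<Rightarrow> real \<Rightarrow> complex"
  assumes open_dom: "open \<Omega>"
    and d_test: "\<And>k. d k \<in> test_functions \<Omega>"
    and d_dense: "\<And>\<psi> \<epsilon>. \<psi> \<in> test_functions \<Omega> \<Longrightarrow> 0 < \<epsilon> \<Longrightarrow>
      \<exists>k. nr lborel (\<lambda>x. \<psi> x - d k x) < \<epsilon> \<and> nr lborel (\<lambda>x. D \<psi> x - D (d k) x) < \<epsilon>"
begin

abbreviation "TF \<equiv> test_functions \<Omega>"
abbreviation "N2 \<equiv> nr lborel"

lemma tf_nr_zero: "f \<in> TF \<Longrightarrow> N2 f = 0 \<Longrightarrow> f = (\<lambda>x. 0)"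
  using tf_sup_bound[of f \<Omega>] by (auto simp: fun_eq_iff)

lemma hip_self: "hip f f = of_real ((N2 f)\<^sup>2 + (N2 (D f))\<^sup>2)"
  by (simp add: hip_def ip_self)

sublocale L: inner TF "ip lborel"
proof
  fix f assume "f \<in> TF" "ip lborel f f = 0"
  then show "f = (\<lambda>x. 0)" by (auto simp: ip_self tf_nr_zero)
qed (auto simp: tf_add tf_cmult ip_add_left tf_sq ip_cmult_left ip_self simp del: of_real_power intro: ip_commute)

sublocale H: inner TF hip
proof
  fix f g h assume "f \<in> TF" "g \<in> TF" "h \<in> TF"
  then show "hip (\<lambda>x. f x + g x) h = hip f h + hip g h"
    unfolding hip_def by (simp add: D_add_fun ip_add_left tf_sq tf_D_sq)
next
  fix f h c assume "f \<in> TF" "h \<in> TF"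
  then show "hip (\<lambda>x. c * f x) h = c * hip f h"
    unfolding hip_def by (simp add: D_cmult_fun ip_cmult_left distrib_left)
next
  fix f h assume "f \<in> TF" "h \<in> TF"
  show "hip h f = cnj (hip f h)"
    unfolding hip_def using ip_commute[of lborel h f] ip_commute[of lborel "D h" "D f"] by simp
next
  fix f assume "f \<in> TF"
  show "0 \<le> Re (hip f f)" unfolding hip_self by simp
next
  fix f assume f: "f \<in> TF" "hip f f = 0"
  then have "(N2 f)\<^sup>2 + (N2 (D f))\<^sup>2 = 0" unfolding hip_self by (simp only: of_real_eq_0_iff)
  then have "N2 f = 0" by (simp add: add_nonneg_eq_0_iff)
  then show "f = (\<lambda>x. 0)" using f tf_nr_zero by blast
qed (auto simp: tf_add tf_cmult)

definition e :: "nat \<Rightarrow> real \<Rightarrow> complex" where "e = H.gs d"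

lemma e_tf: "e k \<in> TF"
  unfolding e_def by (rule H.gs_T[OF d_test])

lemma N2_le_hip: "N2 f \<le> sqrt (Re (hip f f))" "N2 (D f) \<le> sqrt (Re (hip f f))"
  unfolding hip_self by (auto intro!: real_le_rsqrt)

abbreviation S :: "(nat \<Rightarrow> complex) \<Rightarrow> nat \<Rightarrow> real \<Rightarrow> complex" where
  "S a N \<equiv> \<lambda>x. \<Sum>k<N. a k * e k x"

lemma S_tf: "S a N \<in> TF"
  by (intro tf_sum tf_cmult e_tf)

lemma D_S: "D (S a N) = (\<lambda>x. \<Sum>k<N. a k * D (e k) x)"
proof
  fix x
  have "D (S a N) x = (\<Sum>k<N. D (\<lambda>x. a k * e k x) x)" by (rule D_sum[of _ _ \<Omega>]) (intro tf_cmult e_tf)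
  then show "D (S a N) x = (\<Sum>k<N. a k * D (e k) x)" by (simp only: D_cmult[OF e_tf])
qed

lemma hip_S: "Re (hip (S a N) (S a N)) \<le> (\<Sum>k<N. (cmod (a k))\<^sup>2)"
  unfolding e_def by (rule H.gs_Parseval_le[OF d_test])

lemma S_norm:
  "N2 (S a N) \<le> sqrt (\<Sum>k<N. (cmod (a k))\<^sup>2)" "N2 (D (S a N)) \<le> sqrt (\<Sum>k<N. (cmod (a k))\<^sup>2)"
  using N2_le_hip[of "S a N"] real_sqrt_le_mono[OF hip_S[of a N]] by linarith+

lemma S_diff: "N \<le> M \<Longrightarrow> S a M x - S a N x = S (\<lambda>k. if k < N then 0 else a k) M x"
proof -
  assume "N \<le> M"
  have "S (\<lambda>k. if k < N then 0 else a k) M x = (\<Sum>k<M. a k * e k x) - (\<Sum>k<M. if k < N then a k * e k x else 0)"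
    unfolding sum_subtractf[symmetric] by (intro sum.cong) auto
  also have "(\<Sum>k<M. if k < N then a k * e k x else 0) = (\<Sum>k<N. a k * e k x)"
    using \<open>N \<le> M\<close> by (intro sum.mono_neutral_cong_right) auto
  finally show ?thesis by simp
qed

lemma S_diff_norm:
  assumes "N \<le> M"
  shows "N2 (\<lambda>x. S a M x - S a N x) \<le> sqrt (\<Sum>k\<in>{N..<M}. (cmod (a k))\<^sup>2)"
    "N2 (\<lambda>x. D (S a M) x - D (S a N) x) \<le> sqrt (\<Sum>k\<in>{N..<M}. (cmod (a k))\<^sup>2)"
proof -
  define a' where "a' k = (if k < N then 0 else a k)" for k
  have eq: "(\<lambda>x. S a M x - S a N x) = S a' M" unfolding a'_def using S_diff[OF assms] by blast
  have "(\<lambda>x. D (S a M) x - D (S a N) x) = D (\<lambda>x. S a M x - S a N x)"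
    by (intro ext D_diff[symmetric, of _ \<Omega> _ \<Omega>] S_tf)
  then have eqD: "(\<lambda>x. D (S a M) x - D (S a N) x) = D (S a' M)" unfolding eq .
  have s: "(\<Sum>k<M. (cmod (a' k))\<^sup>2) = (\<Sum>k\<in>{N..<M}. (cmod (a k))\<^sup>2)"
    unfolding a'_def by (intro sum.mono_neutral_cong_right) auto
  show "N2 (\<lambda>x. S a M x - S a N x) \<le> sqrt (\<Sum>k\<in>{N..<M}. (cmod (a k))\<^sup>2)"
    "N2 (\<lambda>x. D (S a M) x - D (S a N) x) \<le> sqrt (\<Sum>k\<in>{N..<M}. (cmod (a k))\<^sup>2)"
    unfolding eq eqD s[symmetric] by (rule S_norm)+
qed

text \<open>An expansion of f and of its derivative g in the H1 basis, convergent for f also at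
  every point. Uniqueness of the coefficients is not asserted, since some \<open>e k\<close> may be
  zero.\<close>

definition rep :: "(nat \<Rightarrow> complex) \<Rightarrow> (real \<Rightarrow> complex) \<Rightarrow> (real \<Rightarrow> complex) \<Rightarrow> bool" where
  "rep a f g \<longleftrightarrow> sq lborel f \<and> sq lborel g \<and> (\<lambda>N. N2 (\<lambda>x. S a N x - f x)) \<longlonglongrightarrow> 0 \<and>
     (\<lambda>N. N2 (\<lambda>x. D (S a N) x - g x)) \<longlonglongrightarrow> 0 \<and> (\<forall>x. (\<lambda>N. S a N x) \<longlonglongrightarrow> f x)"

lemma rep_HH: "rep a f g \<Longrightarrow> HH \<Omega> f g"
  unfolding rep_def HH_def by (elim conjE, intro conjI exI[of _ "\<lambda>N. S a N"] allI S_tf) auto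

lemma rep_norm:
  assumes "rep a f g" "\<And>N. (\<Sum>k<N. (cmod (a k))\<^sup>2) \<le> C\<^sup>2" "0 \<le> C"
  shows "N2 f \<le> C" "N2 g \<le> C" "cmod (f x) \<le> 2 * C"
proof -
  have b: "N2 (S a N) \<le> C" "N2 (D (S a N)) \<le> C" for N
    using S_norm[of a N] real_sqrt_le_mono[OF assms(2)[of N]] assms(3) by auto
  show 1: "N2 f \<le> C"
    by (rule LIMSEQ_le_const2[OF tendsto_nr[of lborel "S a" f]])
       (use assms(1) b in \<open>auto simp: rep_def tf_sq[OF S_tf]\<close>)
  show 2: "N2 g \<le> C"
    by (rule LIMSEQ_le_const2[OF tendsto_nr[of lborel "\<lambda>N. D (S a N)" g]])
       (use assms(1) b in \<open>auto simp: rep_def tf_D_sq[OF S_tf]\<close>)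
  show "cmod (f x) \<le> 2 * C" by (rule HH_sup_bound'[OF rep_HH[OF assms(1)] 1 2])
qed

lemma rep_finite:
  assumes "\<And>k. k \<ge> n \<Longrightarrow> a k = 0"
  shows "rep a (S a n) (D (S a n))"
proof -
  have "S a N x = S a n x" if "N \<ge> n" for N x
    using that assms by (intro sum.mono_neutral_right) auto
  then have eq: "S a N = S a n" if "N \<ge> n" for N using that by blast
  have ev: "\<forall>\<^sub>F N in sequentially. \<forall>x. S a N x = S a n x"
    unfolding eventually_sequentially using fun_cong[OF eq] by blast
  show ?thesis
    unfolding rep_def
  proof (intro conjI allI tf_sq[OF S_tf] tf_D_sq[OF S_tf])
    show "(\<lambda>N. N2 (\<lambda>x. S a N x - S a n x)) \<longlonglongrightarrow> 0"
      by (rule tendsto_eventually, rule eventually_mono[OF ev]) simp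
    have ev': "\<forall>\<^sub>F N in sequentially. S a N = S a n"
      unfolding eventually_sequentially using eq by blast
    show "(\<lambda>N. N2 (\<lambda>x. D (S a N) x - D (S a n) x)) \<longlonglongrightarrow> 0"
      by (rule tendsto_eventually, rule eventually_mono[OF ev']) (simp only: diff_self nr_zero)
    show "(\<lambda>N. S a N x) \<longlonglongrightarrow> S a n x" for x
      by (rule tendsto_eventually, rule eventually_mono[OF ev]) (rule spec)
  qed
qed

text \<open>The cut-offs \<open>Nj a j\<close> depend measurably on the coefficients, and along them the partial sums
  converge almost everywhere. This yields jointly measurable representatives of the derivative.\<close>

definition Nj :: "(nat \<Rightarrow> complex) \<Rightarrow> nat \<Rightarrow> nat" where
  "Nj a j = (LEAST N. (\<Sum>k. (cmod (a k))\<^sup>2) - (\<Sum>k<N. (cmod (a k))\<^sup>2) \<le> (1/4)^j)"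

definition Gn :: "(nat \<Rightarrow> complex) \<Rightarrow> real \<Rightarrow> complex" where
  "Gn a x = lim (\<lambda>j. \<Sum>k<Nj a j. a k * D (e k) x)"

context
  fixes a :: "nat \<Rightarrow> complex"
  assumes a: "summable (\<lambda>k. (cmod (a k))\<^sup>2)"
begin

abbreviation "tail N \<equiv> (\<Sum>k. (cmod (a k))\<^sup>2) - (\<Sum>k<N. (cmod (a k))\<^sup>2)"

lemma tail_tendsto: "(\<lambda>N. tail N) \<longlonglongrightarrow> 0"
  using tendsto_diff[OF tendsto_const[of "\<Sum>k. (cmod (a k))\<^sup>2"] summable_LIMSEQ[OF a]] by simp

lemma tail_ge: "N \<le> M \<Longrightarrow> (\<Sum>k\<in>{N..<M}. (cmod (a k))\<^sup>2) \<le> tail N"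
  using sum_le_suminf[OF a, of "{..<M}"] sum.atLeastLessThan_concat[of 0 N M "\<lambda>k. (cmod (a k))\<^sup>2"]
  by (auto simp: lessThan_atLeast0)

lemma Nj_tail: "tail (Nj a j) \<le> (1/4)^j"
proof -
  have "\<forall>\<^sub>F N in sequentially. tail N < (1/4)^j"
    by (rule order_tendstoD(2)[OF tail_tendsto]) (intro zero_less_power, simp)
  then obtain N where "tail N < (1/4)^j" unfolding eventually_sequentially by blast
  then have "tail N \<le> (1/4)^j" by (rule less_imp_le)
  then show ?thesis unfolding Nj_def by (rule LeastI[of "\<lambda>N. tail N \<le> (1/4)^j"])
qed

lemma Nj_mono: "Nj a j \<le> Nj a (Suc j)"
  unfolding Nj_def[of a j]
proof (rule Least_le)
  have "tail (Nj a (Suc j)) \<le> (1/4)^(Suc j)" by (rule Nj_tail)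
  also have "\<dots> \<le> (1/4)^j" by (rule power_decreasing) auto
  finally show "tail (Nj a (Suc j)) \<le> (1/4)^j" .
qed

lemma sqrt_quarter: "sqrt ((1/4)^j) = (1/2)^j"
proof -
  have "(1/4 :: real)^j = ((1/2) * (1/2))^j" by simp
  also have "\<dots> = ((1/2)^j)\<^sup>2" by (simp only: power_mult_distrib power2_eq_square)
  finally show ?thesis by (simp only: real_sqrt_abs) simp
qed

text \<open>The threshold (1/4)^j in \<open>Nj\<close> bounds a squared norm; its root (1/2)^j is
  the rate required by \<open>fast_Cauchy_lim\<close>.\<close>

lemma Nj_fast:
  "N2 (\<lambda>x. S a (Nj a (Suc j)) x - S a (Nj a j) x) \<le> (1/2)^j"
  "N2 (\<lambda>x. D (S a (Nj a (Suc j))) x - D (S a (Nj a j)) x) \<le> (1/2)^j"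
proof -
  have "(\<Sum>k\<in>{Nj a j..<Nj a (Suc j)}. (cmod (a k))\<^sup>2) \<le> (1/4)^j"
    using tail_ge[OF Nj_mono, of j] Nj_tail[of j] by linarith
  then have "sqrt (\<Sum>k\<in>{Nj a j..<Nj a (Suc j)}. (cmod (a k))\<^sup>2) \<le> (1/2)^j"
    unfolding sqrt_quarter[symmetric] by (rule real_sqrt_le_mono)
  then show "N2 (\<lambda>x. S a (Nj a (Suc j)) x - S a (Nj a j) x) \<le> (1/2)^j"
    "N2 (\<lambda>x. D (S a (Nj a (Suc j))) x - D (S a (Nj a j)) x) \<le> (1/2)^j"
    using S_diff_norm[OF Nj_mono, of a j] by linarith+
qed

lemma S_convergent: "convergent (\<lambda>N. S a N x)"
proof (rule Cauchy_convergent, rule CauchyI)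
  fix \<epsilon> :: real assume "\<epsilon> > 0"
  then have "(\<epsilon> / 4)\<^sup>2 > 0" by simp
  from order_tendstoD(2)[OF tail_tendsto this] obtain N where N: "tail N < (\<epsilon>/4)\<^sup>2"
    unfolding eventually_sequentially by blast
  have *: "cmod (S a M x - S a N x) \<le> 2 * (\<epsilon> / 4)" if M: "M \<ge> N" for M
  proof (rule HH_sup_bound'[OF HH_diff[OF HH_tf[OF S_tf] HH_tf[OF S_tf]]])
    have "sqrt (\<Sum>k\<in>{N..<M}. (cmod (a k))\<^sup>2) \<le> sqrt ((\<epsilon>/4)\<^sup>2)"
      using tail_ge[OF M] N by (intro real_sqrt_le_mono) linarith
    also have "\<dots> = \<epsilon> / 4" using \<open>\<epsilon> > 0\<close> by simp
    finally have s: "sqrt (\<Sum>k\<in>{N..<M}. (cmod (a k))\<^sup>2) \<le> \<epsilon> / 4" .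
    show "N2 (\<lambda>x. S a M x - S a N x) \<le> \<epsilon> / 4" "N2 (\<lambda>x. D (S a M) x - D (S a N) x) \<le> \<epsilon> / 4"
      using S_diff_norm[OF M, of a] s by linarith+
  qed
  obtain N' where N': "N \<le> N'" "tail N' < (\<epsilon>/8)\<^sup>2"
  proof -
    have "(\<epsilon> / 8)\<^sup>2 > 0" using \<open>\<epsilon> > 0\<close> by simp
    from eventually_conj[OF order_tendstoD(2)[OF tail_tendsto this] eventually_ge_at_top[of N]]
    show ?thesis unfolding eventually_sequentially using that by blast
  qed
  have **: "cmod (S a M x - S a N' x) \<le> 2 * (\<epsilon> / 8)" if M: "M \<ge> N'" for M
  proof (rule HH_sup_bound'[OF HH_diff[OF HH_tf[OF S_tf] HH_tf[OF S_tf]]])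
    have "sqrt (\<Sum>k\<in>{N'..<M}. (cmod (a k))\<^sup>2) \<le> sqrt ((\<epsilon>/8)\<^sup>2)"
      using tail_ge[OF M] N' by (intro real_sqrt_le_mono) linarith
    also have "\<dots> = \<epsilon> / 8" using \<open>\<epsilon> > 0\<close> by simp
    finally have s: "sqrt (\<Sum>k\<in>{N'..<M}. (cmod (a k))\<^sup>2) \<le> \<epsilon> / 8" .
    show "N2 (\<lambda>x. S a M x - S a N' x) \<le> \<epsilon> / 8" "N2 (\<lambda>x. D (S a M) x - D (S a N') x) \<le> \<epsilon> / 8"
      using S_diff_norm[OF M, of a] s by linarith+
  qed
  show "\<exists>M. \<forall>m\<ge>M. \<forall>n\<ge>M. norm (S a m x - S a n x) < \<epsilon>"
  proof (intro exI[of _ N'] allI impI)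
    fix m n assume mn: "m \<ge> N'" "n \<ge> N'"
    have "S a m x - S a n x = (S a m x - S a N' x) - (S a n x - S a N' x)" by simp
    then have "norm (S a m x - S a n x) \<le> cmod (S a m x - S a N' x) + cmod (S a n x - S a N' x)"
      by (simp only: norm_triangle_ineq4)
    then show "norm (S a m x - S a n x) < \<epsilon>" using **[OF mn(1)] **[OF mn(2)] \<open>\<epsilon> > 0\<close> by simp
  qed
qed

text \<open>Every block beyond \<open>Nj a i\<close> is dominated by the tail there, so convergence
  along the cut-offs extends to all partial sums.\<close>

lemma N2_extend:
  assumes s: "\<And>N. sq lborel (s N)" and h: "sq lborel h"
    and diff: "\<And>N M. N \<le> M \<Longrightarrow> N2 (\<lambda>x. s M x - s N x) \<le> sqrt (\<Sum>k\<in>{N..<M}. (cmod (a k))\<^sup>2)"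
    and j: "\<And>j. N2 (\<lambda>x. s (Nj a j) x - h x) \<le> 2 * (1/2)^j"
  shows "(\<lambda>N. N2 (\<lambda>x. s N x - h x)) \<longlonglongrightarrow> 0"
proof (rule LIMSEQ_I)
  fix \<epsilon> :: real assume "\<epsilon> > 0"
  obtain i where i: "(1/2 :: real)^i < \<epsilon> / 4"
    using real_arch_pow_inv[of "\<epsilon> / 4" "1/2"] \<open>\<epsilon> > 0\<close> by auto
  show "\<exists>no. \<forall>n\<ge>no. norm (N2 (\<lambda>x. s n x - h x) - 0) < \<epsilon>"
  proof (intro exI[of _ "Nj a i"] allI impI)
    fix n assume n: "n \<ge> Nj a i"
    have "(\<Sum>k\<in>{Nj a i..<n}. (cmod (a k))\<^sup>2) \<le> (1/4)^i"
      using tail_ge[OF n] Nj_tail[of i] by linarith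
    then have "sqrt (\<Sum>k\<in>{Nj a i..<n}. (cmod (a k))\<^sup>2) \<le> (1/2)^i"
      unfolding sqrt_quarter[symmetric] by (rule real_sqrt_le_mono)
    then have "N2 (\<lambda>x. s n x - s (Nj a i) x) \<le> (1/2)^i" using diff[OF n] by linarith
    then have "N2 (\<lambda>x. s n x - h x) \<le> (1/2)^i + 2 * (1/2)^i"
      using nr_triangle_diff[OF s s h, of n "Nj a i"] j[of i] by linarith
    then show "norm (N2 (\<lambda>x. s n x - h x) - 0) < \<epsilon>" using i \<open>\<epsilon> > 0\<close> by simp
  qed
qed

text \<open>The partial sums converge at every point by the sup bound, so the plain limit serves for
  the function. For the derivatives only L2 convergence is at hand, and the limit is taken along the
  cut-offs, where it exists almost everywhere.\<close>

lemma rep_lim_Gn: "rep a (\<lambda>x. lim (\<lambda>N. S a N x)) (Gn a)"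
proof -
  define f0 where "f0 x = lim (\<lambda>j. S a (Nj a j) x)" for x
  define f where "f x = lim (\<lambda>N. S a N x)" for x
  have Gn: "Gn a = (\<lambda>x. lim (\<lambda>j. D (S a (Nj a j)) x))"
    by (simp add: Gn_def[abs_def] D_S)
  have lim: "(\<lambda>N. S a N x) \<longlonglongrightarrow> f x" for x
    using S_convergent[of x] unfolding f_def by (simp add: convergent_LIMSEQ_iff)
  have f0: "sq lborel f0" "\<And>j. N2 (\<lambda>x. S a (Nj a j) x - f0 x) \<le> 2 * (1/2)^j"
    unfolding f0_def[abs_def]
    by (rule fast_Cauchy_lim(2,3)[where s="\<lambda>j. S a (Nj a j)", OF tf_sq[OF S_tf] Nj_fast(1)])+
  have g: "sq lborel (Gn a)" "\<And>j. N2 (\<lambda>x. D (S a (Nj a j)) x - Gn a x) \<le> 2 * (1/2)^j"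
    unfolding Gn
    by (rule fast_Cauchy_lim(2,3)[where s="\<lambda>j. D (S a (Nj a j))", OF tf_D_sq[OF S_tf] Nj_fast(2)])+
  have c0: "(\<lambda>N. N2 (\<lambda>x. S a N x - f0 x)) \<longlonglongrightarrow> 0"
    by (rule N2_extend[OF tf_sq[OF S_tf] f0(1) S_diff_norm(1) f0(2)])
  have cg: "(\<lambda>N. N2 (\<lambda>x. D (S a N) x - Gn a x)) \<longlonglongrightarrow> 0"
    by (rule N2_extend[OF tf_D_sq[OF S_tf] g(1) S_diff_norm(2) g(2)])
  have [measurable]: "S a N \<in> borel_measurable borel" for N using tf_measurable[OF S_tf] .
  have fm: "f \<in> borel_measurable lborel"
    using borel_measurable_LIMSEQ_metric[of "S a" lborel f] lim by simp
  have eq: "AE x in lborel. f0 x = f x"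
    by (rule nr_limit_unique[OF tf_sq[OF S_tf] f0(1) c0 fm]) (simp add: lim)
  have fs: "sq lborel f"
    by (rule sq_bound[OF f0(1) fm, of 1]) (use eq in auto)
  have "N2 (\<lambda>x. S a N x - f0 x) = N2 (\<lambda>x. S a N x - f x)" for N
    by (rule nr_cong_AE) (use fm eq tf_sq[OF S_tf] f0(1) in auto)
  then have "rep a f (Gn a)"
    unfolding rep_def using fs g(1) c0 cg lim by simp
  then show ?thesis unfolding f_def[abs_def] .
qed

end

section \<open>Bessel inequalities and consequences of weak convergence\<close>

lemma Bessel_ip:
  assumes h: "sq lborel h"
  shows "(\<Sum>k<N. (cmod (ip lborel (e k) h))\<^sup>2) \<le> (N2 h)\<^sup>2" "(\<Sum>k<N. (cmod (ip lborel (D (e k)) h))\<^sup>2) \<le> (N2 h)\<^sup>2"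
proof -
  show "(\<Sum>k<N. (cmod (ip lborel (e k) h))\<^sup>2) \<le> (N2 h)\<^sup>2"
    unfolding e_def
  proof (rule H.gs_Bessel[OF d_test, where l="\<lambda>f. ip lborel f h"])
    fix f assume f: "f \<in> TF"
    have "cmod (ip lborel f h) \<le> N2 f * N2 h" by (rule ip_Cauchy_Schwarz[OF tf_sq[OF f] h])
    also have "\<dots> \<le> sqrt (Re (hip f f)) * N2 h" by (intro mult_right_mono N2_le_hip) simp
    finally show "cmod (ip lborel f h) \<le> N2 h * sqrt (Re (hip f f))" by (simp add: mult.commute)
  qed (auto simp: ip_add_left ip_cmult_left tf_sq h)
  show "(\<Sum>k<N. (cmod (ip lborel (D (e k)) h))\<^sup>2) \<le> (N2 h)\<^sup>2"
    unfolding e_def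
  proof (rule H.gs_Bessel[OF d_test, where l="\<lambda>f. ip lborel (D f) h"])
    fix f assume f: "f \<in> TF"
    have "cmod (ip lborel (D f) h) \<le> N2 (D f) * N2 h" by (rule ip_Cauchy_Schwarz[OF tf_D_sq[OF f] h])
    also have "\<dots> \<le> sqrt (Re (hip f f)) * N2 h" by (intro mult_right_mono N2_le_hip) simp
    finally show "cmod (ip lborel (D f) h) \<le> N2 h * sqrt (Re (hip f f))" by (simp add: mult.commute)
  qed (auto simp: D_add_fun D_cmult_fun ip_add_left ip_cmult_left tf_D_sq h)
qed

text \<open>Point evaluation is a functional on H1 of norm at most 2, uniformly in x. This is what
  makes weak convergence pointwise.\<close>

lemma Bessel_eval: "(\<Sum>k<N. (cmod (e k x))\<^sup>2) \<le> 2\<^sup>2"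
  unfolding e_def
proof (rule H.gs_Bessel[OF d_test, where l="\<lambda>f. f x"])
  fix f assume "f \<in> TF"
  then show "cmod (f x) \<le> 2 * sqrt (Re (hip f f))"
    by (intro HH_sup_bound'[OF HH_tf] N2_le_hip)
qed auto

lemma rep_sums:
  assumes "rep a f g" "sq lborel h"
  shows "(\<lambda>k. a k * ip lborel (e k) h) sums ip lborel f h" "(\<lambda>k. a k * ip lborel (D (e k)) h) sums ip lborel g h"
    "(\<lambda>k. a k * e k x) sums f x"
proof -
  have r: "sq lborel f" "sq lborel g" "(\<lambda>N. N2 (\<lambda>x. S a N x - f x)) \<longlonglongrightarrow> 0"
     "(\<lambda>N. N2 (\<lambda>x. D (S a N) x - g x)) \<longlonglongrightarrow> 0" "\<And>x. (\<lambda>N. S a N x) \<longlonglongrightarrow> f x"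
    using assms(1) by (auto simp: rep_def)
  have "ip lborel (S a N) h = (\<Sum>k<N. a k * ip lborel (e k) h)" for N
    by (subst ip_sum_left) (auto simp: ip_cmult_left intro: tf_sq[OF e_tf] assms(2))
  then show "(\<lambda>k. a k * ip lborel (e k) h) sums ip lborel f h"
    unfolding sums_def using tendsto_ip_left[OF tf_sq[OF S_tf] r(1) assms(2) r(3)] by simp
  have "ip lborel (D (S a N)) h = (\<Sum>k<N. a k * ip lborel (D (e k)) h)" for N
    unfolding D_S by (subst ip_sum_left) (auto simp: ip_cmult_left intro: tf_D_sq[OF e_tf] assms(2))
  then show "(\<lambda>k. a k * ip lborel (D (e k)) h) sums ip lborel g h"
    unfolding sums_def using tendsto_ip_left[OF tf_D_sq[OF S_tf] r(2) assms(2) r(4)] by simp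
  show "(\<lambda>k. a k * e k x) sums f x" unfolding sums_def by (rule r(5))
qed

context
  fixes a :: "nat \<Rightarrow> nat \<Rightarrow> complex" and f g a' f' g' C
  assumes rep: "\<And>n. rep (a n) (f n) (g n)" and rep': "rep a' f' g'"
    and bd: "\<And>n N. (\<Sum>k<N. (cmod (a n k))\<^sup>2) \<le> C\<^sup>2" and C: "0 \<le> C"
    and lim: "\<And>k. (\<lambda>n. a n k) \<longlonglongrightarrow> a' k"
begin

lemma weak_pointwise: "(\<lambda>n. f n x) \<longlonglongrightarrow> f' x"
  using weak_convergence[OF bd Bessel_eval lim C] sums_unique[OF rep_sums(3)[OF rep sq_zero]]
    sums_unique[OF rep_sums(3)[OF rep' sq_zero]] by simp

lemma weak_ip: "sq lborel h \<Longrightarrow> (\<lambda>n. ip lborel (f n) h) \<longlonglongrightarrow> ip lborel f' h"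
  using weak_convergence[OF bd Bessel_ip(1) lim C, of h] sums_unique[OF rep_sums(1)[OF rep, of h]]
    sums_unique[OF rep_sums(1)[OF rep', of h]] by simp

lemma weak_ip_deriv: "sq lborel h \<Longrightarrow> (\<lambda>n. ip lborel (g n) h) \<longlonglongrightarrow> ip lborel g' h"
  using weak_convergence[OF bd Bessel_ip(2) lim C, of h] sums_unique[OF rep_sums(2)[OF rep, of h]]
    sums_unique[OF rep_sums(2)[OF rep', of h]] by simp

lemma weak_bd': "(\<Sum>k<N. (cmod (a' k))\<^sup>2) \<le> C\<^sup>2"
  by (rule weak_limit_square_bound[OF bd lim])

text \<open>Dominated convergence: \<open>pw\<close> is continuous, the values converge pointwise
  and are bounded by 2 C, and h provides the integrable majorant even on an unbounded
  domain.\<close>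

lemma weak_pw_norm:
  assumes h: "sq lborel h" and \<sigma>: "0 < \<sigma>"
  shows "(\<lambda>n. N2 (\<lambda>x. (pw \<sigma> (f n x) - pw \<sigma> (f' x)) * h x)) \<longlonglongrightarrow> 0"
proof -
  define B where "B = 2 * (2 * C) powr (2 * \<sigma>)"
  have [measurable]: "f n \<in> borel_measurable borel" "f' \<in> borel_measurable borel" "h \<in> borel_measurable borel" for n
    using HH_measurable[OF rep_HH[OF rep]] HH_measurable[OF rep_HH[OF rep']] sq_measurable[OF h] by auto
  have bb: "cmod (pw \<sigma> (f n x) - pw \<sigma> (f' x)) \<le> B" for n x
    using norm_triangle_ineq4[of "pw \<sigma> (f n x)" "pw \<sigma> (f' x)"]
      norm_pw_le[OF \<sigma> rep_norm(3)[OF rep bd C, of n x]] norm_pw_le[OF \<sigma> rep_norm(3)[OF rep' weak_bd' C, of x]]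
    by (simp add: B_def)
  have "(\<lambda>n. \<integral>x. (cmod ((pw \<sigma> (f n x) - pw \<sigma> (f' x)) * h x))\<^sup>2 \<partial>lborel) \<longlonglongrightarrow> integral\<^sup>L lborel (\<lambda>x::real. 0)"
  proof (rule integral_dominated_convergence[where f="\<lambda>x. 0" and
        s="\<lambda>n x. (cmod ((pw \<sigma> (f n x) - pw \<sigma> (f' x)) * h x))\<^sup>2" and w="\<lambda>x. B\<^sup>2 * (cmod (h x))\<^sup>2"])
    show "integrable lborel (\<lambda>x. B\<^sup>2 * (cmod (h x))\<^sup>2)" using sq_integrable[OF h] by simp
    show "AE x in lborel. (\<lambda>n. (cmod ((pw \<sigma> (f n x) - pw \<sigma> (f' x)) * h x))\<^sup>2) \<longlonglongrightarrow> 0"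
    proof (rule AE_I2)
      fix x
      have "(\<lambda>n. (cmod ((pw \<sigma> (f n x) - pw \<sigma> (f' x)) * h x))\<^sup>2) \<longlonglongrightarrow> (cmod ((pw \<sigma> (f' x) - pw \<sigma> (f' x)) * h x))\<^sup>2"
        by (intro tendsto_intros tendsto_pw \<sigma> weak_pointwise)
      then show "(\<lambda>n. (cmod ((pw \<sigma> (f n x) - pw \<sigma> (f' x)) * h x))\<^sup>2) \<longlonglongrightarrow> 0" by simp
    qed
    show "AE x in lborel. norm ((cmod ((pw \<sigma> (f n x) - pw \<sigma> (f' x)) * h x))\<^sup>2) \<le> B\<^sup>2 * (cmod (h x))\<^sup>2" for n
      using bb by (intro AE_I2) (auto simp: norm_mult power_mult_distrib intro!: mult_right_mono power_mono)
  qed measurable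
  then show ?thesis unfolding nr_def using tendsto_real_sqrt[of _ 0] by fastforce
qed

text \<open>The real factor \<open>pw\<close> is moved onto h, where it converges strongly, while
  \<open>g n\<close> converges weakly with bounded norms; such a pairing passes to the
  limit.\<close>

lemma weak_nonlinear:
  assumes h: "sq lborel h" and \<sigma>: "0 < \<sigma>"
  shows "(\<lambda>n. ip lborel (\<lambda>x. pw \<sigma> (f n x) * g n x) h) \<longlonglongrightarrow> ip lborel (\<lambda>x. pw \<sigma> (f' x) * g' x) h"
proof -
  have [measurable]: "f n \<in> borel_measurable borel" "f' \<in> borel_measurable borel" "h \<in> borel_measurable borel" for n
    using HH_measurable[OF rep_HH[OF rep]] HH_measurable[OF rep_HH[OF rep']] sq_measurable[OF h] by auto
  have sh: "sq lborel (\<lambda>x. pw \<sigma> (F x) * h x)" if "\<And>x. cmod (F x) \<le> 2 * C" "F \<in> borel_measurable borel" for F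
    by (rule sq_bound[OF h, of _ "(2 * C) powr (2 * \<sigma>)"])
       (use that in \<open>auto simp: norm_mult intro!: mult_right_mono norm_pw_le \<sigma>\<close>)
  have sn: "sq lborel (\<lambda>x. pw \<sigma> (f n x) * h x)" for n by (intro sh rep_norm(3)[OF rep bd C]) simp
  have s': "sq lborel (\<lambda>x. pw \<sigma> (f' x) * h x)" by (intro sh rep_norm(3)[OF rep' weak_bd' C]) simp
  have gs: "sq lborel (g n)" "sq lborel g'" for n using HH_sq rep_HH rep rep' by blast+
  have move: "ip lborel (\<lambda>x. pw \<sigma> (F x) * G x) h = ip lborel G (\<lambda>x. pw \<sigma> (F x) * h x)" for F G
    unfolding ip_def by (intro Bochner_Integration.integral_cong) (auto simp: mult_ac)
  have split: "ip lborel (g n) (\<lambda>x. pw \<sigma> (f n x) * h x)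
      = ip lborel (g n) (\<lambda>x. (pw \<sigma> (f n x) - pw \<sigma> (f' x)) * h x) + ip lborel (g n) (\<lambda>x. pw \<sigma> (f' x) * h x)" for n
    using ip_diff_right[OF sn s' gs(1), of n n] by (simp add: left_diff_distrib)
  have "(\<lambda>n. ip lborel (g n) (\<lambda>x. (pw \<sigma> (f n x) - pw \<sigma> (f' x)) * h x)) \<longlonglongrightarrow> 0"
  proof (rule tendsto_norm_zero_cancel, rule real_tendsto_0I)
    fix n
    have "sq lborel (\<lambda>x. (pw \<sigma> (f n x) - pw \<sigma> (f' x)) * h x)"
      unfolding left_diff_distrib by (rule sq_diff[OF sn s'])
    then have "norm (ip lborel (g n) (\<lambda>x. (pw \<sigma> (f n x) - pw \<sigma> (f' x)) * h x))
      \<le> N2 (g n) * N2 (\<lambda>x. (pw \<sigma> (f n x) - pw \<sigma> (f' x)) * h x)"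
      by (rule ip_Cauchy_Schwarz[OF gs(1)])
    also have "\<dots> \<le> C * N2 (\<lambda>x. (pw \<sigma> (f n x) - pw \<sigma> (f' x)) * h x)"
      by (intro mult_right_mono rep_norm(2)[OF rep bd C]) simp
    finally show "norm (ip lborel (g n) (\<lambda>x. (pw \<sigma> (f n x) - pw \<sigma> (f' x)) * h x))
      \<le> C * N2 (\<lambda>x. (pw \<sigma> (f n x) - pw \<sigma> (f' x)) * h x)" .
  qed (use tendsto_mult_right_zero[OF weak_pw_norm[OF h \<sigma>]] in auto)
  from tendsto_add[OF this weak_ip_deriv[OF s']] show ?thesis unfolding move split by simp
qed

end

end

section \<open>Peano's theorem\<close>

text \<open>A diagonal subsequence converges at rational times, and equicontinuity extends this to
  all times. Equicontinuity is asked only for large n, because Euler step functions have jumps of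
  size up to B / (n+1).\<close>

lemma diagonal_equicontinuous:
  fixes Y :: "nat \<Rightarrow> real \<Rightarrow> nat \<Rightarrow> complex"
  assumes bd: "\<And>n t k. cmod (Y n t k) \<le> B t k"
    and eq: "\<And>t k \<epsilon>. 0 < \<epsilon> \<Longrightarrow> \<exists>\<delta>>0. \<forall>s. \<bar>t - s\<bar> < \<delta> \<longrightarrow> (\<forall>\<^sub>F n in sequentially. cmod (Y n t k - Y n s k) \<le> \<epsilon>)"
  shows "\<exists>r y. strict_mono r \<and> (\<forall>t k. (\<lambda>n. Y (r n) t k) \<longlonglongrightarrow> y t k)"
proof -
  \<comment> \<open>Normalization to the unit disc, since the subsequence lemma wants one bound for
    all indices.\<close>
  define Z where "Z n p = Y n (fst p) (snd p) / of_real (1 + \<bar>B (fst p) (snd p)\<bar>)" for n p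
  have Zb: "norm (Z n p) \<le> 1" for n p
  proof -
    have "cmod (Y n (fst p) (snd p)) \<le> 1 + \<bar>B (fst p) (snd p)\<bar>"
      using bd[of n "fst p" "snd p"] by linarith
    moreover have "norm (Z n p) = cmod (Y n (fst p) (snd p)) / (1 + \<bar>B (fst p) (snd p)\<bar>)"
      unfolding Z_def norm_divide norm_of_real by simp
    ultimately show ?thesis by (simp add: divide_le_eq)
  qed
  have "countable (\<rat> \<times> (UNIV :: nat set))" by (intro countable_SIGMA countable_rat) auto
  then obtain r :: "nat \<Rightarrow> nat" where r: "strict_mono r"
    and rl: "\<And>p. p \<in> \<rat> \<times> UNIV \<Longrightarrow> \<exists>l. (\<lambda>n. Z (r n) p) \<longlonglongrightarrow> l"
    using function_convergent_subsequence[of "\<rat> \<times> UNIV" Z 1] Zb by blast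
  have conv: "convergent (\<lambda>n. Y (r n) t k)" for t k
  proof (rule Cauchy_convergent, rule CauchyI)
    fix \<epsilon> :: real assume "\<epsilon> > 0"
    then have e4: "\<epsilon> / 4 > 0" by simp
    obtain \<delta> where \<delta>: "\<delta> > 0" "\<forall>s. \<bar>t - s\<bar> < \<delta> \<longrightarrow> (\<forall>\<^sub>F n in sequentially. cmod (Y n t k - Y n s k) \<le> \<epsilon> / 4)"
      using eq[OF e4] by blast
    obtain q where q: "q \<in> \<rat>" "t < q" "q < t + \<delta>" using Rats_dense_in_real[of t "t + \<delta>"] \<delta>(1) by auto
    then have "\<bar>t - q\<bar> < \<delta>" by simp
    with \<delta>(2) have "\<forall>\<^sub>F n in sequentially. cmod (Y n t k - Y n q k) \<le> \<epsilon> / 4" by blast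
    then have ev: "\<forall>\<^sub>F n in sequentially. cmod (Y (r n) t k - Y (r n) q k) \<le> \<epsilon> / 4"
      by (rule eventually_subseq[OF r])
    obtain l where "(\<lambda>n. Z (r n) (q, k)) \<longlonglongrightarrow> l" using rl[of "(q, k)"] q(1) by auto
    then have "(\<lambda>n. Z (r n) (q, k) * of_real (1 + \<bar>B q k\<bar>)) \<longlonglongrightarrow> l * of_real (1 + \<bar>B q k\<bar>)"
      by (intro tendsto_intros)
    moreover have "Z n (q, k) * of_real (1 + \<bar>B q k\<bar>) = Y n q k" for n
    proof -
      have "complex_of_real (1 + \<bar>B q k\<bar>) \<noteq> 0" by (simp only: of_real_eq_0_iff)
      then show ?thesis unfolding Z_def fst_conv snd_conv by simp
    qed
    ultimately have "Cauchy (\<lambda>n. Y (r n) q k)" by (auto intro: LIMSEQ_imp_Cauchy)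
    then obtain M where M: "\<And>m n. m \<ge> M \<Longrightarrow> n \<ge> M \<Longrightarrow> cmod (Y (r m) q k - Y (r n) q k) < \<epsilon> / 4"
      using CauchyD[OF _ e4] by blast
    obtain M' where M': "\<And>n. n \<ge> M' \<Longrightarrow> cmod (Y (r n) t k - Y (r n) q k) \<le> \<epsilon> / 4"
      using ev unfolding eventually_sequentially by blast
    show "\<exists>M. \<forall>m\<ge>M. \<forall>n\<ge>M. norm (Y (r m) t k - Y (r n) t k) < \<epsilon>"
    proof (intro exI[of _ "max M M'"] allI impI)
      fix m n assume mn: "m \<ge> max M M'" "n \<ge> max M M'"
      have "Y (r m) t k - Y (r n) t k = (Y (r m) t k - Y (r m) q k) + (Y (r m) q k - Y (r n) q k) - (Y (r n) t k - Y (r n) q k)"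
        by simp
      then have "norm (Y (r m) t k - Y (r n) t k) \<le> cmod (Y (r m) t k - Y (r m) q k) + cmod (Y (r m) q k - Y (r n) q k) + cmod (Y (r n) t k - Y (r n) q k)"
        by (simp only:) (rule order_trans[OF norm_triangle_ineq4 add_right_mono[OF norm_triangle_ineq]])
      then show "norm (Y (r m) t k - Y (r n) t k) < \<epsilon>"
        using M[of m n] M'[of m] M'[of n] mn \<open>\<epsilon> > 0\<close> by simp
    qed
  qed
  then have "(\<lambda>n. Y (r n) t k) \<longlonglongrightarrow> lim (\<lambda>n. Y (r n) t k)" for t k by (simp add: convergent_LIMSEQ_iff)
  then show ?thesis using r by (intro exI[of _ r] exI[of _ "\<lambda>t k. lim (\<lambda>n. Y (r n) t k)"]) auto
qed

context
  fixes f :: "(nat \<Rightarrow> complex) \<Rightarrow> nat \<Rightarrow> complex" and init :: "nat \<Rightarrow> complex" and B :: real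
  assumes bd: "\<And>c k. cmod (f c k) \<le> B"
    and cont_all: "\<forall>c x k. (\<forall>j. (\<lambda>m. c m j) \<longlonglongrightarrow> x j) \<longrightarrow> (\<lambda>m. f (c m) k) \<longlonglongrightarrow> f x k"
begin

primrec euler :: "nat \<Rightarrow> nat \<Rightarrow> nat \<Rightarrow> complex" where
  "euler m 0 = init"
| "euler m (Suc j) = (\<lambda>k. euler m j k + f (euler m j) k / of_nat (Suc m))"

text \<open>Euler's method with step width 1 / (m+1), read as a step function. The conversion
  \<open>nat\<close> sends negative times to index 0, so the function equals the initial value
  there.\<close>

definition step :: "nat \<Rightarrow> real \<Rightarrow> nat \<Rightarrow> complex" where
  "step m t = euler m (nat \<lfloor>t * Suc m\<rfloor>)"

lemma cont: "(\<And>j. (\<lambda>m. c m j) \<longlonglongrightarrow> x j) \<Longrightarrow> (\<lambda>m. f (c m) k) \<longlonglongrightarrow> f x k"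
  using cont_all by blast

lemma B_nonneg: "0 \<le> B"
  using bd[of init 0] norm_ge_zero order_trans by blast

lemma euler_lipschitz: "i \<le> j \<Longrightarrow> cmod (euler m j k - euler m i k) \<le> B * (real j - real i) / Suc m"
proof (induction j rule: dec_induct)
  case (step j)
  have "euler m (Suc j) k - euler m i k = (euler m j k - euler m i k) + f (euler m j) k / of_nat (Suc m)" by simp
  then have "cmod (euler m (Suc j) k - euler m i k) \<le> cmod (euler m j k - euler m i k) + cmod (f (euler m j) k / of_nat (Suc m))"
    by (simp only: norm_triangle_ineq)
  also have "cmod (f (euler m j) k / of_nat (Suc m)) \<le> B / Suc m"
    unfolding norm_divide norm_of_nat by (intro divide_right_mono bd) simp
  finally have "cmod (euler m (Suc j) k - euler m i k) \<le> B * (real j - real i) / Suc m + B / Suc m"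
    using step.IH by linarith
  also have "\<dots> = B * (real (Suc j) - real i) / Suc m" by (simp add: add_divide_distrib[symmetric] algebra_simps)
  finally show ?case .
qed simp

lemma step_lipschitz: "cmod (step m t k - step m s k) \<le> B * \<bar>t - s\<bar> + B / Suc m"
proof -
  have *: "cmod (step m t k - step m s k) \<le> B * (t - s) + B / Suc m" if "s \<le> t" for s t
  proof -
    define i where "i = nat \<lfloor>s * Suc m\<rfloor>"
    define j where "j = nat \<lfloor>t * Suc m\<rfloor>"
    have "s * Suc m \<le> t * Suc m" using that by (intro mult_right_mono) auto
    then have "i \<le> j" unfolding i_def j_def by (intro nat_mono floor_mono)
    \<comment> \<open>Rounding both times down loses at most one step; this is the term B /
      (m+1).\<close>
    have "real j - real i \<le> t * Suc m - s * Suc m + 1"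
    proof (cases "t * Suc m \<ge> 0")
      case True
      then have "real j \<le> t * Suc m" unfolding j_def by linarith
      moreover have "real i \<ge> s * Suc m - 1" unfolding i_def by linarith
      ultimately show ?thesis by linarith
    next
      case False
      then have "j = 0" unfolding j_def by simp
      then show ?thesis using \<open>s * Suc m \<le> t * Suc m\<close> by linarith
    qed
    then have "B * (real j - real i) \<le> B * ((t - s) * Suc m + 1)"
      by (intro mult_left_mono B_nonneg) (simp add: algebra_simps)
    then have "B * (real j - real i) / Suc m \<le> B * ((t - s) * Suc m + 1) / Suc m"
      by (intro divide_right_mono) auto
    also have "\<dots> = B * (t - s) + B / Suc m" by (simp add: field_simps)
    finally show ?thesis
      using euler_lipschitz[OF \<open>i \<le> j\<close>, of m k] unfolding step_def i_def j_def by linarith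
  qed
  show ?thesis
  proof (cases "s \<le> t")
    case True then show ?thesis using *[of s t] by simp
  next
    case False
    then show ?thesis using *[of t s] by (simp add: norm_minus_commute)
  qed
qed

text \<open>On each mesh interval the step function is constant except at the right end point, so at
  mesh points the Euler sum is exactly an integral.\<close>

lemma euler_integral: "((\<lambda>s. f (step m s) k) has_integral (euler m j k - init k)) {0..real j / Suc m}"
proof (induction j)
  case (Suc j)
  have "((\<lambda>s. f (step m s) k) has_integral (f (euler m j) k / of_nat (Suc m))) {real j / Suc m..real (Suc j) / Suc m}"
  proof (rule has_integral_spike_finite[of "{real (Suc j) / Suc m}"])
    have "((\<lambda>s. f (euler m j) k) has_integral (real (Suc j) / Suc m - real j / Suc m) *\<^sub>R f (euler m j) k) {real j / Suc m..real (Suc j) / Suc m}"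
      by (rule has_integral_const_real[THEN has_integral_eq_rhs]) (simp add: divide_right_mono)
    moreover have "(real (Suc j) / Suc m - real j / Suc m) *\<^sub>R f (euler m j) k = f (euler m j) k / of_nat (Suc m)"
      by (simp add: diff_divide_distrib[symmetric] scaleR_conv_of_real)
    ultimately show "((\<lambda>s. f (euler m j) k) has_integral (f (euler m j) k / of_nat (Suc m))) {real j / Suc m..real (Suc j) / Suc m}"
      by simp
    fix s assume "s \<in> {real j / Suc m..real (Suc j) / Suc m} - {real (Suc j) / Suc m}"
    then have "real j \<le> s * Suc m" "s * Suc m < real (Suc j)" by (auto simp: field_simps)
    then have "nat \<lfloor>s * Suc m\<rfloor> = j" by (simp add: floor_eq_iff nat_eq_iff)
    then show "f (step m s) k = f (euler m j) k" by (simp add: step_def)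
  qed simp
  from has_integral_combine[OF _ _ Suc this]
  have "((\<lambda>s. f (step m s) k) has_integral (euler m j k - init k + f (euler m j) k / of_nat (Suc m))) {0..real (Suc j) / Suc m}"
    by (simp add: divide_right_mono)
  moreover have "euler m j k - init k + f (euler m j) k / of_nat (Suc m) = euler m (Suc j) k - init k" by simp
  ultimately show ?case by (simp only:)
qed (simp add: has_integral_refl)

lemma step_integral:
  assumes "0 \<le> t"
  shows "(\<lambda>s. f (step m s) k) integrable_on {0..t}"
    "cmod (step m t k - init k - integral {0..t} (\<lambda>s. f (step m s) k)) \<le> B / Suc m"
proof -
  define j where "j = nat \<lfloor>t * Suc m\<rfloor>"
  have j: "real j \<le> t * Suc m" "t * Suc m \<le> real (Suc j)" using assms unfolding j_def by auto linarith+
  then have j': "real j / Suc m \<le> t" "t \<le> real (Suc j) / Suc m" by (auto simp: field_simps)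
  show int: "(\<lambda>s. f (step m s) k) integrable_on {0..t}"
    by (rule integrable_subinterval_real[OF has_integral_integrable[OF euler_integral[of m k "Suc j"]]]) (use j' in auto)
  have int2: "(\<lambda>s. f (step m s) k) integrable_on {real j / Suc m..t}"
    by (rule integrable_subinterval_real[OF int]) auto
  have alg: "s - x - t = - j" if "i + j = t" "i = s - x" for i j t s x :: complex
    using that by (auto simp: algebra_simps)
  have "integral {0..real j / Suc m} (\<lambda>s. f (step m s) k) + integral {real j / Suc m..t} (\<lambda>s. f (step m s) k)
      = integral {0..t} (\<lambda>s. f (step m s) k)"
    by (rule Henstock_Kurzweil_Integration.integral_combine) (use j' int in auto)
  moreover have "integral {0..real j / Suc m} (\<lambda>s. f (step m s) k) = step m t k - init k"
    using integral_unique[OF euler_integral[of m k j]] by (simp add: step_def j_def)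
  ultimately have eq: "step m t k - init k - integral {0..t} (\<lambda>s. f (step m s) k) = - integral {real j / Suc m..t} (\<lambda>s. f (step m s) k)"
    by (rule alg)
  have "cmod (integral {real j / Suc m..t} (\<lambda>s. f (step m s) k)) \<le> B * (t - real j / Suc m)"
    using has_integral_bound_real[of B "{}", OF B_nonneg _ integrable_integral[OF int2]] j' bd by simp
  moreover have "B * (t - real j / Suc m) \<le> B * (1 / Suc m)"
    using j' by (intro mult_left_mono B_nonneg) (simp add: add_divide_distrib)
  ultimately show "cmod (step m t k - init k - integral {0..t} (\<lambda>s. f (step m s) k)) \<le> B / Suc m"
    unfolding eq norm_minus_cancel by (simp add: algebra_simps)
qed

text \<open>The step functions satisfy the integral equation up to B / (m+1), and dominated
  convergence passes to the limit along a subsequence. Freezing the solution at \<open>init\<close>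
  for negative times prepares the gluing of two half lines.\<close>

lemma peano_forward:
  "\<exists>y :: real \<Rightarrow> nat \<Rightarrow> complex. (\<forall>t\<le>0. y t = init) \<and> (\<forall>k t. isCont (\<lambda>t. y t k) t) \<and> (\<forall>k t. isCont (\<lambda>t. f (y t) k) t) \<and>
     (\<forall>k t. 0 \<le> t \<longrightarrow> ((\<lambda>s. f (y s) k) has_integral (y t k - init k)) {0..t})"
proof -
  have neg: "step m t = init" if "t \<le> 0" for m t
  proof -
    have "t * real (Suc m) \<le> 0" using that by (simp add: mult_nonpos_nonneg)
    then have "nat \<lfloor>t * real (Suc m)\<rfloor> = 0" by linarith
    then show ?thesis by (simp add: step_def)
  qed
  have inv: "(\<lambda>m. B / real (Suc m)) \<longlonglongrightarrow> 0"
    using tendsto_mult_right_zero[OF LIMSEQ_inverse_real_of_nat, of B] by (simp add: divide_inverse)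
  have "\<exists>r y. strict_mono r \<and> (\<forall>t k. (\<lambda>n. step (r n) t k) \<longlonglongrightarrow> y t k)"
  proof (rule diagonal_equicontinuous)
    show "cmod (step n t k) \<le> cmod (init k) + (B * \<bar>t\<bar> + B)" for n t k
    proof -
      have "B / real (Suc n) \<le> B" using B_nonneg divide_left_mono[of 1 "real (Suc n)" B] by simp
      then show ?thesis
        using step_lipschitz[of n t k 0] neg[of 0 n] norm_triangle_sub[of "step n t k" "init k"] by simp
    qed
    fix t k and \<epsilon> :: real assume "\<epsilon> > 0"
    show "\<exists>\<delta>>0. \<forall>s. \<bar>t - s\<bar> < \<delta> \<longrightarrow> (\<forall>\<^sub>F n in sequentially. cmod (step n t k - step n s k) \<le> \<epsilon>)"
    proof (intro exI[of _ "\<epsilon> / (2 * (B + 1))"] conjI allI impI)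
      show "\<epsilon> / (2 * (B + 1)) > 0" using \<open>\<epsilon> > 0\<close> B_nonneg by simp
      fix s assume s: "\<bar>t - s\<bar> < \<epsilon> / (2 * (B + 1))"
      have "B * \<bar>t - s\<bar> \<le> (B + 1) * (\<epsilon> / (2 * (B + 1)))"
        using s B_nonneg by (intro mult_mono) auto
      also have "\<dots> = \<epsilon> / 2" using B_nonneg by (simp add: field_simps)
      finally have 1: "B * \<bar>t - s\<bar> \<le> \<epsilon> / 2" .
      have "\<forall>\<^sub>F n in sequentially. B / real (Suc n) < \<epsilon> / 2"
        using \<open>\<epsilon> > 0\<close> by (intro order_tendstoD(2)[OF inv]) simp
      then show "\<forall>\<^sub>F n in sequentially. cmod (step n t k - step n s k) \<le> \<epsilon>"
      proof eventually_elim
        case (elim n)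
        then show ?case using step_lipschitz[of n t k s] 1 by linarith
      qed
    qed
  qed
  then obtain r y where r: "strict_mono (r :: nat \<Rightarrow> nat)" and y: "\<And>t k. (\<lambda>n. step (r n) t k) \<longlonglongrightarrow> y t k"
    by blast
  have invr: "(\<lambda>n. B / real (Suc (r n))) \<longlonglongrightarrow> 0"
    using LIMSEQ_subseq_LIMSEQ[OF inv r] by (simp add: o_def)
  have y_neg: "y t = init" if "t \<le> 0" for t
  proof
    fix k
    have "(\<lambda>n. init k) \<longlonglongrightarrow> y t k" using y[of t k] by (simp add: neg[OF that])
    then show "y t k = init k" by (simp add: LIMSEQ_const_iff)
  qed
  have y_lip: "cmod (y t k - y s k) \<le> B * \<bar>t - s\<bar>" for t s k
  proof (rule LIMSEQ_le)
    show "(\<lambda>n. cmod (step (r n) t k - step (r n) s k)) \<longlonglongrightarrow> cmod (y t k - y s k)"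
      by (intro tendsto_intros y)
    show "(\<lambda>n. B * \<bar>t - s\<bar> + B / Suc (r n)) \<longlonglongrightarrow> B * \<bar>t - s\<bar>"
      using tendsto_add[OF tendsto_const invr, of "B * \<bar>t - s\<bar>"] by simp
  qed (use step_lipschitz in blast)
  have cy: "isCont (\<lambda>t. y t k) t" for t k
    unfolding isCont_def
  proof (rule LIM_zero_cancel, rule tendsto_norm_zero_cancel, rule tendsto_sandwich[OF _ _ tendsto_const])
    show "\<forall>\<^sub>F s in at t. cmod (y s k - y t k) \<le> B * \<bar>s - t\<bar>" using y_lip by simp
    have "((\<lambda>s. B * \<bar>s - t\<bar>) \<longlongrightarrow> B * \<bar>t - t\<bar>) (at t)" by (intro tendsto_intros)
    then show "((\<lambda>s. B * \<bar>s - t\<bar>) \<longlongrightarrow> 0) (at t)" by simp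
  qed simp
  have cf: "isCont (\<lambda>t. f (y t) k) t" for t k
    unfolding continuous_at_sequentially
  proof (intro allI impI)
    fix x assume x: "x \<longlonglongrightarrow> t"
    have "(\<lambda>m. y (x m) j) \<longlonglongrightarrow> y t j" for j using isCont_tendsto_compose[OF cy x] .
    from cont[OF this] show "((\<lambda>t. f (y t) k) \<circ> x) \<longlonglongrightarrow> f (y t) k" by (simp add: o_def)
  qed
  have int: "((\<lambda>s. f (y s) k) has_integral (y t k - init k)) {0..t}" if t: "0 \<le> t" for t k
  proof -
    have 1: "(\<lambda>s. f (y s) k) integrable_on {0..t}"
      and 2: "(\<lambda>n. integral {0..t} (\<lambda>s. f (step (r n) s) k)) \<longlonglongrightarrow> integral {0..t} (\<lambda>s. f (y s) k)"
      using dominated_convergence[of "\<lambda>n s. f (step (r n) s) k" "{0..t}" "\<lambda>_. B" "\<lambda>s. f (y s) k"]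
        step_integral(1)[OF t] bd cont y by auto
    have "(\<lambda>n. step (r n) t k - init k - integral {0..t} (\<lambda>s. f (step (r n) s) k)) \<longlonglongrightarrow> y t k - init k - integral {0..t} (\<lambda>s. f (y s) k)"
      by (intro tendsto_intros y 2)
    moreover have "(\<lambda>n. step (r n) t k - init k - integral {0..t} (\<lambda>s. f (step (r n) s) k)) \<longlonglongrightarrow> 0"
      by (rule tendsto_norm_zero_cancel, rule real_tendsto_0I[OF norm_ge_zero step_integral(2)[OF t] invr])
    ultimately have "y t k - init k - integral {0..t} (\<lambda>s. f (y s) k) = 0" by (rule LIMSEQ_unique)
    then show ?thesis using integrable_integral[OF 1] by simp
  qed
  show ?thesis
    by (rule exI[of _ y]) (simp add: y_neg cy cf int)
qed

end

text \<open>Peano rather than Picard: |z|^(2 \<sigma>) is not Lipschitz at 0 when \<sigma> < 1/2. A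
  solution for f and a time-reversed solution for -f are joined at 0.\<close>

theorem peano:
  fixes f :: "(nat \<Rightarrow> complex) \<Rightarrow> nat \<Rightarrow> complex" and init :: "nat \<Rightarrow> complex" and B :: real
  assumes bd: "\<And>c k. cmod (f c k) \<le> B"
    and cont: "\<And>c x k. (\<And>j. (\<lambda>m. c m j) \<longlonglongrightarrow> x j) \<Longrightarrow> (\<lambda>m. f (c m) k) \<longlonglongrightarrow> f x k"
  shows "\<exists>y :: real \<Rightarrow> nat \<Rightarrow> complex. y 0 = init \<and> (\<forall>k t. ((\<lambda>t. y t k) has_vector_derivative f (y t) k) (at t)) \<and>
    (\<forall>k t. isCont (\<lambda>t. f (y t) k) t)"
proof -
  have cont_all: "\<forall>c x k. (\<forall>j. (\<lambda>m. c m j) \<longlonglongrightarrow> x j) \<longrightarrow> (\<lambda>m. f (c m) k) \<longlonglongrightarrow> f x k"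
    using cont by blast
  from peano_forward[of f B init, OF bd cont_all]
  obtain y1 :: "real \<Rightarrow> nat \<Rightarrow> complex" where "(\<forall>t\<le>0. y1 t = init) \<and> (\<forall>k t. isCont (\<lambda>t. y1 t k) t) \<and> (\<forall>k t. isCont (\<lambda>t. f (y1 t) k) t) \<and>
     (\<forall>k t. 0 \<le> t \<longrightarrow> ((\<lambda>s. f (y1 s) k) has_integral (y1 t k - init k)) {0..t})" ..
  then have y1: "\<And>t. t \<le> 0 \<Longrightarrow> y1 t = init" "\<And>k t. isCont (\<lambda>t. y1 t k) t"
    "\<And>k t. 0 \<le> t \<Longrightarrow> ((\<lambda>s. f (y1 s) k) has_integral (y1 t k - init k)) {0..t}" by simp_all
  have bd': "cmod (- f c k) \<le> B" for c k using bd by simp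
  have cont': "\<forall>c x k. (\<forall>j. (\<lambda>m. c m j) \<longlonglongrightarrow> x j) \<longrightarrow> (\<lambda>m. - f (c m) k) \<longlonglongrightarrow> - f x k"
    using cont_all by (intro allI impI tendsto_minus) blast
  from peano_forward[of "\<lambda>c k. - f c k" B init, OF bd' cont']
  obtain y2 :: "real \<Rightarrow> nat \<Rightarrow> complex" where "(\<forall>t\<le>0. y2 t = init) \<and> (\<forall>k t. isCont (\<lambda>t. y2 t k) t) \<and> (\<forall>k t. isCont (\<lambda>t. - f (y2 t) k) t) \<and>
     (\<forall>k t. 0 \<le> t \<longrightarrow> ((\<lambda>s. - f (y2 s) k) has_integral (y2 t k - init k)) {0..t})" ..
  then have y2: "\<And>t. t \<le> 0 \<Longrightarrow> y2 t = init" "\<And>k t. isCont (\<lambda>t. y2 t k) t"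
    "\<And>k t. 0 \<le> t \<Longrightarrow> ((\<lambda>s. - f (y2 s) k) has_integral (y2 t k - init k)) {0..t}" by simp_all
  \<comment> \<open>On each half line one of the two solutions is frozen at \<open>init\<close> and
    cancels.\<close>
  define y where "y t k = y1 t k + y2 (- t) k - init k" for t k
  have ypos: "y t = y1 t" if "0 \<le> t" for t using y2(1)[of "-t"] that by (auto simp: y_def)
  have yneg: "y t = y2 (- t)" if "t \<le> 0" for t using y1(1)[of t] that by (auto simp: y_def)
  have cy: "isCont (\<lambda>t. y t k) t" for k t
    unfolding y_def by (intro continuous_intros y1(2) isCont_o2[OF _ y2(2)])
  have cf: "isCont (\<lambda>t. f (y t) k) t" for t k
    unfolding continuous_at_sequentially
  proof (intro allI impI)
    fix x assume x: "x \<longlonglongrightarrow> t"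
    have "(\<lambda>m. y (x m) j) \<longlonglongrightarrow> y t j" for j using isCont_tendsto_compose[OF cy x] .
    from cont[OF this] show "((\<lambda>t. f (y t) k) \<circ> x) \<longlonglongrightarrow> f (y t) k" by (simp add: o_def)
  qed
  have pos: "((\<lambda>s. f (y s) k) has_integral (y t k - init k)) {0..t}" if "0 \<le> t" for t k
    using y1(3)[OF that, of k] by (subst has_integral_cong[of _ _ "\<lambda>s. f (y1 s) k"]) (auto simp: ypos that)
  have neg: "((\<lambda>s. f (y s) k) has_integral (init k - y t k)) {t..0}" if "t \<le> 0" for t k
  proof -
    have "((\<lambda>s. f (y2 s) k) has_integral (init k - y2 (- t) k)) {0..- t}"
      using has_integral_neg[OF y2(3)[of "-t" k]] that by simp
    then have "((\<lambda>s. f (y2 (- s)) k) has_integral (init k - y2 (- t) k)) {- (- t)..- 0}"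
      by (subst has_integral_reflect_real)
    then have "((\<lambda>s. f (y2 (- s)) k) has_integral (init k - y2 (- t) k)) {t..0}" by simp
    then show ?thesis
      by (subst has_integral_cong[of _ _ "\<lambda>s. f (y2 (- s)) k"]) (auto simp: yneg that)
  qed
  \<comment> \<open>Starting the integral at -T makes t an interior point, so that the fundamental
    theorem gives a two-sided derivative, also at 0.\<close>
  have int: "((\<lambda>s. f (y s) k) has_integral (y t k - y (-T) k)) {-T..t}" if "-T \<le> t" "T \<ge> 0" for t T k
  proof (cases "0 \<le> t")
    case True
    show ?thesis using has_integral_combine[OF _ True neg[of "-T" k] pos[OF True, of k]] that by simp
  next
    case False
    have "(\<lambda>s. f (y s) k) integrable_on {-T..t}"
      by (rule integrable_subinterval_real[OF has_integral_integrable[OF neg[of "-T" k]]]) (use that False in auto)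
    then have i: "((\<lambda>s. f (y s) k) has_integral integral {-T..t} (\<lambda>s. f (y s) k)) {-T..t}" by (rule integrable_integral)
    have "((\<lambda>s. f (y s) k) has_integral (integral {-T..t} (\<lambda>s. f (y s) k) + (init k - y t k))) {-T..0}"
      by (rule has_integral_combine[OF _ _ i neg]) (use that False in auto)
    from has_integral_unique[OF this neg[of "-T" k]] that have "integral {-T..t} (\<lambda>s. f (y s) k) = y t k - y (-T) k"
      by (simp add: algebra_simps)
    then show ?thesis using i by simp
  qed
  have deriv: "((\<lambda>t. y t k) has_vector_derivative f (y t) k) (at t)" for t k
  proof -
    define T where "T = \<bar>t\<bar> + 1"
    have t: "t \<in> {-T<..<T}" "T \<ge> 0" by (auto simp: T_def)
    have "((\<lambda>u. integral {-T..u} (\<lambda>s. f (y s) k)) has_vector_derivative f (y t) k) (at t within {-T..T})"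
      by (rule integral_has_vector_derivative) (use t cf in \<open>auto intro: continuous_at_imp_continuous_on\<close>)
    then have "((\<lambda>u. integral {-T..u} (\<lambda>s. f (y s) k)) has_vector_derivative f (y t) k) (at t)"
      using t by (simp add: at_within_Icc_at)
    then have "((\<lambda>u. y (-T) k + integral {-T..u} (\<lambda>s. f (y s) k)) has_vector_derivative 0 + f (y t) k) (at t)"
      by (intro has_vector_derivative_add has_vector_derivative_const)
    then have "((\<lambda>u. y (-T) k + integral {-T..u} (\<lambda>s. f (y s) k)) has_vector_derivative f (y t) k) (at t)"
      by simp
    then show ?thesis
      by (rule has_vector_derivative_transform_within_open[where S="{-T<..<T}"])
         (use t integral_unique[OF int] in auto)
  qed
  have "y 0 = init" using y1(1)[of 0] y2(1)[of 0] by (auto simp: y_def)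
  then show ?thesis using deriv cf by blast
qed

section \<open>The nonlinearity\<close>

definition Gz :: "real \<Rightarrow> complex \<Rightarrow> complex" where
  "Gz \<sigma> z = pw \<sigma> z * cnj z"

text \<open>The real derivative of \<open>Gz\<close> at z in direction h;
  \<open>z \<bullet> h\<close> is Re (cnj z h). At z = 0 both summands vanish, which is the correct
  derivative for \<sigma> > 0.\<close>

definition DG :: "real \<Rightarrow> complex \<Rightarrow> complex \<Rightarrow> complex" where
  "DG \<sigma> z h = of_real (2 * \<sigma> * cmod z powr (2 * \<sigma> - 2) * (z \<bullet> h)) * cnj z + pw \<sigma> z * cnj h"

lemma norm_Gz: "cmod (Gz \<sigma> z) = cmod z powr (2 * \<sigma>) * cmod z"
  by (simp add: Gz_def norm_mult norm_pw)

lemma DG_zero [simp]: "DG \<sigma> 0 h = 0"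
  by (simp add: DG_def pw_def)

lemma powr_minus_two: "z \<noteq> 0 \<Longrightarrow> cmod z powr (2 * \<sigma> - 2) = cmod z powr (2 * \<sigma>) / (cmod z)\<^sup>2"
  by (simp add: powr_diff powr_numeral)

lemma DG_nonzero:
  assumes "z \<noteq> 0"
  shows "DG \<sigma> z h = pw \<sigma> z * (of_real (2 * \<sigma> * (z \<bullet> h) / (cmod z)\<^sup>2) * cnj z + cnj h)"
  unfolding DG_def powr_minus_two[OF assms] pw_def by (simp add: algebra_simps)

lemma norm_DG_le:
  assumes "0 < \<sigma>"
  shows "cmod (DG \<sigma> z h) \<le> (2 * \<sigma> + 1) * (cmod z powr (2 * \<sigma>) * cmod h)"
proof (cases "z = 0")
  case False
  have "cmod (of_real (2 * \<sigma> * (z \<bullet> h) / (cmod z)\<^sup>2) * cnj z) = 2 * \<sigma> * \<bar>z \<bullet> h\<bar> / cmod z"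
    unfolding norm_mult norm_of_real complex_mod_cnj using assms False by (simp add: abs_mult power2_eq_square)
  also have "\<dots> \<le> 2 * \<sigma> * (cmod z * cmod h) / cmod z"
    using assms by (intro divide_right_mono mult_left_mono Cauchy_Schwarz_ineq2) auto
  finally have "cmod (of_real (2 * \<sigma> * (z \<bullet> h) / (cmod z)\<^sup>2) * cnj z) \<le> 2 * \<sigma> * cmod h" using False by simp
  then have "cmod (of_real (2 * \<sigma> * (z \<bullet> h) / (cmod z)\<^sup>2) * cnj z + cnj h) \<le> (2 * \<sigma> + 1) * cmod h"
    using norm_triangle_ineq[of "of_real (2 * \<sigma> * (z \<bullet> h) / (cmod z)\<^sup>2) * cnj z" "cnj h"]
    by (simp add: algebra_simps)
  then have "cmod z powr (2 * \<sigma>) * cmod (of_real (2 * \<sigma> * (z \<bullet> h) / (cmod z)\<^sup>2) * cnj z + cnj h)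
      \<le> cmod z powr (2 * \<sigma>) * ((2 * \<sigma> + 1) * cmod h)"
    by (intro mult_left_mono) auto
  then show ?thesis unfolding DG_nonzero[OF False] norm_mult norm_pw by (simp add: mult_ac)
qed simp

lemma bounded_linear_DG: "bounded_linear (DG \<sigma> z)"
proof -
  have "bounded_linear (\<lambda>h. of_real ((2 * \<sigma> * cmod z powr (2 * \<sigma> - 2)) * (z \<bullet> h)) * cnj z + pw \<sigma> z * cnj h)"
    by (intro bounded_linear_add bounded_linear_mult_const bounded_linear_of_real[THEN bounded_linear_compose]
        bounded_linear_const_mult bounded_linear_inner_right bounded_linear_cnj)
  then show ?thesis unfolding DG_def[abs_def] by (simp add: mult.assoc)
qed

lemma Gz_has_derivative:
  assumes "0 < \<sigma>"
  shows "(Gz \<sigma> has_derivative DG \<sigma> z) (at z)"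
proof (cases "z = 0")
  case True
  \<comment> \<open>The difference quotient of \<open>Gz\<close> at 0 has modulus |h|^(2
    \<sigma>).\<close>
  have "((\<lambda>h. cmod h powr (2 * \<sigma>)) \<longlongrightarrow> cmod 0 powr (2 * \<sigma>)) (at 0)"
    by (intro tendsto_powr' tendsto_norm tendsto_const tendsto_ident_at) (use assms in auto)
  then have "((\<lambda>h. cmod h powr (2 * \<sigma>)) \<longlongrightarrow> 0) (at 0)" by simp
  then have "((\<lambda>h. cmod (Gz \<sigma> (0 + h) - Gz \<sigma> 0 - DG \<sigma> 0 h) / cmod h) \<longlongrightarrow> 0) (at 0)"
    by (rule Lim_transform_eventually)
       (auto simp: eventually_at_filter norm_Gz Gz_def[of _ 0])
  then show ?thesis using True bounded_linear_DG by (simp add: has_derivative_at)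
next
  case False
  have n: "((\<lambda>z. z \<bullet> z) has_derivative (\<lambda>h. z \<bullet> h + h \<bullet> z)) (at z)"
    by (rule has_derivative_inner[OF has_derivative_ident has_derivative_ident])
  have p: "((\<lambda>z. (z \<bullet> z) powr \<sigma>) has_derivative
      (\<lambda>h. (z \<bullet> z) powr \<sigma> * (0 * ln (z \<bullet> z) + (z \<bullet> h + h \<bullet> z) * \<sigma> / (z \<bullet> z)))) (at z)"
    by (rule has_derivative_powr[OF n has_derivative_const]) (use False in auto)
  \<comment> \<open>Written through the differentiable \<open>w \<bullet> w\<close>, the power falls
    under the ordinary chain rule away from 0.\<close>
  have eq: "cmod w powr (2 * \<sigma>) = (w \<bullet> w) powr \<sigma>" for w
    by (simp add: power2_norm_eq_inner[symmetric] powr_powr[symmetric] powr_numeral)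
  have "((\<lambda>w. of_real ((w \<bullet> w) powr \<sigma>) * cnj w) has_derivative
      (\<lambda>h. of_real ((z \<bullet> z) powr \<sigma>) * cnj h + of_real ((z \<bullet> z) powr \<sigma> * (0 * ln (z \<bullet> z) + (z \<bullet> h + h \<bullet> z) * \<sigma> / (z \<bullet> z))) * cnj z)) (at z)"
    by (intro has_derivative_mult has_derivative_of_real p bounded_linear.has_derivative[OF bounded_linear_cnj has_derivative_ident])
  moreover have "(\<lambda>h. of_real ((z \<bullet> z) powr \<sigma>) * cnj h + of_real ((z \<bullet> z) powr \<sigma> * (0 * ln (z \<bullet> z) + (z \<bullet> h + h \<bullet> z) * \<sigma> / (z \<bullet> z))) * cnj z) = DG \<sigma> z"
    unfolding DG_nonzero[OF False] pw_def eq
    by (rule ext) (simp add: inner_commute[of _ z] dot_square_norm distrib_left divide_inverse mult_ac)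
  ultimately show ?thesis unfolding Gz_def[abs_def] pw_def eq by (simp only:)
qed

lemma continuous_on_DG:
  assumes "0 < \<sigma>"
  shows "continuous_on UNIV (\<lambda>p. DG \<sigma> (fst p) (snd p))"
proof (rule continuous_at_imp_continuous_on, intro ballI)
  fix p :: "complex \<times> complex"
  show "isCont (\<lambda>p. DG \<sigma> (fst p) (snd p)) p"
  proof (cases "fst p = 0")
    case False
    have pwc: "isCont (\<lambda>p. pw \<sigma> (fst p)) p"
      unfolding isCont_def by (intro tendsto_pw assms tendsto_fst tendsto_ident_at)
    have "isCont (\<lambda>p. cmod (fst p) powr (2 * \<sigma> - 2)) p"
      by (intro continuous_intros) (simp_all add: False)
    then show ?thesis
      unfolding DG_def by (intro continuous_intros pwc) (use False in auto)
  next
    case True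
    have "((\<lambda>q. (2 * \<sigma> + 1) * (cmod (fst q) powr (2 * \<sigma>) * cmod (snd q))) \<longlongrightarrow> (2 * \<sigma> + 1) * (cmod (fst p) powr (2 * \<sigma>) * cmod (snd p))) (at p)"
      by (intro tendsto_mult tendsto_powr' tendsto_const tendsto_norm tendsto_fst tendsto_snd tendsto_ident_at) (use assms in auto)
    then have lim: "((\<lambda>q. (2 * \<sigma> + 1) * (cmod (fst q) powr (2 * \<sigma>) * cmod (snd q))) \<longlongrightarrow> 0) (at p)"
      using True by simp
    have "((\<lambda>q. DG \<sigma> (fst q) (snd q)) \<longlongrightarrow> 0) (at p)"
      by (rule Lim_null_comparison[OF _ lim]) (use norm_DG_le[OF assms] in auto)
    then show ?thesis using True by (simp add: isCont_def)
  qed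
qed

text \<open>The radial part contributes 2 \<sigma>, by the plane identity (z . w) Im (cnj z p) - (z
  . p) Im (cnj z w) = |z|^2 Im (cnj w p), and the conjugation contributes 2. The resulting factor 2
  (\<sigma> + 1) is the origin of 1 / (\<sigma> + 1) in the energy.\<close>

lemma DG_skew:
  "Im (DG \<sigma> z w * p - DG \<sigma> z p * w) = 2 * (\<sigma> + 1) * cmod z powr (2 * \<sigma>) * Im (cnj w * p)"
proof (cases "z = 0")
  case False
  define n where "n = (cmod z)\<^sup>2"
  have n: "n \<noteq> 0" "n = (Re z)\<^sup>2 + (Im z)\<^sup>2" using False by (simp_all add: n_def cmod_power2[symmetric])
  define \<alpha> where "\<alpha> h = 2 * \<sigma> * (z \<bullet> h) / n" for h
  have "\<alpha> w * Im (cnj z * p) - \<alpha> p * Im (cnj z * w) = 2 * \<sigma> / n * ((z \<bullet> w) * Im (cnj z * p) - (z \<bullet> p) * Im (cnj z * w))"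
    by (simp add: \<alpha>_def algebra_simps diff_divide_distrib)
  also have "(z \<bullet> w) * Im (cnj z * p) - (z \<bullet> p) * Im (cnj z * w) = n * Im (cnj w * p)"
    unfolding n(2) by (simp add: inner_complex_def power2_eq_square algebra_simps)
  finally have *: "\<alpha> w * Im (cnj z * p) - \<alpha> p * Im (cnj z * w) = 2 * \<sigma> * Im (cnj w * p)" using n(1) by simp
  have dg: "DG \<sigma> z h = of_real (cmod z powr (2 * \<sigma>)) * (of_real (\<alpha> h) * cnj z + cnj h)" for h
    unfolding DG_nonzero[OF False] pw_def \<alpha>_def n_def by (rule refl)
  have eq: "DG \<sigma> z w * p - DG \<sigma> z p * w = of_real (cmod z powr (2 * \<sigma>)) *
      (of_real (\<alpha> w) * (cnj z * p) - of_real (\<alpha> p) * (cnj z * w) + (cnj w * p - cnj p * w))"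
    unfolding dg by (simp add: algebra_simps)
  have "Im (DG \<sigma> z w * p - DG \<sigma> z p * w) = cmod z powr (2 * \<sigma>) *
      (\<alpha> w * Im (cnj z * p) - \<alpha> p * Im (cnj z * w) + 2 * Im (cnj w * p))"
    unfolding eq by (simp add: algebra_simps)
  then show ?thesis unfolding * by (simp add: algebra_simps)
qed simp

text \<open>\<open>Gz \<sigma> z * z\<close> is |z|^(2 \<sigma> + 2), and both sides are its
  derivative in direction h; in particular the result is real.\<close>

lemma DG_charge:
  "DG \<sigma> z h * z + Gz \<sigma> z * h = of_real ((2 * \<sigma> + 2) * cmod z powr (2 * \<sigma>) * (z \<bullet> h))"
proof (cases "z = 0")
  case False
  have zz: "cnj z * z = of_real ((cmod z)\<^sup>2)" by (simp only: complex_norm_square mult.commute)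
  have hz: "cnj h * z + cnj z * h = of_real (2 * (z \<bullet> h))" by (simp add: complex_eq_iff inner_complex_def)
  have "DG \<sigma> z h * z + Gz \<sigma> z * h = pw \<sigma> z * (of_real (2 * \<sigma> * (z \<bullet> h) / (cmod z)\<^sup>2) * (cnj z * z) + (cnj h * z + cnj z * h))"
    unfolding DG_nonzero[OF False] Gz_def by (simp add: algebra_simps)
  also have "\<dots> = of_real (cmod z powr (2 * \<sigma>) * (2 * \<sigma> * (z \<bullet> h) / (cmod z)\<^sup>2 * (cmod z)\<^sup>2 + 2 * (z \<bullet> h)))"
    unfolding zz hz pw_def by (simp only: of_real_mult of_real_add)
  also have "cmod z powr (2 * \<sigma>) * (2 * \<sigma> * (z \<bullet> h) / (cmod z)\<^sup>2 * (cmod z)\<^sup>2 + 2 * (z \<bullet> h)) = (2 * \<sigma> + 2) * cmod z powr (2 * \<sigma>) * (z \<bullet> h)"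
    using False by (simp add: algebra_simps)
  finally show ?thesis .
qed (simp add: Gz_def)

section \<open>Galerkin approximations\<close>

locale galerkin = basis +
  fixes \<sigma> :: real
  assumes \<sigma>_pos: "0 < \<sigma>" and \<sigma>_less_1: "\<sigma> < 1"
begin

text \<open>The weak form of \<open>i u\<^sub>x\<^sub>x - |u|\<^sup>2\<^sup>\<sigma> u\<^sub>x\<close> for \<open>u = f\<close>, \<open>u\<^sub>x = g\<close>, tested with \<open>h\<close>, where \<open>h\<^sub>x = h'\<close>.\<close>

definition Phi :: "(real \<Rightarrow> complex) \<Rightarrow> (real \<Rightarrow> complex) \<Rightarrow> (real \<Rightarrow> complex) \<Rightarrow> (real \<Rightarrow> complex) \<Rightarrow> complex" where
  "Phi f g h h' = - \<i> * ip lborel g h' - ip lborel (\<lambda>x. pw \<sigma> (f x) * g x) h"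

text \<open>Controls \<open>Phi\<close> when both norms are at most C: C for the derivative term and
  (2 C)^(2 \<sigma>) C for the nonlinear one, where |f| <= 2 C by the sup bound.\<close>

definition KC :: "real \<Rightarrow> real" where
  "KC C = C + (2 * C) powr (2 * \<sigma>) * C"

lemma sq_pw_mult:
  assumes "f \<in> borel_measurable borel" "\<And>x. cmod (f x) \<le> B" "sq lborel g"
  shows "sq lborel (\<lambda>x. pw \<sigma> (f x) * g x)" "N2 (\<lambda>x. pw \<sigma> (f x) * g x) \<le> B powr (2 * \<sigma>) * N2 g"
proof -
  have [measurable]: "f \<in> borel_measurable borel" "g \<in> borel_measurable borel"
    using assms(1) sq_measurable[OF assms(3)] by auto
  have b: "AE x in lborel. cmod (pw \<sigma> (f x) * g x) \<le> B powr (2 * \<sigma>) * cmod (g x)"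
    by (intro AE_I2) (simp add: norm_mult mult_right_mono norm_pw_le[OF \<sigma>_pos assms(2)])
  show "sq lborel (\<lambda>x. pw \<sigma> (f x) * g x)" by (rule sq_bound[OF assms(3) _ b]) measurable
  show "N2 (\<lambda>x. pw \<sigma> (f x) * g x) \<le> B powr (2 * \<sigma>) * N2 g" by (rule nr_mono[OF assms(3) _ b]) auto
qed

lemma HH_pw_sq:
  assumes "HH \<Omega> f g" "N2 f \<le> C" "N2 g \<le> C"
  shows "sq lborel (\<lambda>x. pw \<sigma> (f x) * g x)" "N2 (\<lambda>x. pw \<sigma> (f x) * g x) \<le> (2 * C) powr (2 * \<sigma>) * C"
proof -
  note b = HH_sup_bound'[OF assms]
  note * = sq_pw_mult[OF HH_measurable(1)[OF assms(1)] b HH_sq(2)[OF assms(1)]]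
  show "sq lborel (\<lambda>x. pw \<sigma> (f x) * g x)" by (rule *)
  show "N2 (\<lambda>x. pw \<sigma> (f x) * g x) \<le> (2 * C) powr (2 * \<sigma>) * C"
    by (rule order_trans[OF *(2)]) (intro mult_left_mono assms(3), simp)
qed

lemma HH_pw_sq': "HH \<Omega> f g \<Longrightarrow> sq lborel (\<lambda>x. pw \<sigma> (f x) * g x)"
  by (rule HH_pw_sq(1)[of f g "max (N2 f) (N2 g)"]) auto

lemma Phi_bound:
  assumes "HH \<Omega> f g" "N2 f \<le> C" "N2 g \<le> C" "sq lborel h" "sq lborel h'"
  shows "cmod (Phi f g h h') \<le> KC C * (N2 h + N2 h')"
proof -
  have C: "0 \<le> C" using assms(2) nr_nonneg[of lborel f] by linarith
  have "cmod (Phi f g h h') \<le> cmod (\<i> * ip lborel g h') + cmod (ip lborel (\<lambda>x. pw \<sigma> (f x) * g x) h)"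
    unfolding Phi_def using norm_triangle_ineq4[of "- \<i> * ip lborel g h'" "ip lborel (\<lambda>x. pw \<sigma> (f x) * g x) h"] by simp
  also have "\<dots> \<le> C * N2 h' + (2 * C) powr (2 * \<sigma>) * C * N2 h"
  proof (rule add_mono)
    have "cmod (\<i> * ip lborel g h') \<le> N2 g * N2 h'"
      using ip_Cauchy_Schwarz[OF HH_sq(2)[OF assms(1)] assms(5)] by (simp add: norm_mult)
    also have "\<dots> \<le> C * N2 h'" by (intro mult_right_mono assms) simp
    finally show "cmod (\<i> * ip lborel g h') \<le> C * N2 h'" .
    have "cmod (ip lborel (\<lambda>x. pw \<sigma> (f x) * g x) h) \<le> N2 (\<lambda>x. pw \<sigma> (f x) * g x) * N2 h"
      by (rule ip_Cauchy_Schwarz[OF HH_pw_sq(1)[OF assms(1-3)] assms(4)])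
    also have "\<dots> \<le> (2 * C) powr (2 * \<sigma>) * C * N2 h"
      by (intro mult_right_mono HH_pw_sq(2)[OF assms(1-3)]) simp
    finally show "cmod (ip lborel (\<lambda>x. pw \<sigma> (f x) * g x) h) \<le> (2 * C) powr (2 * \<sigma>) * C * N2 h" .
  qed
  also have "\<dots> \<le> KC C * N2 h' + KC C * N2 h"
    by (intro add_mono mult_right_mono) (auto simp: KC_def C)
  finally show ?thesis by (simp add: distrib_left)
qed

lemma KC_nonneg: "0 \<le> C \<Longrightarrow> 0 \<le> KC C"
  by (simp add: KC_def)

lemma Phi_add:
  assumes "HH \<Omega> f g" "sq lborel h" "sq lborel h'" "sq lborel k" "sq lborel k'"
  shows "Phi f g (\<lambda>x. h x + k x) (\<lambda>x. h' x + k' x) = Phi f g h h' + Phi f g k k'"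
  unfolding Phi_def using assms HH_sq[OF assms(1)] HH_pw_sq'[OF assms(1)]
  by (simp add: ip_add_right algebra_simps)

lemma Phi_cmult: "Phi f g (\<lambda>x. c * h x) (\<lambda>x. c * h' x) = cnj c * Phi f g h h'"
  unfolding Phi_def by (simp add: ip_cmult_right algebra_simps)

lemma Phi_zero: "Phi f g (\<lambda>x. 0) (\<lambda>x. 0) = 0"
  by (simp add: Phi_def)

lemma Phi_diff:
  assumes "HH \<Omega> f g" "sq lborel h" "sq lborel h'" "sq lborel k" "sq lborel k'"
  shows "Phi f g (\<lambda>x. h x - k x) (\<lambda>x. h' x - k' x) = Phi f g h h' - Phi f g k k'"
  using Phi_add[OF assms(1-3), of "\<lambda>x. (-1) * k x" "\<lambda>x. (-1) * k' x"] Phi_cmult[of f g "-1" k k'] assms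
  by (auto simp: sq_uminus)

lemma Phi_sum:
  assumes "HH \<Omega> f g" "\<And>i. i \<in> I \<Longrightarrow> sq lborel (h i)" "\<And>i. i \<in> I \<Longrightarrow> sq lborel (h' i)"
  shows "Phi f g (\<lambda>x. \<Sum>i\<in>I. h i x) (\<lambda>x. \<Sum>i\<in>I. h' i x) = (\<Sum>i\<in>I. Phi f g (h i) (h' i))"
  using assms(2,3)
  by (induction I rule: infinite_finite_induct) (auto simp: Phi_zero Phi_add[OF assms(1)] sq_sum)

section \<open>Charge identity and first variation of the energy for test functions\<close>

lemma integral_continuous_support:
  fixes f :: "real \<Rightarrow> 'b::euclidean_space"
  assumes "continuous_on UNIV f" "\<And>x. R < \<bar>x\<bar> \<Longrightarrow> f x = 0"
  shows "(\<integral>x. f x \<partial>lborel) = integral (cbox (-R) R) f"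
proof -
  have int: "integrable lborel f" by (rule continuous_compact_support_integrable) fact+
  have "(f has_integral (\<integral>x. f x \<partial>lborel)) UNIV" by (rule has_integral_integral_lborel[OF int])
  moreover have "f = (\<lambda>x. if x \<in> cbox (-R) R then f x else 0)"
    using assms(2) by (fastforce simp: abs_le_iff not_less)
  ultimately have "(f has_integral (\<integral>x. f x \<partial>lborel)) (cbox (-R) R)"
    by (metis has_integral_restrict_UNIV)
  then show ?thesis by (rule integral_unique[symmetric])
qed

lemma tf_comp_deriv:
  assumes u: "u \<in> TF"
  shows "((\<lambda>x. Gz \<sigma> (u x)) has_vector_derivative DG \<sigma> (u x) (D u x)) (at x)"
proof -
  have "((\<lambda>x. Gz \<sigma> (u x)) has_derivative (\<lambda>h. DG \<sigma> (u x) (h *\<^sub>R D u x))) (at x)"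
    using has_derivative_compose[OF tf_vector_derivative[OF u, unfolded has_vector_derivative_def] Gz_has_derivative[OF \<sigma>_pos]] .
  then show ?thesis
    unfolding has_vector_derivative_def
    by (simp add: linear_cmul[OF bounded_linear.linear[OF bounded_linear_DG]])
qed

lemma continuous_on_DG_comp:
  assumes "continuous_on A f" "continuous_on A g"
  shows "continuous_on A (\<lambda>x. DG \<sigma> (f x) (g x))"
  using continuous_on_compose2[OF continuous_on_DG[OF \<sigma>_pos] continuous_on_Pair[OF assms]] by simp

lemma continuous_on_Gz_comp:
  assumes "continuous_on A f"
  shows "continuous_on A (\<lambda>x. Gz \<sigma> (f x))"
  unfolding Gz_def using continuous_on_compose2[OF continuous_on_pw[OF \<sigma>_pos] assms]
  by (intro continuous_intros assms) auto

lemma TF_cont: "u \<in> TF \<Longrightarrow> continuous_on A u" "u \<in> TF \<Longrightarrow> continuous_on A (D u)"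
  by (auto intro: tf_continuous tf_dir_deriv)

lemma tf_radius2: "u \<in> TF \<Longrightarrow> \<exists>R>0. (\<forall>x. R < \<bar>x\<bar> \<longrightarrow> u x = 0 \<and> D u x = 0)"
proof -
  assume u: "u \<in> TF"
  obtain R where R: "0 < R" "\<forall>x. R < norm x \<longrightarrow> u x = 0" using tf_radius[OF u] by blast
  obtain S where S: "0 < S" "\<forall>x. S < norm x \<longrightarrow> D u x = 0" using tf_radius[OF tf_dir_deriv[OF u]] by blast
  show ?thesis by (rule exI[of _ "max R S"]) (use R S in auto)
qed

text \<open>Re (|u|^(2 \<sigma>) u_x cnj u) is the derivative of |u|^(2 \<sigma> + 2) / (2 \<sigma>
  + 2), a function of compact support.\<close>

lemma charge_identity:
  assumes u: "u \<in> TF"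
  shows "Re (ip lborel (\<lambda>x. pw \<sigma> (u x) * D u x) u) = 0"
proof -
  obtain R where R: "\<And>x. R < \<bar>x\<bar> \<Longrightarrow> u x = 0 \<and> D u x = 0" using tf_radius2[OF u] by blast
  have "(\<integral>x. Gz \<sigma> (u x) * D u x + DG \<sigma> (u x) (D u x) * u x \<partial>lborel) = 0"
    by (rule integral_derivative_zero[of "\<lambda>x. Gz \<sigma> (u x) * u x" _ R])
       (use R in \<open>auto intro!: has_vector_derivative_mult tf_comp_deriv[OF u] tf_vector_derivative[OF u]
        continuous_intros continuous_on_DG_comp continuous_on_Gz_comp TF_cont[OF u]\<close>)
  moreover have "Gz \<sigma> (u x) * D u x + DG \<sigma> (u x) (D u x) * u x
      = of_real ((2 * \<sigma> + 2) * Re (pw \<sigma> (u x) * D u x * cnj (u x)))" for x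
    using DG_charge[of \<sigma> "u x" "D u x"]
    by (simp add: add.commute pw_def inner_complex_def algebra_simps)
  ultimately have "(\<integral>x. (2 * \<sigma> + 2) * Re (pw \<sigma> (u x) * D u x * cnj (u x)) \<partial>lborel) = 0"
    by (simp only: integral_complex_of_real of_real_eq_0_iff)
  moreover have int: "integrable lborel (\<lambda>x. pw \<sigma> (u x) * D u x * cnj (u x))"
    by (rule sq_ip_integrable[OF HH_pw_sq'[OF HH_tf[OF u]] tf_sq[OF u]])
  ultimately have "(2 * \<sigma> + 2) * Re (\<integral>x. pw \<sigma> (u x) * D u x * cnj (u x) \<partial>lborel) = 0"
    using integral_Re[OF int] by (simp only: integral_mult_right_zero)
  then show ?thesis using \<sigma>_pos by (simp add: ip_def)
qed

lemma Re_Phi_self: "u \<in> TF \<Longrightarrow> Re (Phi u (D u) u (D u)) = 0"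
  unfolding Phi_def using charge_identity[of u] by (simp add: ip_self del: of_real_power)

text \<open>The left side is the derivative of the energy at u in direction w. Subtracting the
  vanishing integral of the derivative of \<open>Gz \<sigma> (u x) * w x\<close> removes D w and
  leaves the skew expression of \<open>DG_skew\<close>. The result exhibits the energy as the
  Hamiltonian of the equation.\<close>

lemma variation:
  assumes u: "u \<in> TF" and w: "w \<in> TF"
  shows "2 * Re (ip lborel (D w) (D u)) + 1 / (\<sigma> + 1) *
      Im (\<integral>x. DG \<sigma> (u x) (w x) * D u x + Gz \<sigma> (u x) * D w x \<partial>lborel) = 2 * Re (\<i> * Phi u (D u) w (D w))"
proof -
  obtain R1 where R1: "\<And>x. R1 < \<bar>x\<bar> \<Longrightarrow> u x = 0 \<and> D u x = 0" using tf_radius2[OF u] by blast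
  obtain R2 where R2: "\<And>x. R2 < \<bar>x\<bar> \<Longrightarrow> w x = 0 \<and> D w x = 0" using tf_radius2[OF w] by blast
  note c = TF_cont[OF u] TF_cont[OF w]
  have zero: "(\<integral>x. Gz \<sigma> (u x) * D w x + DG \<sigma> (u x) (D u x) * w x \<partial>lborel) = 0"
    by (rule integral_derivative_zero[of "\<lambda>x. Gz \<sigma> (u x) * w x" _ R2])
       (use R2 in \<open>auto intro!: has_vector_derivative_mult tf_comp_deriv[OF u] tf_vector_derivative[OF w]
        continuous_intros continuous_on_DG_comp continuous_on_Gz_comp c\<close>)
  have i1: "integrable lborel (\<lambda>x. Gz \<sigma> (u x) * D w x + DG \<sigma> (u x) (D u x) * w x)"
    by (rule continuous_compact_support_integrable[of _ R2])
       (use R2 in \<open>auto intro!: continuous_intros continuous_on_DG_comp continuous_on_Gz_comp c\<close>)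
  have i2: "integrable lborel (\<lambda>x. DG \<sigma> (u x) (w x) * D u x + Gz \<sigma> (u x) * D w x)"
    by (rule continuous_compact_support_integrable[of _ "max R1 R2"])
       (use R1 R2 in \<open>auto intro!: continuous_intros continuous_on_DG_comp continuous_on_Gz_comp c\<close>)
  have i3: "integrable lborel (\<lambda>x. pw \<sigma> (u x) * D u x * cnj (w x))"
    by (rule sq_ip_integrable[OF HH_pw_sq'[OF HH_tf[OF u]] tf_sq[OF w]])
  have "(\<integral>x. DG \<sigma> (u x) (w x) * D u x + Gz \<sigma> (u x) * D w x \<partial>lborel)
      = (\<integral>x. DG \<sigma> (u x) (w x) * D u x + Gz \<sigma> (u x) * D w x \<partial>lborel)
        - (\<integral>x. Gz \<sigma> (u x) * D w x + DG \<sigma> (u x) (D u x) * w x \<partial>lborel)"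
    unfolding zero by simp
  also have "\<dots> = (\<integral>x. (DG \<sigma> (u x) (w x) * D u x + Gz \<sigma> (u x) * D w x)
      - (Gz \<sigma> (u x) * D w x + DG \<sigma> (u x) (D u x) * w x) \<partial>lborel)"
    by (rule Bochner_Integration.integral_diff[OF i2 i1, symmetric])
  also have "\<dots> = (\<integral>x. DG \<sigma> (u x) (w x) * D u x - DG \<sigma> (u x) (D u x) * w x \<partial>lborel)"
    by (intro Bochner_Integration.integral_cong) auto
  finally have eq: "(\<integral>x. DG \<sigma> (u x) (w x) * D u x + Gz \<sigma> (u x) * D w x \<partial>lborel)
      = (\<integral>x. DG \<sigma> (u x) (w x) * D u x - DG \<sigma> (u x) (D u x) * w x \<partial>lborel)" .
  have i4: "integrable lborel (\<lambda>x. DG \<sigma> (u x) (w x) * D u x - DG \<sigma> (u x) (D u x) * w x)"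
    using Bochner_Integration.integrable_diff[OF i2 i1] by (rule back_subst[of "integrable lborel"]) auto
  have "Im (\<integral>x. DG \<sigma> (u x) (w x) * D u x - DG \<sigma> (u x) (D u x) * w x \<partial>lborel)
      = (\<integral>x. Im (DG \<sigma> (u x) (w x) * D u x - DG \<sigma> (u x) (D u x) * w x) \<partial>lborel)"
    using integral_Im[OF i4] by simp
  also have "\<dots> = (\<integral>x. 2 * (\<sigma> + 1) * Im (pw \<sigma> (u x) * D u x * cnj (w x)) \<partial>lborel)"
    unfolding DG_skew by (intro Bochner_Integration.integral_cong) (auto simp: pw_def algebra_simps)
  also have "\<dots> = 2 * (\<sigma> + 1) * Im (ip lborel (\<lambda>x. pw \<sigma> (u x) * D u x) w)"
    using integral_Im[OF i3] by (simp add: ip_def)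
  finally have "1 / (\<sigma> + 1) * Im (\<integral>x. DG \<sigma> (u x) (w x) * D u x + Gz \<sigma> (u x) * D w x \<partial>lborel)
      = 2 * Im (ip lborel (\<lambda>x. pw \<sigma> (u x) * D u x) w)"
    unfolding eq using \<sigma>_pos by (simp add: field_simps)
  moreover have "Re (ip lborel (D w) (D u)) = Re (ip lborel (D u) (D w))"
    using ip_commute[of lborel "D w" "D u"] by simp
  ultimately show ?thesis unfolding Phi_def by (simp add: algebra_simps)
qed

definition En :: "(real \<Rightarrow> complex) \<Rightarrow> (real \<Rightarrow> complex) \<Rightarrow> real" where
  "En f g = (N2 g)\<^sup>2 + 1 / (\<sigma> + 1) * Im (ip lborel g (\<lambda>x. cnj (Gz \<sigma> (f x))))"

text \<open>Orthonormal in L2 up to zero vectors, so that testing the equation with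
  \<open>b k\<close> yields the time derivative of the k-th coordinate. The H1 basis
  \<open>e\<close> is kept for weak limits.\<close>

definition b :: "nat \<Rightarrow> real \<Rightarrow> complex" where "b = L.gs d"

lemma b_tf: "b k \<in> TF"
  unfolding b_def by (rule L.gs_T[OF d_test])

abbreviation U :: "nat \<Rightarrow> (nat \<Rightarrow> complex) \<Rightarrow> real \<Rightarrow> complex" where
  "U n c \<equiv> \<lambda>x. \<Sum>k<n. c k * b k x"

lemma U_tf: "U n c \<in> TF"
  by (intro tf_sum tf_cmult b_tf)

lemma D_U: "D (U n c) = (\<lambda>x. \<Sum>k<n. c k * D (b k) x)"
proof
  fix x
  have "D (U n c) x = (\<Sum>k<n. D (\<lambda>x. c k * b k x) x)" by (rule D_sum[of _ _ \<Omega>]) (intro tf_cmult b_tf)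
  then show "D (U n c) x = (\<Sum>k<n. c k * D (b k) x)" by (simp only: D_cmult[OF b_tf])
qed

lemma U_lin: "U n c \<in> lin d n"
  unfolding b_def using linI[where e="L.gs d" and n=n and a=c] L.lin_gs[OF d_test, where n=n] by simp

lemma lin_TF: "f \<in> lin d n \<Longrightarrow> f \<in> TF"
  by (rule L.T_lin[OF d_test])

lemma lin_U: "f \<in> lin d n \<Longrightarrow> f = U n (\<lambda>k. ip lborel f (b k))"
  unfolding b_def by (rule L.gs_expansion[OF d_test])

lemma hip_Cauchy_Schwarz:
  assumes "f \<in> TF" "g \<in> TF"
  shows "cmod (hip f g) \<le> sqrt (Re (hip f f)) * sqrt (Re (hip g g))"
proof -
  have "cmod (hip f g) \<le> N2 f * N2 g + N2 (D f) * N2 (D g)"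
    unfolding hip_def using ip_Cauchy_Schwarz[OF tf_sq[OF assms(1)] tf_sq[OF assms(2)]]
      ip_Cauchy_Schwarz[OF tf_D_sq[OF assms(1)] tf_D_sq[OF assms(2)]] norm_triangle_ineq order_trans
    by (metis (no_types, lifting) add_mono)
  also have "\<dots> \<le> sqrt ((N2 f)\<^sup>2 + (N2 (D f))\<^sup>2) * sqrt ((N2 g)\<^sup>2 + (N2 (D g))\<^sup>2)"
  proof -
    have "0 \<le> (N2 f * N2 (D g) - N2 (D f) * N2 g)\<^sup>2" by simp
    then have "(N2 f * N2 g + N2 (D f) * N2 (D g))\<^sup>2 \<le> ((N2 f)\<^sup>2 + (N2 (D f))\<^sup>2) * ((N2 g)\<^sup>2 + (N2 (D g))\<^sup>2)"
      by (simp add: power2_eq_square algebra_simps)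
    then show ?thesis unfolding real_sqrt_mult[symmetric] by (rule real_le_rsqrt)
  qed
  finally show ?thesis by (simp add: hip_self)
qed

lemma coef_bound:
  assumes "f \<in> TF"
  shows "(\<Sum>k<N. (cmod (hip f (e k)))\<^sup>2) \<le> (sqrt (Re (hip f f)))\<^sup>2"
proof -
  have "(\<Sum>k<N. (cmod (hip (e k) f))\<^sup>2) \<le> (sqrt (Re (hip f f)))\<^sup>2"
    unfolding e_def
    by (rule H.gs_Bessel[OF d_test, where l="\<lambda>g. hip g f"])
       (use assms hip_Cauchy_Schwarz[OF _ assms] H.Q_nonneg[OF assms] in \<open>auto simp: H.Q_add H.Q_cmult mult.commute\<close>)
  moreover have "cmod (hip f (e k)) = cmod (hip (e k) f)" for k
    using H.Q_commute[OF assms e_tf, of k] by simp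
  ultimately show ?thesis by simp
qed

text \<open>Orthogonality makes the coefficients from n on vanish, so the expansion is
  finite.\<close>

lemma coef_rep:
  assumes "f \<in> lin d n"
  shows "rep (\<lambda>k. hip f (e k)) f (D f)"
proof -
  have f: "f = S (\<lambda>k. hip f (e k)) n" unfolding e_def by (rule H.gs_expansion[OF d_test assms])
  have "hip f (e k) = 0" if "k \<ge> n" for k
  proof -
    have "hip (S (\<lambda>k. hip f (e k)) n) (e k) = (\<Sum>j<n. hip f (e j) * hip (e j) (e k))"
      by (subst H.Q_sum) (auto simp: H.Q_cmult e_tf tf_cmult)
    also have "\<dots> = 0"
      by (intro sum.neutral ballI) (use that in \<open>auto simp: e_def H.gs_orthogonal[OF d_test]\<close>)
    finally show ?thesis using f by simp
  qed
  from rep_finite[of n "\<lambda>k. hip f (e k)", OF this] show ?thesis using f by simp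
qed

lemma Phi_weak_continuous:
  assumes rep: "\<And>n. rep (a n) (f n) (g n)" and rep': "rep a' f' g'"
    and bd: "\<And>n N. (\<Sum>k<N. (cmod (a n k))\<^sup>2) \<le> C\<^sup>2" and C: "0 \<le> C"
    and lim: "\<And>k. (\<lambda>n. a n k) \<longlonglongrightarrow> a' k" and h: "sq lborel h" "sq lborel h'"
  shows "(\<lambda>n. Phi (f n) (g n) h h') \<longlonglongrightarrow> Phi f' g' h h'"
  unfolding Phi_def
  by (intro tendsto_intros weak_ip_deriv[OF rep rep' bd C lim h(2)] weak_nonlinear[OF rep rep' bd C lim h(1) \<sigma>_pos])

lemma N2_U: "N2 (U n c) \<le> (\<Sum>k<n. cmod (c k) * N2 (b k))" "N2 (D (U n c)) \<le> (\<Sum>k<n. cmod (c k) * N2 (D (b k)))"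
proof -
  have *: "N2 (\<lambda>x. \<Sum>k<n. c k * h k x) \<le> (\<Sum>k<n. cmod (c k) * N2 (h k))" if "\<And>k. sq lborel (h k)" for h
  proof (induction n)
    case (Suc n)
    have "N2 (\<lambda>x. (\<Sum>k<n. c k * h k x) + c n * h n x) \<le> N2 (\<lambda>x. \<Sum>k<n. c k * h k x) + N2 (\<lambda>x. c n * h n x)"
      by (intro nr_triangle sq_sum sq_cmult that)
    then show ?case using Suc by (simp add: nr_cmult)
  qed simp
  show "N2 (U n c) \<le> (\<Sum>k<n. cmod (c k) * N2 (b k))" by (rule *[OF tf_sq[OF b_tf]])
  show "N2 (D (U n c)) \<le> (\<Sum>k<n. cmod (c k) * N2 (D (b k)))" unfolding D_U by (rule *[OF tf_D_sq[OF b_tf]])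
qed

text \<open>Continuity in finite dimension, obtained as a special case of weak continuity:
  converging coordinates in \<open>b\<close> give bounded, converging coefficients in
  \<open>e\<close>.\<close>

lemma Phi_U_continuous:
  assumes lim: "\<And>j. (\<lambda>m. c m j) \<longlonglongrightarrow> x j" and h: "sq lborel h" "sq lborel h'"
  shows "(\<lambda>m. Phi (U n (c m)) (D (U n (c m))) h h') \<longlonglongrightarrow> Phi (U n x) (D (U n x)) h h'"
proof -
  define p where "p m = (\<Sum>k<n. cmod (c m k) * N2 (b k)) + (\<Sum>k<n. cmod (c m k) * N2 (D (b k)))" for m
  have "p \<longlonglongrightarrow> (\<Sum>k<n. cmod (x k) * N2 (b k)) + (\<Sum>k<n. cmod (x k) * N2 (D (b k)))"
    unfolding p_def by (intro tendsto_intros lim)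
  then have "Bseq p" by (intro convergent_imp_Bseq) (auto simp: convergent_def)
  then obtain C where C: "C > 0" "\<And>m. \<bar>p m\<bar> \<le> C" by (auto simp: Bseq_def)
  have bd: "(\<Sum>k<N. (cmod (hip (U n (c m)) (e k)))\<^sup>2) \<le> C\<^sup>2" for m N
  proof -
    have "sqrt (Re (hip (U n (c m)) (U n (c m)))) \<le> N2 (U n (c m)) + N2 (D (U n (c m)))"
      unfolding hip_self Re_complex_of_real by (rule sqrt_sum_squares_le_sum) auto
    also have "\<dots> \<le> C" using N2_U[where n=n and c="c m"] C(2)[of m] by (simp add: p_def)
    finally have "(sqrt (Re (hip (U n (c m)) (U n (c m)))))\<^sup>2 \<le> C\<^sup>2"
      by (intro power_mono) (auto simp: hip_self)
    then show ?thesis using coef_bound[OF U_tf[where n=n and c="c m"], where N=N] by linarith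
  qed
  have hipU: "hip (U n y) (e k) = (\<Sum>j<n. y j * hip (b j) (e k))" for y k
    by (subst H.Q_sum) (auto simp: H.Q_cmult e_tf b_tf tf_cmult)
  have l: "(\<lambda>m. hip (U n (c m)) (e k)) \<longlonglongrightarrow> hip (U n x) (e k)" for k
    unfolding hipU by (intro tendsto_intros lim)
  show ?thesis
    by (rule Phi_weak_continuous[OF coef_rep[OF U_lin] coef_rep[OF U_lin] bd less_imp_le[OF C(1)] l h])
qed

text \<open>Makes the vector field bounded, as \<open>peano\<close> demands: 1 while the square sum
  is at most R, 0 beyond R + 1. With R the initial square sum, which is conserved, the factor stays
  1 along the solution.\<close>

definition cutoff :: "nat \<Rightarrow> real \<Rightarrow> (nat \<Rightarrow> complex) \<Rightarrow> real" where
  "cutoff n R c = max 0 (min 1 (R + 1 - (\<Sum>k<n. (cmod (c k))\<^sup>2)))"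

definition field :: "nat \<Rightarrow> real \<Rightarrow> (nat \<Rightarrow> complex) \<Rightarrow> nat \<Rightarrow> complex" where
  "field n R c k = (if k < n then of_real (cutoff n R c) * Phi (U n c) (D (U n c)) (b k) (D (b k)) else 0)"

lemma field_continuous:
  assumes "\<And>j. (\<lambda>m. c m j) \<longlonglongrightarrow> x j"
  shows "(\<lambda>m. field n R (c m) k) \<longlonglongrightarrow> field n R x k"
proof (cases "k < n")
  case True
  have "(\<lambda>m. of_real (cutoff n R (c m)) * Phi (U n (c m)) (D (U n (c m))) (b k) (D (b k)))
      \<longlonglongrightarrow> of_real (cutoff n R x) * Phi (U n x) (D (U n x)) (b k) (D (b k))"
    unfolding cutoff_def
    by (intro tendsto_intros Phi_U_continuous assms tf_sq[OF b_tf] tf_D_sq[OF b_tf])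
  then show ?thesis using True by (simp add: field_def)
qed (simp add: field_def)

lemma field_bounded: "\<exists>B. \<forall>c k. cmod (field n R c k) \<le> B"
proof -
  define \<rho> where "\<rho> = sqrt (\<bar>R\<bar> + 1)"
  define C where "C = \<rho> * (\<Sum>k<n. N2 (b k)) + \<rho> * (\<Sum>k<n. N2 (D (b k)))"
  define B where "B = KC C * ((\<Sum>k<n. N2 (b k)) + (\<Sum>k<n. N2 (D (b k))))"
  have C0: "0 \<le> C" by (auto simp: C_def \<rho>_def intro!: add_nonneg_nonneg mult_nonneg_nonneg sum_nonneg)
  have B0: "0 \<le> B" by (auto simp: B_def intro!: add_nonneg_nonneg mult_nonneg_nonneg sum_nonneg KC_nonneg C0)
  have "cmod (field n R c k) \<le> B" for c k
  proof (cases "k < n \<and> (\<Sum>k<n. (cmod (c k))\<^sup>2) \<le> \<bar>R\<bar> + 1")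
    case False
    then have "field n R c k = 0" by (auto simp: field_def cutoff_def)
    then show ?thesis using B0 by simp
  next
    case True
    have ck: "cmod (c j) \<le> \<rho>" if "j < n" for j
    proof -
      have "(cmod (c j))\<^sup>2 \<le> (\<Sum>k<n. (cmod (c k))\<^sup>2)" using that by (intro member_le_sum) auto
      then show ?thesis unfolding \<rho>_def using True by (intro real_le_rsqrt) linarith
    qed
    have sums: "(\<Sum>k<n. cmod (c k) * N2 (b k)) \<le> \<rho> * (\<Sum>k<n. N2 (b k))"
      "(\<Sum>k<n. cmod (c k) * N2 (D (b k))) \<le> \<rho> * (\<Sum>k<n. N2 (D (b k)))"
      unfolding sum_distrib_left by (auto intro!: sum_mono mult_right_mono ck)
    have pos: "0 \<le> \<rho> * (\<Sum>k<n. N2 (b k))" "0 \<le> \<rho> * (\<Sum>k<n. N2 (D (b k)))"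
      by (auto simp: \<rho>_def intro!: mult_nonneg_nonneg sum_nonneg)
    have "N2 (U n c) \<le> C" "N2 (D (U n c)) \<le> C" using N2_U[where n=n and c=c] sums pos by (auto simp: C_def)
    then have "cmod (Phi (U n c) (D (U n c)) (b k) (D (b k))) \<le> KC C * (N2 (b k) + N2 (D (b k)))"
      by (rule Phi_bound[OF HH_tf[OF U_tf] _ _ tf_sq[OF b_tf] tf_D_sq[OF b_tf]])
    also have "\<dots> \<le> B"
      unfolding B_def using True
      by (intro mult_left_mono add_mono member_le_sum KC_nonneg C0) auto
    finally have P: "cmod (Phi (U n c) (D (U n c)) (b k) (D (b k))) \<le> B" .
    have "cmod (of_real (cutoff n R c)) \<le> 1" by (simp add: cutoff_def)
    then have "cmod (of_real (cutoff n R c)) * cmod (Phi (U n c) (D (U n c)) (b k) (D (b k))) \<le> 1 * B"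
      using P by (intro mult_mono) auto
    then show ?thesis using True by (simp add: field_def norm_mult)
  qed
  then show ?thesis by blast
qed

lemma Phi_U_right:
  assumes "HH \<Omega> f g"
  shows "Phi f g (U n c) (D (U n c)) = (\<Sum>k<n. cnj (c k) * Phi f g (b k) (D (b k)))"
  unfolding D_U
  by (subst Phi_sum[OF assms]) (auto simp: Phi_cmult intro: sq_cmult tf_sq[OF b_tf] tf_D_sq[OF b_tf])

text \<open>The derivative of the square sum is a real multiple of Re \<open>Phi\<close> (u, u) = 0.
  The cut-off enters only as a real factor, so conservation can be proved before the cut-off is
  removed.\<close>

lemma galerkin_charge:
  assumes y: "\<And>k t. ((\<lambda>t. y t k) has_vector_derivative field n R (y t) k) (at t)"
  shows "(\<Sum>k<n. (cmod (y t k))\<^sup>2) = (\<Sum>k<n. (cmod (y 0 k))\<^sup>2)"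
proof -
  define \<rho> where "\<rho> t = (\<Sum>k<n. (cmod (y t k))\<^sup>2)" for t
  have "(\<rho> has_vector_derivative 0) (at t)" for t
  proof -
    define \<phi> where "\<phi> k = field n R (y t) k" for k
    have "((\<lambda>t. y t k * cnj (y t k)) has_vector_derivative (y t k * cnj (\<phi> k) + \<phi> k * cnj (y t k))) (at t)" for k
      unfolding \<phi>_def by (intro has_vector_derivative_mult has_vector_derivative_cnj y)
    then have "((\<lambda>t. Re (y t k * cnj (y t k))) has_vector_derivative Re (y t k * cnj (\<phi> k) + \<phi> k * cnj (y t k))) (at t)" for k
      by (rule bounded_linear.has_vector_derivative[OF bounded_linear_Re])
    moreover have "Re (z * cnj z) = (cmod z)\<^sup>2" for z by (simp only: complex_norm_square[symmetric] Re_complex_of_real)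
    moreover have "Re (y t k * cnj (\<phi> k) + \<phi> k * cnj (y t k)) = 2 * Re (cnj (y t k) * \<phi> k)" for k
      by (simp add: algebra_simps)
    ultimately have "((\<lambda>t. (cmod (y t k))\<^sup>2) has_vector_derivative 2 * Re (cnj (y t k) * \<phi> k)) (at t)" for k
      by (simp only:)
    then have "(\<rho> has_vector_derivative (\<Sum>k<n. 2 * Re (cnj (y t k) * \<phi> k))) (at t)"
      unfolding \<rho>_def by (intro has_vector_derivative_sum)
    moreover have "(\<Sum>k<n. 2 * Re (cnj (y t k) * \<phi> k)) = 2 * cutoff n R (y t) * Re (Phi (U n (y t)) (D (U n (y t))) (U n (y t)) (D (U n (y t))))"
      unfolding Phi_U_right[OF HH_tf[OF U_tf]] Re_sum sum_distrib_left
      by (intro sum.cong) (auto simp: \<phi>_def field_def algebra_simps)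
    ultimately show ?thesis by (simp add: Re_Phi_self[OF U_tf])
  qed
  then have "\<exists>c. \<forall>t\<in>UNIV. \<rho> t = c"
    by (intro has_derivative_zero_constant) (auto simp: has_vector_derivative_def)
  then have "\<rho> t = \<rho> 0" by auto
  then show ?thesis by (simp add: \<rho>_def)
qed

lemma energy_integral:
  assumes u: "u \<in> TF" and R: "\<And>x. R < \<bar>x\<bar> \<Longrightarrow> D u x = 0"
  shows "En u (D u) = integral (cbox (-R) R) (\<lambda>x. (cmod (D u x))\<^sup>2 + 1 / (\<sigma> + 1) * Im (Gz \<sigma> (u x) * D u x))"
proof -
  note c = TF_cont[OF u]
  have i1: "integrable lborel (\<lambda>x. (cmod (D u x))\<^sup>2)" by (rule sq_integrable[OF tf_D_sq[OF u]])
  have i2: "integrable lborel (\<lambda>x. Gz \<sigma> (u x) * D u x)"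
    by (rule continuous_compact_support_integrable[of _ R])
       (use R in \<open>auto intro!: continuous_intros continuous_on_Gz_comp c\<close>)
  have "Im (ip lborel (D u) (\<lambda>x. cnj (Gz \<sigma> (u x)))) = (\<integral>x. Im (Gz \<sigma> (u x) * D u x) \<partial>lborel)"
    using integral_Im[OF i2] by (simp add: ip_def mult.commute)
  then have "En u (D u) = (\<integral>x. (cmod (D u x))\<^sup>2 \<partial>lborel) + (\<integral>x. 1 / (\<sigma> + 1) * Im (Gz \<sigma> (u x) * D u x) \<partial>lborel)"
    unfolding En_def nr_power2 by (simp only: integral_mult_right_zero)
  also have "\<dots> = (\<integral>x. (cmod (D u x))\<^sup>2 + 1 / (\<sigma> + 1) * Im (Gz \<sigma> (u x) * D u x) \<partial>lborel)"
    by (rule Bochner_Integration.integral_add[symmetric, OF i1 integrable_mult_right[OF integrable_Im[OF i2]]])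
  also have "\<dots> = integral (cbox (-R) R) (\<lambda>x. (cmod (D u x))\<^sup>2 + 1 / (\<sigma> + 1) * Im (Gz \<sigma> (u x) * D u x))"
    by (rule integral_continuous_support)
       (use R \<sigma>_pos in \<open>auto intro!: continuous_intros continuous_on_Gz_comp c\<close>)
  finally show ?thesis .
qed

text \<open>Fixes one compact interval outside which all basis functions in play vanish, so that the
  energy can be differentiated under an integral over a compact set.\<close>

lemma common_radius: "\<exists>R>0. \<forall>k<n. \<forall>x. R < \<bar>x\<bar> \<longrightarrow> b k x = 0 \<and> D (b k) x = 0"
proof (induction n)
  case 0
  show ?case by (rule exI[of _ 1]) simp
next
  case (Suc n)
  then obtain R where R: "R > 0" "\<forall>k<n. \<forall>x. R < \<bar>x\<bar> \<longrightarrow> b k x = 0 \<and> D (b k) x = 0" by blast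
  obtain S where S: "S > 0" "\<forall>x. S < \<bar>x\<bar> \<longrightarrow> b n x = 0 \<and> D (b n) x = 0"
    using tf_radius2[OF b_tf] by blast
  show ?case by (rule exI[of _ "max R S"]) (use R S in \<open>auto simp: less_Suc_eq\<close>)
qed

text \<open>With w the function whose coordinates are the time derivatives of y,
  \<open>variation\<close> gives 2 Re (i \<open>Phi\<close> (u, w)), and \<open>Phi\<close> (u, w)
  is a sum of squared moduli, hence real.\<close>

lemma galerkin_energy:
  assumes y: "\<And>k t. k < n \<Longrightarrow> ((\<lambda>t. y t k) has_vector_derivative Phi (U n (y t)) (D (U n (y t))) (b k) (D (b k))) (at t)"
    and cont: "\<And>k t. k < n \<Longrightarrow> isCont (\<lambda>t. Phi (U n (y t)) (D (U n (y t))) (b k) (D (b k))) t"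
  shows "En (U n (y t)) (D (U n (y t))) = En (U n (y 0)) (D (U n (y 0)))"
proof -
  define y' where "y' t k = Phi (U n (y t)) (D (U n (y t))) (b k) (D (b k))" for t k
  have cy': "continuous_on UNIV (\<lambda>t. y' t k)" if "k < n" for k
    using cont[OF that] unfolding y'_def by (simp add: continuous_at_imp_continuous_on)
  have cy: "continuous_on UNIV (\<lambda>t. y t k)" if "k < n" for k
    using y[OF that] by (auto intro!: continuous_at_imp_continuous_on has_vector_derivative_continuous)
  obtain R where R: "R > 0" "\<And>k x. k < n \<Longrightarrow> R < \<bar>x\<bar> \<Longrightarrow> b k x = 0 \<and> D (b k) x = 0"
    using common_radius[of n] by blast
  define c where "c = 1 / (\<sigma> + 1)"
  define h where "h t x = (cmod (D (U n (y t)) x))\<^sup>2 + c * Im (Gz \<sigma> (U n (y t) x) * D (U n (y t)) x)" for t x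
  define h' where "h' t x = 2 * Re (D (U n (y' t)) x * cnj (D (U n (y t)) x))
    + c * Im (DG \<sigma> (U n (y t) x) (U n (y' t) x) * D (U n (y t)) x + Gz \<sigma> (U n (y t) x) * D (U n (y' t)) x)" for t x
  have En: "En (U n (y t)) (D (U n (y t))) = integral (cbox (-R) R) (h t)" for t
    unfolding h_def[abs_def] c_def by (rule energy_integral[OF U_tf]) (use R(2) in \<open>simp add: D_U\<close>)
  have du: "((\<lambda>t. U n (y t) x) has_vector_derivative U n (y' t) x) (at t)" for t x
    unfolding y'_def by (intro has_vector_derivative_sum has_vector_derivative_mult_left y) auto
  have dDu: "((\<lambda>t. D (U n (y t)) x) has_vector_derivative D (U n (y' t)) x) (at t)" for t x
    unfolding D_U y'_def by (intro has_vector_derivative_sum has_vector_derivative_mult_left y[unfolded D_U]) auto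
  have dh: "((\<lambda>t. h t x) has_vector_derivative h' t x) (at t)" for t x
  proof -
    have G: "((\<lambda>t. Gz \<sigma> (U n (y t) x)) has_vector_derivative DG \<sigma> (U n (y t) x) (U n (y' t) x)) (at t)"
      using has_derivative_compose[OF du[unfolded has_vector_derivative_def] Gz_has_derivative[OF \<sigma>_pos]]
      unfolding has_vector_derivative_def
      by (simp add: linear_cmul[OF bounded_linear.linear[OF bounded_linear_DG]])
    have 1: "((\<lambda>t. Re (D (U n (y t)) x * cnj (D (U n (y t)) x))) has_vector_derivative
        Re (D (U n (y t)) x * cnj (D (U n (y' t)) x) + D (U n (y' t)) x * cnj (D (U n (y t)) x))) (at t)"
      by (intro bounded_linear.has_vector_derivative[OF bounded_linear_Re] has_vector_derivative_mult has_vector_derivative_cnj dDu)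
    have 2: "((\<lambda>t. Im (Gz \<sigma> (U n (y t) x) * D (U n (y t)) x)) has_vector_derivative
        Im (Gz \<sigma> (U n (y t) x) * D (U n (y' t)) x + DG \<sigma> (U n (y t) x) (U n (y' t) x) * D (U n (y t)) x)) (at t)"
      by (intro bounded_linear.has_vector_derivative[OF bounded_linear_Im] has_vector_derivative_mult G dDu)
    have sqn: "Re (z * cnj z) = (cmod z)\<^sup>2" for z by (simp only: complex_norm_square[symmetric] Re_complex_of_real)
    have re: "Re (z * cnj w + w * cnj z) = 2 * Re (w * cnj z)" for z w :: complex by (simp add: algebra_simps)
    from has_vector_derivative_add[OF 1[unfolded sqn re] has_vector_derivative_mult_right[OF 2, of c]]
    show ?thesis unfolding h_def h'_def by (simp only: add.commute)
  qed
  have cU: "continuous_on (UNIV \<times> cbox (-R) R) (\<lambda>p. U n (v (fst p)) (snd p))"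
    and cDU: "continuous_on (UNIV \<times> cbox (-R) R) (\<lambda>p. D (U n (v (fst p))) (snd p))"
    if v: "\<And>k. k < n \<Longrightarrow> continuous_on UNIV (\<lambda>t. v t k)" for v
  proof -
    have v': "continuous_on (UNIV \<times> cbox (-R) R) (\<lambda>p. v (fst p) k)" if "k < n" for k
      using continuous_on_compose2[OF v[OF that] continuous_on_fst[OF continuous_on_id]] by auto
    have sc: "continuous_on (UNIV \<times> cbox (-R) R) (\<lambda>p. \<psi> (snd p))" if "continuous_on UNIV \<psi>" for \<psi> :: "real \<Rightarrow> complex"
      using continuous_on_compose2[OF that continuous_on_snd[OF continuous_on_id]] by auto
    show "continuous_on (UNIV \<times> cbox (-R) R) (\<lambda>p. U n (v (fst p)) (snd p))"
      by (intro continuous_intros v' sc TF_cont[OF b_tf]) auto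
    show "continuous_on (UNIV \<times> cbox (-R) R) (\<lambda>p. D (U n (v (fst p))) (snd p))"
      unfolding D_U by (intro continuous_intros v' sc TF_cont[OF b_tf]) auto
  qed
  note cs = cU[of y, OF cy] cDU[of y, OF cy] cU[of y', OF cy'] cDU[of y', OF cy']
  have ch': "continuous_on (UNIV \<times> cbox (-R) R) (\<lambda>(t, x). h' t x)"
    unfolding h'_def case_prod_beta
    by (intro continuous_on_add continuous_on_mult continuous_on_const continuous_on_Re continuous_on_Im
        continuous_on_cnj continuous_on_DG_comp continuous_on_Gz_comp cs)
  have hint: "h t integrable_on cbox (-R) R" for t
    unfolding h_def
    by (intro integrable_continuous continuous_on_add continuous_on_mult continuous_on_const continuous_on_power
        continuous_on_norm continuous_on_Im continuous_on_Gz_comp TF_cont[OF U_tf])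
  have "((\<lambda>t. integral (cbox (-R) R) (h t)) has_vector_derivative integral (cbox (-R) R) (h' t)) (at t within UNIV)" for t
    by (rule leibniz_rule_vector_derivative[OF _ hint ch']) (use dh in auto)
  moreover have "integral (cbox (-R) R) (h' t) = 0" for t
  proof -
    define u where "u = U n (y t)"
    define w where "w = U n (y' t)"
    have tf: "u \<in> TF" "w \<in> TF" unfolding u_def w_def by (rule U_tf)+
    have zero: "w x = 0" "D w x = 0" "u x = 0" "D u x = 0" if "R < \<bar>x\<bar>" for x
      using R(2)[OF _ that] by (auto simp: u_def w_def D_U intro!: sum.neutral)
    note c' = TF_cont[OF tf(1)] TF_cont[OF tf(2)]
    have i1: "integrable lborel (\<lambda>x. D w x * cnj (D u x))" by (rule sq_ip_integrable[OF tf_D_sq[OF tf(2)] tf_D_sq[OF tf(1)]])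
    have i2: "integrable lborel (\<lambda>x. DG \<sigma> (u x) (w x) * D u x + Gz \<sigma> (u x) * D w x)"
      by (rule continuous_compact_support_integrable[of _ R])
         (use zero in \<open>auto intro!: continuous_on_add continuous_on_mult continuous_on_DG_comp continuous_on_Gz_comp c'\<close>)
    have "integral (cbox (-R) R) (h' t) = (\<integral>x. h' t x \<partial>lborel)"
    proof (rule integral_continuous_support[symmetric])
      show "continuous_on UNIV (h' t)"
        unfolding h'_def
        by (intro continuous_on_add continuous_on_mult continuous_on_const continuous_on_Re continuous_on_Im
          continuous_on_cnj continuous_on_DG_comp continuous_on_Gz_comp TF_cont[OF U_tf])
      show "h' t x = 0" if "R < \<bar>x\<bar>" for x
        using zero[OF that] unfolding h'_def u_def w_def by simp
    qed
    also have "\<dots> = (\<integral>x. 2 * Re (D w x * cnj (D u x)) + c * Im (DG \<sigma> (u x) (w x) * D u x + Gz \<sigma> (u x) * D w x) \<partial>lborel)"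
      unfolding h'_def u_def w_def ..
    also have "\<dots> = (\<integral>x. 2 * Re (D w x * cnj (D u x)) \<partial>lborel) + (\<integral>x. c * Im (DG \<sigma> (u x) (w x) * D u x + Gz \<sigma> (u x) * D w x) \<partial>lborel)"
      by (rule Bochner_Integration.integral_add[OF integrable_mult_right[OF integrable_Re[OF i1]] integrable_mult_right[OF integrable_Im[OF i2]]])
    also have "\<dots> = 2 * Re (ip lborel (D w) (D u)) + c * Im (\<integral>x. DG \<sigma> (u x) (w x) * D u x + Gz \<sigma> (u x) * D w x \<partial>lborel)"
      unfolding ip_def integral_Re[OF i1, symmetric] integral_Im[OF i2, symmetric] by (simp only: integral_mult_right_zero)
    also have "\<dots> = 2 * Re (\<i> * Phi u (D u) w (D w))"
      unfolding c_def by (rule variation[OF tf])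
    \<comment> \<open>\<open>Phi\<close> is conjugate linear in its test function, and the equation
      identifies its value at \<open>b k\<close> with \<open>y' t k\<close>.\<close>
    also have "Phi u (D u) w (D w) = of_real (\<Sum>k<n. (cmod (y' t k))\<^sup>2)"
    proof -
      have "Phi u (D u) w (D w) = (\<Sum>k<n. cnj (y' t k) * Phi u (D u) (b k) (D (b k)))"
        unfolding w_def by (rule Phi_U_right[OF HH_tf[OF tf(1)]])
      also have "\<dots> = (\<Sum>k<n. of_real ((cmod (y' t k))\<^sup>2))"
      proof (intro sum.cong refl)
        fix k
        have "Phi u (D u) (b k) (D (b k)) = y' t k" unfolding y'_def u_def ..
        then show "cnj (y' t k) * Phi u (D u) (b k) (D (b k)) = of_real ((cmod (y' t k))\<^sup>2)"
          by (simp only: complex_norm_square mult.commute)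
      qed
      finally show ?thesis by (simp only: of_real_sum)
    qed
    finally show ?thesis by simp
  qed
  ultimately have "\<exists>c. \<forall>t\<in>UNIV. integral (cbox (-R) R) (h t) = c"
    by (intro has_derivative_zero_constant) (auto simp: has_vector_derivative_def)
  then show ?thesis unfolding En by auto
qed

theorem galerkin_solution:
  assumes \<phi>: "\<phi> \<in> lin d n"
  shows "\<exists>u :: real \<Rightarrow> real \<Rightarrow> complex. u 0 = \<phi> \<and> (\<forall>t. u t \<in> lin d n) \<and>
    (\<forall>t. N2 (u t) = N2 \<phi>) \<and> (\<forall>t. En (u t) (D (u t)) = En \<phi> (D \<phi>)) \<and>
    (\<forall>w\<in>lin d n. \<forall>t. ((\<lambda>t. ip lborel (u t) w) has_vector_derivative Phi (u t) (D (u t)) w (D w)) (at t)) \<and>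
    (\<forall>w\<in>lin d n. \<forall>t. isCont (\<lambda>t. Phi (u t) (D (u t)) w (D w)) t)"
proof -
  define init where "init k = (if k < n then ip lborel \<phi> (b k) else 0)" for k
  define R where "R = (\<Sum>k<n. (cmod (init k))\<^sup>2)"
  obtain B where B: "\<And>c k. cmod (field n R c k) \<le> B" using field_bounded[of n R] by blast
  from peano[of "field n R" B init, OF B field_continuous]
  obtain y :: "real \<Rightarrow> nat \<Rightarrow> complex" where "y 0 = init \<and> (\<forall>k t. ((\<lambda>t. y t k) has_vector_derivative field n R (y t) k) (at t))
     \<and> (\<forall>k t. isCont (\<lambda>t. field n R (y t) k) t)" ..
  then have y0: "y 0 = init" and y: "\<And>k t. ((\<lambda>t. y t k) has_vector_derivative field n R (y t) k) (at t)"
    and cy: "\<And>k t. isCont (\<lambda>t. field n R (y t) k) t" by simp_all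
  have sumR: "(\<Sum>k<n. (cmod (y t k))\<^sup>2) = R" for t
    using galerkin_charge[OF y, of t] unfolding y0 R_def .
  \<comment> \<open>The conserved square sum equals R, so the cut-off is min 1 (R + 1 - R) =
    1.\<close>
  have field: "field n R (y t) k = Phi (U n (y t)) (D (U n (y t))) (b k) (D (b k))" if "k < n" for t k
    using that by (simp add: field_def cutoff_def sumR)
  define u where "u t = U n (y t)" for t
  have u0: "u 0 = \<phi>"
  proof -
    have "u 0 = U n (\<lambda>k. ip lborel \<phi> (b k))"
      unfolding u_def y0 init_def by (intro ext sum.cong) auto
    then show ?thesis using lin_U[OF \<phi>] by simp
  qed
  have ul: "u t \<in> lin d n" for t unfolding u_def by (rule U_lin)
  have bb: "Re (ip lborel (b k) (b k)) * z = z" if "b k \<noteq> (\<lambda>x. 0)" for k z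
    using L.gs_norm_cases[of d k, OF d_test] that unfolding b_def by auto
  have charge: "N2 (u t) = N2 \<phi>" for t
  proof -
    have P: "(N2 (u t))\<^sup>2 = (\<Sum>k<n. (cmod (y t k))\<^sup>2 * Re (ip lborel (b k) (b k)))" for t
      using L.gs_Parseval[of d, OF d_test, where a="y t" and n=n] unfolding u_def b_def ip_self[of lborel "\<lambda>x. \<Sum>k<n. y t k * L.gs d k x"]
      by (simp only: Re_complex_of_real)
    have const: "cmod (y t k) = cmod (y 0 k)" if k: "k < n" "b k = (\<lambda>x. 0)" for k
    proof -
      have "((\<lambda>t. y t k) has_vector_derivative 0) (at t)" for t
        using y[of k t] field[OF k(1), of t] k(2) by (simp add: Phi_zero D_zero[abs_def])
      then have "\<exists>c. \<forall>t\<in>UNIV. y t k = c"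
        by (intro has_derivative_zero_constant) (auto simp: has_vector_derivative_def)
      then show ?thesis by auto
    qed
    have init0: "cmod (y 0 k) = 0" if "k < n" "b k = (\<lambda>x. 0)" for k
      using that by (simp add: y0 init_def)
    have "(N2 (u t))\<^sup>2 = (\<Sum>k<n. (cmod (y t k))\<^sup>2)" for t
      unfolding P
    proof (intro sum.cong refl)
      fix k assume k: "k \<in> {..<n}"
      show "(cmod (y t k))\<^sup>2 * Re (ip lborel (b k) (b k)) = (cmod (y t k))\<^sup>2"
      \<comment> \<open>For a zero basis vector the field vanishes, so the coordinate keeps its
        initial value 0 and may be counted in the square sum.\<close>
      proof (cases "b k = (\<lambda>x. 0)")
        case True
        have "((\<lambda>t. y t k) has_vector_derivative 0) (at t)" for t
          using y[of k t] field[of k t] k True by (simp add: Phi_zero D_zero[abs_def])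
        then have "\<exists>c. \<forall>t\<in>UNIV. y t k = c"
          by (intro has_derivative_zero_constant) (auto simp: has_vector_derivative_def)
        then have "y t k = y 0 k" by auto
        then show ?thesis using init0[of k] k True by simp
      next
        case False
        from bb[OF False, of "(cmod (y t k))\<^sup>2"] show ?thesis by (simp only: mult.commute)
      qed
    qed
    then have "(N2 (u t))\<^sup>2 = (N2 (u 0))\<^sup>2" using sumR[of t] sumR[of 0] by simp
    then show ?thesis unfolding u0 by (simp add: power2_eq_iff_nonneg)
  qed
  have Phi_w: "Phi f g w (D w) = (\<Sum>k<n. cnj (ip lborel w (b k)) * Phi f g (b k) (D (b k)))"
    if "w \<in> lin d n" "HH \<Omega> f g" for w f g
    using Phi_U_right[OF that(2), where n=n and c="\<lambda>k. ip lborel w (b k)"] lin_U[OF that(1)] by simp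
  have deriv: "((\<lambda>t. ip lborel (u t) w) has_vector_derivative Phi (u t) (D (u t)) w (D w)) (at t)"
    if w: "w \<in> lin d n" for w t
  proof -
    have wk: "cnj (ip lborel w (b k)) * z = z * ip lborel (b k) w" for k z
      using ip_commute[of lborel w "b k"] by simp
    have ipu: "ip lborel (u t) w = (\<Sum>k<n. y t k * ip lborel (b k) w)" for t
      unfolding u_def by (subst ip_sum_left) (auto simp: ip_cmult_left intro: sq_cmult tf_sq[OF b_tf] tf_sq[OF lin_TF[OF w]])
    have "((\<lambda>t. \<Sum>k<n. y t k * ip lborel (b k) w) has_vector_derivative (\<Sum>k<n. field n R (y t) k * ip lborel (b k) w)) (at t)"
      by (intro has_vector_derivative_sum has_vector_derivative_mult_left y)
    moreover have "(\<Sum>k<n. field n R (y t) k * ip lborel (b k) w) = Phi (u t) (D (u t)) w (D w)"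
      unfolding Phi_w[OF w HH_tf[OF lin_TF[OF ul]]] wk
      by (intro sum.cong) (auto simp: field u_def)
    ultimately show ?thesis unfolding ipu by simp
  qed
  have contin: "isCont (\<lambda>t. Phi (u t) (D (u t)) w (D w)) t" if w: "w \<in> lin d n" for w t
  proof -
    have eq: "Phi (u t) (D (u t)) w (D w) = (\<Sum>k<n. cnj (ip lborel w (b k)) * field n R (y t) k)" for t
      unfolding Phi_w[OF w HH_tf[OF lin_TF[OF ul]]] by (intro sum.cong) (auto simp: field u_def)
    show ?thesis unfolding eq by (intro continuous_intros cy)
  qed
  have energy: "En (u t) (D (u t)) = En \<phi> (D \<phi>)" for t
  proof -
    have "En (U n (y t)) (D (U n (y t))) = En (U n (y 0)) (D (U n (y 0)))"
    proof (rule galerkin_energy)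
      show "((\<lambda>t. y t k) has_vector_derivative Phi (U n (y t)) (D (U n (y t))) (b k) (D (b k))) (at t)" if "k < n" for k t
        using y[of k t] field[OF that] by simp
      show "isCont (\<lambda>t. Phi (U n (y t)) (D (U n (y t))) (b k) (D (b k))) t" if "k < n" for k t
        unfolding field[OF that, symmetric] by (rule cy)
    qed
    then show ?thesis using u0 by (simp only: u_def)
  qed
  show ?thesis
    by (intro exI[of _ u] conjI allI ballI u0 ul charge energy deriv contin)
qed

end

section \<open>A transport identity for kernels with antisymmetric derivative\<close>

text \<open>Shifting the integration variable in \<open>\<integral> f (t + h + \<delta>) t dt\<close> expresses the \<open>\<delta>\<close>-derivative of this
  integral in two ways; their difference is \<open>f (B + h) B - f (A + h) A\<close>. No joint differentiability
  of \<open>f\<close> is needed.\<close>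

lemma symmetric_kernel_transport:
  fixes f P :: "real \<Rightarrow> real \<Rightarrow> real"
  assumes cont: "continuous_on UNIV (\<lambda>p. f (fst p) (snd p))"
    and sym: "\<And>s t. f s t = f t s"
    and lip: "\<And>s s' t. \<bar>f s t - f s' t\<bar> \<le> L * \<bar>s - s'\<bar>"
    and P: "\<And>s t. ((\<lambda>s. f s t) has_real_derivative P s t) (at s)"
    and bound: "\<And>t. \<bar>P (t + h) t + P t (t + h)\<bar> \<le> \<epsilon>"
    and AB: "A \<le> B"
  shows "\<bar>f (B + h) B - f (A + h) A\<bar> \<le> \<epsilon> * (B - A)"
proof -
  define \<delta> where "\<delta> n = inverse (real (Suc n))" for n
  have \<delta>: "\<delta> n > 0" "\<delta> \<longlonglongrightarrow> 0" for n
    unfolding \<delta>_def[abs_def] using LIMSEQ_inverse_real_of_nat by auto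
  have "\<bar>f 1 0 - f 0 0\<bar> \<le> L" using lip[of 1 0 0] by simp
  then have L: "0 \<le> L" using abs_ge_zero order_trans by blast
  have fc: "continuous_on S (\<lambda>t. f (g t) (k t))" if "continuous_on S g" "continuous_on S k" for S :: "real set" and g k
    using continuous_on_compose2[OF cont continuous_on_Pair[OF that]] by simp
  have fi: "(\<lambda>t. f (g t) (k t)) integrable_on {a..b}" if "continuous_on UNIV g" "continuous_on UNIV k" for g k and a b :: real
    by (intro integrable_continuous_real fc continuous_on_subset[OF that(1) subset_UNIV] continuous_on_subset[OF that(2) subset_UNIV])
  have dq: "(\<lambda>n. (f (s + \<delta> n) t - f s t) / \<delta> n) \<longlonglongrightarrow> P s t" for s t
  proof -
    have "((\<lambda>h. (f (s + h) t - f s t) / h) \<longlongrightarrow> P s t) (at 0)" using P[of t s] by (simp add: DERIV_def)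
    then show ?thesis
      by (rule filterlim_compose[OF _ filterlim_at[THEN iffD2]]) (use \<delta> in \<open>auto simp: less_imp_neq[symmetric]\<close>)
  qed
  have dq': "(\<lambda>n. (f (s - \<delta> n) t - f s t) / \<delta> n) \<longlonglongrightarrow> - P s t" for s t
  proof -
    have "((\<lambda>h. (f (s + h) t - f s t) / h) \<longlongrightarrow> P s t) (at 0)" using P[of t s] by (simp add: DERIV_def)
    moreover have "filterlim (\<lambda>n. - \<delta> n) (at 0) sequentially"
      using tendsto_minus[OF \<delta>(2)] \<delta>(1) by (auto simp: filterlim_at less_imp_neq[symmetric])
    ultimately have "(\<lambda>n. (f (s + - \<delta> n) t - f s t) / (- \<delta> n)) \<longlonglongrightarrow> P s t"
      by (rule filterlim_compose)
    from tendsto_minus[OF this] show ?thesis by simp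
  qed
  have bd: "\<bar>(f s t - f s' t) / \<delta> n\<bar> \<le> L" if "\<bar>s - s'\<bar> = \<delta> n" for s s' t n
    using lip[of s t s'] that \<delta>(1)[of n] by (simp add: abs_divide divide_le_eq)
  \<comment> \<open>\<open>X\<close> integrates a forward difference quotient in the argument t + h.
    Symmetry of f and a shift of t by \<delta> turn it into \<open>Y\<close>, a backward difference
    quotient in the argument t, up to the boundary averages \<open>Z\<close>.\<close>
  define X where "X n = integral {A..B} (\<lambda>t. (f (t + h + \<delta> n) t - f (t + h) t) / \<delta> n)" for n
  define Y where "Y n = integral {A..B} (\<lambda>t. (f (t - \<delta> n) (t + h) - f t (t + h)) / \<delta> n)" for n
  define Z where "Z T n = integral {T..T + \<delta> n} (\<lambda>t. f (t - \<delta> n) (t + h)) / \<delta> n" for T n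
  have iX: "(\<lambda>t. (f (t + h + \<delta> n) t - f (t + h) t) / \<delta> n) integrable_on {A..B}" for n
    by (intro integrable_on_divide integrable_diff fi continuous_intros)
  have bX: "norm ((f (t + h + \<delta> n) t - f (t + h) t) / \<delta> n) \<le> L" for t n
    using bd[of "t + h + \<delta> n" "t + h" n t] \<delta>(1)[of n] by simp
  have X': "(\<lambda>t. P (t + h) t) integrable_on {A..B}" "X \<longlonglongrightarrow> integral {A..B} (\<lambda>t. P (t + h) t)"
    unfolding X_def[abs_def]
    by (rule dominated_convergence[where h="\<lambda>_. L", OF iX integrable_const_ivl bX dq])+
  have iY: "(\<lambda>t. (f (t - \<delta> n) (t + h) - f t (t + h)) / \<delta> n) integrable_on {A..B}" for n
    by (intro integrable_on_divide integrable_diff fi continuous_intros)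
  have bY: "norm ((f (t - \<delta> n) (t + h) - f t (t + h)) / \<delta> n) \<le> L" for t n
    using bd[of "t - \<delta> n" t n "t + h"] \<delta>(1)[of n] by simp
  have Y: "(\<lambda>t. - P t (t + h)) integrable_on {A..B}" "Y \<longlonglongrightarrow> integral {A..B} (\<lambda>t. - P t (t + h))"
    unfolding Y_def[abs_def]
    by (rule dominated_convergence[where h="\<lambda>_. L", OF iY integrable_const_ivl bY dq'])+
  have Z: "Z T \<longlonglongrightarrow> f T (T + h)" for T
  proof (rule LIM_zero_cancel, rule tendsto_norm_zero_cancel, rule real_tendsto_0I)
    fix n
    have lip2: "\<bar>f s t - f s t'\<bar> \<le> L * \<bar>t - t'\<bar>" for s t t' using lip[of t s t'] by (simp add: sym)
    have i: "(\<lambda>t. f (t - \<delta> n) (t + h)) integrable_on {T..T + \<delta> n}" by (intro fi continuous_intros)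
    have "norm (integral {T..T + \<delta> n} (\<lambda>t. f (t - \<delta> n) (t + h)) - (T + \<delta> n - T) *\<^sub>R f T (T + h)) \<le> (2 * L * \<delta> n) * (T + \<delta> n - T)"
    proof -
      have hi: "((\<lambda>t. f (t - \<delta> n) (t + h) - f T (T + h)) has_integral
          (integral {T..T + \<delta> n} (\<lambda>t. f (t - \<delta> n) (t + h)) - (T + \<delta> n - T) *\<^sub>R f T (T + h))) {T..T + \<delta> n}"
        using has_integral_diff[OF integrable_integral[OF i] has_integral_const_real[of "f T (T + h)" T "T + \<delta> n"]] \<delta>(1)[of n]
        by simp
      \<comment> \<open>Both arguments move by at most \<delta>, and by symmetry f is Lipschitz in
        each of them.\<close>
      have bd2: "norm (f (t - \<delta> n) (t + h) - f T (T + h)) \<le> 2 * L * \<delta> n" if t: "t \<in> {T..T + \<delta> n}" for t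
      proof -
        have "\<bar>f (t - \<delta> n) (t + h) - f T (T + h)\<bar> \<le> \<bar>f (t - \<delta> n) (t + h) - f T (t + h)\<bar> + \<bar>f T (t + h) - f T (T + h)\<bar>"
          by linarith
        also have "\<dots> \<le> L * \<bar>t - \<delta> n - T\<bar> + L * \<bar>(t + h) - (T + h)\<bar>" by (intro add_mono lip lip2)
        also have "\<dots> \<le> L * \<delta> n + L * \<delta> n" using t by (intro add_mono mult_left_mono L) auto
        finally show ?thesis by simp
      qed
      have "0 \<le> 2 * L * \<delta> n" using L \<delta>(1)[of n] by simp
      from has_integral_bound_real[OF this finite.emptyI hi] bd2 show ?thesis using \<delta>(1)[of n] by simp
    qed
    then have "\<bar>integral {T..T + \<delta> n} (\<lambda>t. f (t - \<delta> n) (t + h)) - \<delta> n * f T (T + h)\<bar> \<le> (2 * L * \<delta> n) * \<delta> n" by simp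
    moreover have "Z T n - f T (T + h) = (integral {T..T + \<delta> n} (\<lambda>t. f (t - \<delta> n) (t + h)) - \<delta> n * f T (T + h)) / \<delta> n"
      using \<delta>(1)[of n] by (simp add: Z_def diff_divide_distrib)
    ultimately show "norm (Z T n - f T (T + h)) \<le> 2 * L * \<delta> n"
      using \<delta>(1)[of n] by (simp add: abs_divide divide_le_eq)
  qed (use tendsto_mult_right_zero[OF \<delta>(2)] in auto)
  have XYZ: "X n = Y n + (Z B n - Z A n)" for n
  proof -
    define g where "g t = f (t - \<delta> n) (t + h)" for t
    have gi: "g integrable_on {a..b}" for a b unfolding g_def by (intro fi continuous_intros)
    have "integral {A..B} (\<lambda>t. f (t + h + \<delta> n) t) = integral {A..B} (\<lambda>t. g (t + \<delta> n))"
      by (intro integral_cong) (simp add: g_def sym algebra_simps)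
    also have "\<dots> = integral {A + \<delta> n..B + \<delta> n} g"
    proof -
      have "((\<lambda>t. g (1 *\<^sub>R t + \<delta> n)) has_integral integral (cbox (A + \<delta> n) (B + \<delta> n)) g /\<^sub>R 1 ^ DIM(real))
          (cbox ((A + \<delta> n - \<delta> n) /\<^sub>R 1) ((B + \<delta> n - \<delta> n) /\<^sub>R 1))"
        by (rule has_integral_affinity') (use gi integrable_integral in auto)
      then show ?thesis by (intro integral_unique) simp
    qed
    finally have 1: "integral {A..B} (\<lambda>t. f (t + h + \<delta> n) t) = integral {A + \<delta> n..B + \<delta> n} g" .
    have 2: "integral {A..A + \<delta> n} g + integral {A + \<delta> n..B + \<delta> n} g = integral {A..B + \<delta> n} g"
      by (rule Henstock_Kurzweil_Integration.integral_combine) (use AB \<delta>(1)[of n] gi in auto)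
    have 3: "integral {A..B} g + integral {B..B + \<delta> n} g = integral {A..B + \<delta> n} g"
      by (rule Henstock_Kurzweil_Integration.integral_combine) (use AB \<delta>(1)[of n] gi in auto)
    have "X n = (integral {A..B} (\<lambda>t. f (t + h + \<delta> n) t) - integral {A..B} (\<lambda>t. f (t + h) t)) / \<delta> n"
      unfolding X_def by (subst integral_divide, subst integral_diff) (auto intro!: fi continuous_intros)
    moreover have "Y n = (integral {A..B} g - integral {A..B} (\<lambda>t. f (t + h) t)) / \<delta> n"
      unfolding Y_def g_def sym[of _ "_ + h"]
      by (subst integral_divide, subst integral_diff) (auto intro!: fi continuous_intros)
    moreover have "Z B n - Z A n = (integral {B..B + \<delta> n} g - integral {A..A + \<delta> n} g) / \<delta> n"
      unfolding Z_def g_def by (simp add: diff_divide_distrib)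
    ultimately show ?thesis using 1 2 3 by (simp add: add_divide_distrib[symmetric])
  qed
  have "X \<longlonglongrightarrow> integral {A..B} (\<lambda>t. - P t (t + h)) + (f B (B + h) - f A (A + h))"
    unfolding XYZ by (intro tendsto_intros Y(2) Z)
  then have "integral {A..B} (\<lambda>t. P (t + h) t) = integral {A..B} (\<lambda>t. - P t (t + h)) + (f B (B + h) - f A (A + h))"
    by (rule LIMSEQ_unique[OF X'(2)])
  then have eq: "f (B + h) B - f (A + h) A = integral {A..B} (\<lambda>t. P (t + h) t - - P t (t + h))"
    by (subst integral_diff[OF X'(1) Y(1)]) (simp add: sym)
  have hi: "((\<lambda>t. P (t + h) t - - P t (t + h)) has_integral (f (B + h) B - f (A + h) A)) {A..B}"
    unfolding eq by (intro integrable_integral integrable_diff X'(1) Y(1))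
  have "0 \<le> \<epsilon>" using bound[of 0] by linarith
  from has_integral_bound_real[OF this finite.emptyI hi] bound AB show ?thesis by simp
qed

section \<open>Uniform bounds\<close>

lemma limit_has_integral:
  fixes G g :: "nat \<Rightarrow> real \<Rightarrow> complex"
  assumes "\<And>m. (g m has_integral (G m b - G m a)) {a..b}"
    and "\<And>t. t \<in> {a..b} \<Longrightarrow> (\<lambda>m. g m t) \<longlonglongrightarrow> g' t" "(\<lambda>m. G m a) \<longlonglongrightarrow> G' a" "(\<lambda>m. G m b) \<longlonglongrightarrow> G' b"
    and "\<And>m t. t \<in> {a..b} \<Longrightarrow> cmod (g m t) \<le> B"
  shows "(g' has_integral (G' b - G' a)) {a..b}"
proof -
  have 1: "g' integrable_on {a..b}" and 2: "(\<lambda>m. integral {a..b} (g m)) \<longlonglongrightarrow> integral {a..b} g'"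
    using dominated_convergence[of g "{a..b}" "\<lambda>_. B" g'] assms by (auto simp: has_integral_integrable)
  have "(\<lambda>m. G m b - G m a) \<longlonglongrightarrow> integral {a..b} g'"
    using 2 integral_unique[OF assms(1)] by simp
  moreover have "(\<lambda>m. G m b - G m a) \<longlonglongrightarrow> G' b - G' a" by (intro tendsto_intros assms)
  ultimately have "integral {a..b} g' = G' b - G' a" by (rule LIMSEQ_unique)
  then show ?thesis using integrable_integral[OF 1] by simp
qed

context galerkin
begin

lemma Gz_sq:
  assumes "HH \<Omega> f g"
  shows "sq lborel (\<lambda>x. Gz \<sigma> (f x))" "sq lborel (\<lambda>x. cnj (Gz \<sigma> (f x)))"
    "N2 (\<lambda>x. Gz \<sigma> (f x)) \<le> (2 * N2 f * N2 g) powr \<sigma> * N2 f"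
proof -
  have [measurable]: "f \<in> borel_measurable borel" using HH_measurable[OF assms] by simp
  have b: "cmod (f x) \<le> sqrt (2 * N2 f * N2 g)" for x
    using HH_sup_bound[OF assms, of x] by (rule real_le_rsqrt)
  have m: "(\<lambda>x. Gz \<sigma> (f x)) \<in> borel_measurable lborel" unfolding Gz_def by measurable
  have AE: "AE x in lborel. cmod (Gz \<sigma> (f x)) \<le> sqrt (2 * N2 f * N2 g) powr (2 * \<sigma>) * cmod (f x)"
    by (intro AE_I2) (use b \<sigma>_pos in \<open>auto simp: norm_Gz intro!: mult_right_mono powr_mono2\<close>)
  show s: "sq lborel (\<lambda>x. Gz \<sigma> (f x))" by (rule sq_bound[OF HH_sq(1)[OF assms] m AE])
  then show "sq lborel (\<lambda>x. cnj (Gz \<sigma> (f x)))" by (rule sq_cnj)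
  have "sqrt (2 * N2 f * N2 g) powr (2 * \<sigma>) = (2 * N2 f * N2 g) powr \<sigma>"
    by (simp add: powr_half_sqrt[symmetric] powr_powr)
  then show "N2 (\<lambda>x. Gz \<sigma> (f x)) \<le> (2 * N2 f * N2 g) powr \<sigma> * N2 f"
    using nr_mono[OF HH_sq(1)[OF assms] m AE] by simp
qed

text \<open>A Gagliardo-Nirenberg estimate in elementary form: |f|^(2 \<sigma>) is at most (2 ||f||
  ||g||)^\<sigma>, so pairing with g leaves the power 1 + \<sigma> of ||g||. The factor 1 /
  (\<sigma> + 1) is at most 1.\<close>

lemma energy_nonlinear_bound:
  assumes "HH \<Omega> f g"
  shows "\<bar>1 / (\<sigma> + 1) * Im (ip lborel g (\<lambda>x. cnj (Gz \<sigma> (f x))))\<bar> \<le> (2 * N2 f) powr \<sigma> * N2 f * N2 g powr (1 + \<sigma>)"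
proof -
  have "\<bar>Im (ip lborel g (\<lambda>x. cnj (Gz \<sigma> (f x))))\<bar> \<le> N2 g * N2 (\<lambda>x. cnj (Gz \<sigma> (f x)))"
    using ip_Cauchy_Schwarz[OF HH_sq(2)[OF assms] Gz_sq(2)[OF assms]] abs_Im_le_cmod order_trans by blast
  also have "\<dots> \<le> N2 g * ((2 * N2 f * N2 g) powr \<sigma> * N2 f)"
    using Gz_sq(3)[OF assms] by (intro mult_left_mono) auto
  also have "\<dots> = (2 * N2 f) powr \<sigma> * N2 f * N2 g powr (1 + \<sigma>)"
    by (cases "N2 g = 0") (auto simp: powr_mult powr_add nr_nonneg less_le mult_ac)
  finally have *: "\<bar>Im (ip lborel g (\<lambda>x. cnj (Gz \<sigma> (f x))))\<bar> \<le> (2 * N2 f) powr \<sigma> * N2 f * N2 g powr (1 + \<sigma>)" .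
  have "1 / (\<sigma> + 1) * \<bar>Im (ip lborel g (\<lambda>x. cnj (Gz \<sigma> (f x))))\<bar> \<le> 1 * \<bar>Im (ip lborel g (\<lambda>x. cnj (Gz \<sigma> (f x))))\<bar>"
    using \<sigma>_pos by (intro mult_right_mono) auto
  then show ?thesis using * \<sigma>_pos by (simp add: abs_mult)
qed

text \<open>This is where \<open>\<sigma> < 1\<close> enters: the nonlinear part of the energy grows more slowly than \<open>\<parallel>u\<^sub>x\<parallel>\<^sup>2\<close>.\<close>

lemma a_priori:
  assumes "HH \<Omega> f g" "N2 f \<le> M" "En f g \<le> E"
  shows "N2 g \<le> max 1 ((\<bar>E\<bar> + (2 * M) powr \<sigma> * M) powr (1 / (1 - \<sigma>)))"
proof (cases "N2 g \<le> 1")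
  case False
  define x where "x = N2 g"
  define L where "L = \<bar>E\<bar> + (2 * M) powr \<sigma> * M"
  have x: "x > 1" using False by (simp add: x_def)
  have M: "0 \<le> M" using assms(2) nr_nonneg[of lborel f] by linarith
  have "x\<^sup>2 = En f g - 1 / (\<sigma> + 1) * Im (ip lborel g (\<lambda>x. cnj (Gz \<sigma> (f x))))" by (simp add: En_def x_def)
  also have "\<dots> \<le> \<bar>E\<bar> + (2 * N2 f) powr \<sigma> * N2 f * x powr (1 + \<sigma>)"
    using energy_nonlinear_bound[OF assms(1)] assms(3) unfolding x_def by linarith
  also have "\<dots> \<le> \<bar>E\<bar> * x powr (1 + \<sigma>) + (2 * M) powr \<sigma> * M * x powr (1 + \<sigma>)"
  proof (intro add_mono mult_right_mono mult_mono powr_mono2)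
    \<comment> \<open>x > 1 absorbs the constant |E| into the power, leaving a single term to divide
      by.\<close>
    have "1 \<le> x powr (1 + \<sigma>)" using x \<sigma>_pos by (intro ge_one_powr_ge_zero) auto
    then have "\<bar>E\<bar> * 1 \<le> \<bar>E\<bar> * x powr (1 + \<sigma>)" by (rule mult_left_mono) simp
    then show "\<bar>E\<bar> \<le> \<bar>E\<bar> * x powr (1 + \<sigma>)" by simp
  qed (use assms(2) \<sigma>_pos M in auto)
  also have "\<dots> = L * x powr (1 + \<sigma>)" by (simp add: L_def algebra_simps)
  finally have "x powr 2 \<le> L * x powr (1 + \<sigma>)" using x by (simp add: powr_numeral)
  moreover have "x powr 2 = x powr (1 - \<sigma>) * x powr (1 + \<sigma>)" by (simp flip: powr_add)
  ultimately have "x powr (1 - \<sigma>) \<le> L" using x by simp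
  then have "(x powr (1 - \<sigma>)) powr (1 / (1 - \<sigma>)) \<le> L powr (1 / (1 - \<sigma>))"
    using \<sigma>_less_1 by (intro powr_mono2) auto
  then have "x \<le> L powr (1 / (1 - \<sigma>))" using \<sigma>_less_1 x by (simp add: powr_powr)
  then show ?thesis by (simp add: x_def L_def)
qed simp

lemma dense_sequence:
  assumes "HH \<Omega> f g"
  shows "\<exists>\<kappa>. (\<lambda>j. N2 (\<lambda>x. d (\<kappa> j) x - f x)) \<longlonglongrightarrow> 0 \<and> (\<lambda>j. N2 (\<lambda>x. D (d (\<kappa> j)) x - g x)) \<longlonglongrightarrow> 0"
proof -
  have ex: "\<exists>k. N2 (\<lambda>x. d k x - f x) < \<epsilon> \<and> N2 (\<lambda>x. D (d k) x - g x) < \<epsilon>" if "\<epsilon> > 0" for \<epsilon> :: real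
  proof -
    have e2: "\<epsilon> / 2 > 0" using that by simp
    obtain \<psi> where \<psi>: "\<psi> \<in> TF" "N2 (\<lambda>x. \<psi> x - f x) < \<epsilon> / 2" "N2 (\<lambda>x. D \<psi> x - g x) < \<epsilon> / 2"
      using HH_approx[OF assms e2] by blast
    obtain k where k: "N2 (\<lambda>x. \<psi> x - d k x) < \<epsilon> / 2" "N2 (\<lambda>x. D \<psi> x - D (d k) x) < \<epsilon> / 2"
      using d_dense[OF \<psi>(1) e2] by blast
    have "N2 (\<lambda>x. d k x - f x) < \<epsilon>"
      using nr_triangle_diff[OF tf_sq[OF d_test] tf_sq[OF \<psi>(1)] HH_sq(1)[OF assms], of k] k(1) \<psi>(2)
      unfolding nr_diff_commute[of lborel \<psi> "d k"] by linarith
    moreover have "N2 (\<lambda>x. D (d k) x - g x) < \<epsilon>"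
      using nr_triangle_diff[OF tf_D_sq[OF d_test] tf_D_sq[OF \<psi>(1)] HH_sq(2)[OF assms], of k] k(2) \<psi>(3)
      unfolding nr_diff_commute[of lborel "D \<psi>" "D (d k)"] by linarith
    ultimately show ?thesis by blast
  qed
  define \<epsilon> where "\<epsilon> n = inverse (real (Suc n))" for n
  have \<epsilon>: "\<epsilon> n > 0" "\<epsilon> \<longlonglongrightarrow> 0" for n
    unfolding \<epsilon>_def[abs_def] using LIMSEQ_inverse_real_of_nat by auto
  have "\<forall>n. \<exists>k. N2 (\<lambda>x. d k x - f x) < \<epsilon> n \<and> N2 (\<lambda>x. D (d k) x - g x) < \<epsilon> n" using ex[OF \<epsilon>(1)] by blast
  from choice[OF this] obtain \<kappa> where "\<forall>n. N2 (\<lambda>x. d (\<kappa> n) x - f x) < \<epsilon> n \<and> N2 (\<lambda>x. D (d (\<kappa> n)) x - g x) < \<epsilon> n" ..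
  then have \<kappa>: "N2 (\<lambda>x. d (\<kappa> n) x - f x) \<le> \<epsilon> n" "N2 (\<lambda>x. D (d (\<kappa> n)) x - g x) \<le> \<epsilon> n" for n
    by (auto intro: less_imp_le)
  show ?thesis
    by (intro exI[of _ \<kappa>] conjI real_tendsto_0I[OF nr_nonneg \<kappa>(1) \<epsilon>(2)] real_tendsto_0I[OF nr_nonneg \<kappa>(2) \<epsilon>(2)])
qed

text \<open>The difference k of the two derivatives belongs to the function 0, so integration by
  parts makes it orthogonal to every D \<psi>; being itself an L2 limit of such derivatives, k is
  orthogonal to itself.\<close>

lemma HH_deriv_unique:
  assumes "HH \<Omega> f g" "HH \<Omega> f h"
  shows "AE x in lborel. g x = h x"
proof -
  define k where "k x = g x - h x" for x
  have Hk: "HH \<Omega> (\<lambda>x. 0) k" using HH_diff[OF assms] by (simp add: k_def[abs_def])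
  have ks: "sq lborel k" using HH_sq(2)[OF Hk] .
  have "ip lborel (D \<psi>) k = 0" if "\<psi> \<in> TF" for \<psi>
  proof -
    have "(\<integral>x. 0 * D (\<lambda>x. cnj (D \<psi> x)) x \<partial>lborel) = - (\<integral>x. k x * cnj (D \<psi> x) \<partial>lborel)"
      by (rule HH_by_parts[OF Hk tf_cnj[OF tf_dir_deriv[OF that]]])
    then have "ip lborel k (D \<psi>) = 0" by (simp add: ip_def)
    then show ?thesis using ip_commute[of lborel "D \<psi>" k] by simp
  qed
  moreover obtain \<psi> where p: "\<And>n. \<psi> n \<in> TF" "(\<lambda>n. N2 (\<lambda>x. D (\<psi> n) x - k x)) \<longlonglongrightarrow> 0"
    using HH_seq[OF Hk] by metis
  ultimately have "(\<lambda>n. 0) \<longlonglongrightarrow> ip lborel k k"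
    using tendsto_ip_left[OF tf_D_sq[OF p(1)] ks ks p(2)] by simp
  then have "ip lborel k k = 0" by (simp add: LIMSEQ_const_iff)
  then have "N2 k = 0" by (simp add: ip_self)
  from nr_zero_imp_AE[OF ks this] show ?thesis by eventually_elim (simp add: k_def)
qed

end

section \<open>The weak limit of the Galerkin approximations\<close>

text \<open>Interface between the compactness argument and the properties of the limit. The equation
  \<open>evol\<close> admits every test function in H1_0, not only members of a Galerkin space, so
  that u at a fixed time may be inserted. \<open>u_eq\<close> and \<open>v_eq\<close> retain
  explicit formulas for the sake of joint measurability.\<close>

locale evolution = galerkin +
  fixes C :: real and a :: "real \<Rightarrow> nat \<Rightarrow> complex" and u v :: "real \<Rightarrow> real \<Rightarrow> complex"
    and A :: "nat \<Rightarrow> real \<Rightarrow> nat \<Rightarrow> complex" and un :: "nat \<Rightarrow> real \<Rightarrow> real \<Rightarrow> complex"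
    and \<phi> \<phi>' :: "real \<Rightarrow> complex"
  assumes C_nonneg: "0 \<le> C"
    and init: "HH \<Omega> \<phi> \<phi>'"
    and a_bound: "\<And>t N. (\<Sum>k<N. (cmod (a t k))\<^sup>2) \<le> C\<^sup>2"
    and a_rep: "\<And>t. rep (a t) (u t) (v t)"
    and a_cont: "\<And>k. continuous_on UNIV (\<lambda>t. a t k)"
    and u_eq: "\<And>t x. u t x = lim (\<lambda>N. S (a t) N x)"
    and v_eq: "\<And>t. v t = Gn (a t)"
    and u_0: "u 0 = \<phi>"
    and un_TF: "\<And>j t. un j t \<in> TF"
    and A_rep: "\<And>j t. rep (A j t) (un j t) (D (un j t))"
    and A_bound: "\<And>j t N. (\<Sum>k<N. (cmod (A j t k))\<^sup>2) \<le> C\<^sup>2"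
    and A_lim: "\<And>t k. (\<lambda>j. A j t k) \<longlonglongrightarrow> a t k"
    and un_charge: "\<And>j t. N2 (un j t) = N2 (un j 0)"
    and un_energy: "\<And>j t. En (un j t) (D (un j t)) = En (un j 0) (D (un j 0))"
    and un_init: "(\<lambda>j. N2 (\<lambda>x. un j 0 x - \<phi> x)) \<longlonglongrightarrow> 0" "(\<lambda>j. N2 (\<lambda>x. D (un j 0) x - \<phi>' x)) \<longlonglongrightarrow> 0"
    and evol: "\<And>w w' s t. HH \<Omega> w w' \<Longrightarrow> s \<le> t \<Longrightarrow>
      ((\<lambda>\<tau>. Phi (u \<tau>) (v \<tau>) w w') has_integral (ip lborel (u t) w - ip lborel (u s) w)) {s..t}"

lemma LIMSEQ_bounded:
  fixes x :: "nat \<Rightarrow> real"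
  assumes "x \<longlonglongrightarrow> l"
  shows "\<exists>M\<ge>0. \<forall>n. x n \<le> M"
proof -
  have "Bseq x" using assms by (intro convergent_imp_Bseq) (auto simp: convergent_def)
  then obtain K where "K > 0" "\<forall>n. norm (x n) \<le> K" by (auto simp: Bseq_def)
  then show ?thesis by (intro exI[of _ K]) (auto simp: abs_le_iff)
qed

context galerkin
begin

lemma En_le:
  assumes "HH \<Omega> f g" "N2 f \<le> M" "N2 g \<le> M'"
  shows "En f g \<le> M'\<^sup>2 + (2 * M) powr \<sigma> * M * M' powr (1 + \<sigma>)"
proof -
  have M: "0 \<le> M" "0 \<le> M'" using assms(2,3) nr_nonneg[of lborel f] nr_nonneg[of lborel g] by linarith+
  have "1 / (\<sigma> + 1) * Im (ip lborel g (\<lambda>x. cnj (Gz \<sigma> (f x)))) \<le> (2 * N2 f) powr \<sigma> * N2 f * N2 g powr (1 + \<sigma>)"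
    using energy_nonlinear_bound[OF assms(1)] by (rule order_trans[OF abs_ge_self])
  also have "\<dots> \<le> (2 * M) powr \<sigma> * M * M' powr (1 + \<sigma>)"
    using assms \<sigma>_pos M by (intro mult_mono powr_mono2) auto
  finally show ?thesis
    unfolding En_def using power_mono[OF assms(3), of 2] by simp
qed

lemma has_vector_derivative_imp_integral:
  fixes g :: "real \<Rightarrow> complex"
  assumes "\<And>t. (g has_vector_derivative g' t) (at t)" "s \<le> t"
  shows "(g' has_integral (g t - g s)) {s..t}"
  by (rule fundamental_theorem_of_calculus) (use assms in \<open>auto intro: has_vector_derivative_at_within\<close>)

theorem weak_limit:
  assumes init: "HH \<Omega> \<phi> \<phi>'"
  shows "\<exists>C a u v A un. evolution \<Omega> d \<sigma> C a u v A un \<phi> \<phi>'"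
proof -
  obtain \<kappa> where \<kappa>: "(\<lambda>j. N2 (\<lambda>x. d (\<kappa> j) x - \<phi> x)) \<longlonglongrightarrow> 0" "(\<lambda>j. N2 (\<lambda>x. D (d (\<kappa> j)) x - \<phi>' x)) \<longlonglongrightarrow> 0"
    using dense_sequence[OF init] by blast
  define \<nu> where "\<nu> j = max (Suc (\<kappa> j)) j" for j
  have "d (\<kappa> j) \<in> lin d (\<nu> j)" for j by (rule lin_basis) (simp add: \<nu>_def)
  then have "\<forall>j. \<exists>u :: real \<Rightarrow> real \<Rightarrow> complex. u 0 = d (\<kappa> j) \<and> (\<forall>t. u t \<in> lin d (\<nu> j)) \<and>
    (\<forall>t. N2 (u t) = N2 (d (\<kappa> j))) \<and> (\<forall>t. En (u t) (D (u t)) = En (d (\<kappa> j)) (D (d (\<kappa> j)))) \<and>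
    (\<forall>w\<in>lin d (\<nu> j). \<forall>t. ((\<lambda>t. ip lborel (u t) w) has_vector_derivative Phi (u t) (D (u t)) w (D w)) (at t)) \<and>
    (\<forall>w\<in>lin d (\<nu> j). \<forall>t. isCont (\<lambda>t. Phi (u t) (D (u t)) w (D w)) t)"
    by (intro allI galerkin_solution)
  from choice[OF this] obtain W :: "nat \<Rightarrow> real \<Rightarrow> real \<Rightarrow> complex"
    where "\<forall>j. W j 0 = d (\<kappa> j) \<and> (\<forall>t. W j t \<in> lin d (\<nu> j)) \<and>
    (\<forall>t. N2 (W j t) = N2 (d (\<kappa> j))) \<and> (\<forall>t. En (W j t) (D (W j t)) = En (d (\<kappa> j)) (D (d (\<kappa> j)))) \<and>
    (\<forall>w\<in>lin d (\<nu> j). \<forall>t. ((\<lambda>t. ip lborel (W j t) w) has_vector_derivative Phi (W j t) (D (W j t)) w (D w)) (at t)) \<and>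
    (\<forall>w\<in>lin d (\<nu> j). \<forall>t. isCont (\<lambda>t. Phi (W j t) (D (W j t)) w (D w)) t)" ..
  then have W0: "\<And>j. W j 0 = d (\<kappa> j)" and Wlin: "\<And>j t. W j t \<in> lin d (\<nu> j)"
    and WN: "\<And>j t. N2 (W j t) = N2 (d (\<kappa> j))"
    and WE: "\<And>j t. En (W j t) (D (W j t)) = En (d (\<kappa> j)) (D (d (\<kappa> j)))"
    and Wd: "\<And>j t w. w \<in> lin d (\<nu> j) \<Longrightarrow> ((\<lambda>t. ip lborel (W j t) w) has_vector_derivative Phi (W j t) (D (W j t)) w (D w)) (at t)"
    by simp_all
  have WT: "W j t \<in> TF" for j t using lin_TF[OF Wlin] .
  have WH: "HH \<Omega> (W j t) (D (W j t))" for j t by (rule HH_tf[OF WT])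
  obtain M where M: "M \<ge> 0" "\<And>j. N2 (d (\<kappa> j)) \<le> M"
    using LIMSEQ_bounded[OF tendsto_nr[OF tf_sq[OF d_test] HH_sq(1)[OF init] \<kappa>(1)]] by blast
  obtain M' where M': "M' \<ge> 0" "\<And>j. N2 (D (d (\<kappa> j))) \<le> M'"
    using LIMSEQ_bounded[OF tendsto_nr[OF tf_D_sq[OF d_test] HH_sq(2)[OF init] \<kappa>(2)]] by blast
  define E where "E = M'\<^sup>2 + (2 * M) powr \<sigma> * M * M' powr (1 + \<sigma>)"
  \<comment> \<open>The larger of the charge bound and of the bound from \<open>a_priori\<close>;
    independent of j and of time.\<close>
  define C1 where "C1 = max M (max 1 ((\<bar>E\<bar> + (2 * M) powr \<sigma> * M) powr (1 / (1 - \<sigma>))))"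
  have WM: "N2 (W j t) \<le> M" for j t unfolding WN by (rule M(2))
  have N2W: "N2 (W j t) \<le> C1" "N2 (D (W j t)) \<le> C1" for j t
  proof -
    show "N2 (W j t) \<le> C1" using WM[of j t] by (simp add: C1_def)
    have "En (W j t) (D (W j t)) \<le> E"
      unfolding WE E_def by (rule En_le[OF HH_tf[OF d_test] M(2) M'(2)])
    from a_priori[OF WH WM this] show "N2 (D (W j t)) \<le> C1" by (simp add: C1_def)
  qed
  have C1: "C1 \<ge> 1" by (simp add: C1_def)
  \<comment> \<open>The H1 norm combines two norms bounded by \<open>C1\<close>, hence is at most
    twice as large.\<close>
  define C where "C = 2 * C1"
  have C: "0 \<le> C" using C1 by (simp add: C_def)
  define A0 where "A0 j t k = hip (W j t) (e k)" for j t k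
  have A0b: "(\<Sum>k<N. (cmod (A0 j t k))\<^sup>2) \<le> C\<^sup>2" for j t N
  proof -
    have "(\<Sum>k<N. (cmod (A0 j t k))\<^sup>2) \<le> (sqrt (Re (hip (W j t) (W j t))))\<^sup>2"
      unfolding A0_def by (rule coef_bound[OF WT])
    also have "\<dots> = (N2 (W j t))\<^sup>2 + (N2 (D (W j t)))\<^sup>2" by (simp add: hip_self)
    also have "\<dots> \<le> C1\<^sup>2 + C1\<^sup>2" by (intro add_mono power_mono N2W) auto
    also have "\<dots> \<le> C\<^sup>2" by (simp add: C_def power2_eq_square)
    finally show ?thesis .
  qed
  have A0r: "rep (A0 j t) (W j t) (D (W j t))" for j t
    unfolding A0_def by (rule coef_rep[OF Wlin])
  define K where "K = KC C1 * (4 * C1)"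
  have K: "0 \<le> K" using C1 KC_nonneg[of C1] by (simp add: K_def)
  \<comment> \<open>The difference w of two times lies in the Galerkin space, so the equation may be
    tested with w itself: ||w||^2 is at most |t - s| times a bound for \<open>Phi\<close>. This
    gives Hoelder exponent 1/2 in L2.\<close>
  have Wt: "(N2 (\<lambda>x. W j t x - W j s x))\<^sup>2 \<le> K * \<bar>t - s\<bar>" for j s t
  proof -
    define w where "w x = W j t x - W j s x" for x
    have wl: "w \<in> lin d (\<nu> j)" unfolding w_def by (intro lin_diff Wlin)
    have wT: "w \<in> TF" by (rule lin_TF[OF wl])
    have Dw: "D w = (\<lambda>x. D (W j t) x - D (W j s) x)"
      unfolding w_def by (intro ext D_diff[OF WT WT])
    have Nw: "N2 w \<le> 2 * C1" "N2 (D w) \<le> 2 * C1"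
      using nr_diff_le[OF tf_sq[OF WT] tf_sq[OF WT], of j t j s] nr_diff_le[OF tf_D_sq[OF WT] tf_D_sq[OF WT], of j t j s]
        N2W[of j t] N2W[of j s] unfolding Dw w_def by auto
    have bd: "cmod (Phi (W j \<tau>) (D (W j \<tau>)) w (D w)) \<le> K" for \<tau>
    proof -
      have "cmod (Phi (W j \<tau>) (D (W j \<tau>)) w (D w)) \<le> KC C1 * (N2 w + N2 (D w))"
        by (rule Phi_bound[OF WH N2W tf_sq[OF wT] tf_D_sq[OF wT]])
      also have "\<dots> \<le> K" unfolding K_def using Nw C1 by (intro mult_left_mono KC_nonneg) auto
      finally show ?thesis .
    qed
    have "norm (ip lborel (W j t) w - ip lborel (W j s) w) \<le> K * norm (t - s)"
    proof (rule differentiable_bound[of UNIV])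
      show "((\<lambda>t. ip lborel (W j t) w) has_derivative (\<lambda>h. h *\<^sub>R Phi (W j \<tau>) (D (W j \<tau>)) w (D w))) (at \<tau> within UNIV)" for \<tau>
        using Wd[OF wl, of \<tau>] by (simp add: has_vector_derivative_def)
      show "onorm (\<lambda>h. h *\<^sub>R Phi (W j \<tau>) (D (W j \<tau>)) w (D w)) \<le> K" for \<tau>
      proof (rule onorm_le)
        show "norm (h *\<^sub>R Phi (W j \<tau>) (D (W j \<tau>)) w (D w)) \<le> K * norm h" for h
          using mult_right_mono[OF bd[of \<tau>] norm_ge_zero[of h]] by (simp add: mult.commute)
      qed
    qed auto
    moreover have "ip lborel (W j t) w - ip lborel (W j s) w = ip lborel w w"
      unfolding w_def by (rule ip_diff_left[symmetric]) (intro tf_sq[OF WT] sq_diff)+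
    ultimately show ?thesis by (simp add: ip_self w_def[abs_def] norm_power)
  qed
  define Q where "Q k = N2 (\<lambda>x. e k x - D (D (e k)) x)" for k
  \<comment> \<open>Integration by parts puts the derivative of w on the smooth \<open>e k\<close>,
    so that L2 continuity in time controls the H1 coefficients; \<open>Q k\<close> is the norm of e
    - e''.\<close>
  have A0t: "cmod (A0 j t k - A0 j s k) \<le> sqrt (K * \<bar>t - s\<bar>) * Q k" for j s t k
  proof -
    define w where "w x = W j t x - W j s x" for x
    have wT: "w \<in> TF" unfolding w_def by (intro tf_diff WT)
    have "A0 j t k - A0 j s k = hip w (e k)"
      unfolding A0_def w_def by (rule H.Q_diff[OF WT WT e_tf, symmetric])
    also have "\<dots> = ip lborel w (e k) + (\<integral>x. D w x * cnj (D (e k) x) \<partial>lborel)" by (simp add: hip_def ip_def)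
    also have "(\<integral>x. D w x * cnj (D (e k) x) \<partial>lborel) = - (\<integral>x. w x * D (\<lambda>x. cnj (D (e k) x)) x \<partial>lborel)"
      by (rule tf_by_parts[OF wT tf_cnj[OF tf_dir_deriv[OF e_tf]]])
    also have "\<dots> = - ip lborel w (D (D (e k)))" by (simp add: ip_def D_cnj[OF tf_dir_deriv[OF e_tf]])
    also have "ip lborel w (e k) + - ip lborel w (D (D (e k))) = ip lborel w (\<lambda>x. e k x - D (D (e k)) x)"
      by (subst ip_diff_right[OF tf_sq[OF e_tf] tf_D_sq[OF tf_dir_deriv[OF e_tf]] tf_sq[OF wT]]) simp
    finally have "cmod (A0 j t k - A0 j s k) \<le> N2 w * Q k"
      unfolding Q_def using ip_Cauchy_Schwarz[OF tf_sq[OF wT] sq_diff[OF tf_sq[OF e_tf] tf_D_sq[OF tf_dir_deriv[OF e_tf]]]] by simp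
    also have "\<dots> \<le> sqrt (K * \<bar>t - s\<bar>) * Q k"
      using Wt[of j t s] unfolding w_def Q_def by (intro mult_right_mono real_le_rsqrt) auto
    finally show ?thesis .
  qed
  have Qlim: "((\<lambda>s. sqrt (K * \<bar>t - s\<bar>) * Q k) \<longlongrightarrow> 0) (at t)" for t k
  proof -
    have "((\<lambda>s. sqrt (K * \<bar>t - s\<bar>) * Q k) \<longlongrightarrow> sqrt (K * \<bar>t - t\<bar>) * Q k) (at t)" by (intro tendsto_intros)
    then show ?thesis by simp
  qed
  have "\<exists>r a. strict_mono r \<and> (\<forall>t k. (\<lambda>n. A0 (r n) t k) \<longlonglongrightarrow> a t k)"
  proof (rule diagonal_equicontinuous)
    show "cmod (A0 n t k) \<le> C" for n t k
    proof (rule power2_le_imp_le[OF _ C])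
      have "(cmod (A0 n t k))\<^sup>2 \<le> (\<Sum>k<Suc k. (cmod (A0 n t k))\<^sup>2)" by (intro member_le_sum) auto
      then show "(cmod (A0 n t k))\<^sup>2 \<le> C\<^sup>2" using A0b[of n t "Suc k"] by linarith
    qed
    fix t k and \<epsilon> :: real assume \<epsilon>: "\<epsilon> > 0"
    have "\<forall>\<^sub>F s in at t. sqrt (K * \<bar>t - s\<bar>) * Q k < \<epsilon>" by (rule order_tendstoD(2)[OF Qlim \<epsilon>])
    then obtain \<delta> where \<delta>: "\<delta> > 0" "\<And>s. s \<noteq> t \<Longrightarrow> dist s t < \<delta> \<Longrightarrow> sqrt (K * \<bar>t - s\<bar>) * Q k < \<epsilon>"
      unfolding eventually_at by auto
    show "\<exists>\<delta>>0. \<forall>s. \<bar>t - s\<bar> < \<delta> \<longrightarrow> (\<forall>\<^sub>F n in sequentially. cmod (A0 n t k - A0 n s k) \<le> \<epsilon>)"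
    proof (intro exI[of _ \<delta>] conjI allI impI \<delta>(1) always_eventually)
      fix s n assume s: "\<bar>t - s\<bar> < \<delta>"
      show "cmod (A0 n t k - A0 n s k) \<le> \<epsilon>"
        using A0t[of n t k s] \<delta>(2)[of s] s \<epsilon> by (cases "s = t") (auto simp: dist_real_def abs_minus_commute)
    qed
  qed
  then obtain r a where r: "strict_mono (r :: nat \<Rightarrow> nat)" and lim: "\<And>t k. (\<lambda>n. A0 (r n) t k) \<longlonglongrightarrow> a t k" by blast
  define u where "u t x = lim (\<lambda>N. S (a t) N x)" for t x
  define v where "v t = Gn (a t)" for t
  have ab: "(\<Sum>k<N. (cmod (a t k))\<^sup>2) \<le> C\<^sup>2" for t N
    by (rule weak_limit_square_bound[OF A0b lim])
  have ar: "rep (a t) (u t) (v t)" for t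
    unfolding u_def[abs_def] v_def by (rule rep_lim_Gn[OF summable_square_bound[OF ab]])
  have acont: "continuous_on UNIV (\<lambda>t. a t k)" for k
  proof (rule continuous_at_imp_continuous_on, intro ballI)
    fix t
    have le: "cmod (a s k - a t k) \<le> sqrt (K * \<bar>t - s\<bar>) * Q k" for s
    proof (rule LIMSEQ_le_const2)
      show "(\<lambda>n. cmod (A0 (r n) s k - A0 (r n) t k)) \<longlonglongrightarrow> cmod (a s k - a t k)" by (intro tendsto_intros lim)
      show "\<exists>N. \<forall>n\<ge>N. cmod (A0 (r n) s k - A0 (r n) t k) \<le> sqrt (K * \<bar>t - s\<bar>) * Q k"
        using A0t[of _ s k t] by (simp add: abs_minus_commute)
    qed
    have "((\<lambda>s. a s k - a t k) \<longlongrightarrow> 0) (at t)"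
      by (rule Lim_null_comparison[OF always_eventually[OF allI[OF le]] Qlim])
    then show "isCont (\<lambda>t. a t k) t" by (simp add: isCont_def LIM_zero_cancel)
  qed
  have uv: "N2 (u t) \<le> C" "N2 (v t) \<le> C" for t using rep_norm(1,2)[OF ar ab C] by blast+
  have uvH: "HH \<Omega> (u t) (v t)" for t by (rule rep_HH[OF ar])
  have ev1: "((\<lambda>\<tau>. Phi (u \<tau>) (v \<tau>) (d m) (D (d m))) has_integral (ip lborel (u t) (d m) - ip lborel (u s) (d m))) {s..t}"
    if "s \<le> t" for s t m
  proof -
    \<comment> \<open>A strictly increasing r satisfies r n >= n, so from this index on the Galerkin
      space contains \<open>d m\<close>.\<close>
    define q where "q n = r (n + Suc m)" for n
    have qm: "Suc m \<le> q n" for n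
      using seq_suble[OF r, of "n + Suc m"] by (simp add: q_def)
    have dl: "d m \<in> lin d (\<nu> (q n))" for n
      by (rule lin_basis) (use qm[of n] in \<open>simp add: \<nu>_def\<close>)
    have limq: "(\<lambda>n. A0 (q n) t k) \<longlonglongrightarrow> a t k" for t k
      unfolding q_def by (rule LIMSEQ_ignore_initial_segment[OF lim])
    have ipl: "(\<lambda>n. ip lborel (W (q n) \<tau>) (d m)) \<longlonglongrightarrow> ip lborel (u \<tau>) (d m)" for \<tau>
      by (rule weak_ip[OF A0r ar A0b C limq tf_sq[OF d_test]])
    show ?thesis
    proof (rule limit_has_integral[where G="\<lambda>n t. ip lborel (W (q n) t) (d m)" and G'="\<lambda>t. ip lborel (u t) (d m)", OF _ _ ipl ipl])
      show "((\<lambda>\<tau>. Phi (W (q n) \<tau>) (D (W (q n) \<tau>)) (d m) (D (d m))) has_integral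
          (ip lborel (W (q n) t) (d m) - ip lborel (W (q n) s) (d m))) {s..t}" for n
        by (rule has_vector_derivative_imp_integral[OF Wd[OF dl] that])
      show "(\<lambda>n. Phi (W (q n) \<tau>) (D (W (q n) \<tau>)) (d m) (D (d m))) \<longlonglongrightarrow> Phi (u \<tau>) (v \<tau>) (d m) (D (d m))" for \<tau>
        by (rule Phi_weak_continuous[OF A0r ar A0b C limq tf_sq[OF d_test] tf_D_sq[OF d_test]])
      show "cmod (Phi (W (q n) \<tau>) (D (W (q n) \<tau>)) (d m) (D (d m))) \<le> KC C1 * (N2 (d m) + N2 (D (d m)))" for n \<tau>
        by (rule Phi_bound[OF WH N2W tf_sq[OF d_test] tf_D_sq[OF d_test]])
    qed
  qed
  \<comment> \<open>Density extends the equation from the \<open>d m\<close> to all of H1_0, as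
    \<open>Phi\<close> is bounded by the H1 size of its test function uniformly in time.\<close>
  have ev: "((\<lambda>\<tau>. Phi (u \<tau>) (v \<tau>) w w') has_integral (ip lborel (u t) w - ip lborel (u s) w)) {s..t}"
    if w: "HH \<Omega> w w'" and st: "s \<le> t" for w w' s t
  proof -
    obtain \<mu> where \<mu>: "(\<lambda>j. N2 (\<lambda>x. d (\<mu> j) x - w x)) \<longlonglongrightarrow> 0" "(\<lambda>j. N2 (\<lambda>x. D (d (\<mu> j)) x - w' x)) \<longlonglongrightarrow> 0"
      using dense_sequence[OF w] by blast
    obtain B where B: "B \<ge> 0" "\<And>j. N2 (d (\<mu> j)) \<le> B"
      using LIMSEQ_bounded[OF tendsto_nr[OF tf_sq[OF d_test] HH_sq(1)[OF w] \<mu>(1)]] by blast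
    obtain B' where B': "B' \<ge> 0" "\<And>j. N2 (D (d (\<mu> j))) \<le> B'"
      using LIMSEQ_bounded[OF tendsto_nr[OF tf_D_sq[OF d_test] HH_sq(2)[OF w] \<mu>(2)]] by blast
    have ipl: "(\<lambda>j. ip lborel (u \<tau>) (d (\<mu> j))) \<longlonglongrightarrow> ip lborel (u \<tau>) w" for \<tau>
    proof -
      have "(\<lambda>j. cnj (ip lborel (d (\<mu> j)) (u \<tau>))) \<longlonglongrightarrow> cnj (ip lborel w (u \<tau>))"
        by (intro tendsto_cnj tendsto_ip_left tf_sq[OF d_test] HH_sq[OF w] HH_sq[OF uvH] \<mu>)
      then show ?thesis by (simp only: ip_commute[symmetric])
    qed
    show ?thesis
    proof (rule limit_has_integral[where G="\<lambda>j t. ip lborel (u t) (d (\<mu> j))" and G'="\<lambda>t. ip lborel (u t) w", OF ev1[OF st] _ ipl ipl])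
      show "(\<lambda>j. Phi (u \<tau>) (v \<tau>) (d (\<mu> j)) (D (d (\<mu> j)))) \<longlonglongrightarrow> Phi (u \<tau>) (v \<tau>) w w'" for \<tau>
      proof (rule LIM_zero_cancel, rule tendsto_norm_zero_cancel, rule real_tendsto_0I)
        fix j
        have "Phi (u \<tau>) (v \<tau>) (d (\<mu> j)) (D (d (\<mu> j))) - Phi (u \<tau>) (v \<tau>) w w'
            = Phi (u \<tau>) (v \<tau>) (\<lambda>x. d (\<mu> j) x - w x) (\<lambda>x. D (d (\<mu> j)) x - w' x)"
          by (rule Phi_diff[OF uvH tf_sq[OF d_test] tf_D_sq[OF d_test] HH_sq[OF w], symmetric])
        then show "norm (Phi (u \<tau>) (v \<tau>) (d (\<mu> j)) (D (d (\<mu> j))) - Phi (u \<tau>) (v \<tau>) w w')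
            \<le> KC C * (N2 (\<lambda>x. d (\<mu> j) x - w x) + N2 (\<lambda>x. D (d (\<mu> j)) x - w' x))"
          using Phi_bound[OF uvH uv sq_diff[OF tf_sq[OF d_test] HH_sq(1)[OF w]] sq_diff[OF tf_D_sq[OF d_test] HH_sq(2)[OF w]]]
          by simp
      qed (rule norm_ge_zero, rule tendsto_mult_right_zero[OF tendsto_add_zero[OF \<mu>]])
      show "cmod (Phi (u \<tau>) (v \<tau>) (d (\<mu> j)) (D (d (\<mu> j)))) \<le> KC C * (B + B')" for j \<tau>
        by (rule order_trans[OF Phi_bound[OF uvH uv tf_sq[OF d_test] tf_D_sq[OF d_test]]])
           (intro mult_left_mono add_mono B B' KC_nonneg C)
    qed
  qed
  have \<kappa>r: "(\<lambda>j. N2 (\<lambda>x. W (r j) 0 x - \<phi> x)) \<longlonglongrightarrow> 0" "(\<lambda>j. N2 (\<lambda>x. D (W (r j) 0) x - \<phi>' x)) \<longlonglongrightarrow> 0"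
    using LIMSEQ_subseq_LIMSEQ[OF \<kappa>(1) r] LIMSEQ_subseq_LIMSEQ[OF \<kappa>(2) r] unfolding W0 o_def by auto
  have u0: "u 0 = \<phi>"
  proof
    fix x
    \<comment> \<open>H1 convergence of the initial data is pointwise by the sup bound, and weak
      convergence is pointwise too; hence equality at every point.\<close>
    have "(\<lambda>j. W (r j) 0 x - \<phi> x) \<longlonglongrightarrow> 0"
    proof (rule tendsto_norm_zero_cancel, rule real_tendsto_0I)
      fix j
      show "norm (W (r j) 0 x - \<phi> x) \<le> 2 * (N2 (\<lambda>x. W (r j) 0 x - \<phi> x) + N2 (\<lambda>x. D (W (r j) 0) x - \<phi>' x))"
        by (rule HH_sup_bound'[OF HH_diff[OF WH init]]) auto
    qed (rule norm_ge_zero, rule tendsto_mult_right_zero[OF tendsto_add_zero[OF \<kappa>r]])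
    then have "(\<lambda>j. W (r j) 0 x) \<longlonglongrightarrow> \<phi> x" by (rule LIM_zero_cancel)
    moreover have "(\<lambda>j. W (r j) 0 x) \<longlonglongrightarrow> u 0 x"
      by (rule weak_pointwise[OF A0r ar A0b C lim])
    ultimately show "u 0 x = \<phi> x" by (metis LIMSEQ_unique)
  qed
  have "evolution \<Omega> d \<sigma> C a u v (\<lambda>j. A0 (r j)) (\<lambda>j. W (r j)) \<phi> \<phi>'"
    by (intro evolution.intro evolution_axioms.intro galerkin_axioms C init ab ar acont u_def v_def u0 WT A0r A0b lim \<kappa>r ev)
       (simp_all add: WN WE W0)
  then show ?thesis by blast
qed

end

section \<open>Conservation of charge and the energy inequality\<close>

context basis
begin

text \<open>The partial sums of one expansion form a sequence of the kind treated by the weak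
  convergence lemmas, so identities for test functions carry over to H1_0.\<close>

lemma rep_truncate:
  assumes "rep a f g"
  defines "a' \<equiv> \<lambda>n k. if k < n then a k else 0"
  shows "rep (a' n) (S a n) (D (S a n))" "(\<lambda>n. a' n k) \<longlonglongrightarrow> a k"
    "(\<Sum>k<N. (cmod (a' n k))\<^sup>2) \<le> (\<Sum>k<N. (cmod (a k))\<^sup>2)"
proof -
  have "S (a' n) n x = S a n x" for x unfolding a'_def by (intro sum.cong) auto
  then have eq: "S (a' n) n = S a n" by blast
  have "a' n k = 0" if "k \<ge> n" for k using that by (simp add: a'_def)
  from rep_finite[of n "a' n", OF this] show "rep (a' n) (S a n) (D (S a n))" unfolding eq .
  show "(\<lambda>n. a' n k) \<longlonglongrightarrow> a k"
    by (rule tendsto_eventually) (auto simp: a'_def eventually_sequentially intro!: exI[of _ "Suc k"])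
  show "(\<Sum>k<N. (cmod (a' n k))\<^sup>2) \<le> (\<Sum>k<N. (cmod (a k))\<^sup>2)"
    by (intro sum_mono) (auto simp: a'_def)
qed

end

context galerkin
begin

text \<open>\<open>weak_nonlinear\<close> keeps the second argument f fixed, whereas for test
  functions the identity has the partial sum there; the discrepancy is controlled by the L2 distance
  of the partial sum from f.\<close>

lemma rep_charge_identity:
  assumes r: "rep a f g" and bd: "\<And>N. (\<Sum>k<N. (cmod (a k))\<^sup>2) \<le> C\<^sup>2" and C: "0 \<le> C"
  shows "Re (ip lborel (\<lambda>x. pw \<sigma> (f x) * g x) f) = 0"
proof -
  define a' where "a' n k = (if k < n then a k else 0)" for n k
  have r': "rep (a' n) (S a n) (D (S a n))" for n using rep_truncate(1)[OF r] by (simp add: a'_def[abs_def])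
  have l': "(\<lambda>n. a' n k) \<longlonglongrightarrow> a k" for k using rep_truncate(2)[OF r] by (simp add: a'_def)
  have b': "(\<Sum>k<N. (cmod (a' n k))\<^sup>2) \<le> C\<^sup>2" for n N
    using rep_truncate(3)[OF r, of n N] bd[of N] unfolding a'_def by linarith
  have fs: "sq lborel f" by (rule HH_sq(1)[OF rep_HH[OF r]])
  have c0: "(\<lambda>n. N2 (\<lambda>x. S a n x - f x)) \<longlonglongrightarrow> 0" using r by (simp add: rep_def)
  have lim: "(\<lambda>n. ip lborel (\<lambda>x. pw \<sigma> (S a n x) * D (S a n) x) f) \<longlonglongrightarrow> ip lborel (\<lambda>x. pw \<sigma> (f x) * g x) f"
    by (rule weak_nonlinear[OF r' r b' C l' fs \<sigma>_pos])
  have "(\<lambda>n. Re (ip lborel (\<lambda>x. pw \<sigma> (S a n x) * D (S a n) x) f)) \<longlonglongrightarrow> 0"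
  proof (rule tendsto_norm_zero_cancel, rule real_tendsto_0I)
    fix n
    note nb = rep_norm(1,2)[OF r' b' C, of n]
    note hs = HH_pw_sq[OF HH_tf[OF S_tf] nb]
    have "ip lborel (\<lambda>x. pw \<sigma> (S a n x) * D (S a n) x) (\<lambda>x. S a n x - f x)
        = ip lborel (\<lambda>x. pw \<sigma> (S a n x) * D (S a n) x) (S a n) - ip lborel (\<lambda>x. pw \<sigma> (S a n x) * D (S a n) x) f"
      by (rule ip_diff_right[OF tf_sq[OF S_tf] fs hs(1)])
    then have "Re (ip lborel (\<lambda>x. pw \<sigma> (S a n x) * D (S a n) x) f)
        = - Re (ip lborel (\<lambda>x. pw \<sigma> (S a n x) * D (S a n) x) (\<lambda>x. S a n x - f x))"
      using charge_identity[OF S_tf] by simp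
    then have "norm (Re (ip lborel (\<lambda>x. pw \<sigma> (S a n x) * D (S a n) x) f))
        \<le> cmod (ip lborel (\<lambda>x. pw \<sigma> (S a n x) * D (S a n) x) (\<lambda>x. S a n x - f x))"
      by (simp add: abs_Re_le_cmod)
    also have "\<dots> \<le> N2 (\<lambda>x. pw \<sigma> (S a n x) * D (S a n) x) * N2 (\<lambda>x. S a n x - f x)"
      by (rule ip_Cauchy_Schwarz[OF hs(1) sq_diff[OF tf_sq[OF S_tf] fs]])
    also have "\<dots> \<le> ((2 * C) powr (2 * \<sigma>) * C) * N2 (\<lambda>x. S a n x - f x)"
      by (intro mult_right_mono hs(2)) simp
    finally show "norm (Re (ip lborel (\<lambda>x. pw \<sigma> (S a n x) * D (S a n) x) f)) \<le> ((2 * C) powr (2 * \<sigma>) * C) * N2 (\<lambda>x. S a n x - f x)" .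
  qed (use tendsto_mult_right_zero[OF c0] in auto)
  from LIMSEQ_unique[OF tendsto_Re[OF lim] this] show ?thesis .
qed

text \<open>The difference splits into the bounded factor \<open>pw\<close> times the L2 error, and
  the difference of the factors times the fixed limit, whose convergence \<open>weak_pw_norm\<close>
  can supply.\<close>

lemma Gz_strong:
  assumes f: "\<And>j. HH \<Omega> (f j) (g j)" "HH \<Omega> f' g'"
    and B: "\<And>j x. cmod (f j x) \<le> B"
    and c: "(\<lambda>j. N2 (\<lambda>x. f j x - f' x)) \<longlonglongrightarrow> 0"
    and p: "(\<lambda>j. N2 (\<lambda>x. (pw \<sigma> (f j x) - pw \<sigma> (f' x)) * cnj (f' x))) \<longlonglongrightarrow> 0"
    and ps: "\<And>j. sq lborel (\<lambda>x. (pw \<sigma> (f j x) - pw \<sigma> (f' x)) * cnj (f' x))"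
  shows "(\<lambda>j. N2 (\<lambda>x. Gz \<sigma> (f j x) - Gz \<sigma> (f' x))) \<longlonglongrightarrow> 0"
proof (rule real_tendsto_0I)
  fix j
  have fm: "f j \<in> borel_measurable borel" using HH_measurable(1)[OF f(1)] .
  have ds: "sq lborel (\<lambda>x. cnj (f j x - f' x))" by (intro sq_cnj sq_diff HH_sq(1)[OF f(1)] HH_sq(1)[OF f(2)])
  note s1 = sq_pw_mult[OF fm B ds]
  have "(\<lambda>x. Gz \<sigma> (f j x) - Gz \<sigma> (f' x)) = (\<lambda>x. pw \<sigma> (f j x) * cnj (f j x - f' x) + (pw \<sigma> (f j x) - pw \<sigma> (f' x)) * cnj (f' x))"
    by (simp add: Gz_def algebra_simps)
  then have "N2 (\<lambda>x. Gz \<sigma> (f j x) - Gz \<sigma> (f' x)) \<le> N2 (\<lambda>x. pw \<sigma> (f j x) * cnj (f j x - f' x)) + N2 (\<lambda>x. (pw \<sigma> (f j x) - pw \<sigma> (f' x)) * cnj (f' x))"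
    using nr_triangle[OF s1(1) ps] by (simp only:)
  also have "\<dots> \<le> B powr (2 * \<sigma>) * N2 (\<lambda>x. f j x - f' x) + N2 (\<lambda>x. (pw \<sigma> (f j x) - pw \<sigma> (f' x)) * cnj (f' x))"
    using s1(2) nr_cnj[of lborel "\<lambda>x. f j x - f' x"] by (intro add_right_mono) (simp only:)
  finally show "N2 (\<lambda>x. Gz \<sigma> (f j x) - Gz \<sigma> (f' x)) \<le> B powr (2 * \<sigma>) * N2 (\<lambda>x. f j x - f' x) + N2 (\<lambda>x. (pw \<sigma> (f j x) - pw \<sigma> (f' x)) * cnj (f' x))" .
qed (use tendsto_add_zero[OF tendsto_mult_right_zero[OF c] p] in auto)

end

context evolution
begin

lemma uH: "HH \<Omega> (u t) (v t)"
  by (rule rep_HH[OF a_rep])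

lemma u_norm: "N2 (u t) \<le> C" "N2 (v t) \<le> C" "cmod (u t x) \<le> 2 * C"
  using rep_norm[OF a_rep a_bound C_nonneg] by blast+

lemma a_seq: "x \<longlonglongrightarrow> t \<Longrightarrow> (\<lambda>n. a (x n) k) \<longlonglongrightarrow> a t k"
  using a_cont[of k] by (auto simp: continuous_on_eq_continuous_at intro: isCont_tendsto_compose)

lemma Phi_isCont:
  assumes "sq lborel w" "sq lborel w'"
  shows "isCont (\<lambda>\<tau>. Phi (u \<tau>) (v \<tau>) w w') t"
  unfolding continuous_at_sequentially
proof (intro allI impI)
  fix x assume "x \<longlonglongrightarrow> t"
  from Phi_weak_continuous[OF a_rep a_rep a_bound C_nonneg a_seq[OF this] assms]
  show "((\<lambda>\<tau>. Phi (u \<tau>) (v \<tau>) w w') \<circ> x) \<longlonglongrightarrow> Phi (u t) (v t) w w'" by (simp add: o_def)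
qed

lemma ip_derivative:
  assumes w: "HH \<Omega> w w'"
  shows "((\<lambda>t. ip lborel (u t) w) has_vector_derivative Phi (u t) (v t) w w') (at t)"
proof -
  define g where "g \<tau> = Phi (u \<tau>) (v \<tau>) w w'" for \<tau>
  have gc: "isCont g t" for t unfolding g_def by (rule Phi_isCont[OF HH_sq[OF w]])
  have "((\<lambda>\<tau>. integral {t - 1..\<tau>} g) has_vector_derivative g t) (at t within {t - 1..t + 1})"
    by (rule integral_has_vector_derivative) (use gc in \<open>auto intro: continuous_at_imp_continuous_on\<close>)
  then have "((\<lambda>\<tau>. integral {t - 1..\<tau>} g) has_vector_derivative g t) (at t)"
    by (simp add: at_within_Icc_at)
  then have "((\<lambda>\<tau>. ip lborel (u (t - 1)) w + integral {t - 1..\<tau>} g) has_vector_derivative g t) (at t)"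
    using has_vector_derivative_add[OF has_vector_derivative_const] by fastforce
  then have "((\<lambda>t. ip lborel (u t) w) has_vector_derivative g t) (at t)"
  proof (rule has_vector_derivative_transform_within_open[where S="{t - 1<..<t + 1}"])
    fix \<tau> assume "\<tau> \<in> {t - 1<..<t + 1}"
    then show "ip lborel (u (t - 1)) w + integral {t - 1..\<tau>} g = ip lborel (u \<tau>) w"
      using integral_unique[OF evol[OF w, of "t - 1" \<tau>]] by (simp add: g_def[abs_def])
  qed auto
  then show ?thesis by (simp add: g_def)
qed

lemma ip_lipschitz:
  assumes w: "HH \<Omega> w w'"
  shows "cmod (ip lborel (u t) w - ip lborel (u s) w) \<le> KC C * (N2 w + N2 w') * \<bar>t - s\<bar>"
proof -
  have "norm (ip lborel (u t) w - ip lborel (u s) w) \<le> (KC C * (N2 w + N2 w')) * norm (t - s)"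
  proof (rule differentiable_bound[of UNIV])
    show "((\<lambda>t. ip lborel (u t) w) has_derivative (\<lambda>h. h *\<^sub>R Phi (u \<tau>) (v \<tau>) w w')) (at \<tau> within UNIV)" for \<tau>
      using ip_derivative[OF w, of \<tau>] by (simp add: has_vector_derivative_def)
    show "onorm (\<lambda>h. h *\<^sub>R Phi (u \<tau>) (v \<tau>) w w') \<le> KC C * (N2 w + N2 w')" for \<tau>
    proof (rule onorm_le)
      show "norm (h *\<^sub>R Phi (u \<tau>) (v \<tau>) w w') \<le> KC C * (N2 w + N2 w') * norm h" for h
        using mult_right_mono[OF Phi_bound[OF uH u_norm(1,2) HH_sq[OF w]] norm_ge_zero[of h], of \<tau>] by (simp add: mult.commute)
    qed
  qed auto
  then show ?thesis by simp
qed

definition KL :: real where "KL = KC C * (4 * C)"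

text \<open>The equation is tested with w = u(t) - u(s). The norms of w and of its derivative are at
  most 2 C each, whence the 4 C in \<open>KL\<close>.\<close>

lemma u_holder: "N2 (\<lambda>x. u t x - u s x) \<le> sqrt (KL * \<bar>t - s\<bar>)"
proof (rule real_le_rsqrt)
  define w where "w x = u t x - u s x" for x
  have w: "HH \<Omega> w (\<lambda>x. v t x - v s x)" unfolding w_def by (rule HH_diff[OF uH uH])
  have "ip lborel (u t) w - ip lborel (u s) w = ip lborel w w"
    unfolding w_def by (rule ip_diff_left[symmetric]) (intro HH_sq(1)[OF uH] sq_diff)+
  then have "(N2 w)\<^sup>2 \<le> KC C * (N2 w + N2 (\<lambda>x. v t x - v s x)) * \<bar>t - s\<bar>"
    using ip_lipschitz[OF w, of t s] by (simp add: ip_self norm_power)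
  also have "\<dots> \<le> KL * \<bar>t - s\<bar>"
  proof (intro mult_right_mono)
    have "N2 w + N2 (\<lambda>x. v t x - v s x) \<le> 4 * C"
      using nr_diff_le[OF HH_sq(1)[OF uH] HH_sq(1)[OF uH], of t s] nr_diff_le[OF HH_sq(2)[OF uH] HH_sq(2)[OF uH], of t s]
        u_norm(1,2)[of t] u_norm(1,2)[of s] unfolding w_def by linarith
    then show "KC C * (N2 w + N2 (\<lambda>x. v t x - v s x)) \<le> KL"
      unfolding KL_def by (intro mult_left_mono KC_nonneg C_nonneg)
  qed simp
  finally show "(N2 (\<lambda>x. u t x - u s x))\<^sup>2 \<le> KL * \<bar>t - s\<bar>" by (simp add: w_def[abs_def])
qed

text \<open>At t = s the real part vanishes by the charge identity; replacing u(s) by u(t) costs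
  their L2 distance, of order |t - s|^(1/2).\<close>

lemma nonlinear_small:
  "\<bar>Re (ip lborel (\<lambda>x. pw \<sigma> (u s x) * v s x) (u t))\<bar> \<le> (2 * C) powr (2 * \<sigma>) * C * sqrt (KL * \<bar>t - s\<bar>)"
proof -
  note hs = HH_pw_sq[OF uH u_norm(1,2), of s]
  have "ip lborel (\<lambda>x. pw \<sigma> (u s x) * v s x) (\<lambda>x. u t x - u s x)
      = ip lborel (\<lambda>x. pw \<sigma> (u s x) * v s x) (u t) - ip lborel (\<lambda>x. pw \<sigma> (u s x) * v s x) (u s)"
    by (rule ip_diff_right[OF HH_sq(1)[OF uH] HH_sq(1)[OF uH] hs(1)])
  then have "Re (ip lborel (\<lambda>x. pw \<sigma> (u s x) * v s x) (u t)) = Re (ip lborel (\<lambda>x. pw \<sigma> (u s x) * v s x) (\<lambda>x. u t x - u s x))"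
    using rep_charge_identity[OF a_rep a_bound C_nonneg, of s] by simp
  then have "\<bar>Re (ip lborel (\<lambda>x. pw \<sigma> (u s x) * v s x) (u t))\<bar> \<le> cmod (ip lborel (\<lambda>x. pw \<sigma> (u s x) * v s x) (\<lambda>x. u t x - u s x))"
    by (simp add: abs_Re_le_cmod)
  also have "\<dots> \<le> N2 (\<lambda>x. pw \<sigma> (u s x) * v s x) * N2 (\<lambda>x. u t x - u s x)"
    by (rule ip_Cauchy_Schwarz[OF hs(1) sq_diff[OF HH_sq(1)[OF uH] HH_sq(1)[OF uH]]])
  also have "\<dots> \<le> (2 * C) powr (2 * \<sigma>) * C * sqrt (KL * \<bar>t - s\<bar>)"
    by (intro mult_mono hs(2) u_holder) (auto simp: C_nonneg)
  finally show ?thesis .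
qed

theorem charge_conserved: "N2 (u t) = N2 \<phi>"
proof -
  define f where "f s t = Re (ip lborel (u s) (u t))" for s t
  define P where "P s t = Re (Phi (u s) (v s) (u t) (v t))" for s t
  define L where "L = KC C * (C + C)"
  have L: "0 \<le> L" by (simp add: L_def KC_nonneg C_nonneg)
  have sym: "f s t = f t s" for s t
    unfolding f_def using ip_commute[of lborel "u s" "u t"] by simp
  have lip: "\<bar>f s t - f s' t\<bar> \<le> L * \<bar>s - s'\<bar>" for s s' t
  proof -
    have "\<bar>f s t - f s' t\<bar> \<le> cmod (ip lborel (u s) (u t) - ip lborel (u s') (u t))"
      unfolding f_def using abs_Re_le_cmod[of "ip lborel (u s) (u t) - ip lborel (u s') (u t)"] by simp
    also have "\<dots> \<le> KC C * (N2 (u t) + N2 (v t)) * \<bar>s - s'\<bar>" by (rule ip_lipschitz[OF uH])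
    also have "\<dots> \<le> L * \<bar>s - s'\<bar>"
      unfolding L_def by (intro mult_right_mono mult_left_mono add_mono u_norm KC_nonneg C_nonneg) auto
    finally show ?thesis .
  qed
  have cont: "continuous_on UNIV (\<lambda>p. f (fst p) (snd p))"
  proof (rule continuous_at_imp_continuous_on, intro ballI)
    fix p :: "real \<times> real"
    have "((\<lambda>q. f (fst q) (snd q) - f (fst p) (snd p)) \<longlongrightarrow> 0) (at p)"
    proof (rule Lim_null_comparison)
      show "\<forall>\<^sub>F q in at p. norm (f (fst q) (snd q) - f (fst p) (snd p)) \<le> L * \<bar>fst q - fst p\<bar> + L * \<bar>snd q - snd p\<bar>"
      proof (intro always_eventually allI)
        fix q
        show "norm (f (fst q) (snd q) - f (fst p) (snd p)) \<le> L * \<bar>fst q - fst p\<bar> + L * \<bar>snd q - snd p\<bar>"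
          using lip[of "fst q" "snd q" "fst p"] lip[of "snd q" "fst p" "snd p"]
          unfolding sym[of "fst p"] real_norm_def by linarith
      qed
      have "((\<lambda>q. L * \<bar>fst q - fst p\<bar> + L * \<bar>snd q - snd p\<bar>) \<longlongrightarrow> L * \<bar>fst p - fst p\<bar> + L * \<bar>snd p - snd p\<bar>) (at p)"
        by (intro tendsto_intros)
      then show "((\<lambda>q. L * \<bar>fst q - fst p\<bar> + L * \<bar>snd q - snd p\<bar>) \<longlongrightarrow> 0) (at p)" by simp
    qed
    then show "isCont (\<lambda>p. f (fst p) (snd p)) p" unfolding isCont_def by (rule LIM_zero_cancel)
  qed
  have PD: "((\<lambda>s. f s t) has_real_derivative P s t) (at s)" for s t
    unfolding f_def P_def has_real_derivative_iff_has_vector_derivative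
    by (rule bounded_linear.has_vector_derivative[OF bounded_linear_Re ip_derivative[OF uH]])
  define \<epsilon> where "\<epsilon> h = 2 * ((2 * C) powr (2 * \<sigma>) * C * sqrt (KL * \<bar>h\<bar>))" for h
  have Pb: "\<bar>P (t + h) t + P t (t + h)\<bar> \<le> \<epsilon> h" for t h
  proof -
    \<comment> \<open>The terms with two derivatives are complex conjugates of each other, so their
      imaginary parts cancel.\<close>
    have "Im (ip lborel (v s) (v t)) + Im (ip lborel (v t) (v s)) = 0" for s t
      using ip_commute[of lborel "v s" "v t"] by simp
    then have "P (t + h) t + P t (t + h) = - Re (ip lborel (\<lambda>x. pw \<sigma> (u (t + h) x) * v (t + h) x) (u t))
        - Re (ip lborel (\<lambda>x. pw \<sigma> (u t x) * v t x) (u (t + h)))"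
      unfolding P_def Phi_def by simp
    then show ?thesis
      using nonlinear_small[of "t + h" t] nonlinear_small[of t "t + h"] unfolding \<epsilon>_def by simp
  qed
  have eq: "f B B = f A A" if "A \<le> B" for A B
  proof -
    define \<delta> where "\<delta> n = inverse (real (Suc n))" for n
    have \<delta>: "\<delta> \<longlonglongrightarrow> 0" unfolding \<delta>_def[abs_def] by (rule LIMSEQ_inverse_real_of_nat)
    have fl: "(\<lambda>n. f (T + \<delta> n) T) \<longlonglongrightarrow> f T T" for T
    proof (rule LIM_zero_cancel, rule tendsto_norm_zero_cancel, rule real_tendsto_0I)
      show "norm (f (T + \<delta> n) T - f T T) \<le> L * \<bar>\<delta> n\<bar>" for n using lip[of "T + \<delta> n" T T] by simp
    qed (use tendsto_mult_right_zero[OF tendsto_rabs_zero[OF \<delta>]] in auto)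
    \<comment> \<open>Off the diagonal by \<open>\<delta> n\<close>, the transport identity holds up
      to \<open>\<epsilon> (\<delta> n) * (B - A)\<close>; then the offset tends to 0.\<close>
    have "\<bar>f B B - f A A\<bar> \<le> 0"
    proof (rule LIMSEQ_le)
      show "(\<lambda>n. \<bar>f (B + \<delta> n) B - f (A + \<delta> n) A\<bar>) \<longlonglongrightarrow> \<bar>f B B - f A A\<bar>" by (intro tendsto_intros fl)
      have "(\<lambda>n. \<epsilon> (\<delta> n) * (B - A)) \<longlonglongrightarrow> 2 * ((2 * C) powr (2 * \<sigma>) * C * sqrt (KL * \<bar>0\<bar>)) * (B - A)"
        unfolding \<epsilon>_def by (intro tendsto_intros \<delta>)
      then show "(\<lambda>n. \<epsilon> (\<delta> n) * (B - A)) \<longlonglongrightarrow> 0" by simp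
      show "\<exists>N. \<forall>n\<ge>N. \<bar>f (B + \<delta> n) B - f (A + \<delta> n) A\<bar> \<le> \<epsilon> (\<delta> n) * (B - A)"
        using symmetric_kernel_transport[OF cont sym lip PD Pb that] by blast
    qed
    then show ?thesis by simp
  qed
  have "f t t = f 0 0" using eq[of 0 t] eq[of t 0] by (cases "0 \<le> t") auto
  then have "(N2 (u t))\<^sup>2 = (N2 (u 0))\<^sup>2" unfolding f_def ip_self Re_complex_of_real .
  then show ?thesis unfolding u_0 by (simp add: power2_eq_iff_nonneg)
qed

text \<open>Expand the square: the norms converge because all charges are those of the initial data,
  the mixed term by weak convergence.\<close>

lemma strong_limit: "(\<lambda>j. N2 (\<lambda>x. un j t x - u t x)) \<longlonglongrightarrow> 0"
proof -
  have us: "sq lborel (un j t)" for j by (rule tf_sq[OF un_TF])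
  have "(\<lambda>j. N2 (un j 0)) \<longlonglongrightarrow> N2 \<phi>"
    by (rule tendsto_nr[OF tf_sq[OF un_TF] HH_sq(1)[OF init] un_init(1)])
  then have n: "(\<lambda>j. N2 (un j t)) \<longlonglongrightarrow> N2 (u t)" unfolding charge_conserved un_charge[of _ t] .
  have i: "(\<lambda>j. ip lborel (un j t) (u t)) \<longlonglongrightarrow> ip lborel (u t) (u t)"
    by (rule weak_ip[OF A_rep a_rep A_bound C_nonneg A_lim HH_sq(1)[OF uH]])
  have "(\<lambda>j. (N2 (un j t))\<^sup>2 - 2 * Re (ip lborel (un j t) (u t)) + (N2 (u t))\<^sup>2)
      \<longlonglongrightarrow> (N2 (u t))\<^sup>2 - 2 * Re (ip lborel (u t) (u t)) + (N2 (u t))\<^sup>2"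
    by (intro tendsto_intros n i)
  then have "(\<lambda>j. (N2 (\<lambda>x. un j t x - u t x))\<^sup>2) \<longlonglongrightarrow> 0"
    unfolding nr_diff_power2[OF us HH_sq(1)[OF uH]] by (simp add: ip_self del: of_real_power)
  from tendsto_real_sqrt[OF this] show ?thesis by simp
qed

lemma un_norm: "N2 (un j t) \<le> C" "N2 (D (un j t)) \<le> C" "cmod (un j t x) \<le> 2 * C"
  using rep_norm[OF A_rep A_bound C_nonneg] by blast+

text \<open>\<open>Gz\<close> of the approximations converges strongly in L2 and their derivatives
  converge weakly with bounded norms, so the pairing converges.\<close>

lemma nonlinear_energy_limit:
  "(\<lambda>j. ip lborel (D (un j t)) (\<lambda>x. cnj (Gz \<sigma> (un j t x)))) \<longlonglongrightarrow> ip lborel (v t) (\<lambda>x. cnj (Gz \<sigma> (u t x)))"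
proof -
  have unH: "HH \<Omega> (un j t) (D (un j t))" for j by (rule HH_tf[OF un_TF])
  have cs: "sq lborel (\<lambda>x. cnj (u t x))" by (rule sq_cnj[OF HH_sq(1)[OF uH]])
  have p: "(\<lambda>j. N2 (\<lambda>x. (pw \<sigma> (un j t x) - pw \<sigma> (u t x)) * cnj (u t x))) \<longlonglongrightarrow> 0"
    by (rule weak_pw_norm[OF A_rep a_rep A_bound C_nonneg A_lim cs \<sigma>_pos])
  have ps: "sq lborel (\<lambda>x. (pw \<sigma> (un j t x) - pw \<sigma> (u t x)) * cnj (u t x))" for j
    unfolding left_diff_distrib
    by (rule sq_diff[OF sq_pw_mult(1)[OF HH_measurable(1)[OF unH] un_norm(3) cs]
        sq_pw_mult(1)[OF HH_measurable(1)[OF uH] u_norm(3) cs]])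
  have g: "(\<lambda>j. N2 (\<lambda>x. Gz \<sigma> (un j t x) - Gz \<sigma> (u t x))) \<longlonglongrightarrow> 0"
    by (rule Gz_strong[OF unH uH un_norm(3) strong_limit p ps])
  have "(\<lambda>j. ip lborel (D (un j t)) (\<lambda>x. cnj (Gz \<sigma> (un j t x))) - ip lborel (D (un j t)) (\<lambda>x. cnj (Gz \<sigma> (u t x)))) \<longlonglongrightarrow> 0"
  proof (rule tendsto_norm_zero_cancel, rule real_tendsto_0I)
    fix j
    have "ip lborel (D (un j t)) (\<lambda>x. cnj (Gz \<sigma> (un j t x))) - ip lborel (D (un j t)) (\<lambda>x. cnj (Gz \<sigma> (u t x)))
        = ip lborel (D (un j t)) (\<lambda>x. cnj (Gz \<sigma> (un j t x)) - cnj (Gz \<sigma> (u t x)))"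
      by (rule ip_diff_right[OF Gz_sq(2)[OF unH] Gz_sq(2)[OF uH] HH_sq(2)[OF unH], symmetric])
    then have "norm (ip lborel (D (un j t)) (\<lambda>x. cnj (Gz \<sigma> (un j t x))) - ip lborel (D (un j t)) (\<lambda>x. cnj (Gz \<sigma> (u t x))))
        \<le> N2 (D (un j t)) * N2 (\<lambda>x. cnj (Gz \<sigma> (un j t x)) - cnj (Gz \<sigma> (u t x)))"
      using ip_Cauchy_Schwarz[OF HH_sq(2)[OF unH] sq_diff[OF Gz_sq(2)[OF unH] Gz_sq(2)[OF uH]]] by simp
    also have "N2 (\<lambda>x. cnj (Gz \<sigma> (un j t x)) - cnj (Gz \<sigma> (u t x))) = N2 (\<lambda>x. Gz \<sigma> (un j t x) - Gz \<sigma> (u t x))"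
      using nr_cnj[of lborel "\<lambda>x. Gz \<sigma> (un j t x) - Gz \<sigma> (u t x)"] by (simp del: nr_cnj)
    also have "N2 (D (un j t)) * \<dots> \<le> C * \<dots>" by (intro mult_right_mono un_norm) simp
    finally show "norm (ip lborel (D (un j t)) (\<lambda>x. cnj (Gz \<sigma> (un j t x))) - ip lborel (D (un j t)) (\<lambda>x. cnj (Gz \<sigma> (u t x))))
        \<le> C * N2 (\<lambda>x. Gz \<sigma> (un j t x) - Gz \<sigma> (u t x))" .
  qed (use tendsto_mult_right_zero[OF g] in auto)
  from tendsto_add[OF this weak_ip_deriv[OF A_rep[of _ t] a_rep A_bound C_nonneg A_lim Gz_sq(2)[OF uH[of t]]]]
  show ?thesis by simp
qed

theorem energy_inequality: "En (u t) (v t) \<le> En \<phi> \<phi>'"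
proof -
  define I where "I t = 1 / (\<sigma> + 1) * Im (ip lborel (v t) (\<lambda>x. cnj (Gz \<sigma> (u t x))))" for t
  define J where "J j t = 1 / (\<sigma> + 1) * Im (ip lborel (D (un j t)) (\<lambda>x. cnj (Gz \<sigma> (un j t x))))" for j t
  have J: "(\<lambda>j. J j t) \<longlonglongrightarrow> I t" for t
    unfolding J_def I_def by (intro tendsto_intros nonlinear_energy_limit)
  have EnJ: "En (un j t) (D (un j t)) = (N2 (D (un j t)))\<^sup>2 + J j t" for j t by (simp add: En_def J_def)
  \<comment> \<open>\<open>v 0\<close> and \<phi>' are both derivatives of \<phi>; uniqueness
    identifies the nonlinear energy at time 0 with that of the data.\<close>
  have v0: "AE x in lborel. v 0 x = \<phi>' x" using HH_deriv_unique[of \<phi> "v 0" \<phi>'] uH[of 0] init u_0 by simp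
  have "ip lborel (v 0) (\<lambda>x. cnj (Gz \<sigma> (u 0 x))) = ip lborel \<phi>' (\<lambda>x. cnj (Gz \<sigma> (\<phi> x)))"
    unfolding ip_def u_0
  proof (rule integral_cong_AE)
    show "AE x in lborel. v 0 x * cnj (cnj (Gz \<sigma> (\<phi> x))) = \<phi>' x * cnj (cnj (Gz \<sigma> (\<phi> x)))"
      using v0 by eventually_elim simp
  qed (use sq_ip_integrable[OF HH_sq(2)[OF uH, of 0] Gz_sq(2)[OF init]] sq_ip_integrable[OF HH_sq(2)[OF init] Gz_sq(2)[OF init]]
      in \<open>auto dest: borel_measurable_integrable\<close>)
  then have En0: "En \<phi> \<phi>' = (N2 \<phi>')\<^sup>2 + I 0" by (simp add: En_def I_def)
  have "(\<lambda>j. (N2 (D (un j 0)))\<^sup>2 + J j 0) \<longlonglongrightarrow> (N2 \<phi>')\<^sup>2 + I 0"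
    by (intro tendsto_intros J tendsto_nr[OF tf_D_sq[OF un_TF] HH_sq(2)[OF init] un_init(2)])
  then have lim0: "(\<lambda>j. En (un j t) (D (un j t))) \<longlonglongrightarrow> En \<phi> \<phi>'"
    unfolding En0 un_energy[of _ t] unfolding EnJ .
  have weak: "(\<lambda>j. ip lborel (D (un j t)) (v t)) \<longlonglongrightarrow> ip lborel (v t) (v t)"
    by (rule weak_ip_deriv[OF A_rep a_rep A_bound C_nonneg A_lim HH_sq(2)[OF uH]])
  \<comment> \<open>Lower semicontinuity in linear form: ||g||^2 >= 2 Re <g, v> - ||v||^2, where the
    right side is weakly continuous in g and has limit ||v||^2.\<close>
  have "(\<lambda>j. 2 * Re (ip lborel (D (un j t)) (v t)) - (N2 (v t))\<^sup>2 + J j t)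
      \<longlonglongrightarrow> 2 * Re (ip lborel (v t) (v t)) - (N2 (v t))\<^sup>2 + I t"
    by (intro tendsto_intros weak J)
  then have lim1: "(\<lambda>j. 2 * Re (ip lborel (D (un j t)) (v t)) - (N2 (v t))\<^sup>2 + J j t) \<longlonglongrightarrow> En (u t) (v t)"
    by (simp add: ip_self En_def I_def del: of_real_power)
  show ?thesis
  proof (rule LIMSEQ_le[OF lim1 lim0], intro exI[of _ 0] allI impI)
    fix j
    have "0 \<le> (N2 (\<lambda>x. D (un j t) x - v t x))\<^sup>2" by simp
    then have "2 * Re (ip lborel (D (un j t)) (v t)) - (N2 (v t))\<^sup>2 \<le> (N2 (D (un j t)))\<^sup>2"
      unfolding nr_diff_power2[OF tf_D_sq[OF un_TF] HH_sq(2)[OF uH]] by linarith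
    then show "2 * Re (ip lborel (D (un j t)) (v t)) - (N2 (v t))\<^sup>2 + J j t \<le> En (un j t) (D (un j t))"
      unfolding EnJ by simp
  qed
qed

end

section \<open>Membership in the function spaces of time\<close>

context evolution
begin

lemma H10_HH: "HH \<Omega> f g \<Longrightarrow> f \<in> H10 \<Omega>"
  by (rule HH_imp_H10[OF open_dom])

lemma H1_norm_le: "HH \<Omega> f g \<Longrightarrow> H1_norm \<Omega> f \<le> N2 f + N2 g"
  unfolding H1_norm_HH[OF open_dom] by (rule sqrt_sum_squares_le_sum) auto

text \<open>Every bounded functional has square summable values on the basis, by
  \<open>gs_Bessel\<close>; hence continuity of the single coefficients, with their uniform bound,
  already gives weak continuity.\<close>

lemma u_Cw: "u \<in> Cw_H10 \<Omega>"
  unfolding Cw_H10_def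
proof (intro CollectI conjI allI ballI)
  show "u t \<in> H10 \<Omega>" for t by (rule H10_HH[OF uH])
  fix l assume "l \<in> H10_dual \<Omega>"
  then obtain K where add: "\<And>f g. f \<in> H10 \<Omega> \<Longrightarrow> g \<in> H10 \<Omega> \<Longrightarrow> l (\<lambda>x. f x + g x) = l f + l g"
    and cm: "\<And>c f. f \<in> H10 \<Omega> \<Longrightarrow> l (\<lambda>x. c * f x) = c * l f"
    and bd: "\<And>f. f \<in> H10 \<Omega> \<Longrightarrow> cmod (l f) \<le> K * H1_norm \<Omega> f"
    unfolding H10_dual_def by blast
  \<comment> \<open>The constant in \<open>H10_dual\<close> carries no sign.\<close>
  define B where "B = max K 0"
  have B: "0 \<le> B" by (simp add: B_def)
  have H1n: "0 \<le> H1_norm \<Omega> f" if "HH \<Omega> f g" for f g unfolding H1_norm_HH[OF open_dom that] by simp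
  have bdB: "cmod (l f) \<le> B * H1_norm \<Omega> f" if "HH \<Omega> f g" for f g
    using bd[OF H10_HH[OF that]] mult_right_mono[of K B "H1_norm \<Omega> f"] H1n[OF that] unfolding B_def by linarith
  have tfH: "\<psi> \<in> H10 \<Omega>" if "\<psi> \<in> TF" for \<psi> by (rule H10_HH[OF HH_tf[OF that]])
  have Bes: "(\<Sum>k<N. (cmod (l (e k)))\<^sup>2) \<le> B\<^sup>2" for N
    unfolding e_def
  proof (rule H.gs_Bessel[OF d_test])
    fix f assume f: "f \<in> TF"
    show "cmod (l f) \<le> B * sqrt (Re (hip f f))"
      using bdB[OF HH_tf[OF f]] unfolding H1_norm_HH[OF open_dom HH_tf[OF f]] hip_self by simp
  qed (auto simp: add cm tfH B)
  have lsum: "l (S c N) = (\<Sum>k<N. c k * l (e k))" for c N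
  proof (induction N)
    case 0
    have "l (\<lambda>x. 0 * 0) = 0" using cm[OF tfH[OF tf_zero], of 0] by simp
    then show ?case by simp
  next
    case (Suc N)
    have "l (\<lambda>x. S c N x + c N * e N x) = l (S c N) + c N * l (e N)"
      by (subst add) (auto simp: cm tfH S_tf tf_cmult e_tf)
    then show ?case using Suc by simp
  qed
  have lu: "(\<lambda>k. a t k * l (e k)) sums l (u t)" for t
    unfolding sums_def lsum[symmetric]
  proof (rule LIM_zero_cancel, rule tendsto_norm_zero_cancel, rule real_tendsto_0I)
    fix N
    have Hd: "HH \<Omega> (\<lambda>x. S (a t) N x - u t x) (\<lambda>x. D (S (a t) N) x - v t x)"
      by (rule HH_diff[OF HH_tf[OF S_tf] uH])
    have "l (\<lambda>x. S (a t) N x + (-1) * u t x) = l (S (a t) N) + (-1) * l (u t)"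
      using add[OF tfH[OF S_tf] H10_HH[OF HH_cmult[OF uH, of "-1"]]] cm[OF H10_HH[OF uH], of "-1"] by metis
    then have "norm (l (S (a t) N) - l (u t)) = cmod (l (\<lambda>x. S (a t) N x - u t x))" by simp
    also have "\<dots> \<le> B * (N2 (\<lambda>x. S (a t) N x - u t x) + N2 (\<lambda>x. D (S (a t) N) x - v t x))"
      by (rule order_trans[OF bdB[OF Hd]]) (intro mult_left_mono H1_norm_le[OF Hd] B)
    finally show "norm (l (S (a t) N) - l (u t)) \<le> B * (N2 (\<lambda>x. S (a t) N x - u t x) + N2 (\<lambda>x. D (S (a t) N) x - v t x))" .
  next
    have "(\<lambda>N. N2 (\<lambda>x. S (a t) N x - u t x)) \<longlonglongrightarrow> 0" "(\<lambda>N. N2 (\<lambda>x. D (S (a t) N) x - v t x)) \<longlonglongrightarrow> 0"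
      using a_rep[of t] by (auto simp: rep_def)
    from tendsto_mult_right_zero[OF tendsto_add_zero[OF this]]
    show "(\<lambda>N. B * (N2 (\<lambda>x. S (a t) N x - u t x) + N2 (\<lambda>x. D (S (a t) N) x - v t x))) \<longlonglongrightarrow> 0" .
  qed simp
  show "continuous_on UNIV (\<lambda>t. l (u t))"
  proof (rule continuous_at_imp_continuous_on, intro ballI)
    fix t
    show "isCont (\<lambda>t. l (u t)) t"
      unfolding continuous_at_sequentially
    proof (intro allI impI)
      fix x assume x: "x \<longlonglongrightarrow> t"
      show "((\<lambda>t. l (u t)) \<circ> x) \<longlonglongrightarrow> l (u t)"
        using weak_convergence[OF a_bound Bes a_seq[OF x] C_nonneg] unfolding sums_unique[OF lu] o_def .
    qed
  qed
qed

lemma S_sub_norm: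
  "N2 (\<lambda>x. S c n x - S c' n x) \<le> sqrt (\<Sum>k<n. (cmod (c k - c' k))\<^sup>2)"
  "N2 (\<lambda>x. D (S c n) x - D (S c' n) x) \<le> sqrt (\<Sum>k<n. (cmod (c k - c' k))\<^sup>2)"
proof -
  have eq: "(\<lambda>x. S c n x - S c' n x) = S (\<lambda>k. c k - c' k) n"
    by (simp add: sum_subtractf left_diff_distrib)
  have "(\<lambda>x. D (S c n) x - D (S c' n) x) = D (\<lambda>x. S c n x - S c' n x)"
    by (intro ext D_diff[symmetric, OF S_tf S_tf])
  then have eqD: "(\<lambda>x. D (S c n) x - D (S c' n) x) = D (S (\<lambda>k. c k - c' k) n)" unfolding eq .
  show "N2 (\<lambda>x. S c n x - S c' n x) \<le> sqrt (\<Sum>k<n. (cmod (c k - c' k))\<^sup>2)" unfolding eq by (rule S_norm)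
  show "N2 (\<lambda>x. D (S c n) x - D (S c' n) x) \<le> sqrt (\<Sum>k<n. (cmod (c k - c' k))\<^sup>2)" unfolding eqD by (rule S_norm)
qed

text \<open>Uniform continuity of finitely many coefficients on a compact square; its half side n +
  1 leaves room for a displacement of at most 1 / m <= 1.\<close>

lemma coefficients_uniform:
  "\<exists>m>0. \<forall>t \<tau>. \<bar>t\<bar> \<le> real n \<longrightarrow> \<bar>\<tau> - t\<bar> \<le> 1 / real m \<longrightarrow> (\<Sum>k<n. (cmod (a \<tau> k - a t k))\<^sup>2) < (inverse (real (Suc n)))\<^sup>2"
proof -
  define g where "g p = (\<Sum>k<n. (cmod (a (snd p) k - a (fst p) k))\<^sup>2)" for p :: "real \<times> real"
  define Q where "Q = {- real n - 1..real n + 1} \<times> {- real n - 1..real n + 1}"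
  have c: "continuous_on Q (\<lambda>p. a (h p) k)" if "continuous_on Q h" for h :: "real \<times> real \<Rightarrow> real" and k
    using continuous_on_compose2[OF a_cont that] by simp
  have "uniformly_continuous_on Q g"
    unfolding g_def Q_def
    by (intro compact_uniformly_continuous compact_Times continuous_intros c[unfolded Q_def]) auto
  moreover have "(inverse (real (Suc n)))\<^sup>2 > 0" by simp
  ultimately obtain \<delta> where \<delta>: "\<delta> > 0" "\<And>p q. p \<in> Q \<Longrightarrow> q \<in> Q \<Longrightarrow> dist q p < \<delta> \<Longrightarrow> dist (g q) (g p) < (inverse (real (Suc n)))\<^sup>2"
    unfolding uniformly_continuous_on_def by meson
  obtain m where m: "m > 0" "1 / real m < \<delta>"
    using \<delta>(1) by (metis nat_approx_posE zero_less_Suc)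
  show ?thesis
  proof (intro exI[of _ m] conjI allI impI m(1))
    fix t \<tau> assume t: "\<bar>t\<bar> \<le> real n" and \<tau>: "\<bar>\<tau> - t\<bar> \<le> 1 / real m"
    have "1 / real m \<le> 1" using m(1) by simp
    then have Q: "(t, t) \<in> Q" "(t, \<tau>) \<in> Q" using t \<tau> by (auto simp: Q_def)
    have "dist (t, \<tau>) (t, t) < \<delta>" using \<tau> m(2) by (simp add: dist_Pair_Pair dist_real_def)
    from \<delta>(2)[OF Q this] have "\<bar>g (t, \<tau>) - g (t, t)\<bar> < (inverse (real (Suc n)))\<^sup>2" by (simp add: dist_real_def)
    then show "(\<Sum>k<n. (cmod (a \<tau> k - a t k))\<^sup>2) < (inverse (real (Suc n)))\<^sup>2" by (simp add: g_def)
  qed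
qed

text \<open>Simple functions have to converge in norm although only weak continuity in time is
  known. The expansion is truncated at n and its coefficients are frozen on a time grid so fine that
  n coefficients change little; at each fixed t the expansion itself converges in norm.\<close>

lemma u_Linf: "u \<in> Linf_H10 \<Omega>"
  unfolding Linf_H10_def
proof (intro CollectI conjI)
  show "\<exists>K. AE t in lebesgue. u t \<in> H10 \<Omega> \<and> H1_norm \<Omega> (u t) \<le> K"
  proof (intro exI AE_I2 conjI H10_HH[OF uH])
    show "H1_norm \<Omega> (u t) \<le> C + C" for t
      using H1_norm_le[OF uH, of t] rep_norm(1,2)[OF a_rep a_bound C_nonneg, of t] by linarith
  qed
  have "\<forall>n. \<exists>m>0. \<forall>t \<tau>. \<bar>t\<bar> \<le> real n \<longrightarrow> \<bar>\<tau> - t\<bar> \<le> 1 / real m \<longrightarrow> (\<Sum>k<n. (cmod (a \<tau> k - a t k))\<^sup>2) < (inverse (real (Suc n)))\<^sup>2"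
    by (intro allI coefficients_uniform)
  from choice[OF this] obtain m where m: "\<And>n. m n > (0::nat)"
    and close: "\<And>n t \<tau>. \<bar>t\<bar> \<le> real n \<Longrightarrow> \<bar>\<tau> - t\<bar> \<le> 1 / real (m n) \<Longrightarrow> (\<Sum>k<n. (cmod (a \<tau> k - a t k))\<^sup>2) < (inverse (real (Suc n)))\<^sup>2"
    by blast
  define F where "F n i = S (a (real_of_int i / real (m n))) n" for n i
  define s where "s n t = (if \<bar>t\<bar> \<le> real n then F n \<lfloor>t * real (m n)\<rfloor> else (\<lambda>x. 0))" for n t
  show "\<exists>s. (\<forall>n. simple_H10 \<Omega> (s n)) \<and> (AE t in lebesgue. (\<lambda>n. H1_norm \<Omega> (\<lambda>x. s n t x - u t x)) \<longlonglongrightarrow> 0)"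
  proof (intro exI[of _ s] conjI allI AE_I2)
    fix n
    have FH: "F n i \<in> H10 \<Omega>" for i unfolding F_def by (rule H10_HH[OF HH_tf[OF S_tf]])
    have zH: "(\<lambda>x. 0) \<in> H10 \<Omega>" by (rule H10_HH[OF HH_zero])
    \<comment> \<open>The finitely many grid indices that times in [-n, n] can produce; for other
      times \<open>s n\<close> is 0.\<close>
    define I where "I = {- int n * int (m n) - 1 .. int n * int (m n) + 1}"
    have rng: "range (s n) \<subseteq> insert (\<lambda>x. 0) (F n ` I)"
    proof
      fix f assume "f \<in> range (s n)"
      then obtain t where f: "f = s n t" by blast
      show "f \<in> insert (\<lambda>x. 0) (F n ` I)"
      proof (cases "\<bar>t\<bar> \<le> real n")
        case True
        then have "\<bar>t * real (m n)\<bar> \<le> real n * real (m n)" by (simp add: abs_mult mult_right_mono)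
        then have "- real (n * m n) \<le> t * real (m n)" "t * real (m n) \<le> real (n * m n)" by auto
        then have "\<lfloor>t * real (m n)\<rfloor> \<in> I" unfolding I_def by (auto simp: le_floor_iff floor_le_iff)
        then show ?thesis using True f by (auto simp: s_def)
      qed (simp add: f s_def)
    qed
    have "finite (range (s n))" by (rule finite_subset[OF rng]) (simp add: I_def)
    moreover have "range (s n) \<subseteq> H10 \<Omega>" by (rule order_trans[OF rng]) (intro insert_subsetI zH image_subsetI FH)
    moreover have "s n -` {y} \<in> sets lebesgue" for y
    proof -
      have "s n -` {y} = {t. \<bar>t\<bar> \<le> real n \<and> \<lfloor>t * real (m n)\<rfloor> \<in> {i. F n i = y}} \<union> {t. \<not> \<bar>t\<bar> \<le> real n \<and> (\<lambda>x. 0) = y}"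
        by (auto simp: s_def split: if_splits)
      moreover have "{t. \<bar>t\<bar> \<le> real n \<and> \<lfloor>t * real (m n)\<rfloor> \<in> {i. F n i = y}} \<in> sets borel"
      proof -
        have "Measurable.pred borel (\<lambda>t::real. \<bar>t\<bar> \<le> real n \<and> \<lfloor>t * real (m n)\<rfloor> \<in> {i. F n i = y})" by measurable
        then show ?thesis by (simp add: pred_def)
      qed
      moreover have "{t. \<not> \<bar>t\<bar> \<le> real n \<and> (\<lambda>x::real. 0::complex) = y} \<in> sets borel"
      proof -
        have "Measurable.pred borel (\<lambda>t::real. \<not> \<bar>t\<bar> \<le> real n \<and> (\<lambda>x::real. 0::complex) = y)" by measurable
        then show ?thesis by (simp add: pred_def)
      qed
      ultimately have "s n -` {y} \<in> sets borel" by auto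
      then show ?thesis by simp
    qed
    ultimately show "simple_H10 \<Omega> (s n)" by (simp add: simple_H10_def)
  next
    fix t :: real
    define b where "b n = 2 * inverse (real (Suc n)) + (N2 (\<lambda>x. S (a t) n x - u t x) + N2 (\<lambda>x. D (S (a t) n) x - v t x))" for n
    obtain n0 :: nat where n0: "\<bar>t\<bar> \<le> real n0" using real_arch_simple by blast
    have le: "H1_norm \<Omega> (\<lambda>x. s n t x - u t x) \<le> b n" if "n \<ge> n0" for n
    proof -
      define \<tau> where "\<tau> = real_of_int \<lfloor>t * real (m n)\<rfloor> / real (m n)"
      have tn: "\<bar>t\<bar> \<le> real n" using n0 that by linarith
      have sn: "s n t = S (a \<tau>) n" using tn by (simp add: s_def F_def \<tau>_def)
      have "\<bar>\<lfloor>t * real (m n)\<rfloor> - t * real (m n)\<bar> \<le> 1" by linarith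
      moreover have "\<tau> - t = (\<lfloor>t * real (m n)\<rfloor> - t * real (m n)) / real (m n)" using m[of n] by (simp add: \<tau>_def field_simps)
      ultimately have "\<bar>\<tau> - t\<bar> \<le> 1 / real (m n)" using m[of n] by (simp add: abs_divide divide_right_mono)
      from close[OF tn this] have "sqrt (\<Sum>k<n. (cmod (a \<tau> k - a t k))\<^sup>2) \<le> sqrt ((inverse (real (Suc n)))\<^sup>2)"
        by (intro real_sqrt_le_mono) simp
      then have sq: "sqrt (\<Sum>k<n. (cmod (a \<tau> k - a t k))\<^sup>2) \<le> inverse (real (Suc n))" by simp
      have H: "HH \<Omega> (\<lambda>x. s n t x - u t x) (\<lambda>x. D (S (a \<tau>) n) x - v t x)"
        unfolding sn by (rule HH_diff[OF HH_tf[OF S_tf] uH])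
      have "N2 (\<lambda>x. s n t x - u t x) \<le> inverse (real (Suc n)) + N2 (\<lambda>x. S (a t) n x - u t x)"
        using nr_triangle_diff[of lborel "S (a \<tau>) n" "S (a t) n" "u t", OF tf_sq[OF S_tf] tf_sq[OF S_tf] HH_sq(1)[OF uH]] S_sub_norm(1)[of "a \<tau>" n "a t"] sq
        unfolding sn by linarith
      moreover have "N2 (\<lambda>x. D (S (a \<tau>) n) x - v t x) \<le> inverse (real (Suc n)) + N2 (\<lambda>x. D (S (a t) n) x - v t x)"
        using nr_triangle_diff[of lborel "D (S (a \<tau>) n)" "D (S (a t) n)" "v t", OF tf_D_sq[OF S_tf] tf_D_sq[OF S_tf] HH_sq(2)[OF uH]] S_sub_norm(2)[of "a \<tau>" n "a t"] sq
        by linarith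
      ultimately show ?thesis using H1_norm_le[OF H] unfolding b_def by linarith
    qed
    have H1n: "0 \<le> H1_norm \<Omega> (\<lambda>x. s n t x - u t x)" for n
      unfolding H1_norm_def
      by (intro real_sqrt_ge_zero add_nonneg_nonneg) (auto simp: set_lebesgue_integral_def intro!: integral_nonneg_AE)
    have c: "(\<lambda>N. N2 (\<lambda>x. S (a t) N x - u t x)) \<longlonglongrightarrow> 0" "(\<lambda>N. N2 (\<lambda>x. D (S (a t) N) x - v t x)) \<longlonglongrightarrow> 0"
      using a_rep[of t] by (auto simp: rep_def)
    have b: "b \<longlonglongrightarrow> 0"
      unfolding b_def[abs_def]
      by (intro tendsto_add_zero c tendsto_mult_right_zero LIMSEQ_inverse_real_of_nat)
    show "(\<lambda>n. H1_norm \<Omega> (\<lambda>x. s n t x - u t x)) \<longlonglongrightarrow> 0"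
      by (rule real_tendsto_sandwich[OF _ _ tendsto_const b]) (use H1n le in \<open>auto simp: eventually_sequentially\<close>)
  qed
qed

end

section \<open>Functions of time and space through their time slices\<close>

text \<open>Cauchy-Schwarz on each time slice, together with the bounded time support of \<psi>,
  provides the absolute integrability that Fubini requires.\<close>

lemma slice_product:
  fixes F \<psi> :: "real \<times> real \<Rightarrow> complex"
  assumes m: "F \<in> borel_measurable borel" "\<psi> \<in> borel_measurable borel"
    and F: "\<And>t. sq lborel (\<lambda>x. F (t, x))" "\<And>t. nr lborel (\<lambda>x. F (t, x)) \<le> B"
    and \<psi>: "\<And>t. sq lborel (\<lambda>x. \<psi> (t, x))" "\<And>t. nr lborel (\<lambda>x. \<psi> (t, x)) \<le> B'"
    and supp: "\<And>t x. R < \<bar>t\<bar> \<Longrightarrow> \<psi> (t, x) = 0"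
  shows "integrable lborel (\<lambda>p. F p * \<psi> p)"
    "(\<integral>p. F p * \<psi> p \<partial>lborel) = (\<integral>t. (\<integral>x. F (t, x) * \<psi> (t, x) \<partial>lborel) \<partial>lborel)"
    "integrable lborel (\<lambda>t. \<integral>x. F (t, x) * \<psi> (t, x) \<partial>lborel)"
proof -
  define f where "f p = F p * \<psi> p" for p
  have f: "f \<in> borel_measurable (lborel \<Otimes>\<^sub>M lborel)"
    using borel_measurable_times[OF m] unfolding f_def[abs_def] lborel_prod by simp
  have B: "0 \<le> B" "0 \<le> B'" using order_trans[OF nr_nonneg F(2)] order_trans[OF nr_nonneg \<psi>(2)] by blast+
  have le: "norm (\<integral>x. norm (f (t, x)) \<partial>lborel) \<le> B * B' * indicat_real {-R..R} t" for t
  proof (cases "R < \<bar>t\<bar>")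
    case True
    then show ?thesis using supp[OF True] B by (simp add: f_def)
  next
    case False
    have "(\<integral>x. norm (f (t, x)) \<partial>lborel) \<le> nr lborel (\<lambda>x. F (t, x)) * nr lborel (\<lambda>x. \<psi> (t, x))"
      unfolding f_def norm_mult by (rule nr_Cauchy_Schwarz[OF F(1) \<psi>(1)])
    also have "\<dots> \<le> B * B'" by (intro mult_mono F(2) \<psi>(2) B nr_nonneg)
    finally have "(\<integral>x. norm (f (t, x)) \<partial>lborel) \<le> B * B'" .
    moreover have "t \<in> {-R..R}" using False by auto
    ultimately show ?thesis by simp
  qed
  have i1: "integrable lborel (\<lambda>t. \<integral>x. norm (f (t, x)) \<partial>lborel)"
  proof (rule Bochner_Integration.integrable_bound[where f="\<lambda>t. B * B' * indicat_real {-R..R} t"])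
    show "integrable lborel (\<lambda>t. B * B' * indicat_real {-R..R} t)" by (simp add: integrable_indicator_iff emeasure_lborel_Icc_eq)
    have "(\<lambda>(t, x). norm (f (t, x))) \<in> borel_measurable (lborel \<Otimes>\<^sub>M lborel)"
      using measurable_compose[OF f borel_measurable_norm] by (simp add: case_prod_unfold)
    from lborel.borel_measurable_lebesgue_integral[OF this]
    show "(\<lambda>t. \<integral>x. norm (f (t, x)) \<partial>lborel) \<in> borel_measurable lborel" by simp
    show "AE t in lborel. norm (\<integral>x. norm (f (t, x)) \<partial>lborel) \<le> norm (B * B' * indicat_real {-R..R} t)"
      using le B by (intro AE_I2) simp
  qed
  have fi: "integrable (lborel \<Otimes>\<^sub>M lborel) f"
    by (rule lborel_pair.Fubini_integrable[OF f i1 AE_I2]) (simp add: f_def sq_mult_integrable[OF F(1) \<psi>(1)])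
  show "integrable lborel (\<lambda>p. F p * \<psi> p)" using fi unfolding f_def[abs_def] lborel_prod .
  show "(\<integral>p. F p * \<psi> p \<partial>lborel) = (\<integral>t. (\<integral>x. F (t, x) * \<psi> (t, x) \<partial>lborel) \<partial>lborel)"
    using lborel_pair.integral_fst'[OF fi] unfolding f_def[abs_def] lborel_prod by simp
  show "integrable lborel (\<lambda>t. \<integral>x. F (t, x) * \<psi> (t, x) \<partial>lborel)"
    using lborel_pair.integrable_fst'[OF fi] unfolding f_def[abs_def] .
qed

lemma sq_indicator_interval:
  fixes R :: real
  shows "sq lborel (\<lambda>x. complex_of_real (indicat_real {-R..R} x))"
proof -
  have "(\<lambda>x. (cmod (complex_of_real (indicat_real {-R..R} x)))\<^sup>2) = indicat_real {-R..R}"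
    by (auto simp: indicator_def)
  moreover have "integrable lborel (indicat_real {-R..R})"
    by (rule integrable_real_indicator) (simp_all add: emeasure_lborel_Icc_eq)
  moreover have "(\<lambda>x. complex_of_real (indicat_real {-R..R} x)) \<in> borel_measurable lborel" by measurable
  ultimately show ?thesis by (simp only: sq_def simp_thms)
qed

text \<open>A compact set lies in a square, whose indicator plays the role of \<psi> in
  \<open>slice_product\<close>.\<close>

lemma locally_integrable_slices:
  fixes F :: "real \<times> real \<Rightarrow> complex"
  assumes m: "F \<in> borel_measurable borel"
    and F: "\<And>t. sq lborel (\<lambda>x. F (t, x))" "\<And>t. nr lborel (\<lambda>x. F (t, x)) \<le> B"
  shows "locally_integrable U F"
  unfolding locally_integrable_def set_integrable_def
proof (intro allI impI)
  fix K :: "(real \<times> real) set" assume K: "compact K \<and> K \<subseteq> U"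
  then obtain R where R: "\<And>p. p \<in> K \<Longrightarrow> norm p \<le> R" using compact_imp_bounded[of K] by (auto simp: bounded_iff)
  define \<psi> where "\<psi> p = complex_of_real (indicat_real {-R..R} (fst p)) * complex_of_real (indicat_real {-R..R} (snd p))" for p :: "real \<times> real"
  have [measurable]: "F \<in> borel_measurable borel" "K \<in> sets borel" using m K by (auto intro: borel_compact)
  have \<psi>m: "\<psi> \<in> borel_measurable borel"
    unfolding \<psi>_def[abs_def] borel_prod[symmetric] by measurable
  have s: "sq lborel (\<lambda>x. \<psi> (t, x))" "nr lborel (\<lambda>x. \<psi> (t, x)) \<le> 1 * nr lborel (\<lambda>x. complex_of_real (indicat_real {-R..R} x))" for t
    unfolding \<psi>_def fst_conv snd_conv
    by (rule sq_cmult[OF sq_indicator_interval],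
        unfold nr_cmult, rule mult_right_mono) (auto simp: indicator_def)
  have i: "integrable lborel (\<lambda>p. F p * \<psi> p)"
    by (rule slice_product(1)[OF m \<psi>m F s, where R=R]) (auto simp: \<psi>_def indicator_def)
  have "integrable lborel (\<lambda>p. indicat_real K p *\<^sub>R F p)"
  proof (rule Bochner_Integration.integrable_bound[OF i])
    show "AE p in lborel. norm (indicat_real K p *\<^sub>R F p) \<le> norm (F p * \<psi> p)"
    proof (rule AE_I2)
      fix p :: "real \<times> real"
      have "\<bar>fst p\<bar> \<le> norm p" "\<bar>snd p\<bar> \<le> norm p" using norm_fst_le[of "fst p" "snd p"] norm_snd_le[of "snd p" "fst p"] by simp_all
      then have "p \<in> K \<Longrightarrow> \<psi> p = 1" using R[of p] by (auto simp: \<psi>_def indicator_def abs_le_iff)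
      then show "norm (indicat_real K p *\<^sub>R F p) \<le> norm (F p * \<psi> p)" by (auto simp: indicator_def)
    qed
  qed measurable
  then show "integrable lebesgue (\<lambda>p. indicat_real K p *\<^sub>R F p)"
    by (subst integrable_completion) auto
qed

lemma vector_lipschitz:
  fixes f :: "real \<Rightarrow> 'b::real_normed_vector"
  assumes d: "\<And>r. (f has_vector_derivative f' r) (at r)" and b: "\<And>r. \<bar>r - t\<bar> \<le> \<bar>s - t\<bar> \<Longrightarrow> norm (f' r) \<le> M"
  shows "norm (f s - f t) \<le> M * \<bar>s - t\<bar>"
proof -
  have "norm (f s - f t) \<le> M * norm (s - t)"
  proof (rule differentiable_bound[of "closed_segment s t"])
    fix r assume r: "r \<in> closed_segment s t"
    show "(f has_derivative (\<lambda>h. h *\<^sub>R f' r)) (at r within closed_segment s t)"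
      using d[of r] unfolding has_vector_derivative_def by (rule has_derivative_at_withinI)
    have "\<bar>r - t\<bar> \<le> \<bar>s - t\<bar>" using r by (auto simp: closed_segment_eq_real_ivl split: if_splits)
    then have "norm (h *\<^sub>R f' r) \<le> M * norm h" for h
      using mult_right_mono[OF b norm_ge_zero[of h]] by (simp add: mult.commute)
    then show "onorm (\<lambda>h. h *\<^sub>R f' r) \<le> M" by (rule onorm_le)
  qed auto
  then show ?thesis by simp
qed

context
  fixes \<psi> :: "real \<times> real \<Rightarrow> complex" and \<Omega> :: "real set"
  assumes \<psi>: "\<psi> \<in> test_functions (UNIV \<times> \<Omega>)"
begin

lemma tf_slice: "(\<lambda>x. \<psi> (t, x)) \<in> test_functions \<Omega>"
proof -
  obtain K where K: "compact K" "K \<subseteq> UNIV \<times> \<Omega>" "\<And>p. p \<notin> K \<Longrightarrow> \<psi> p = 0" using \<psi> by (metis tf_support)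
  have "Ck n (\<lambda>x. \<psi> ((0, x) + (t, 0)))" for n
    by (rule Ck_affine[OF _ tf_Ck[OF \<psi>]]) (intro bounded_linear_Pair bounded_linear_zero bounded_linear_ident)
  then have "Ck n (\<lambda>x. \<psi> (t, x))" for n by simp
  then show ?thesis
  proof (rule tfI)
    show "compact (snd ` K)" by (intro compact_continuous_image continuous_intros K(1))
    show "\<psi> (t, x) = 0" if "x \<notin> snd ` K" for x using K(3)[of "(t, x)"] that by force
  qed (use K(2) in auto)
qed

lemma D_slice: "D (\<lambda>x. \<psi> (t, x)) = (\<lambda>x. dir_deriv (0, 1) \<psi> (t, x))"
proof
  fix x
  have "((\<lambda>x. \<psi> (t, x)) has_derivative (\<lambda>h. frechet_derivative \<psi> (at (t, x)) (0, h))) (at x)"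
    by (rule has_derivative_compose[OF _ tf_has_derivative[OF \<psi>], of "\<lambda>x. (t, x)"]) (auto intro!: derivative_eq_intros)
  from dir_deriv_eq[OF this] show "D (\<lambda>x. \<psi> (t, x)) x = dir_deriv (0, 1) \<psi> (t, x)" by (simp add: dir_deriv_def)
qed

lemma time_derivative: "((\<lambda>t. \<psi> (t, x)) has_vector_derivative dir_deriv (1, 0) \<psi> (t, x)) (at t)"
proof -
  let ?L = "frechet_derivative \<psi> (at (t, x))"
  have d: "((\<lambda>t. \<psi> (t, x)) has_derivative (\<lambda>h. ?L (h, 0))) (at t)"
    by (rule has_derivative_compose[OF _ tf_has_derivative[OF \<psi>], of "\<lambda>t. (t, x)"]) (auto intro!: derivative_eq_intros)
  have lin: "linear ?L" by (rule has_derivative_linear[OF tf_has_derivative[OF \<psi>]])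
  have "?L (h, 0) = h *\<^sub>R ?L (1, 0)" for h
    by (rule linear_scale[OF lin, of h "(1, 0)", unfolded scaleR_Pair real_scaleR_def mult_1_right mult_zero_right])
  then have eq: "(\<lambda>h. ?L (h, 0)) = (\<lambda>h. h *\<^sub>R dir_deriv (1, 0) \<psi> (t, x))" unfolding dir_deriv_def by (rule ext)
  show ?thesis unfolding has_vector_derivative_def by (rule has_derivative_eq_rhs[OF d eq])
qed

lemma slice_bound: "\<exists>R>0. \<exists>B>0. \<forall>t x. cmod (\<psi> (t, x)) \<le> B * indicat_real {-R..R} x \<and> (R < \<bar>t\<bar> \<longrightarrow> \<psi> (t, x) = 0)"
proof -
  obtain R B where b: "0 < R" "0 < B" "\<And>p. cmod (\<psi> p) \<le> B" "\<And>p. R < norm p \<Longrightarrow> \<psi> p = 0"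
    by (rule tf_bound[OF \<psi>]) blast
  have "\<bar>t\<bar> \<le> norm (t, x)" "\<bar>x\<bar> \<le> norm (t, x)" for t x :: real
    using norm_fst_le[of t x] norm_snd_le[of x t] by simp_all
  then have "\<psi> (t, x) = 0" if "R < \<bar>t\<bar> \<or> R < \<bar>x\<bar>" for t x
    using that by (intro b(4)) (meson order.strict_trans2)
  then have "cmod (\<psi> (t, x)) \<le> B * indicat_real {-R..R} x \<and> (R < \<bar>t\<bar> \<longrightarrow> \<psi> (t, x) = 0)" for t x
    using b(3)[of "(t, x)"] by (cases "R < \<bar>x\<bar>") (auto simp: indicator_def)
  then show ?thesis using b(1,2) by blast
qed

lemma slice_norm_bound: "\<exists>B R. \<forall>t. nr lborel (\<lambda>x. \<psi> (t, x)) \<le> B \<and> (\<forall>x. R < \<bar>t\<bar> \<longrightarrow> \<psi> (t, x) = 0)"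
proof -
  obtain R B where b: "0 < R" "0 < B" "\<And>t x. cmod (\<psi> (t, x)) \<le> B * indicat_real {-R..R} x" "\<And>t x. R < \<bar>t\<bar> \<Longrightarrow> \<psi> (t, x) = 0"
    using slice_bound by blast
  have "nr lborel (\<lambda>x. \<psi> (t, x)) \<le> B * nr lborel (\<lambda>x. complex_of_real (indicat_real {-R..R} x))" for t
    by (rule nr_mono[OF sq_indicator_interval]) (use b tf_measurable[OF tf_slice] in auto)
  then show ?thesis using b(4) by blast
qed

lemma dist_of_slices:
  assumes "open \<Omega>" and m: "F \<in> borel_measurable borel"
    and F: "\<And>t. sq lborel (\<lambda>x. F (t, x))" "\<And>t. nr lborel (\<lambda>x. F (t, x)) \<le> B"
  shows "dist_of (UNIV \<times> \<Omega>) F \<psi> = (\<integral>t. (\<integral>x. F (t, x) * \<psi> (t, x) \<partial>lborel) \<partial>lborel)"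
    "integrable lborel (\<lambda>t. \<integral>x. F (t, x) * \<psi> (t, x) \<partial>lborel)"
proof -
  obtain B' R where b: "\<And>t. nr lborel (\<lambda>x. \<psi> (t, x)) \<le> B'" "\<And>t x. R < \<bar>t\<bar> \<Longrightarrow> \<psi> (t, x) = 0"
    using slice_norm_bound by blast
  note p = slice_product[OF m tf_measurable[OF \<psi>] F tf_sq[OF tf_slice] b]
  have "dist_of (UNIV \<times> \<Omega>) F \<psi> = (\<integral>p. F p * \<psi> p \<partial>lborel)"
    unfolding dist_of_def
  proof (rule set_lebesgue_integral_support)
    show "open ((UNIV :: real set) \<times> \<Omega>)" by (intro open_Times assms) simp
    show "(\<lambda>p. F p * \<psi> p) \<in> borel_measurable borel" by (intro borel_measurable_times m tf_measurable[OF \<psi>])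
    show "AE p in lborel. p \<notin> UNIV \<times> \<Omega> \<longrightarrow> F p * \<psi> p = 0" using tf_outside[OF \<psi>] by (intro AE_I2) simp
  qed
  then show "dist_of (UNIV \<times> \<Omega>) F \<psi> = (\<integral>t. (\<integral>x. F (t, x) * \<psi> (t, x) \<partial>lborel) \<partial>lborel)"
    using p(2) by simp
  show "integrable lborel (\<lambda>t. \<integral>x. F (t, x) * \<psi> (t, x) \<partial>lborel)" by (rule p(3))
qed

end

text \<open>The second-order Taylor remainder in time, from two applications of the mean value
  inequality; the common bounded support of the slices turns the pointwise bound into an L2 bound
  uniform in time.\<close>

lemma slice_expansion:
  fixes \<psi> :: "real \<times> real \<Rightarrow> complex"
  assumes \<psi>: "\<psi> \<in> test_functions (UNIV \<times> \<Omega>)"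
  shows "\<exists>K\<ge>0. \<forall>s t. nr lborel (\<lambda>x. \<psi> (s, x) - \<psi> (t, x) - (s - t) *\<^sub>R dir_deriv (1, 0) \<psi> (t, x)) \<le> K * (s - t)\<^sup>2"
proof -
  define \<psi>' where "\<psi>' = dir_deriv (1, 0) \<psi>"
  define \<psi>'' where "\<psi>'' = dir_deriv (1, 0) \<psi>'"
  have t1: "\<psi>' \<in> test_functions (UNIV \<times> \<Omega>)" unfolding \<psi>'_def by (rule tf_dir_deriv[OF \<psi>])
  have t2: "\<psi>'' \<in> test_functions (UNIV \<times> \<Omega>)" unfolding \<psi>''_def by (rule tf_dir_deriv[OF t1])
  note d0 = time_derivative[OF \<psi>, folded \<psi>'_def]
  note d1 = time_derivative[OF t1, folded \<psi>''_def]
  obtain R B where b: "0 < R" "0 < B" "\<And>t x. cmod (\<psi>'' (t, x)) \<le> B * indicat_real {-R..R} x"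
    using slice_bound[OF t2] by blast
  have l1: "cmod (\<psi>' (r, x) - \<psi>' (t, x)) \<le> B * indicat_real {-R..R} x * \<bar>r - t\<bar>" for r t x
    by (rule vector_lipschitz[OF d1 b(3)])
  have l0: "cmod (\<psi> (s, x) - \<psi> (t, x) - (s - t) *\<^sub>R \<psi>' (t, x)) \<le> B * (s - t)\<^sup>2 * indicat_real {-R..R} x" for s t x
  proof -
    define h where "h r = \<psi> (r, x) - r *\<^sub>R \<psi>' (t, x)" for r
    have "norm (h s - h t) \<le> B * indicat_real {-R..R} x * \<bar>s - t\<bar> * \<bar>s - t\<bar>"
    proof (rule vector_lipschitz)
      have "((\<lambda>r. r *\<^sub>R \<psi>' (t, x)) has_vector_derivative \<psi>' (t, x)) (at r)" for r
        by (auto simp: has_vector_derivative_def intro!: derivative_eq_intros)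
      from has_vector_derivative_diff[OF d0 this]
      show "(h has_vector_derivative \<psi>' (r, x) - \<psi>' (t, x)) (at r)" for r unfolding h_def[abs_def] .
      fix r assume "\<bar>r - t\<bar> \<le> \<bar>s - t\<bar>"
      then have "B * indicat_real {-R..R} x * \<bar>r - t\<bar> \<le> B * indicat_real {-R..R} x * \<bar>s - t\<bar>"
        using b(2) by (intro mult_left_mono) auto
      then show "norm (\<psi>' (r, x) - \<psi>' (t, x)) \<le> B * indicat_real {-R..R} x * \<bar>s - t\<bar>"
        using l1[of r x t] by linarith
    qed
    moreover have "h s - h t = \<psi> (s, x) - \<psi> (t, x) - (s - t) *\<^sub>R \<psi>' (t, x)" by (simp add: h_def algebra_simps)
    moreover have "B * indicat_real {-R..R} x * \<bar>s - t\<bar> * \<bar>s - t\<bar> = B * (s - t)\<^sup>2 * indicat_real {-R..R} x"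
      by (simp add: power2_eq_square mult.assoc abs_mult[symmetric])
    ultimately show ?thesis by simp
  qed
  define N where "N = nr lborel (\<lambda>x. complex_of_real (indicat_real {-R..R} x))"
  have [measurable]: "(\<lambda>x. \<psi> (r, x)) \<in> borel_measurable borel" "(\<lambda>x. \<psi>' (r, x)) \<in> borel_measurable borel" for r
    by (rule tf_measurable[OF tf_slice[OF \<psi>]], rule tf_measurable[OF tf_slice[OF t1]])
  have "nr lborel (\<lambda>x. \<psi> (s, x) - \<psi> (t, x) - (s - t) *\<^sub>R \<psi>' (t, x)) \<le> (B * (s - t)\<^sup>2) * N" for s t
    unfolding N_def
  proof (rule nr_mono[OF sq_indicator_interval])
    show "(\<lambda>x. \<psi> (s, x) - \<psi> (t, x) - (s - t) *\<^sub>R \<psi>' (t, x)) \<in> borel_measurable lborel" by measurable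
    show "AE x in lborel. cmod (\<psi> (s, x) - \<psi> (t, x) - (s - t) *\<^sub>R \<psi>' (t, x)) \<le> (B * (s - t)\<^sup>2) * cmod (complex_of_real (indicat_real {-R..R} x))"
      using l0 by (intro AE_I2) simp
  qed (use b(2) in simp)
  then have "nr lborel (\<lambda>x. \<psi> (s, x) - \<psi> (t, x) - (s - t) *\<^sub>R \<psi>' (t, x)) \<le> (B * N) * (s - t)\<^sup>2" for s t
    by (simp only: mult.assoc mult.commute[of N])
  moreover have "0 \<le> B * N" using b(2) by (simp add: N_def)
  ultimately show ?thesis unfolding \<psi>'_def by blast
qed

section \<open>The equation in the sense of distributions\<close>

context evolution
begin

abbreviation "uu \<equiv> \<lambda>p. u (fst p) (snd p)"
abbreviation "vv \<equiv> \<lambda>p. v (fst p) (snd p)"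

lemma a_measurable: "(\<lambda>p. a (fst p) k) \<in> borel_measurable (borel :: (real \<times> real) measure)"
proof -
  have "continuous_on UNIV (\<lambda>p :: real \<times> real. a (fst p) k)"
    by (rule continuous_on_compose2[OF a_cont]) (auto intro: continuous_intros)
  then show ?thesis by (rule borel_measurable_continuous_onI)
qed

lemma tf_snd_measurable:
  assumes "\<psi> \<in> test_functions V"
  shows "(\<lambda>p. \<psi> (snd p)) \<in> borel_measurable (borel :: (real \<times> real) measure)"
proof -
  have "continuous_on UNIV (\<lambda>p :: real \<times> real. \<psi> (snd p))"
    by (rule continuous_on_compose2[OF tf_continuous[OF assms, of UNIV]]) (auto intro: continuous_intros)
  then show ?thesis by (rule borel_measurable_continuous_onI)
qed

lemma uu_measurable: "uu \<in> borel_measurable borel"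
proof -
  note [measurable] = a_measurable tf_snd_measurable[OF e_tf]
  show ?thesis unfolding u_eq by measurable
qed

text \<open>The cut-off index is a measurable function of time with countably many values, so the
  partial sum with variable upper limit is jointly measurable, and so is its \<open>lim\<close>.
  This is the point of choosing v by \<open>Gn\<close>.\<close>

lemma vv_measurable: "vv \<in> borel_measurable borel"
proof -
  note [measurable] = a_measurable tf_snd_measurable[OF tf_dir_deriv[OF e_tf]]
  have N: "(\<lambda>p :: real \<times> real. Nj (a (fst p)) j) \<in> borel \<rightarrow>\<^sub>M count_space UNIV" for j
    unfolding Nj_def by measurable
  have "(\<lambda>p :: real \<times> real. \<Sum>k<n. a (fst p) k * D (e k) (snd p)) \<in> borel_measurable borel" for n
    by measurable
  from measurable_compose_countable[OF this N]
  have [measurable]: "(\<lambda>p :: real \<times> real. \<Sum>k<Nj (a (fst p)) j. a (fst p) k * D (e k) (snd p)) \<in> borel_measurable borel" for j .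
  show ?thesis unfolding v_eq Gn_def by measurable
qed

lemma pv_slice:
  "sq lborel (\<lambda>x. pw \<sigma> (u t x) * v t x)" "N2 (\<lambda>x. pw \<sigma> (u t x) * v t x) \<le> (2 * C) powr (2 * \<sigma>) * C"
  by (rule HH_pw_sq[OF uH u_norm(1,2)])+

lemma pv_measurable: "(\<lambda>p. pw \<sigma> (uu p) * vv p) \<in> borel_measurable borel"
  by (intro borel_measurable_times borel_measurable_pw uu_measurable vv_measurable)

context
  fixes \<psi> :: "real \<times> real \<Rightarrow> complex"
  assumes \<psi>: "\<psi> \<in> test_functions (UNIV \<times> \<Omega>)"
begin

lemma dist_uu: "dist_of (UNIV \<times> \<Omega>) uu \<psi> = (\<integral>t. (\<integral>x. u t x * \<psi> (t, x) \<partial>lborel) \<partial>lborel)"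
    "integrable lborel (\<lambda>t. \<integral>x. u t x * \<psi> (t, x) \<partial>lborel)"
  using dist_of_slices[OF \<psi> open_dom uu_measurable, unfolded fst_conv snd_conv, OF HH_sq(1)[OF uH] u_norm(1)] by simp_all

lemma dist_vv: "dist_of (UNIV \<times> \<Omega>) vv \<psi> = (\<integral>t. (\<integral>x. v t x * \<psi> (t, x) \<partial>lborel) \<partial>lborel)"
    "integrable lborel (\<lambda>t. \<integral>x. v t x * \<psi> (t, x) \<partial>lborel)"
  using dist_of_slices[OF \<psi> open_dom vv_measurable, unfolded fst_conv snd_conv, OF HH_sq(2)[OF uH] u_norm(2)] by simp_all

lemma dist_pv: "dist_of (UNIV \<times> \<Omega>) (\<lambda>p. pw \<sigma> (uu p) * vv p) \<psi> = (\<integral>t. (\<integral>x. (pw \<sigma> (u t x) * v t x) * \<psi> (t, x) \<partial>lborel) \<partial>lborel)"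
    "integrable lborel (\<lambda>t. \<integral>x. (pw \<sigma> (u t x) * v t x) * \<psi> (t, x) \<partial>lborel)"
  using dist_of_slices[OF \<psi> open_dom pv_measurable, unfolded fst_conv snd_conv, OF pv_slice] by simp_all

end

lemma uu_weak_deriv: "has_weak_deriv (UNIV \<times> \<Omega>) (0, 1) uu vv"
  unfolding has_weak_deriv_def
proof (intro conjI ballI)
  show "locally_integrable (UNIV \<times> \<Omega>) uu"
    by (rule locally_integrable_slices[OF uu_measurable, unfolded fst_conv snd_conv, OF HH_sq(1)[OF uH] u_norm(1)])
  show "locally_integrable (UNIV \<times> \<Omega>) vv"
    by (rule locally_integrable_slices[OF vv_measurable, unfolded fst_conv snd_conv, OF HH_sq(2)[OF uH] u_norm(2)])
  fix \<psi> :: "real \<times> real \<Rightarrow> complex" assume \<psi>: "\<psi> \<in> test_functions (UNIV \<times> \<Omega>)"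
  have "(\<integral>x. u t x * dir_deriv (0, 1) \<psi> (t, x) \<partial>lborel) = - (\<integral>x. v t x * \<psi> (t, x) \<partial>lborel)" for t
    using HH_by_parts[OF uH tf_slice[OF \<psi>], of t t] unfolding D_slice[OF \<psi>] .
  then show "dist_deriv (0, 1) (dist_of (UNIV \<times> \<Omega>) uu) \<psi> = dist_of (UNIV \<times> \<Omega>) vv \<psi>"
    unfolding dist_deriv_def dist_uu(1)[OF tf_dir_deriv[OF \<psi>]] dist_vv(1)[OF \<psi>] by simp
qed

text \<open>A product rule without strong differentiability of u. With the slice of \<psi> frozen at
  time t the equation applies; the remaining part R is differentiable at t because \<psi> has an L2
  Taylor expansion in time and u is continuous in L2.\<close>

lemma pairing_derivative:
  fixes \<psi> :: "real \<times> real \<Rightarrow> complex"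
  assumes \<psi>: "\<psi> \<in> test_functions (UNIV \<times> \<Omega>)"
  shows "((\<lambda>t. \<integral>x. u t x * \<psi> (t, x) \<partial>lborel) has_vector_derivative
    - \<i> * (\<integral>x. v t x * dir_deriv (0, 1) \<psi> (t, x) \<partial>lborel) - (\<integral>x. (pw \<sigma> (u t x) * v t x) * \<psi> (t, x) \<partial>lborel)
      + (\<integral>x. u t x * dir_deriv (1, 0) \<psi> (t, x) \<partial>lborel)) (at t)"
proof -
  define \<psi>' where "\<psi>' = dir_deriv (1, 0) \<psi>"
  have t1: "\<psi>' \<in> test_functions (UNIV \<times> \<Omega>)" unfolding \<psi>'_def by (rule tf_dir_deriv[OF \<psi>])
  \<comment> \<open>\<open>Phi\<close> is conjugate linear in its test function while the pairing
    with distributions is bilinear, hence the conjugate.\<close>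
  define \<eta> where "\<eta> s x = cnj (\<psi> (s, x))" for s x
  have \<eta>: "\<eta> s \<in> TF" for s unfolding \<eta>_def by (rule tf_cnj[OF tf_slice[OF \<psi>]])
  have D\<eta>: "D (\<eta> t) x = cnj (dir_deriv (0, 1) \<psi> (t, x))" for x
    unfolding \<eta>_def D_cnj[OF tf_slice[OF \<psi>]] D_slice[OF \<psi>] by simp
  obtain K where K: "0 \<le> K" "\<And>s t. N2 (\<lambda>x. \<psi> (s, x) - \<psi> (t, x) - (s - t) *\<^sub>R \<psi>' (t, x)) \<le> K * (s - t)\<^sup>2"
    using slice_expansion[OF \<psi>] unfolding \<psi>'_def by blast
  define L where "L = N2 (\<lambda>x. \<psi>' (t, x))"
  define R where "R s = (\<integral>x. u s x * (\<psi> (s, x) - \<psi> (t, x)) \<partial>lborel)" for s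
  define J where "J = (\<integral>x. u t x * \<psi>' (t, x) \<partial>lborel)"
  have us: "sq lborel (u s)" for s by (rule HH_sq(1)[OF uH])
  have ps: "sq lborel (\<lambda>x. \<psi> (s, x))" "sq lborel (\<lambda>x. \<psi>' (s, x))" for s
    by (rule tf_sq[OF tf_slice[OF \<psi>]], rule tf_sq[OF tf_slice[OF t1]])
  have bd: "norm ((R s - R t) - (s - t) *\<^sub>R J) / norm (s - t) \<le> C * K * \<bar>s - t\<bar> + sqrt (KL * \<bar>s - t\<bar>) * L"
    if "s \<noteq> t" for s
  proof -
    have sc: "sq lborel (\<lambda>x. (s - t) *\<^sub>R \<psi>' (t, x))"
      unfolding scaleR_conv_of_real by (rule sq_cmult[OF ps(2)])
    have df: "sq lborel (\<lambda>x. \<psi> (s, x) - \<psi> (t, x) - (s - t) *\<^sub>R \<psi>' (t, x))"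
      by (intro sq_diff ps sc)
    note i = sq_mult_integrable[OF us sq_diff[OF ps(1) ps(1)]] sq_mult_integrable[OF us df] sq_mult_integrable[OF us ps(2)]
      sq_mult_integrable[OF sq_diff[OF us us] ps(2)]
    have cs: "cmod (\<integral>x. f x * g x \<partial>lborel) \<le> N2 f * N2 g" if "sq lborel f" "sq lborel g" for f g :: "real \<Rightarrow> complex"
      using ip_Cauchy_Schwarz[OF that(1) sq_cnj[OF that(2)]] by (simp add: ip_def)
    have "R t = 0" by (simp add: R_def)
    \<comment> \<open>The error splits into the Taylor remainder of \<psi>, of order (s - t)^2, and
      s - t times an L2 increment of u, of order |s - t|^(1/2).\<close>
    have eq: "(R s - R t) - (s - t) *\<^sub>R J = (\<integral>x. u s x * (\<psi> (s, x) - \<psi> (t, x) - (s - t) *\<^sub>R \<psi>' (t, x)) \<partial>lborel)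
        + (s - t) *\<^sub>R (\<integral>x. (u s x - u t x) * \<psi>' (t, x) \<partial>lborel)"
    proof -
      have "(\<integral>x. u s x * (\<psi> (s, x) - \<psi> (t, x) - (s - t) *\<^sub>R \<psi>' (t, x)) \<partial>lborel)
          = (\<integral>x. u s x * (\<psi> (s, x) - \<psi> (t, x)) - (s - t) *\<^sub>R (u s x * \<psi>' (t, x)) \<partial>lborel)"
        by (simp add: right_diff_distrib)
      also have "\<dots> = R s - (s - t) *\<^sub>R (\<integral>x. u s x * \<psi>' (t, x) \<partial>lborel)"
        unfolding R_def
        by (subst Bochner_Integration.integral_diff[OF i(1) integrable_scaleR_right[OF i(3)]]) simp
      finally have 1: "(\<integral>x. u s x * (\<psi> (s, x) - \<psi> (t, x) - (s - t) *\<^sub>R \<psi>' (t, x)) \<partial>lborel)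
          = R s - (s - t) *\<^sub>R (\<integral>x. u s x * \<psi>' (t, x) \<partial>lborel)" .
      have 2: "(\<integral>x. (u s x - u t x) * \<psi>' (t, x) \<partial>lborel) = (\<integral>x. u s x * \<psi>' (t, x) \<partial>lborel) - J"
        unfolding J_def left_diff_distrib by (rule Bochner_Integration.integral_diff[OF i(3) i(3)])
      show ?thesis unfolding 1 2 \<open>R t = 0\<close> by (simp add: scaleR_diff_right)
    qed
    have "norm ((R s - R t) - (s - t) *\<^sub>R J) \<le> cmod (\<integral>x. u s x * (\<psi> (s, x) - \<psi> (t, x) - (s - t) *\<^sub>R \<psi>' (t, x)) \<partial>lborel)
        + \<bar>s - t\<bar> * cmod (\<integral>x. (u s x - u t x) * \<psi>' (t, x) \<partial>lborel)"
      unfolding eq by (rule order_trans[OF norm_triangle_ineq]) simp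
    also have "\<dots> \<le> C * (K * (s - t)\<^sup>2) + \<bar>s - t\<bar> * (sqrt (KL * \<bar>s - t\<bar>) * L)"
      unfolding L_def
      by (intro add_mono mult_left_mono order_trans[OF cs[OF us df]] order_trans[OF cs[OF sq_diff[OF us us] ps(2)]]
          mult_mono u_norm K u_holder C_nonneg mult_right_mono) auto
    also have "\<dots> = (C * K * \<bar>s - t\<bar> + sqrt (KL * \<bar>s - t\<bar>) * L) * \<bar>s - t\<bar>"
      by (simp add: power2_eq_square distrib_left distrib_right mult.assoc mult.left_commute abs_mult_self_eq)
    finally show ?thesis using that by (simp add: divide_le_eq)
  qed
  have "(R has_derivative (\<lambda>h. h *\<^sub>R J)) (at t)"
  proof (rule has_derivativeI_sandwich[OF zero_less_one])
    show "bounded_linear (\<lambda>h. h *\<^sub>R J)" by (rule bounded_linear_scaleR_left)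
    show "norm ((R s - R t) - (s - t) *\<^sub>R J) / norm (s - t) \<le> C * K * \<bar>s - t\<bar> + sqrt (KL * \<bar>s - t\<bar>) * L" if "s \<noteq> t" for s
      by (rule bd[OF that])
    have "((\<lambda>s. C * K * \<bar>s - t\<bar> + sqrt (KL * \<bar>s - t\<bar>) * L) \<longlongrightarrow> C * K * \<bar>t - t\<bar> + sqrt (KL * \<bar>t - t\<bar>) * L) (at t)"
      by (intro tendsto_intros)
    then show "((\<lambda>s. C * K * \<bar>s - t\<bar> + sqrt (KL * \<bar>s - t\<bar>) * L) \<longlongrightarrow> 0) (at t)" by simp
  qed
  then have "(R has_vector_derivative J) (at t)" by (simp add: has_vector_derivative_def)
  from has_vector_derivative_add[OF ip_derivative[OF HH_tf[OF \<eta>[of t]], of t] this]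
  have "((\<lambda>s. ip lborel (u s) (\<eta> t) + R s) has_vector_derivative Phi (u t) (v t) (\<eta> t) (D (\<eta> t)) + J) (at t)" .
  moreover have "ip lborel (u s) (\<eta> t) + R s = (\<integral>x. u s x * \<psi> (s, x) \<partial>lborel)" for s
  proof -
    have "R s = (\<integral>x. u s x * \<psi> (s, x) \<partial>lborel) - (\<integral>x. u s x * \<psi> (t, x) \<partial>lborel)"
      unfolding R_def right_diff_distrib
      by (rule Bochner_Integration.integral_diff[OF sq_mult_integrable[OF us ps(1)] sq_mult_integrable[OF us ps(1)]])
    then show ?thesis by (simp add: ip_def \<eta>_def)
  qed
  moreover have "Phi (u t) (v t) (\<eta> t) (D (\<eta> t)) = - \<i> * (\<integral>x. v t x * dir_deriv (0, 1) \<psi> (t, x) \<partial>lborel)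
      - (\<integral>x. (pw \<sigma> (u t x) * v t x) * \<psi> (t, x) \<partial>lborel)"
    by (simp add: Phi_def ip_def D\<eta>) (simp add: \<eta>_def)
  ultimately show ?thesis by (simp add: J_def \<psi>'_def)
qed

text \<open>The spatial pairing of u with \<psi> vanishes for large times, so the integral of its
  time derivative is zero. By \<open>pairing_derivative\<close> this is the weak equation, up to the
  factor -i.\<close>

theorem dnls_solution_u: "dnls_solution \<Omega> \<sigma> u"
proof -
  have uu: "(\<lambda>(t, x). u t x) = uu" by (simp add: case_prod_unfold)
  show ?thesis
    unfolding dnls_solution_def Let_def uu pw_def[symmetric]
  proof (intro exI[of _ vv] conjI ballI uu_weak_deriv)
    show "locally_integrable (UNIV \<times> \<Omega>) (\<lambda>p. pw \<sigma> (uu p) * vv p)"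
      by (rule locally_integrable_slices[OF pv_measurable, unfolded fst_conv snd_conv, OF pv_slice])
    fix \<psi> :: "real \<times> real \<Rightarrow> complex" assume \<psi>: "\<psi> \<in> test_functions (UNIV \<times> \<Omega>)"
    let ?x = "dir_deriv (0, 1) \<psi>" and ?t = "dir_deriv (1, 0) \<psi>"
    have tx: "?x \<in> test_functions (UNIV \<times> \<Omega>)" "?t \<in> test_functions (UNIV \<times> \<Omega>)" by (rule tf_dir_deriv[OF \<psi>])+
    define Q where "Q t = (\<integral>x. u t x * \<psi> (t, x) \<partial>lborel)" for t
    define I1 where "I1 t = (\<integral>x. v t x * ?x (t, x) \<partial>lborel)" for t
    define I2 where "I2 t = (\<integral>x. (pw \<sigma> (u t x) * v t x) * \<psi> (t, x) \<partial>lborel)" for t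
    define I3 where "I3 t = (\<integral>x. u t x * ?t (t, x) \<partial>lborel)" for t
    have i: "integrable lborel I1" "integrable lborel I2" "integrable lborel I3"
      unfolding I1_def I2_def I3_def by (rule dist_vv(2)[OF tx(1)] dist_pv(2)[OF \<psi>] dist_uu(2)[OF tx(2)])+
    define q where "q t = - \<i> * I1 t - I2 t + I3 t" for t
    have Qd: "(Q has_vector_derivative q t) (at t)" for t
      unfolding Q_def q_def I1_def I2_def I3_def by (rule pairing_derivative[OF \<psi>])
    have iq: "integrable lborel q"
      unfolding q_def by (intro Bochner_Integration.integrable_add Bochner_Integration.integrable_diff integrable_mult_right i)
    obtain T0 where T0: "\<And>t x. T0 < \<bar>t\<bar> \<Longrightarrow> \<psi> (t, x) = 0"
      using slice_norm_bound[OF \<psi>] by blast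
    define T where "T = \<bar>T0\<bar> + 1"
    have out: "Q t = 0" if "T0 < \<bar>t\<bar>" for t using T0[OF that] by (simp add: Q_def)
    \<comment> \<open>Q vanishes in a neighbourhood of t, hence so does its derivative; this permits
      integrating over all times.\<close>
    have q0: "q t = 0" if "t \<notin> {-T..T}" for t
    proof -
      have "open {t::real. T0 < \<bar>t\<bar>}" by (intro open_Collect_less continuous_intros)
      moreover have "t \<in> {t::real. T0 < \<bar>t\<bar>}" using that by (auto simp: T_def)
      ultimately have "((\<lambda>t. 0) has_vector_derivative q t) (at t)"
        by (rule has_vector_derivative_transform_within_open[OF Qd]) (use out in auto)
      then show ?thesis
        using vector_derivative_unique_at[OF _ has_vector_derivative_const] by blast
    qed
    have "(q has_integral (Q T - Q (- T))) {-T..T}"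
      by (rule fundamental_theorem_of_calculus[OF _ has_vector_derivative_at_within[OF Qd]]) (simp add: T_def)
    moreover have "Q T = 0" "Q (- T) = 0" by (rule out, simp add: T_def)+
    ultimately have "(q has_integral 0) {-T..T}" by simp
    then have "(q has_integral 0) UNIV"
      by (rule has_integral_on_superset) (use q0 in auto)
    moreover have "(q has_integral (\<integral>t. q t \<partial>lborel)) UNIV" by (rule has_integral_integral_lborel[OF iq])
    ultimately have "(\<integral>t. q t \<partial>lborel) = 0" by (rule has_integral_unique[symmetric])
    moreover have "(\<integral>t. q t \<partial>lborel) = - \<i> * (\<integral>t. I1 t \<partial>lborel) - (\<integral>t. I2 t \<partial>lborel) + (\<integral>t. I3 t \<partial>lborel)"
    proof -
      have i1: "integrable lborel (\<lambda>t. - \<i> * I1 t)" by (rule integrable_mult_right[OF i(1)])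
      show ?thesis
        unfolding q_def Bochner_Integration.integral_add[OF Bochner_Integration.integrable_diff[OF i1 i(2)] i(3)]
          Bochner_Integration.integral_diff[OF i1 i(2)] by (simp only: integral_mult_right_zero)
    qed
    ultimately have z: "- \<i> * (\<integral>t. I1 t \<partial>lborel) - (\<integral>t. I2 t \<partial>lborel) + (\<integral>t. I3 t \<partial>lborel) = 0" by simp
    have x: "dist_deriv (0, 1) (dist_deriv (0, 1) (dist_of (UNIV \<times> \<Omega>) uu)) \<psi> = - (\<integral>t. I1 t \<partial>lborel)"
    proof -
      have "dist_deriv (0, 1) (dist_of (UNIV \<times> \<Omega>) uu) ?x = dist_of (UNIV \<times> \<Omega>) vv ?x"
        using uu_weak_deriv tx(1) unfolding has_weak_deriv_def by blast
      then show ?thesis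
        unfolding dist_deriv_def[of _ "dist_deriv (0, 1) (dist_of (UNIV \<times> \<Omega>) uu)"] I1_def dist_vv(1)[OF tx(1), symmetric] by simp
    qed
    have t: "dist_deriv (1, 0) (dist_of (UNIV \<times> \<Omega>) uu) \<psi> = - (\<integral>t. I3 t \<partial>lborel)"
      unfolding dist_deriv_def I3_def dist_uu(1)[OF tx(2)] ..
    have p: "dist_of (UNIV \<times> \<Omega>) (\<lambda>p. pw \<sigma> (uu p) * vv p) \<psi> = (\<integral>t. I2 t \<partial>lborel)"
      unfolding I2_def by (rule dist_pv(1)[OF \<psi>])
    \<comment> \<open>Multiplication by -i turns the weak form for u_t into the stated form for i
      u_t.\<close>
    have "\<i> * - Z - X + \<i> * P = - \<i> * (- \<i> * X - P + Z)" for X P Z :: complex by (simp add: algebra_simps)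
    from this[of "\<integral>t. I3 t \<partial>lborel" "\<integral>t. I1 t \<partial>lborel" "\<integral>t. I2 t \<partial>lborel", unfolded z]
    show "\<i> * dist_deriv (1, 0) (dist_of (UNIV \<times> \<Omega>) uu) \<psi>
        + dist_deriv (0, 1) (dist_deriv (0, 1) (dist_of (UNIV \<times> \<Omega>) uu)) \<psi>
        + \<i> * dist_of (UNIV \<times> \<Omega>) (\<lambda>p. pw \<sigma> (uu p) * vv p) \<psi> = 0"
      unfolding x t p by simp
  qed
qed

end

lemma charge_eq:
  assumes "open \<Omega>" "HH \<Omega> F G" "AE x in lebesgue. x \<in> \<Omega> \<longrightarrow> f x = F x"
  shows "charge \<Omega> f = (nr lborel F)\<^sup>2"
  unfolding charge_def HH_set_integral(1)[OF assms(1,2), symmetric]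
proof (rule set_integral_cong_AE'[OF assms(1)])
  show "AE x in lebesgue. x \<in> \<Omega> \<longrightarrow> (cmod (f x))\<^sup>2 = (cmod (F x))\<^sup>2" using assms(3) by eventually_elim simp
  show "set_borel_measurable lebesgue \<Omega> (\<lambda>x. (cmod (F x))\<^sup>2)"
    using HH_measurable[OF assms(2)] by (intro set_borel_measurable_lebesgue[OF assms(1)]) measurable
qed

lemma (in galerkin) energy_eq:
  assumes H: "HH \<Omega> F G" and f: "AE x in lebesgue. x \<in> \<Omega> \<longrightarrow> f x = F x"
    and g: "AE x in lebesgue. x \<in> \<Omega> \<longrightarrow> weak_deriv \<Omega> f x = G x"
  shows "energy \<Omega> \<sigma> f = En F G"
proof -
  note [measurable] = HH_measurable[OF H]
  define h where "h x = (cmod (G x))\<^sup>2 + 1 / (\<sigma> + 1) * Im (G x * Gz \<sigma> (F x))" for x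
  have Gzm [measurable]: "(\<lambda>x. Gz \<sigma> (F x)) \<in> borel_measurable borel" using sq_measurable[OF Gz_sq(1)[OF H]] by simp
  have hm: "h \<in> borel_measurable borel" unfolding h_def by measurable
  have "energy \<Omega> \<sigma> f = (LINT x:\<Omega>|lebesgue. h x)"
    unfolding energy_def
  proof (rule set_integral_cong_AE'[OF open_dom _ set_borel_measurable_lebesgue[OF open_dom hm]])
    show "AE x in lebesgue. x \<in> \<Omega> \<longrightarrow> (cmod (weak_deriv \<Omega> f x))\<^sup>2 +
        1 / (\<sigma> + 1) * Im (of_real (cmod (f x) powr (2 * \<sigma>)) * cnj (f x) * weak_deriv \<Omega> f x) = h x"
      using f g by eventually_elim (simp add: h_def Gz_def pw_def mult.commute)
  qed
  also have "\<dots> = (\<integral>x. h x \<partial>lborel)"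
  proof (rule set_lebesgue_integral_support[OF open_dom hm])
    show "AE x in lborel. x \<notin> \<Omega> \<longrightarrow> h x = 0"
      using HH_deriv_outside[OF open_dom H] by eventually_elim (simp add: h_def)
  qed
  also have "\<dots> = En F G"
  proof -
    have i: "integrable lborel (\<lambda>x. G x * Gz \<sigma> (F x))" by (rule sq_mult_integrable[OF HH_sq(2)[OF H] Gz_sq(1)[OF H]])
    have "(\<integral>x. h x \<partial>lborel) = (\<integral>x. (cmod (G x))\<^sup>2 \<partial>lborel) + (\<integral>x. 1 / (\<sigma> + 1) * Im (G x * Gz \<sigma> (F x)) \<partial>lborel)"
      unfolding h_def
      by (intro Bochner_Integration.integral_add sq_integrable[OF HH_sq(2)[OF H]] integrable_mult_right integrable_Im i)
    also have "(\<integral>x. 1 / (\<sigma> + 1) * Im (G x * Gz \<sigma> (F x)) \<partial>lborel) = 1 / (\<sigma> + 1) * Im (\<integral>x. G x * Gz \<sigma> (F x) \<partial>lborel)"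
      by (simp only: integral_mult_right_zero integral_Im[OF i])
    finally show ?thesis by (simp add: En_def ip_def nr_power2)
  qed
  finally show ?thesis .
qed

theorem theorem1p7:
  fixes \<Omega> :: "real set" and \<sigma> :: real and \<phi> :: "real \<Rightarrow> complex"
  assumes "open \<Omega>" and "is_interval \<Omega>" and "\<Omega> \<noteq> {}"
    and "0 < \<sigma>" and "\<sigma> < 1"
    and "\<phi> \<in> H10 \<Omega>"
  shows "\<exists>u. u \<in> Cw_H10 \<Omega> \<inter> Linf_H10 \<Omega> \<and>
    dnls_solution \<Omega> \<sigma> u \<and>
    (AE x in lebesgue. x \<in> \<Omega> \<longrightarrow> u 0 x = \<phi> x) \<and>
    (\<forall>t. charge \<Omega> (u t) = charge \<Omega> \<phi> \<and> energy \<Omega> \<sigma> (u t) \<le> energy \<Omega> \<sigma> \<phi>)"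
proof -
  \<comment> \<open>The construction starts from the continuous representative of \<phi>; charge and
    energy see only its class.\<close>
  obtain F G where H: "HH \<Omega> F G" and F: "AE x in lebesgue. x \<in> \<Omega> \<longrightarrow> \<phi> x = F x"
    and G: "AE x in lebesgue. x \<in> \<Omega> \<longrightarrow> weak_deriv \<Omega> \<phi> x = G x"
    using H10_imp_HH[OF assms(1,6)] by blast
  obtain d :: "nat \<Rightarrow> real \<Rightarrow> complex" where d: "\<And>k. d k \<in> test_functions \<Omega>"
    "\<And>\<psi> \<epsilon>. \<psi> \<in> test_functions \<Omega> \<Longrightarrow> 0 < \<epsilon> \<Longrightarrow>
      \<exists>k. nr lborel (\<lambda>x. \<psi> x - d k x) < \<epsilon> \<and> nr lborel (\<lambda>x. D \<psi> x - D (d k) x) < \<epsilon>"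
    using test_functions_separable[of \<Omega>] by blast
  interpret galerkin \<Omega> d \<sigma>
    by (intro galerkin.intro basis.intro galerkin_axioms.intro) (fact assms d)+
  from weak_limit[OF H] obtain C a u v A un where "evolution \<Omega> d \<sigma> C a u v A un F G" by blast
  then interpret E: evolution \<Omega> d \<sigma> C a u v A un F G .
  have wd: "AE x in lebesgue. x \<in> \<Omega> \<longrightarrow> weak_deriv \<Omega> (u t) x = v t x" for t
    by (rule weak_deriv_AE[OF open_dom HH_weak_deriv[OF open_dom E.uH]])
  show ?thesis
  proof (intro exI[of _ u] conjI allI IntI E.u_Cw E.u_Linf E.dnls_solution_u)
    show "AE x in lebesgue. x \<in> \<Omega> \<longrightarrow> u 0 x = \<phi> x"
      using F unfolding E.u_0 by eventually_elim simp
    fix t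
    show "charge \<Omega> (u t) = charge \<Omega> \<phi>"
      using E.charge_conserved[of t] charge_eq[OF open_dom H F] charge_eq[OF open_dom E.uH, of "u t" t] by simp
    have "energy \<Omega> \<sigma> (u t) = En (u t) (v t)" by (rule energy_eq[OF E.uH _ wd]) simp
    then show "energy \<Omega> \<sigma> (u t) \<le> energy \<Omega> \<sigma> \<phi>"
      using E.energy_inequality[of t] energy_eq[OF H F G] by simp
  qed
qed

end
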